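(* Let $m\in\mathbb{N}$ and $0\le\alpha<1$. For $V\in H^{-m\alpha}_{per}[-1,1]$ (complex-valued distribution) let $(\lambda_k)_{k\ge 0}$ be the ordered periodic eigenvalues of $L_m=(-1)^m d^{2m}/dx^{2m}+V$, and for $n\ge1$ put $\tau_{mn}:=\frac{\lambda_{2n}+\lambda_{2n-1}}{2}$ and $\gamma_{mn}:=\lambda_{2n}-\lambda_{2n-1}$. Then, for any $\varepsilon>0$, uniformly for bounded sets of distributions $V$ in $H^{-m\alpha}_{per}[-1,1]$, the following hold: (i) $\left(\tau_{mn}-n^{2m}\pi^{2m}-\hat V(0)\right)_{n\ge1}\in h^{m(1-2\alpha-\varepsilon)}$; (ii) $\left(\min_{\pm}\left|\gamma_{mn}\pm 2\sqrt{\hat V(-2n)\hat V(2n)}\right|\right)_{n\ge1}\in h^{m(1/2-\alpha)}$ if $0\le\alpha<\frac12$, and $\left(\min_{\pm}\left|\gamma_{mn}\pm 2\sqrt{\hat V(-2n)\hat V(2n)}\right|\right)_{n\ge1}\in h^{m(1-2\alpha-\varepsilon)}$ if $\frac12\le\alpha<1$.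
   Context: Write $\langle k\rangle:=1+|k|$. For $s\in\mathbb{R}$, $H^s_{per}=H^s_{per}[-1,1]$ is the space of (2-periodic) distributions $f=\sum_{k\in\mathbb{Z}}\hat f(k)e^{ik\pi x}$ with $\|f\|_{H^s_{per}}:=\left(\sum_{k\in\mathbb{Z}}\langle k\rangle^{2s}|\hat f(k)|^2\right)^{1/2}<\infty$; the Fourier coefficients $\hat f(k)=\langle f,e^{ik\pi x}\rangle$ are taken with respect to the sesquilinear pairing between $H^s_{per}$ and $H^{-s}_{per}$ extending $\frac12\int_{-1}^1 g\overline h\,dx$. For $s\in\mathbb{R}$, $h^s=h^s(\mathbb{N};\mathbb{C})$ is the space of complex sequences $x=(x_n)_{n\ge1}$ with $\|x\|_s:=\left(\sum_{n\ge1}\langle n\rangle^{2s}|x_n|^2\right)^{1/2}<\infty$. The operator $L_m=(-1)^m d^{2m}/dx^{2m}+V$ acts as an unbounded operator on $H^{-m\alpha}_{per}$ with domain $H^{m(2-\alpha)}_{per}$, where the product $Vf$ is defined by convolution of Fourier coefficients, $\widehat{Vf}(k)=\sum_j\hat V(k-j)\hat f(j)$. Its spectrum is discrete and consists of a sequence of eigenvalues $(\lambda_k)_{k\ge0}$ with $\mathrm{Re}\,\lambda_k\to+\infty$, repeated according to algebraic multiplicity and ordered so that for each $k$ either $\mathrm{Re}\,\lambda_k<\mathrm{Re}\,\lambda_{k+1}$, or $\mathrm{Re}\,\lambda_k=\mathrm{Re}\,\lambda_{k+1}$ and $\mathrm{Im}\,\lambda_k\le\mathrm{Im}\,\lambda_{k+1}$.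 "Uniformly for bounded sets of distributions $V$" means: for every $R>0$ the norms of the indicated sequences in the indicated spaces are bounded by a constant independent of $V$ as $V$ ranges over $\|V\|_{H^{-m\alpha}_{per}}\le R$. The choice of the complex square root is immaterial because of the minimum over both signs. *)

theory Defs
  imports "HOL-Analysis.Analysis" "HOL-Library.Function_Algebras"
begin

definition iter_deriv :: "nat \<Rightarrow> (real \<Rightarrow> complex) \<Rightarrow> real \<Rightarrow> complex" where
  "iter_deriv j = (\<lambda>\<phi> x. vector_derivative \<phi> (at x)) ^^ j"

definition per_test :: "(real \<Rightarrow> complex) set" where
  "per_test = {\<phi>. (\<forall>x. \<phi> (x + 2) = \<phi> x) \<and>
                  (\<forall>j x. iter_deriv j \<phi> differentiable (at x))}"

text \<open>A distribution is a functional on test functions; it is set to \<open>0\<close> on all other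
  functions so that equality in the function type is equality of distributions.
  The functional is linear, and a function \<open>g\<close> is identified with
  \<open>\<phi> \<mapsto> 1/2 \<integral> g \<phi>\<close> over \<open>[-1,1]\<close>. The sesquilinear pairing of \<open>u\<close> with \<open>h\<close> is thus
  \<open>u\<close> applied to the complex conjugate of \<open>h\<close>.\<close>

type_synonym functional = "(real \<Rightarrow> complex) \<Rightarrow> complex"

definition per_dist :: "functional set" where
  "per_dist = {u.
     (\<forall>\<phi>\<in>per_test. \<forall>\<psi>\<in>per_test. u (\<lambda>x. \<phi> x + \<psi> x) = u \<phi> + u \<psi>) \<and>
     (\<forall>c. \<forall>\<phi>\<in>per_test. u (\<lambda>x. c * \<phi> x) = c * u \<phi>) \<and>
     (\<exists>C N. \<forall>\<phi>\<in>per_test.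
        cmod (u \<phi>) \<le> C * (\<Sum>j\<le>N. SUP x\<in>{-1..1}. cmod (iter_deriv j \<phi> x))) \<and>
     (\<forall>\<phi>. \<phi> \<notin> per_test \<longrightarrow> u \<phi> = 0)}"

definition fourier_mode :: "int \<Rightarrow> real \<Rightarrow> complex" where
  "fourier_mode k x = exp (\<i> * of_int k * of_real pi * of_real x)"

definition fcoeff :: "functional \<Rightarrow> int \<Rightarrow> complex" where
  "fcoeff u k = u (\<lambda>x. cnj (fourier_mode k x))"

definition dist_deriv :: "functional \<Rightarrow> functional" where
  "dist_deriv u = (\<lambda>\<phi>. if \<phi> \<in> per_test then - u (iter_deriv 1 \<phi>) else 0)"

definition dist_mult :: "functional \<Rightarrow> functional \<Rightarrow> functional" where
  "dist_mult V f = (THE w. w \<in> per_dist \<and>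
     (\<forall>k. fcoeff w k = (\<Sum>\<^sub>\<infinity>j\<in>UNIV. fcoeff V (k - j) * fcoeff f j)))"

definition Hper :: "real \<Rightarrow> functional set" where
  "Hper s = {f \<in> per_dist.
     (\<lambda>k::int. (1 + \<bar>real_of_int k\<bar>) powr (2 * s) * (cmod (fcoeff f k))\<^sup>2) summable_on UNIV}"

definition Hper_norm :: "real \<Rightarrow> functional \<Rightarrow> real" where
  "Hper_norm s f =
     sqrt (\<Sum>\<^sub>\<infinity>k\<in>UNIV. (1 + \<bar>real_of_int k\<bar>) powr (2 * s) * (cmod (fcoeff f k))\<^sup>2)"

text \<open>Sequences are indexed by \<open>n \<ge> 1\<close>; the value at \<open>0\<close> is ignored.\<close>

definition hseq :: "real \<Rightarrow> (nat \<Rightarrow> complex) set" where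
  "hseq s = {x. (\<lambda>n. (1 + real n) powr (2 * s) * (cmod (x n))\<^sup>2) summable_on {1..}}"

definition hseq_norm :: "real \<Rightarrow> (nat \<Rightarrow> complex) \<Rightarrow> real" where
  "hseq_norm s x = sqrt (\<Sum>\<^sub>\<infinity>n\<in>{1..}. (1 + real n) powr (2 * s) * (cmod (x n))\<^sup>2)"

definition cscale :: "complex \<Rightarrow> functional \<Rightarrow> functional" where
  "cscale c u = (\<lambda>\<phi>. c * u \<phi>)"

global_interpretation fnl: vector_space cscale
  by unfold_locales (auto simp: cscale_def plus_fun_def algebra_simps)

definition L_op :: "nat \<Rightarrow> functional \<Rightarrow> functional \<Rightarrow> functional" where
  "L_op m V f = cscale ((-1) ^ m) ((dist_deriv ^^ (2 * m)) f) + dist_mult V f"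

definition L_dom :: "nat \<Rightarrow> real \<Rightarrow> functional set" where
  "L_dom m \<alpha> = Hper (real m * (2 - \<alpha>))"

text \<open>The kernel of \<open>(L - z)\<^sup>n\<close>, with the natural domain of the power of an unbounded
  operator: every intermediate vector has to lie in the domain of \<open>L\<close>.\<close>

primrec ker_pow :: "nat \<Rightarrow> real \<Rightarrow> functional \<Rightarrow> complex \<Rightarrow> nat \<Rightarrow> functional set" where
  "ker_pow m \<alpha> V z 0 = {0}"
| "ker_pow m \<alpha> V z (Suc n) =
     {f \<in> L_dom m \<alpha>. L_op m V f - cscale z f \<in> ker_pow m \<alpha> V z n}"

definition root_space :: "nat \<Rightarrow> real \<Rightarrow> functional \<Rightarrow> complex \<Rightarrow> functional set" where
  "root_space m \<alpha> V z = (\<Union>n. ker_pow m \<alpha> V z n)"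

text \<open>\<open>ev\<close> lists every eigenvalue as often as its algebraic multiplicity, the dimension of
  the root space (which is \<open>{0}\<close> if \<open>z\<close> is not an eigenvalue). Finite dimensionality
  is required explicitly because \<open>fnl.dim\<close> would be \<open>0\<close> otherwise.\<close>

definition ordered_eigenvalues ::
  "nat \<Rightarrow> real \<Rightarrow> functional \<Rightarrow> (nat \<Rightarrow> complex) \<Rightarrow> bool" where
  "ordered_eigenvalues m \<alpha> V ev \<longleftrightarrow>
     (\<forall>z. (\<exists>B. finite B \<and> root_space m \<alpha> V z \<subseteq> fnl.span B) \<and>
          finite {k. ev k = z} \<and> card {k. ev k = z} = fnl.dim (root_space m \<alpha> V z)) \<and>
     (\<forall>k. Re (ev k) < Re (ev (Suc k)) \<or>
          Re (ev k) = Re (ev (Suc k)) \<and> Im (ev k) \<le> Im (ev (Suc k))) \<and>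
     filterlim (\<lambda>k. Re (ev k)) at_top sequentially"

definition tau :: "(nat \<Rightarrow> complex) \<Rightarrow> nat \<Rightarrow> complex" where
  "tau ev n = (ev (2 * n) + ev (2 * n - 1)) / 2"

definition gam :: "(nat \<Rightarrow> complex) \<Rightarrow> nat \<Rightarrow> complex" where
  "gam ev n = ev (2 * n) - ev (2 * n - 1)"

definition gap_deviation :: "functional \<Rightarrow> (nat \<Rightarrow> complex) \<Rightarrow> nat \<Rightarrow> real" where
  "gap_deviation V ev n =
     (let r = 2 * csqrt (fcoeff V (- 2 * int n) * fcoeff V (2 * int n))
      in min (cmod (gam ev n + r)) (cmod (gam ev n - r)))"

definition uniformly_in_hseq ::
  "nat \<Rightarrow> real \<Rightarrow> real \<Rightarrow> (functional \<Rightarrow> (nat \<Rightarrow> complex) \<Rightarrow> nat \<Rightarrow> complex) \<Rightarrow> bool" where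
  "uniformly_in_hseq m \<alpha> s X \<longleftrightarrow>
     (\<forall>R>0. \<exists>C. \<forall>V ev.
        V \<in> Hper (- real m * \<alpha>) \<and> Hper_norm (- real m * \<alpha>) V \<le> R \<and>
        ordered_eigenvalues m \<alpha> V ev \<longrightarrow>
        X V ev \<in> hseq s \<and> hseq_norm s (X V ev) \<le> C)"

end

theory Submission
  imports Defs "HOL-Computational_Algebra.Fundamental_Theorem_Algebra"
begin

text \<open>Relative to the Fourier basis, the operator is \<open>D + V\<close> with \<open>D\<close> diagonal with entries
  \<open>D\<^sub>k = (k \<pi>)\<^sup>2\<^sup>m\<close> and \<open>V\<close> the matrix with entries \<open>v (k - j)\<close>. Weighted by
  \<open>(max n \<bar>k\<bar>)\<^sup>2\<^sup>m\<^sup>-\<^sup>1 (1 + \<bar>\<bar>k\<bar> - n\<bar>)\<close>, which is dominated by the gaps of \<open>D\<close>, the matrix \<open>V\<close> has a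
  Hilbert--Schmidt norm \<open>e\<^sub>n\<close> that tends to \<open>0\<close>. For a finite set \<open>P\<close> of modes separated from the
  others by these gaps, the contraction principle then solves the Riccati equation for an
  invariant subspace that is a graph over the modes in \<open>P\<close>, and the root spaces of \<open>D + V\<close> for
  the eigenvalues near \<open>D\<^sub>k\<close> with \<open>k \<in> P\<close> correspond to those of a matrix \<open>T\<close> on \<open>P\<close>. Taking
  \<open>P = {- n..n}\<close> counts the eigenvalues below \<open>(D\<^sub>n + D\<^sub>n\<^sub>+\<^sub>1) / 2\<close>; taking \<open>P = {n, - n}\<close> shows that
  \<open>\<lambda>\<^sub>2\<^sub>n\<^sub>-\<^sub>1\<close> and \<open>\<lambda>\<^sub>2\<^sub>n\<close> are the eigenvalues of a two by two matrix. Its entries are those of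
  \<open>D + V\<close>, corrected by the terms of second order in \<open>v\<close> and a remainder of size
  \<open>n\<^sup>2\<^sup>m\<^sup>-\<^sup>1 e\<^sub>n\<^sup>3\<close>; trace and discriminant give \<open>\<tau>\<close> and \<open>\<gamma>\<close>. In the second order term on the diagonal,
  symmetrizing in \<open>j\<close> gains a cancellation, which gives the exponent in (i); the estimate for the
  term off the diagonal is a convolution estimate.\<close>

section \<open>Square summable families and matrices\<close>

text \<open>Since \<open>V\<close> may be a distribution, its entries are made small by dividing by
  \<open>sqrt (d k * d j)\<close>, half a weight for each index. The solution of the Riccati
  equation then occurs with a full weight on the left or on the right, divided by the gap; both
  versions stay small because the gap dominates the sum \<open>d k + d j\<close>, hence either
  summand. Neither contour integrals nor a deformation from \<open>V = 0\<close> are used: the graph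
  map intertwines D + V with \<open>T\<close> exactly, so algebraic multiplicities, also those in
  Jordan blocks, are compared by linear algebra. The two diagonal entries of the two by two matrix
  share their second order term, so the discriminant sees their difference only through the
  remainder. It is the square of the gap that is compared with 4 v(2n) v(-2n), which suits the
  minimum over both signs. Every threshold depends on the bound \<open>R\<close> for the norm of
  \<open>V\<close> alone, and the finitely many indices below it are covered by a crude bound on the
  first eigenvalues; this yields uniformity.\<close>

definition l2_le :: "('a \<Rightarrow> 'b::real_normed_vector) \<Rightarrow> real \<Rightarrow> bool" where
  "l2_le f C \<longleftrightarrow> 0 \<le> C \<and> (\<forall>F. finite F \<longrightarrow> L2_set (\<lambda>x. norm (f x)) F \<le> C)"

text \<open>Like \<open>l2_le\<close>, a bound on finite partial sums together with its constant. No
  summability has to be established before an estimate is stated, and constants stay explicit, as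
  uniformity in \<open>V\<close> requires.\<close>

definition l1_le :: "('a \<Rightarrow> 'b::real_normed_vector) \<Rightarrow> real \<Rightarrow> bool" where
  "l1_le f C \<longleftrightarrow> 0 \<le> C \<and> (\<forall>F. finite F \<longrightarrow> (\<Sum>x\<in>F. norm (f x)) \<le> C)"

lemma l2_le_nonneg: "l2_le f C \<Longrightarrow> 0 \<le> C"
  by (simp add: l2_le_def)

lemma l2_leD: "l2_le f C \<Longrightarrow> finite F \<Longrightarrow> L2_set (\<lambda>x. norm (f x)) F \<le> C"
  by (simp add: l2_le_def)

lemma l2_le_sum_sq: "l2_le f C \<Longrightarrow> finite F \<Longrightarrow> (\<Sum>x\<in>F. (norm (f x))\<^sup>2) \<le> C\<^sup>2"
  using l2_leD[of f C F] by (simp add: L2_set_def sqrt_le_D)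

lemma l2_leI_sq:
  assumes "0 \<le> C" "\<And>F. finite F \<Longrightarrow> (\<Sum>x\<in>F. (norm (f x))\<^sup>2) \<le> C\<^sup>2"
  shows "l2_le f C"
  unfolding l2_le_def L2_set_def using assms by (auto intro: real_le_lsqrt sum_nonneg)

lemma l2_le_mono:
  assumes "l2_le g C" "\<And>x. norm (f x) \<le> norm (g x)" "C \<le> D"
  shows "l2_le f D"
proof -
  have "L2_set (\<lambda>x. norm (f x)) F \<le> D" if "finite F" for F
    using L2_set_mono[of F "\<lambda>x. norm (f x)" "\<lambda>x. norm (g x)"] assms that by (force simp: l2_le_def)
  then show ?thesis using assms by (simp add: l2_le_def)
qed

lemma l2_le_point: "l2_le f C \<Longrightarrow> norm (f x) \<le> C"
  using l2_leD[of f C "{x}"] by (simp add: L2_set_def)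

lemma l2_le_zero: "0 \<le> C \<Longrightarrow> l2_le (\<lambda>x. 0) C"
  by (simp add: l2_le_def L2_set_def)

lemma l2_le_add:
  assumes "l2_le f C" "l2_le g D"
  shows "l2_le (\<lambda>x. f x + g x) (C + D)"
  unfolding l2_le_def
proof (intro conjI allI impI)
  show "0 \<le> C + D" using assms by (simp add: l2_le_def)
  fix F :: "'a set" assume F: "finite F"
  have "L2_set (\<lambda>x. norm (f x + g x)) F \<le> L2_set (\<lambda>x. norm (f x) + norm (g x)) F"
    by (intro L2_set_mono norm_triangle_ineq norm_ge_zero)
  also have "\<dots> \<le> L2_set (\<lambda>x. norm (f x)) F + L2_set (\<lambda>x. norm (g x)) F"
    by (rule L2_set_triangle_ineq)
  finally show "L2_set (\<lambda>x. norm (f x + g x)) F \<le> C + D"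
    using l2_leD[OF assms(1) F] l2_leD[OF assms(2) F] by linarith
qed

lemma l2_le_uminus: "l2_le (\<lambda>x. - f x) C \<longleftrightarrow> l2_le f C"
  by (simp add: l2_le_def)

lemma l2_le_diff: "l2_le f C \<Longrightarrow> l2_le g D \<Longrightarrow> l2_le (\<lambda>x. f x - g x) (C + D)"
  using l2_le_add[of f C "\<lambda>x. - g x" D] by (simp add: l2_le_uminus)

lemma l2_le_cmult:
  fixes f :: "'a \<Rightarrow> 'b::real_normed_div_algebra"
  assumes "l2_le f C"
  shows "l2_le (\<lambda>x. c * f x) (norm c * C)"
  using assms unfolding l2_le_def
  by (auto simp: norm_mult mult_left_mono simp flip: L2_set_right_distrib)

lemma l2_le_comp:
  assumes "l2_le f C" "inj h"
  shows "l2_le (\<lambda>x. f (h x)) C"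
proof (rule l2_leI_sq)
  show "0 \<le> C" using assms by (simp add: l2_le_def)
  fix F :: "'c set" assume "finite F"
  then have "(\<Sum>x\<in>h ` F. (norm (f x))\<^sup>2) \<le> C\<^sup>2"
    by (intro l2_le_sum_sq[OF assms(1)]) simp
  then show "(\<Sum>x\<in>F. (norm (f (h x)))\<^sup>2) \<le> C\<^sup>2"
    by (subst (asm) sum.reindex) (auto intro: inj_on_subset[OF assms(2)])
qed

text \<open>Fatou's lemma: a finite partial sum is continuous under pointwise convergence, so a
  bound shared by the approximants survives. This is how bounds pass to infinite sums, matrix
  products and the fixed point below.\<close>

lemma l2_le_tendsto:
  assumes "G \<noteq> bot" "\<And>x. ((\<lambda>i. f i x) \<longlongrightarrow> g x) G" "eventually (\<lambda>i. l2_le (f i) C) G"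
  shows "l2_le g C"
  unfolding l2_le_def
proof (intro conjI allI impI)
  show "0 \<le> C" using assms(3) eventually_happens[OF assms(3)] assms(1) l2_le_nonneg by blast
  fix F :: "'b set" assume F: "finite F"
  have "((\<lambda>i. L2_set (\<lambda>x. norm (f i x)) F) \<longlongrightarrow> L2_set (\<lambda>x. norm (g x)) F) G"
    unfolding L2_set_def by (intro tendsto_intros assms)
  moreover have "eventually (\<lambda>i. L2_set (\<lambda>x. norm (f i x)) F \<le> C) G"
    using assms(3) by eventually_elim (use F l2_leD in blast)
  ultimately show "L2_set (\<lambda>x. norm (g x)) F \<le> C"
    using assms(1) tendsto_upperbound by blast
qed

lemma l2_le_sum:
  assumes "finite A" "\<And>i. i \<in> A \<Longrightarrow> l2_le (f i) (c i)"
  shows "l2_le (\<lambda>x. \<Sum>i\<in>A. f i x) (\<Sum>i\<in>A. c i)"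
  using assms by (induction A rule: finite_induct) (auto intro!: l2_le_add l2_le_zero)

lemma l1_le_abs_summable: "l1_le f C \<Longrightarrow> (\<lambda>x. norm (f x)) summable_on UNIV"
  by (rule nonneg_bdd_above_summable_on) (auto simp: l1_le_def bdd_above_def)

lemma l1_le_infsum:
  assumes "l1_le f C" shows "(\<Sum>\<^sub>\<infinity>x. norm (f x)) \<le> C"
  by (rule infsum_le_finite_sums) (use assms in \<open>auto simp: l1_le_abs_summable l1_le_def\<close>)

lemma l1_le_norm_infsum:
  fixes f :: "'a \<Rightarrow> 'b::banach"
  assumes "l1_le f C" shows "norm (\<Sum>\<^sub>\<infinity>x. f x) \<le> C"
  using norm_infsum_bound[OF l1_le_abs_summable[OF assms]] l1_le_infsum[OF assms] by linarith

lemma l1_le_summable: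
  fixes f :: "'a \<Rightarrow> 'b::banach"
  shows "l1_le f C \<Longrightarrow> f summable_on UNIV"
  by (rule abs_summable_summable[OF l1_le_abs_summable])

lemma l1_le_nonneg: "l1_le f C \<Longrightarrow> 0 \<le> C"
  by (simp add: l1_le_def)

lemma l1_le_mono:
  assumes "l1_le g C" "\<And>x. norm (f x) \<le> norm (g x)" "C \<le> D"
  shows "l1_le f D"
proof -
  have "(\<Sum>x\<in>F. norm (f x)) \<le> D" if "finite F" for F
    using sum_mono[of F "\<lambda>x. norm (f x)" "\<lambda>x. norm (g x)"] assms that by (force simp: l1_le_def)
  then show ?thesis using assms by (simp add: l1_le_def)
qed

text \<open>Minkowski's inequality for infinitely many summands. Pointwise convergence follows from
  the bounds themselves, since every value of \<open>f i\<close> has norm at most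
  \<open>c i\<close>.\<close>

lemma l2_le_infsum:
  fixes f :: "'i \<Rightarrow> 'a \<Rightarrow> 'b::banach"
  assumes f: "\<And>i. l2_le (f i) (c i)" and c: "l1_le c C"
  shows "l2_le (\<lambda>x. \<Sum>\<^sub>\<infinity>i. f i x) C"
proof (rule l2_le_tendsto[where f = "\<lambda>I x. \<Sum>i\<in>I. f i x" and G = "finite_subsets_at_top UNIV"])
  fix x
  have "l1_le (\<lambda>i. f i x) C"
    by (rule l1_le_mono[OF c]) (auto intro: order_trans[OF l2_le_point[OF f] abs_ge_self])
  then show "((\<lambda>I. \<Sum>i\<in>I. f i x) \<longlongrightarrow> (\<Sum>\<^sub>\<infinity>i. f i x)) (finite_subsets_at_top UNIV)"
    by (intro infsum_tendsto l1_le_summable)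
next
  have "l2_le (\<lambda>x. \<Sum>i\<in>I. f i x) C" if "finite I" for I
  proof (rule l2_le_mono[OF l2_le_sum[OF that f]])
    show "sum c I \<le> C" using c that sum_mono[of I c "\<lambda>i. norm (c i)"]
      by (force simp: l1_le_def intro: order_trans)
  qed auto
  then show "\<forall>\<^sub>F I in finite_subsets_at_top UNIV. l2_le (\<lambda>x. \<Sum>i\<in>I. f i x) C"
    by (simp add: eventually_finite_subsets_at_top_weakI)
qed simp

text \<open>Cauchy-Schwarz; it also supplies the absolute convergence of the sums over an inner
  index in matrix products.\<close>

lemma l2_le_prod:
  fixes f g :: "'a \<Rightarrow> 'b::real_normed_div_algebra"
  assumes "l2_le f C" "l2_le g D"
  shows "l1_le (\<lambda>x. f x * g x) (C * D)"
  unfolding l1_le_def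
proof (intro conjI allI impI)
  show "0 \<le> C * D" using assms by (simp add: l2_le_def)
  fix F :: "'a set" assume F: "finite F"
  have "(\<Sum>x\<in>F. norm (f x * g x)) = (\<Sum>x\<in>F. \<bar>norm (f x)\<bar> * \<bar>norm (g x)\<bar>)"
    by (simp add: norm_mult)
  also have "\<dots> \<le> L2_set (\<lambda>x. norm (f x)) F * L2_set (\<lambda>x. norm (g x)) F"
    by (rule L2_set_mult_ineq)
  also have "\<dots> \<le> C * D"
    using assms F by (intro mult_mono) (auto simp: l2_le_def)
  finally show "(\<Sum>x\<in>F. norm (f x * g x)) \<le> C * D" .
qed

lemma infsum_diff:
  fixes f g :: "'a \<Rightarrow> 'b::{topological_ab_group_add,t2_space}"
  assumes "f summable_on A" "g summable_on A"
  shows "infsum (\<lambda>x. f x - g x) A = infsum f A - infsum g A"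
  using infsum_add[of f A "\<lambda>x. - g x"] assms by (simp add: infsum_uminus summable_on_uminus)

section \<open>Products of Hilbert-Schmidt matrices\<close>

definition mat_prod ::
  "('a \<times> 'b \<Rightarrow> complex) \<Rightarrow> ('b \<times> 'c \<Rightarrow> complex) \<Rightarrow> 'a \<times> 'c \<Rightarrow> complex" where
  "mat_prod M N = (\<lambda>(k, j). \<Sum>\<^sub>\<infinity>i. M (k, i) * N (i, j))"

lemma l2_le_row: "l2_le M C \<Longrightarrow> l2_le (\<lambda>i. M (k, i)) C"
  by (rule l2_le_comp) (auto simp: inj_def)

lemma l2_le_column: "l2_le M C \<Longrightarrow> l2_le (\<lambda>i. M (i, j)) C"
  by (rule l2_le_comp[where h = "\<lambda>i. (i, j)"]) (auto simp: inj_def)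

lemma l1_le_mat_prod:
  assumes "l2_le M C" "l2_le N D"
  shows "l1_le (\<lambda>i. M (k, i) * N (i, j) :: complex) (C * D)"
  by (intro l2_le_prod l2_le_row l2_le_column assms)

text \<open>Submultiplicativity of the Hilbert-Schmidt norm. With the inner index truncated to a
  finite set, Cauchy-Schwarz bounds each entry by a row sum times a column sum; Fatou's lemma then
  removes the truncation.\<close>

lemma l2_le_mat_prod:
  assumes M: "l2_le M C" and N: "l2_le N D"
  shows "l2_le (mat_prod M N) (C * D)"
proof (rule l2_le_tendsto[where f = "\<lambda>I (k, j). \<Sum>i\<in>I. M (k, i) * N (i, j)"
        and G = "finite_subsets_at_top UNIV"])
  fix x :: "'a \<times> 'c"
  obtain k j where x: "x = (k, j)" by force
  have "((\<lambda>I. \<Sum>i\<in>I. M (k, i) * N (i, j)) \<longlongrightarrow> (\<Sum>\<^sub>\<infinity>i. M (k, i) * N (i, j))) (finite_subsets_at_top UNIV)"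
    by (intro infsum_tendsto l1_le_summable[OF l1_le_mat_prod[OF M N]])
  then show "((\<lambda>I. case x of (k, j) \<Rightarrow> \<Sum>i\<in>I. M (k, i) * N (i, j)) \<longlongrightarrow> mat_prod M N x)
      (finite_subsets_at_top UNIV)"
    by (simp add: x mat_prod_def)
next
  have "l2_le (\<lambda>(k, j). \<Sum>i\<in>I. M (k, i) * N (i, j)) (C * D)" if I: "finite I" for I
  proof (rule l2_leI_sq)
    show "0 \<le> C * D" using M N by (simp add: l2_le_def)
    fix F :: "('a \<times> 'c) set" assume F: "finite F"
    \<comment> \<open>An arbitrary finite set of pairs is enlarged to a rectangle, over which the
      double sum factorizes.\<close>
    define A B where "A = fst ` F" and "B = snd ` F"
    have AB: "finite A" "finite B" "F \<subseteq> A \<times> B" using F by (force simp: A_def B_def)+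
    have cs: "(norm (\<Sum>i\<in>I. M (k, i) * N (i, j)))\<^sup>2
        \<le> (\<Sum>i\<in>I. (norm (M (k, i)))\<^sup>2) * (\<Sum>i\<in>I. (norm (N (i, j)))\<^sup>2)" for k j
    proof -
      have "norm (\<Sum>i\<in>I. M (k, i) * N (i, j)) \<le> (\<Sum>i\<in>I. \<bar>norm (M (k, i))\<bar> * \<bar>norm (N (i, j))\<bar>)"
        by (rule order_trans[OF norm_sum]) (simp add: norm_mult)
      also have "\<dots> \<le> L2_set (\<lambda>i. norm (M (k, i))) I * L2_set (\<lambda>i. norm (N (i, j))) I"
        by (rule L2_set_mult_ineq)
      finally have "(norm (\<Sum>i\<in>I. M (k, i) * N (i, j)))\<^sup>2
        \<le> (L2_set (\<lambda>i. norm (M (k, i))) I * L2_set (\<lambda>i. norm (N (i, j))) I)\<^sup>2"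
        by (intro power_mono) auto
      then show ?thesis by (simp add: L2_set_def power_mult_distrib sum_nonneg)
    qed
    have "(\<Sum>x\<in>F. (norm (case x of (k, j) \<Rightarrow> \<Sum>i\<in>I. M (k, i) * N (i, j)))\<^sup>2)
       \<le> (\<Sum>x\<in>A\<times>B. (norm (case x of (k, j) \<Rightarrow> \<Sum>i\<in>I. M (k, i) * N (i, j)))\<^sup>2)"
      using AB by (intro sum_mono2) auto
    also have "\<dots> = (\<Sum>k\<in>A. \<Sum>j\<in>B. (norm (\<Sum>i\<in>I. M (k, i) * N (i, j)))\<^sup>2)"
      by (simp add: sum.cartesian_product case_prod_unfold)
    also have "\<dots> \<le> (\<Sum>k\<in>A. \<Sum>j\<in>B. (\<Sum>i\<in>I. (norm (M (k, i)))\<^sup>2) * (\<Sum>i\<in>I. (norm (N (i, j)))\<^sup>2))"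
      by (intro sum_mono cs)
    also have "\<dots> = (\<Sum>k\<in>A. \<Sum>i\<in>I. (norm (M (k, i)))\<^sup>2) * (\<Sum>j\<in>B. \<Sum>i\<in>I. (norm (N (i, j)))\<^sup>2)"
      by (simp add: sum_product)
    also have "\<dots> = (\<Sum>x\<in>A\<times>I. (norm (M x))\<^sup>2) * (\<Sum>x\<in>I\<times>B. (norm (N x))\<^sup>2)"
      by (subst (2) sum.swap) (simp add: sum.cartesian_product)
    also have "\<dots> \<le> C\<^sup>2 * D\<^sup>2"
      using AB I by (intro mult_mono l2_le_sum_sq[OF M] l2_le_sum_sq[OF N] sum_nonneg) auto
    finally show "(\<Sum>x\<in>F. (norm (case x of (k, j) \<Rightarrow> \<Sum>i\<in>I. M (k, i) * N (i, j)))\<^sup>2) \<le> (C * D)\<^sup>2"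
      by (simp add: power_mult_distrib)
  qed
  then show "\<forall>\<^sub>F I in finite_subsets_at_top UNIV. l2_le (\<lambda>(k, j). \<Sum>i\<in>I. M (k, i) * N (i, j)) (C * D)"
    by (simp add: eventually_finite_subsets_at_top_weakI)
qed simp

lemma mat_prod_diff_left:
  assumes "l2_le M C" "l2_le M' C'" "l2_le N D"
  shows "mat_prod (\<lambda>x. M x - M' x) N x = mat_prod M N x - mat_prod M' N x"
proof -
  obtain k j where x: "x = (k, j)" by force
  show ?thesis unfolding x mat_prod_def prod.case left_diff_distrib
    by (intro infsum_diff l1_le_summable[OF l1_le_mat_prod[OF assms(1,3)]]
        l1_le_summable[OF l1_le_mat_prod[OF assms(2,3)]])
qed

lemma mat_prod_diff_right:
  assumes "l2_le M C" "l2_le N D" "l2_le N' D'"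
  shows "mat_prod M (\<lambda>x. N x - N' x) x = mat_prod M N x - mat_prod M N' x"
proof -
  obtain k j where x: "x = (k, j)" by force
  show ?thesis unfolding x mat_prod_def prod.case right_diff_distrib
    by (intro infsum_diff l1_le_summable[OF l1_le_mat_prod[OF assms(1,2)]]
        l1_le_summable[OF l1_le_mat_prod[OF assms(1,3)]])
qed

text \<open>A uniqueness principle: if a family is dominated by its image under a linear map of norm
  at most 1/2, every bound for it can be halved, which forces zero. It takes the place of a Neumann
  series.\<close>

lemma l2_le_zero_if_halving:
  assumes "l2_le f C" "\<And>C. l2_le f C \<Longrightarrow> l2_le f (C / 2)"
  shows "f x = 0"
proof -
  have "l2_le f (C / 2 ^ n)" for n
  proof (induction n)
    case (Suc n)
    then show ?case using assms(2)[OF Suc] by (simp add: field_simps)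
  qed (use assms in simp)
  then have "norm (f x) \<le> C / 2 ^ n" for n by (rule l2_le_point)
  moreover have "(\<lambda>n. C / 2 ^ n) \<longlonglongrightarrow> 0" by (rule LIMSEQ_divide_realpow_zero) simp
  ultimately have "norm (f x) \<le> 0" by (meson LIMSEQ_le_const)
  then show ?thesis by simp
qed

text \<open>Banach's theorem for the ball of radius \<open>r\<close>. As the ball is described by
  the predicate \<open>l2_le\<close>, the iteration from 0 is shown to converge pointwise, and the
  bounds for the limit come from Fatou's lemma.\<close>

lemma l2_contraction_fixed_point:
  fixes \<Phi> :: "('a \<Rightarrow> complex) \<Rightarrow> 'a \<Rightarrow> complex"
  assumes r: "0 \<le> r"
    and self: "\<And>f. l2_le f r \<Longrightarrow> l2_le (\<Phi> f) r"
    and contr: "\<And>f g C. l2_le f r \<Longrightarrow> l2_le g r \<Longrightarrow> l2_le (\<lambda>x. f x - g x) C \<Longrightarrow>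
                  l2_le (\<lambda>x. \<Phi> f x - \<Phi> g x) (C / 2)"
  obtains f where "l2_le f r" "\<Phi> f = f"
proof -
  define h where "h n = (\<Phi> ^^ n) (\<lambda>_. 0)" for n
  have h: "l2_le (h n) r" for n
    by (induction n) (auto simp: h_def r l2_le_zero self)
  have step: "l2_le (\<lambda>x. h (Suc n) x - h n x) (r / 2 ^ n)" for n
  proof (induction n)
    case 0
    show ?case using h[of 1] by (simp add: h_def)
  next
    case (Suc n)
    from contr[OF h h Suc] show ?case by (simp add: h_def field_simps)
  qed
  \<comment> \<open>The telescoped geometric sum is kept exact, so that the induction closes; only
    afterwards is the negative part dropped.\<close>
  have dist: "l2_le (\<lambda>x. h (n + p) x - h n x) (2 * r / 2 ^ n - 2 * r / 2 ^ (n + p))" for n p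
  proof (induction p)
    case (Suc p)
    from l2_le_add[OF this step[of "n + p"]] show ?case by (simp add: field_simps)
  qed (simp add: l2_le_zero)
  have dist': "l2_le (\<lambda>x. h (n + p) x - h n x) (2 * r / 2 ^ n)" for n p
    by (rule l2_le_mono[OF dist]) (use r in auto)
  have lim0: "(\<lambda>n. 2 * r / 2 ^ n) \<longlonglongrightarrow> 0" by (rule LIMSEQ_divide_realpow_zero) simp
  have "Cauchy (\<lambda>n. h n x)" for x
  proof (rule CauchyI)
    fix e :: real assume "e > 0"
    then obtain N where N: "2 * r / 2 ^ N < e / 2"
      using order_tendstoD(2)[OF lim0, of "e / 2"] by (auto simp: eventually_sequentially)
    have *: "norm (h n x - h N x) < e / 2" if "n \<ge> N" for n
      using l2_le_point[OF dist'[of N "n - N"], of x] N that by auto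
    have "norm (h n x - h k x) < e" if nk: "n \<ge> N" "k \<ge> N" for n k
      using norm_triangle_lt[of "h n x - h N x" "h N x - h k x" e] *[OF nk(1)] *[OF nk(2)]
      by (simp add: norm_minus_commute)
    then show "\<exists>M. \<forall>m\<ge>M. \<forall>n\<ge>M. norm (h m x - h n x) < e" by blast
  qed
  then have l: "(\<lambda>n. h n x) \<longlonglongrightarrow> lim (\<lambda>n. h n x)" for x
    by (simp add: Cauchy_convergent_iff convergent_LIMSEQ_iff)
  define l where "l x = lim (\<lambda>n. h n x)" for x
  note l = l[folded l_def]
  have lr: "l2_le l r"
    by (rule l2_le_tendsto[OF _ l]) (use h in auto)
  have ld: "l2_le (\<lambda>x. l x - h n x) (2 * r / 2 ^ n)" for n
  proof (rule l2_le_tendsto[where G = sequentially and f = "\<lambda>p x. h (n + p) x - h n x"])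
    fix x
    show "(\<lambda>p. h (n + p) x - h n x) \<longlonglongrightarrow> l x - h n x"
      using LIMSEQ_ignore_initial_segment[OF l, of n x] by (intro tendsto_intros) (simp add: add.commute)
  qed (use dist' in auto)
  have "\<Phi> l x = l x" for x
  proof -
    have "(\<lambda>n. \<Phi> l x - h (Suc n) x) \<longlonglongrightarrow> 0"
    proof (rule Lim_null_comparison[OF always_eventually lim0], intro allI)
      fix n
      have "l2_le (\<lambda>x. \<Phi> l x - \<Phi> (h n) x) (2 * r / 2 ^ n / 2)" by (rule contr[OF lr h ld])
      from l2_le_point[OF this, of x] l2_le_nonneg[OF this]
      show "norm (\<Phi> l x - h (Suc n) x) \<le> 2 * r / 2 ^ n" by (simp add: h_def)
    qed
    moreover have "(\<lambda>n. \<Phi> l x - h (Suc n) x) \<longlonglongrightarrow> \<Phi> l x - l x"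
      by (intro tendsto_intros LIMSEQ_Suc l)
    ultimately show ?thesis using LIMSEQ_unique by fastforce
  qed
  then show thesis using that lr by blast
qed

section \<open>Invariant graphs of diagonal operators with small coupling\<close>

lemma has_sum_sum:
  fixes f :: "'i \<Rightarrow> 'a \<Rightarrow> 'b::topological_comm_monoid_add"
  assumes "\<And>i. i \<in> I \<Longrightarrow> (f i has_sum s i) A"
  shows "((\<lambda>x. \<Sum>i\<in>I. f i x) has_sum (\<Sum>i\<in>I. s i)) A"
  using assms by (induction I rule: infinite_finite_induct) (auto intro: has_sum_add)

lemma infsum_eq_sum_subset:
  assumes "finite A" "\<And>x. x \<notin> A \<Longrightarrow> f x = 0"
  shows "(\<Sum>\<^sub>\<infinity>x. f x) = (\<Sum>x\<in>A. f x)"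
proof -
  have "(\<Sum>\<^sub>\<infinity>x. f x) = (\<Sum>\<^sub>\<infinity>x\<in>A. f x)" by (rule infsum_cong_neutral) (use assms in auto)
  then show ?thesis using assms by simp
qed

text \<open>Bookkeeping for square roots: with \<open>c\<close> the root of a weight and
  \<open>r\<close> the weight, two half weights at the same index merge into one full weight,
  divided by the gap \<open>t\<close>.\<close>

lemma of_real_square_rescale:
  assumes "c * c = r"
  shows "of_real (a * c) * x * (of_real (c * b / t) * y) = of_real (a * b) * (x * (of_real (r / t) * y) :: complex)"
    and "of_real (b * c / t) * y * (of_real (c * a) * x) = of_real (b * a) * (of_real (r / t) * y * x :: complex)"
    and "of_real c * (of_real (c * b / t) * y) = of_real b * (of_real (r / t) * y :: complex)"
    and "of_real (b * c / t) * y * (of_real c * x) = of_real b * (of_real (r / t) * y * x :: complex)"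
  unfolding assms[symmetric] by (simp_all add: ac_simps)

text \<open>\<open>d k\<close> is the share of the gap owned by the mode \<open>k\<close>: the open
  discs of radius \<open>d k\<close> about \<open>D k\<close> with \<open>k\<close> outside
  \<open>P\<close> avoid those of radius \<open>d j\<close> about \<open>D j\<close> with
  \<open>j\<close> in \<open>P\<close>. The small quantity is the Hilbert-Schmidt norm of
  \<open>V\<close> multiplied by the inverse root of \<open>d\<close> on both sides. The value 1/8
  leaves room for the contraction and for the uniqueness arguments.\<close>

locale small_coupling =
  fixes P :: "'a set" and D d :: "'a \<Rightarrow> real" and V :: "'a \<Rightarrow> 'a \<Rightarrow> complex" and e :: real
  assumes finite_P: "finite P"
    and d_pos: "\<And>k. 0 < d k"
    and gap: "\<And>k j. k \<notin> P \<Longrightarrow> j \<in> P \<Longrightarrow> d k + d j \<le> \<bar>D k - D j\<bar>"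
    and coupling: "l2_le (\<lambda>(k, j). V k j / of_real (sqrt (d k * d j))) e"
    and e_small: "e \<le> 1 / 8"
begin

definition K :: "'a \<times> 'a \<Rightarrow> complex" where
  "K = (\<lambda>(k, j). V k j / of_real (sqrt (d k * d j)))"

text \<open>For the solution \<open>H\<close>, \<open>Yop H\<close> is the matrix \<open>X\<close>
  of the graph with entries multiplied by \<open>sqrt (d k) / sqrt (d j)\<close>, and
  \<open>Zop H\<close> the one with the reciprocal factor. In these terms V X and X V become
  products of \<open>K\<close> with one small matrix, up to outer factors
  \<open>sqrt d\<close>.\<close>

definition Yop :: "('a \<times> 'a \<Rightarrow> complex) \<Rightarrow> 'a \<times> 'a \<Rightarrow> complex" where
  "Yop H = (\<lambda>(k, j). if k \<notin> P \<and> j \<in> P then of_real (d k / (D k - D j)) * H (k, j) else 0)"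

definition Zop :: "('a \<times> 'a \<Rightarrow> complex) \<Rightarrow> 'a \<times> 'a \<Rightarrow> complex" where
  "Zop H = (\<lambda>(k, j). if k \<notin> P \<and> j \<in> P then of_real (d j / (D k - D j)) * H (k, j) else 0)"

definition higher :: "('a \<times> 'a \<Rightarrow> complex) \<Rightarrow> 'a \<times> 'a \<Rightarrow> complex" where
  "higher H = (\<lambda>(k, j). if k \<notin> P \<and> j \<in> P then
     - mat_prod K (Yop H) (k, j) + mat_prod (Zop H) K (k, j)
     + mat_prod (Zop H) (mat_prod K (Yop H)) (k, j) else 0)"

definition \<Phi> :: "('a \<times> 'a \<Rightarrow> complex) \<Rightarrow> 'a \<times> 'a \<Rightarrow> complex" where
  "\<Phi> H = (\<lambda>(k, j). (if k \<notin> P \<and> j \<in> P then - K (k, j) else 0) + higher H (k, j))"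

lemma l2_K: "l2_le K e"
  using coupling by (simp add: K_def)

lemma e_nonneg: "0 \<le> e"
  using l2_le_nonneg[OF l2_K] .

lemma abs_multiplier_le_1:
  assumes "k \<notin> P" "j \<in> P"
  shows "\<bar>d k / (D k - D j)\<bar> \<le> 1" "\<bar>d j / (D k - D j)\<bar> \<le> 1"
  using gap[OF assms] d_pos[of k] d_pos[of j] by (auto simp: abs_div divide_le_eq_1)

lemma D_neq: "k \<notin> P \<Longrightarrow> j \<in> P \<Longrightarrow> D k \<noteq> D j"
  using gap[of k j] d_pos[of k] d_pos[of j] by auto

lemma l2_Yop: "l2_le H r \<Longrightarrow> l2_le (Yop H) r"
proof (erule l2_le_mono)
  fix x :: "'a \<times> 'a"
  obtain k j where x: "x = (k, j)" by force
  show "norm (Yop H x) \<le> norm (H x)"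
    using mult_right_mono[OF abs_multiplier_le_1(1), of k j "norm (H x)"]
    by (auto simp: x Yop_def norm_mult simp del: of_real_divide)
qed simp

lemma l2_Zop: "l2_le H r \<Longrightarrow> l2_le (Zop H) r"
proof (erule l2_le_mono)
  fix x :: "'a \<times> 'a"
  obtain k j where x: "x = (k, j)" by force
  show "norm (Zop H x) \<le> norm (H x)"
    using mult_right_mono[OF abs_multiplier_le_1(2), of k j "norm (H x)"]
    by (auto simp: x Zop_def norm_mult simp del: of_real_divide)
qed simp

lemma Yop_diff: "Yop (\<lambda>x. H x - H' x) = (\<lambda>x. Yop H x - Yop H' x)"
  by (auto simp: Yop_def fun_eq_iff right_diff_distrib)

lemma Zop_diff: "Zop (\<lambda>x. H x - H' x) = (\<lambda>x. Zop H x - Zop H' x)"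
  by (auto simp: Zop_def fun_eq_iff right_diff_distrib)

lemma l2_higher:
  assumes "l2_le H r"
  shows "l2_le (higher H) (e * r + r * e + r * (e * r))"
proof (rule l2_le_mono)
  show "l2_le (\<lambda>x. - mat_prod K (Yop H) x + mat_prod (Zop H) K x
     + mat_prod (Zop H) (mat_prod K (Yop H)) x) (e * r + r * e + r * (e * r))"
    by (intro l2_le_add l2_le_mat_prod l2_K l2_Yop l2_Zop assms, subst l2_le_uminus)
       (intro l2_le_mat_prod l2_K l2_Yop assms)
qed (auto simp: higher_def)

text \<open>On the ball of radius \<open>2 * e\<close> the terms beyond \<open>- K\<close> have norm
  at most \<open>5 * e\<^sup>2\<close>. By \<open>five_e_sq\<close> this is at most
  \<open>e\<close>, so the ball is mapped into itself. The same bound produces the cubic remainder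
  in \<open>C_expansion\<close>.\<close>

lemma small_e: "e * (2 * e) + 2 * e * e + 2 * e * (e * (2 * e)) \<le> 5 * e\<^sup>2"
proof -
  have "e * (2 * e) + 2 * e * e + 2 * e * (e * (2 * e)) = (4 + 4 * e) * (e * e)"
    by (simp add: algebra_simps)
  also have "\<dots> \<le> 5 * (e * e)" using e_small e_nonneg by (intro mult_right_mono) auto
  finally show ?thesis by (simp add: power2_eq_square)
qed

lemma five_e_sq: "5 * e\<^sup>2 \<le> e"
  using mult_mono[OF e_small order_refl, of e] e_nonneg by (simp add: power2_eq_square)

lemma l2_\<Phi>:
  assumes "l2_le H (2 * e)"
  shows "l2_le (\<Phi> H) (2 * e)"
proof -
  have "l2_le (\<lambda>(k, j). if k \<notin> P \<and> j \<in> P then - K (k, j) else 0) e"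
    by (rule l2_le_mono[OF l2_K]) auto
  from l2_le_add[OF this l2_higher[OF assms]]
  show ?thesis
    by (rule l2_le_mono) (use small_e five_e_sq in \<open>auto simp: \<Phi>_def\<close>)
qed

text \<open>The quadratic term is split by changing one of its two factors at a time. The difference
  of the images is then linear in the difference of the arguments, with factor
  \<open>2 * e + 4 * (e * e)\<close>, which is below 1/2.\<close>

lemma \<Phi>_contraction:
  assumes H: "l2_le H (2 * e)" and H': "l2_le H' (2 * e)" and diff: "l2_le (\<lambda>x. H x - H' x) C"
  shows "l2_le (\<lambda>x. \<Phi> H x - \<Phi> H' x) (C / 2)"
proof -
  note YH = l2_Yop[OF H] and ZH = l2_Zop[OF H] and YH' = l2_Yop[OF H'] and ZH' = l2_Zop[OF H']
  note KY = l2_le_mat_prod[OF l2_K YH] and KY' = l2_le_mat_prod[OF l2_K YH']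
  note dY = l2_Yop[OF diff] and dZ = l2_Zop[OF diff]
  have "norm (\<Phi> H x - \<Phi> H' x) \<le> norm (- mat_prod K (Yop (\<lambda>x. H x - H' x)) x
      + mat_prod (Zop (\<lambda>x. H x - H' x)) K x
      + mat_prod (Zop (\<lambda>x. H x - H' x)) (mat_prod K (Yop H)) x
      + mat_prod (Zop H') (mat_prod K (Yop (\<lambda>x. H x - H' x))) x)" for x
  proof -
    have *: "mat_prod (Zop H') (mat_prod K (Yop (\<lambda>x. H x - H' x))) x
        = mat_prod (Zop H') (mat_prod K (Yop H)) x - mat_prod (Zop H') (mat_prod K (Yop H')) x"
      unfolding Yop_diff mat_prod_diff_right[OF l2_K YH YH']
      by (rule mat_prod_diff_right[OF ZH' KY KY'])
    show ?thesis
      unfolding * unfolding Yop_diff Zop_diff mat_prod_diff_right[OF l2_K YH YH']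
        mat_prod_diff_left[OF ZH ZH' l2_K] mat_prod_diff_left[OF ZH ZH' KY]
      by (cases x) (simp add: \<Phi>_def higher_def algebra_simps)
  qed
  moreover have "l2_le (\<lambda>x. - mat_prod K (Yop (\<lambda>x. H x - H' x)) x
      + mat_prod (Zop (\<lambda>x. H x - H' x)) K x
      + mat_prod (Zop (\<lambda>x. H x - H' x)) (mat_prod K (Yop H)) x
      + mat_prod (Zop H') (mat_prod K (Yop (\<lambda>x. H x - H' x))) x)
      (e * C + C * e + C * (e * (2 * e)) + 2 * e * (e * C))"
    by (intro l2_le_add l2_le_mat_prod KY dZ ZH' l2_K dY, subst l2_le_uminus)
       (intro l2_le_mat_prod l2_K dY)
  moreover have "e * C + C * e + C * (e * (2 * e)) + 2 * e * (e * C) \<le> C / 2"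
  proof -
    have "C * (2 * e + 4 * (e * e)) \<le> C * (1 / 2)"
      using mult_mono[OF e_small e_small] e_nonneg e_small l2_le_nonneg[OF diff]
      by (intro mult_left_mono) auto
    then show ?thesis by (simp add: algebra_simps)
  qed
  ultimately show ?thesis by (blast intro: l2_le_mono)
qed

definition H :: "'a \<times> 'a \<Rightarrow> complex" where
  "H = (SOME H. l2_le H (2 * e) \<and> \<Phi> H = H)"

lemma l2_H: "l2_le H (2 * e)" and \<Phi>_H: "\<Phi> H = H"
proof -
  obtain f where "l2_le f (2 * e)" "\<Phi> f = f"
    by (rule l2_contraction_fixed_point[of "2 * e" \<Phi>]) (use e_nonneg l2_\<Phi> \<Phi>_contraction in auto)
  then have "\<exists>H. l2_le H (2 * e) \<and> \<Phi> H = H" by blast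
  from someI_ex[OF this] show "l2_le H (2 * e)" "\<Phi> H = H" by (auto simp: H_def)
qed

text \<open>The graph of \<open>X\<close> over the modes in \<open>P\<close> is invariant under \<open>D + V\<close>; the equation
  \<open>\<Phi> H = H\<close> is the corresponding Riccati equation, rescaled so that both \<open>Yop H\<close> and
  \<open>Zop H\<close> stay small.\<close>

definition X :: "'a \<Rightarrow> 'a \<Rightarrow> complex" where
  "X k j = (if k \<notin> P \<and> j \<in> P then of_real (sqrt (d k * d j) / (D k - D j)) * H (k, j) else 0)"

text \<open>\<open>V\<close> composed with the embedding of the graph. The rows in \<open>P\<close>
  give the reduced matrix \<open>Top\<close>; the other rows enter the Riccati equation.\<close>

definition C :: "'a \<Rightarrow> 'a \<Rightarrow> complex" where
  "C i j = V i j + (\<Sum>\<^sub>\<infinity>l. V i l * X l j)"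

definition graph :: "('a \<Rightarrow> complex) \<Rightarrow> 'a \<Rightarrow> complex" where
  "graph u k = (if k \<in> P then u k else \<Sum>j\<in>P. X k j * u j)"

definition Lop :: "('a \<Rightarrow> complex) \<Rightarrow> 'a \<Rightarrow> complex" where
  "Lop x k = of_real (D k) * x k + (\<Sum>\<^sub>\<infinity>l. V k l * x l)"

definition Top :: "('a \<Rightarrow> complex) \<Rightarrow> 'a \<Rightarrow> complex" where
  "Top u i = (if i \<in> P then of_real (D i) * u i + (\<Sum>j\<in>P. C i j * u j) else 0)"

lemma V_eq_K: "V k j = of_real (sqrt (d k) * sqrt (d j)) * K (k, j)"
  using d_pos[of k] d_pos[of j] by (simp add: K_def real_sqrt_mult)

lemma sqrt_d: "sqrt (d k) * sqrt (d k) = d k" "sqrt (d k) > 0"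
  using d_pos[of k] by auto

lemma V_times_X: "V k l * X l j = of_real (sqrt (d k) * sqrt (d j)) * (K (k, l) * Yop H (l, j))"
proof (cases "l \<notin> P \<and> j \<in> P")
  case True
  show ?thesis
    by (simp only: V_eq_K X_def Yop_def real_sqrt_mult prod.case True if_True simp_thms)
       (rule of_real_square_rescale(1)[OF sqrt_d(1)])
qed (auto simp: X_def Yop_def)

lemma X_times: "X k i * (of_real (sqrt (d i) * sqrt (d j)) * y)
    = of_real (sqrt (d k) * sqrt (d j)) * (Zop H (k, i) * y)"
proof (cases "k \<notin> P \<and> i \<in> P")
  case True
  show ?thesis
    by (simp only: X_def Zop_def real_sqrt_mult prod.case True if_True simp_thms)
       (rule of_real_square_rescale(2)[OF sqrt_d(1)])
qed (auto simp: X_def Zop_def)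

lemma X_times_sqrt: "X k i * (of_real (sqrt (d i)) * y) = of_real (sqrt (d k)) * (Zop H (k, i) * y)"
proof (cases "k \<notin> P \<and> i \<in> P")
  case True
  show ?thesis
    by (simp only: X_def Zop_def real_sqrt_mult prod.case True if_True simp_thms)
       (rule of_real_square_rescale(4)[OF sqrt_d(1)])
qed (auto simp: X_def Zop_def)

lemma sqrt_times_X: "of_real (sqrt (d k)) * X k j = of_real (sqrt (d j)) * Yop H (k, j)"
proof (cases "k \<notin> P \<and> j \<in> P")
  case True
  show ?thesis
    by (simp only: X_def Yop_def real_sqrt_mult prod.case True if_True simp_thms)
       (rule of_real_square_rescale(3)[OF sqrt_d(1)])
qed (auto simp: X_def Yop_def)

lemma l2_Y: "l2_le (Yop H) (2 * e)" and l2_Z: "l2_le (Zop H) (2 * e)"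
  by (intro l2_Yop l2_Zop l2_H)+

lemma VX: "(\<Sum>\<^sub>\<infinity>l. V k l * X l j) = of_real (sqrt (d k) * sqrt (d j)) * mat_prod K (Yop H) (k, j)"
  by (simp only: V_times_X infsum_cmult_right' mat_prod_def prod.case)

lemma C_eq: "C k j = of_real (sqrt (d k) * sqrt (d j)) * (K (k, j) + mat_prod K (Yop H) (k, j))"
  unfolding C_def VX distrib_left by (simp only: V_eq_K[of k j])

lemma X_outside: "k \<in> P \<or> j \<notin> P \<Longrightarrow> X k j = 0"
  by (auto simp: X_def)

lemma Zop_prod: "mat_prod (Zop H) M (k, j) = (\<Sum>i\<in>P. Zop H (k, i) * M (i, j))"
  unfolding mat_prod_def prod.case
  by (rule infsum_eq_sum_subset[OF finite_P]) (auto simp: Zop_def)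

text \<open>This is the fixed point equation multiplied by \<open>sqrt (d k * d j)\<close>:
  multiplying \<open>X k j\<close> by the gap \<open>D k - D j\<close> returns
  \<open>H (k, j)\<close> times this factor, which explains the shape of \<open>X\<close>.\<close>

lemma riccati:
  assumes "k \<notin> P" "j \<in> P"
  shows "of_real (D k) * X k j + C k j = of_real (D j) * X k j + (\<Sum>i\<in>P. X k i * C i j)"
proof -
  define s where "s = complex_of_real (sqrt (d k) * sqrt (d j))"
  have "(\<Sum>i\<in>P. X k i * C i j) =
      (\<Sum>i\<in>P. X k i * V i j) + (\<Sum>i\<in>P. X k i * (of_real (sqrt (d i) * sqrt (d j)) * mat_prod K (Yop H) (i, j)))"
    by (simp add: C_def VX distrib_left sum.distrib)
  also have "(\<Sum>i\<in>P. X k i * V i j) = s * mat_prod (Zop H) K (k, j)"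
    by (simp only: V_eq_K X_times Zop_prod s_def sum_distrib_left)
  also have "(\<Sum>i\<in>P. X k i * (of_real (sqrt (d i) * sqrt (d j)) * mat_prod K (Yop H) (i, j)))
      = s * mat_prod (Zop H) (mat_prod K (Yop H)) (k, j)"
    by (simp only: X_times Zop_prod s_def sum_distrib_left)
  finally have 1: "(\<Sum>i\<in>P. X k i * C i j)
      = s * (mat_prod (Zop H) K (k, j) + mat_prod (Zop H) (mat_prod K (Yop H)) (k, j))"
    by (simp add: distrib_left)
  have 2: "(of_real (D k) - of_real (D j)) * X k j = s * H (k, j)"
    using D_neq[OF assms] assms by (simp add: X_def s_def real_sqrt_mult)
  have 3: "H (k, j) = - K (k, j) - mat_prod K (Yop H) (k, j) + mat_prod (Zop H) K (k, j)
     + mat_prod (Zop H) (mat_prod K (Yop H)) (k, j)"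
    by (subst \<Phi>_H[symmetric]) (simp add: assms \<Phi>_def higher_def)
  have 4: "C k j = s * (K (k, j) + mat_prod K (Yop H) (k, j))"
    by (simp add: C_eq s_def)
  show ?thesis using 2 unfolding 1 3 4 by (simp add: algebra_simps)
qed

lemma l2_X_column: "l2_le (\<lambda>k. of_real (sqrt (d k)) * X k j) (sqrt (d j) * (2 * e))"
  unfolding sqrt_times_X
  using l2_le_cmult[OF l2_le_column[OF l2_Y, of j], of "of_real (sqrt (d j))"] sqrt_d(2)[of j]
  by simp

text \<open>The form domain in coordinates. Finite energy makes the series for \<open>V\<close>
  applied to \<open>x\<close> converge, by Cauchy-Schwarz against a row of \<open>K\<close>.\<close>

definition energy_le :: "('a \<Rightarrow> complex) \<Rightarrow> real \<Rightarrow> bool" where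
  "energy_le x B \<longleftrightarrow> l2_le (\<lambda>k. of_real (sqrt (d k)) * x k) B"

lemma V_times: "V k l * x l = of_real (sqrt (d k)) * (K (k, l) * (of_real (sqrt (d l)) * x l))"
  by (simp add: V_eq_K)

lemma summable_V:
  assumes "energy_le x B"
  shows "(\<lambda>l. V k l * x l) summable_on UNIV"
  unfolding V_times
  by (intro summable_on_cmult_right
      l1_le_summable[OF l2_le_prod[OF l2_le_row[OF l2_K] assms[unfolded energy_le_def]]])

lemma energy_le_add: "energy_le x B \<Longrightarrow> energy_le y B' \<Longrightarrow> energy_le (\<lambda>k. x k + y k) (B + B')"
  unfolding energy_le_def distrib_left by (rule l2_le_add)

lemma energy_le_uminus: "energy_le x B \<Longrightarrow> energy_le (\<lambda>k. - x k) B"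
  by (simp add: energy_le_def l2_le_uminus)

lemma energy_le_sum:
  "finite A \<Longrightarrow> (\<And>i. i \<in> A \<Longrightarrow> energy_le (f i) (c i)) \<Longrightarrow> energy_le (\<lambda>k. \<Sum>i\<in>A. f i k) (sum c A)"
  unfolding energy_le_def sum_distrib_left by (rule l2_le_sum)

lemma energy_le_X: "energy_le (\<lambda>k. X k j * c) (norm c * (sqrt (d j) * (2 * e)))"
  using l2_le_cmult[OF l2_X_column[of j], of c] by (simp add: energy_le_def ac_simps)

lemma energy_le_finite:
  assumes "finite A" "\<And>k. k \<notin> A \<Longrightarrow> x k = 0"
  shows "energy_le x (\<Sum>k\<in>A. norm (of_real (sqrt (d k)) * x k))"
  unfolding energy_le_def l2_le_def
proof (intro conjI allI impI sum_nonneg norm_ge_zero)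
  fix F :: "'a set" assume F: "finite F"
  have "L2_set (\<lambda>k. norm (of_real (sqrt (d k)) * x k)) F \<le> (\<Sum>k\<in>F. norm (of_real (sqrt (d k)) * x k))"
    by (rule L2_set_le_sum) simp
  also have "\<dots> = (\<Sum>k\<in>F \<inter> A. norm (of_real (sqrt (d k)) * x k))"
    using F assms by (intro sum.mono_neutral_right) auto
  also have "\<dots> \<le> (\<Sum>k\<in>A. norm (of_real (sqrt (d k)) * x k))"
    using assms by (intro sum_mono2) auto
  finally show "L2_set (\<lambda>k. norm (of_real (sqrt (d k)) * x k)) F
    \<le> (\<Sum>k\<in>A. norm (of_real (sqrt (d k)) * x k))" .
qed

lemma graph_split: "graph u = (\<lambda>k. (if k \<in> P then u k else 0) + (\<Sum>j\<in>P. X k j * u j))"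
  by (auto simp: graph_def X_outside fun_eq_iff)

lemma energy_le_graph: "\<exists>B. energy_le (graph u) B"
  unfolding graph_split
  by (rule exI, rule energy_le_add[OF energy_le_finite[OF finite_P] energy_le_sum[OF finite_P energy_le_X]])
    auto

lemma V_graph: "(\<Sum>\<^sub>\<infinity>l. V k l * graph u l) = (\<Sum>j\<in>P. C k j * u j)"
proof -
  have *: "(\<lambda>l. V k l * (X l j * u j)) summable_on UNIV" for j
    by (rule summable_V[OF energy_le_X])
  have **: "(\<lambda>l. V k l * (if l \<in> P then u l else 0)) summable_on UNIV"
    by (rule summable_V[OF energy_le_finite[OF finite_P]]) auto
  have "(\<Sum>\<^sub>\<infinity>l. V k l * graph u l) = (\<Sum>\<^sub>\<infinity>l. V k l * (if l \<in> P then u l else 0) + (\<Sum>j\<in>P. V k l * (X l j * u j)))"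
    by (simp add: graph_split distrib_left sum_distrib_left)
  also have "\<dots> = (\<Sum>\<^sub>\<infinity>l. V k l * (if l \<in> P then u l else 0)) + (\<Sum>\<^sub>\<infinity>l. \<Sum>j\<in>P. V k l * (X l j * u j))"
    by (intro infsum_add ** has_sum_imp_summable[OF has_sum_sum[OF has_sum_infsum]] *)
  also have "(\<Sum>\<^sub>\<infinity>l. V k l * (if l \<in> P then u l else 0)) = (\<Sum>l\<in>P. V k l * u l)"
    by (subst infsum_eq_sum_subset[OF finite_P]) auto
  also have "(\<Sum>\<^sub>\<infinity>l. \<Sum>j\<in>P. V k l * (X l j * u j)) = (\<Sum>j\<in>P. \<Sum>\<^sub>\<infinity>l. V k l * (X l j * u j))"
    by (rule infsumI[OF has_sum_sum]) (intro has_sum_infsum *)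
  also have "\<dots> = (\<Sum>j\<in>P. (\<Sum>\<^sub>\<infinity>l. V k l * X l j) * u j)"
    by (intro sum.cong refl, subst infsum_cmult_left'[symmetric]) (simp add: mult.assoc)
  finally show ?thesis by (simp add: C_def distrib_right sum.distrib)
qed

text \<open>The intertwining relation. On \<open>P\<close> it is the definition of
  \<open>Top\<close>; outside \<open>P\<close> it is the Riccati equation.\<close>

lemma Lop_graph: "Lop (graph u) = graph (Top u)"
proof
  fix k
  show "Lop (graph u) k = graph (Top u) k"
  proof (cases "k \<in> P")
    case True
    then show ?thesis by (simp add: Lop_def V_graph) (simp add: graph_def Top_def)
  next
    case False
    have "Lop (graph u) k = (\<Sum>j\<in>P. (of_real (D k) * X k j + C k j) * u j)"
      using False by (simp add: Lop_def V_graph) (simp add: graph_def sum_distrib_left sum.distrib distrib_right mult.assoc)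
    also have "\<dots> = (\<Sum>j\<in>P. (of_real (D j) * X k j + (\<Sum>i\<in>P. X k i * C i j)) * u j)"
      using False by (simp add: riccati)
    also have "\<dots> = (\<Sum>j\<in>P. X k j * (of_real (D j) * u j)) + (\<Sum>j\<in>P. \<Sum>i\<in>P. X k i * (C i j * u j))"
      by (simp add: distrib_right sum.distrib sum_distrib_right mult.assoc mult.left_commute[of "X k _"])
    also have "(\<Sum>j\<in>P. \<Sum>i\<in>P. X k i * (C i j * u j)) = (\<Sum>i\<in>P. X k i * (\<Sum>j\<in>P. C i j * u j))"
      by (subst sum.swap) (simp add: sum_distrib_left)
    finally show ?thesis
      unfolding graph_def[of "Top u"] using False by (simp add: Top_def distrib_left sum.distrib)
  qed
qed

lemma Lop_diff:
  assumes "energy_le x B" "energy_le y B'"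
  shows "Lop (\<lambda>k. x k - y k) k = Lop x k - Lop y k"
  unfolding Lop_def right_diff_distrib
  by (subst infsum_diff) (auto intro: summable_V assms)

lemma graph_diff: "graph (\<lambda>j. u j - u' j) k = graph u k - graph u' k"
  by (simp add: graph_def right_diff_distrib sum_subtractf)

lemma graph_cmult: "graph (\<lambda>j. c * u j) k = c * graph u k"
  by (simp add: graph_def sum_distrib_left ac_simps)

text \<open>The difference \<open>w\<close> of \<open>x\<close> and the graph over its own part in
  \<open>P\<close> vanishes on \<open>P\<close>, and its residual is again a graph. Outside
  \<open>P\<close> this reads (D - z) w = - q + X q with q = V w, and \<open>far\<close> permits
  division by D - z. In weighted form, \<open>w\<close> is dominated by its image under a map of
  norm at most 1/2, hence is 0.\<close>

lemma in_graph_if_residual_in_graph: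
  assumes x: "energy_le x B"
    and res: "\<And>k. Lop x k - z * x k = graph u k"
    and far: "\<And>k. k \<notin> P \<Longrightarrow> d k \<le> cmod (of_real (D k) - z)"
  shows "x = graph x"
proof -
  define w where "w k = x k - graph x k" for k
  define g where "g k = of_real (sqrt (d k)) * w k" for k
  define q where "q k = (\<Sum>\<^sub>\<infinity>l. V k l * w l)" for k
  obtain B' where B': "energy_le (graph x) B'" using energy_le_graph by blast
  have w0: "w k = 0" if "k \<in> P" for k using that by (simp add: w_def graph_def)
  define u' where "u' j = u j - (Top x j - z * x j)" for j
  have Lw: "Lop w k - z * w k = graph u' k" for k
  proof -
    have "Lop w k - z * w k = (Lop x k - z * x k) - (graph (Top x) k - z * graph x k)"
      unfolding w_def by (subst Lop_diff[OF x B']) (simp add: Lop_graph right_diff_distrib)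
    also have "\<dots> = graph u' k"
      unfolding u'_def res graph_diff graph_cmult ..
    finally show ?thesis .
  qed
  \<comment> \<open>On \<open>P\<close> the residual of \<open>w\<close> reduces to
    \<open>q\<close>, because \<open>w\<close> vanishes there; this eliminates
    \<open>u'\<close>.\<close>
  have q_P: "u' j = q j" if "j \<in> P" for j
    using Lw[of j] that w0[OF that] by (simp add: Lop_def graph_def q_def)
  have eq: "(of_real (D k) - z) * w k = - q k + (\<Sum>j\<in>P. X k j * q j)" if "k \<notin> P" for k
    using Lw[of k] that by (simp add: Lop_def graph_def q_P algebra_simps flip: q_def[unfolded mult.commute[of "V _ _"]])
  \<comment> \<open>The sequence becomes a matrix with a single column, so that the Hilbert-Schmidt
    bound for \<open>mat_prod\<close> applies to it.\<close>
  define G where "G = (\<lambda>(k, _::unit). g k)"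
  have q: "q k = of_real (sqrt (d k)) * mat_prod K G (k, ())" for k
    unfolding q_def V_times infsum_cmult_right' mat_prod_def G_def g_def by simp
  have g: "norm (g k) \<le> norm (- mat_prod K G (k, ()) + mat_prod (Zop H) (mat_prod K G) (k, ()))" for k
  proof (cases "k \<in> P")
    case True then show ?thesis by (simp add: g_def w0)
  next
    case False
    have Xq: "X k j * q j = of_real (sqrt (d k)) * (Zop H (k, j) * mat_prod K G (j, ()))" for j
      by (simp only: q X_times_sqrt)
    have "(of_real (D k) - z) * w k = of_real (sqrt (d k)) *
        (- mat_prod K G (k, ()) + mat_prod (Zop H) (mat_prod K G) (k, ()))"
      unfolding eq[OF False] Xq by (simp add: Zop_prod q right_diff_distrib sum_distrib_left)
    then have "cmod (of_real (D k) - z) * norm (w k) = sqrt (d k) *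
        norm (- mat_prod K G (k, ()) + mat_prod (Zop H) (mat_prod K G) (k, ()))"
      using sqrt_d(2)[of k] by (metis norm_mult norm_of_real abs_of_pos)
    moreover have "d k * norm (w k) \<le> cmod (of_real (D k) - z) * norm (w k)"
      by (intro mult_right_mono far False) simp
    moreover have "d k * norm (w k) = sqrt (d k) * norm (g k)"
      using sqrt_d[of k] by (simp add: g_def norm_mult flip: mult.assoc)
    ultimately show ?thesis using sqrt_d(2)[of k] by (metis mult_le_cancel_left_pos)
  qed
  have "g k = 0" for k
  proof (rule l2_le_zero_if_halving[of g])
    have "l2_le (\<lambda>k. of_real (sqrt (d k)) * (x k + - graph x k)) (B + B')"
      using energy_le_add[OF x energy_le_uminus[OF B']] by (simp add: energy_le_def)
    then show "l2_le g (B + B')" by (simp add: g_def[abs_def] w_def)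
  next
    fix c assume "l2_le g c"
    then have G: "l2_le G c" unfolding G_def
      by (intro l2_le_comp[of g c "\<lambda>(k, _::unit). k", simplified case_prod_unfold, THEN l2_le_mono])
         (auto simp: inj_def)
    have "l2_le (\<lambda>x. - mat_prod K G x + mat_prod (Zop H) (mat_prod K G) x) (e * c + 2 * e * (e * c))"
      by (intro l2_le_add l2_le_mat_prod l2_Z l2_K G, subst l2_le_uminus)
         (intro l2_le_mat_prod l2_K G)
    from l2_le_comp[OF this, of "\<lambda>k. (k, ())"]
    have 1: "l2_le (\<lambda>k. - mat_prod K G (k, ()) + mat_prod (Zop H) (mat_prod K G) (k, ()))
       (e * c + 2 * e * (e * c))" by (simp add: inj_def)
    have "(e + 2 * (e * e)) * c \<le> (1 / 2) * c"
      using mult_mono[OF e_small e_small] e_nonneg e_small l2_le_nonneg[OF G]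
      by (intro mult_right_mono) auto
    then show "l2_le g (c / 2)"
      by (intro l2_le_mono[OF 1 g]) (simp add: algebra_simps)
  qed
  then have "w k = 0" for k using d_pos by (simp add: g_def less_imp_neq[symmetric])
  then show ?thesis by (auto simp: w_def)
qed

text \<open>A Gershgorin type bound for the reduced matrix. If \<open>z\<close> kept distance
  \<open>d j\<close> from every \<open>D j\<close>, the weighted eigenvector would be dominated by
  its image under \<open>K\<close> plus \<open>K\<close> times \<open>Yop H\<close>, a map of norm
  below 1/2, and the halving principle would make it 0.\<close>

lemma eigenvalue_near_diagonal:
  assumes u: "\<And>i. Top u i = z * u i" "\<And>i. i \<notin> P \<Longrightarrow> u i = 0" and "u \<noteq> (\<lambda>_. 0)"
  shows "\<exists>j\<in>P. cmod (of_real (D j) - z) < d j"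
proof (rule ccontr)
  assume "\<not> ?thesis"
  then have far: "d j \<le> cmod (of_real (D j) - z)" if "j \<in> P" for j using that by force
  define g where "g k = of_real (sqrt (d k)) * u k" for k
  define G where "G = (\<lambda>(k, _::unit). g k)"
  define M where "M x = K x + mat_prod K (Yop H) x" for x
  have M: "l2_le M (e + e * (2 * e))" unfolding M_def
    by (intro l2_le_add l2_le_mat_prod l2_K l2_Y)
  have g: "norm (g k) \<le> norm (mat_prod M G (k, ()))" for k
  proof (cases "k \<in> P")
    case False then show ?thesis by (simp add: g_def u)
  next
    case True
    have "(of_real (D k) - z) * u k = - (\<Sum>j\<in>P. C k j * u j)"
      using u(1)[of k] True by (simp add: Top_def algebra_simps)
    also have "(\<Sum>j\<in>P. C k j * u j) = of_real (sqrt (d k)) * (\<Sum>j\<in>P. M (k, j) * g j)"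
      unfolding C_eq M_def g_def by (simp add: sum_distrib_left ac_simps)
    also have "(\<Sum>j\<in>P. M (k, j) * g j) = mat_prod M G (k, ())"
      unfolding mat_prod_def G_def prod.case
      by (rule infsum_eq_sum_subset[OF finite_P, symmetric]) (simp add: g_def u)
    finally have "cmod (of_real (D k) - z) * norm (u k) = sqrt (d k) * norm (mat_prod M G (k, ()))"
      using sqrt_d(2)[of k] by (metis norm_mult norm_of_real abs_of_pos norm_minus_cancel)
    moreover have "d k * norm (u k) \<le> cmod (of_real (D k) - z) * norm (u k)"
      by (intro mult_right_mono far True) simp
    moreover have "d k * norm (u k) = sqrt (d k) * norm (g k)"
      using sqrt_d[of k] by (simp add: g_def norm_mult flip: mult.assoc)
    ultimately show ?thesis using sqrt_d(2)[of k] by (metis mult_le_cancel_left_pos)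
  qed
  have "g k = 0" for k
  proof (rule l2_le_zero_if_halving[of g])
    show "l2_le g (\<Sum>k\<in>P. norm (of_real (sqrt (d k)) * u k))"
      using energy_le_finite[OF finite_P, of u] u(2) by (simp add: energy_le_def g_def[abs_def])
  next
    fix c assume "l2_le g c"
    then have G: "l2_le G c" unfolding G_def
      by (intro l2_le_comp[of g c "\<lambda>(k, _::unit). k", simplified case_prod_unfold, THEN l2_le_mono])
         (auto simp: inj_def)
    from l2_le_comp[OF l2_le_mat_prod[OF M G], of "\<lambda>k. (k, ())"]
    have 1: "l2_le (\<lambda>k. mat_prod M G (k, ())) ((e + e * (2 * e)) * c)" by (simp add: inj_def)
    have "(e + e * (2 * e)) * c \<le> (1 / 2) * c"
      using mult_mono[OF e_small e_small] e_nonneg e_small l2_le_nonneg[OF G]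
      by (intro mult_right_mono) auto
    then show "l2_le g (c / 2)"
      by (intro l2_le_mono[OF 1 g]) simp
  qed
  then have "u k = 0" for k using d_pos by (simp add: g_def less_imp_neq[symmetric])
  with \<open>u \<noteq> (\<lambda>_. 0)\<close> show False by auto
qed

text \<open>One iteration of the fixed point equation: between \<open>P\<close> and its complement,
  \<open>H\<close> is \<open>- K\<close> plus \<open>higher H\<close>. Inserted into V X, the part
  \<open>- K\<close> gives minus the sum of second order, and \<open>higher H\<close>, of norm at
  most \<open>5 * e\<^sup>2\<close>, gives the remainder after one more factor
  \<open>K\<close>.\<close>

lemma C_expansion:
  assumes "i \<in> P" "j \<in> P"
  shows "cmod (C i j - V i j + (\<Sum>\<^sub>\<infinity>l. if l \<in> P then 0 else V i l * V l j / of_real (D l - D j)))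
    \<le> sqrt (d i) * sqrt (d j) * (5 * e ^ 3)"
    and "(\<lambda>l. if l \<in> P then 0 else V i l * V l j / of_real (D l - D j)) summable_on UNIV"
proof -
  define s where "s = complex_of_real (sqrt (d i) * sqrt (d j))"
  have term1: "(if l \<in> P then 0 else V i l * V l j / of_real (D l - D j))
      = s * (K (i, l) * Yop K (l, j))" for l
  proof (cases "l \<in> P")
    case False
    have "V i l * V l j / of_real (D l - D j) = of_real (sqrt (d i) * sqrt (d l)) * K (i, l)
        * (of_real (sqrt (d l) * sqrt (d j) / (D l - D j)) * K (l, j))"
      by (simp add: V_eq_K)
    also have "\<dots> = s * (K (i, l) * (of_real (d l / (D l - D j)) * K (l, j)))"
      unfolding s_def by (rule of_real_square_rescale(1)[OF sqrt_d(1)])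
    finally show ?thesis using False assms by (simp add: s_def Yop_def)
  qed (auto simp: Yop_def)
  show "(\<lambda>l. if l \<in> P then 0 else V i l * V l j / of_real (D l - D j)) summable_on UNIV"
    unfolding term1
    by (intro summable_on_cmult_right l1_le_summable[OF l1_le_mat_prod[OF l2_K l2_Yop[OF l2_K]]])
  have sum1: "(\<Sum>\<^sub>\<infinity>l. if l \<in> P then 0 else V i l * V l j / of_real (D l - D j))
      = s * mat_prod K (Yop K) (i, j)"
    unfolding term1 infsum_cmult_right' mat_prod_def by simp
  \<comment> \<open>The double minus puts the identity into the form of a difference, as
    \<open>mat_prod_diff_right\<close> expects it.\<close>
  have Yh: "Yop (higher H) x = Yop H x - - Yop K x" for x
  proof -
    obtain k l where x: "x = (k, l)" by force
    show ?thesis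
    proof (cases "k \<notin> P \<and> l \<in> P")
      case True
      then have "\<Phi> H x = higher H x - K x" by (simp add: x \<Phi>_def)
      then have "higher H x = H x + K x" by (simp add: \<Phi>_H)
      then show ?thesis using True by (simp add: x Yop_def distrib_left)
    qed (auto simp: x Yop_def)
  qed
  have "mat_prod K (Yop (higher H)) (i, j) = mat_prod K (Yop H) (i, j) - mat_prod K (\<lambda>x. - Yop K x) (i, j)"
    unfolding Yh by (rule mat_prod_diff_right[OF l2_K l2_Y]) (subst l2_le_uminus, rule l2_Yop[OF l2_K])
  also have "mat_prod K (\<lambda>x. - Yop K x) (i, j) = - mat_prod K (Yop K) (i, j)"
    by (simp add: mat_prod_def infsum_uminus)
  finally have "C i j - V i j + (\<Sum>\<^sub>\<infinity>l. if l \<in> P then 0 else V i l * V l j / of_real (D l - D j))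
      = s * mat_prod K (Yop (higher H)) (i, j)"
    by (simp add: sum1 C_def VX s_def distrib_left)
  moreover have "cmod (mat_prod K (Yop (higher H)) (i, j)) \<le> 5 * e ^ 3"
  proof -
    have "l2_le (higher H) (5 * e\<^sup>2)"
      by (rule l2_le_mono[OF l2_higher[OF l2_H]]) (use small_e in auto)
    from l2_le_point[OF l2_le_mat_prod[OF l2_K l2_Yop[OF this]], of "(i, j)"]
    show ?thesis by (simp add: power3_eq_cube power2_eq_square ac_simps)
  qed
  ultimately show "cmod (C i j - V i j + (\<Sum>\<^sub>\<infinity>l. if l \<in> P then 0 else V i l * V l j / of_real (D l - D j)))
    \<le> sqrt (d i) * sqrt (d j) * (5 * e ^ 3)"
    using sqrt_d(2)[of i] sqrt_d(2)[of j] by (simp add: norm_mult s_def mult_left_mono)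
qed

end

section \<open>Root spaces of an operator on a finite-dimensional subspace\<close>

text \<open>\<open>T\<close> acts on the whole type, but only the invariant subspace
  \<open>E\<close> is finite-dimensional, just as the sequences supported on \<open>P\<close> among
  all sequences. The finite set \<open>B\<^sub>0\<close> witnesses the finite dimension; it may be
  dependent or leave \<open>E\<close>.\<close>

locale operator_on_subspace = vector_space scale
  for scale :: "complex \<Rightarrow> 'b::ab_group_add \<Rightarrow> 'b" (infixr "*s" 75) +
  fixes T :: "'b \<Rightarrow> 'b" and E B\<^sub>0 :: "'b set"
  assumes T_add: "T (x + y) = T x + T y"
    and T_scale: "T (c *s x) = c *s T x"
    and subspace_E: "subspace E"
    and T_E: "x \<in> E \<Longrightarrow> T x \<in> E"
    and finite_B0: "finite B\<^sub>0"
    and E_span: "E \<subseteq> span B\<^sub>0"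
begin

definition shift :: "complex \<Rightarrow> 'b \<Rightarrow> 'b" where
  "shift z x = T x - z *s x"

definition root :: "complex \<Rightarrow> 'b set" where
  "root z = {x \<in> E. \<exists>n. (shift z ^^ n) x = 0}"

lemma T_zero: "T 0 = 0"
  using T_scale[of 0 0] by simp

lemma T_diff: "T (x - y) = T x - T y"
  using T_add[of x "- y"] T_scale[of "-1" y] by simp

lemma shift_E: "x \<in> E \<Longrightarrow> shift z x \<in> E"
  unfolding shift_def by (intro subspace_diff subspace_scale subspace_E T_E)

lemma shift_zero: "shift z 0 = 0"
  by (simp add: shift_def T_zero)

lemma shift_add: "shift z (x + y) = shift z x + shift z y"
  by (simp add: shift_def T_add scale_right_distrib)

lemma shift_scale: "shift z (c *s x) = c *s shift z x"
  by (simp add: shift_def T_scale scale_right_diff_distrib mult.commute)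

lemma shift_commute: "shift z (shift w x) = shift w (shift z x)"
  by (simp add: shift_def T_diff T_scale scale_right_diff_distrib mult.commute)

lemma funpow_shift_E: "x \<in> E \<Longrightarrow> (shift z ^^ n) x \<in> E"
  by (induction n) (auto intro: shift_E)

lemma funpow_shift_zero: "(shift z ^^ n) 0 = 0"
  by (induction n) (auto simp: shift_zero)

lemma funpow_shift_add: "(shift z ^^ n) (x + y) = (shift z ^^ n) x + (shift z ^^ n) y"
  by (induction n) (auto simp: shift_add)

lemma funpow_shift_scale: "(shift z ^^ n) (c *s x) = c *s (shift z ^^ n) x"
  by (induction n) (auto simp: shift_scale)

lemma funpow_shift_sum: "(shift z ^^ n) (\<Sum>i\<in>I. f i) = (\<Sum>i\<in>I. (shift z ^^ n) (f i))"
  by (induction I rule: infinite_finite_induct) (auto simp: funpow_shift_add funpow_shift_zero)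

lemma funpow_shift_commute: "(shift z ^^ n) (shift w x) = shift w ((shift z ^^ n) x)"
  by (induction n) (auto simp: shift_commute)

lemma funpow_shift_mono: "(shift z ^^ n) x = 0 \<Longrightarrow> n \<le> p \<Longrightarrow> (shift z ^^ p) x = 0"
  using funpow_add[of "p - n" n "shift z"] by (simp add: funpow_shift_zero)

lemma root_E: "x \<in> root z \<Longrightarrow> x \<in> E"
  by (simp add: root_def)

lemma subspace_root: "subspace (root z)"
proof (rule subspaceI)
  show "0 \<in> root z"
    by (auto simp: root_def subspace_0[OF subspace_E] intro: exI[of _ 0])
next
  fix x y assume "x \<in> root z" "y \<in> root z"
  then obtain n p where np: "(shift z ^^ n) x = 0" "(shift z ^^ p) y = 0" and "x \<in> E" "y \<in> E"
    by (auto simp: root_def)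
  have "(shift z ^^ max n p) (x + y) = 0"
    by (simp add: funpow_shift_add funpow_shift_mono[OF np(1)] funpow_shift_mono[OF np(2)])
  with \<open>x \<in> E\<close> \<open>y \<in> E\<close> show "x + y \<in> root z"
    unfolding root_def by (blast intro: subspace_add[OF subspace_E])
next
  fix c x assume "x \<in> root z"
  then show "c *s x \<in> root z"
    by (auto simp: root_def funpow_shift_scale intro: subspace_scale[OF subspace_E])
qed

lemma shift_root: "x \<in> root z \<Longrightarrow> shift w x \<in> root z"
proof -
  assume "x \<in> root z"
  then obtain n where "x \<in> E" "(shift z ^^ n) x = 0" by (auto simp: root_def)
  then have "(shift z ^^ n) (shift w x) = 0" by (simp only: funpow_shift_commute shift_zero)
  with shift_E[OF \<open>x \<in> E\<close>] show ?thesis by (auto simp: root_def)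
qed

lemma root_if_shift_root: "x \<in> E \<Longrightarrow> shift z x \<in> root z \<Longrightarrow> x \<in> root z"
proof -
  assume "x \<in> E" and "shift z x \<in> root z"
  then obtain n where "(shift z ^^ n) (shift z x) = 0" by (auto simp: root_def)
  then have "(shift z ^^ Suc n) x = 0" by (simp add: funpow_swap1)
  with \<open>x \<in> E\<close> show ?thesis unfolding root_def by blast
qed

text \<open>On \<open>root z\<close> the operator T - w is locally nilpotent plus the nonzero scalar
  \<open>z - w\<close>, hence onto. The induction on the order of nilpotency carries out the finite
  Neumann series.\<close>

lemma shift_surj_on_root:
  assumes "z \<noteq> w" "y \<in> root z"
  shows "\<exists>x\<in>root z. shift w x = y"
proof -
  obtain n where "(shift z ^^ n) y = 0" using assms(2) by (auto simp: root_def)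
  then show ?thesis using assms(2)
  proof (induction n arbitrary: y)
    case 0
    then show ?case by (auto intro!: bexI[of _ 0] simp: shift_zero subspace_0[OF subspace_root])
  next
    case (Suc n)
    then have "(shift z ^^ n) (shift z y) = 0" by (simp add: funpow_swap1)
    from Suc.IH[OF this shift_root[OF Suc.prems(2)]]
    obtain h where h: "h \<in> root z" "shift w h = shift z y" by blast
    define x where "x = (1 / (z - w)) *s (y - h)"
    have "x \<in> root z" unfolding x_def
      by (intro subspace_scale subspace_diff subspace_root Suc.prems h)
    moreover have "shift w x = y"
    proof -
      have "shift w (y - h) = shift w y - shift z y"
        using shift_add[of w y "(-1) *s h"] shift_scale[of w "-1" h] h(2) by simp
      also have "\<dots> = (z - w) *s y" by (simp add: shift_def scale_left_diff_distrib)
      finally show ?thesis using assms(1) by (simp add: x_def shift_scale)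
    qed
    ultimately show ?case by blast
  qed
qed

lemma shift_inj_on_root:
  assumes "z \<noteq> w" "x \<in> root z" "shift w x = 0"
  shows "x = 0"
proof -
  have "shift z x = (w - z) *s x"
    using assms(3) by (simp add: shift_def scale_left_diff_distrib)
  then have *: "(shift z ^^ n) x = (w - z) ^ n *s x" for n
    by (induction n) (auto simp: shift_scale mult.commute)
  obtain n where "(shift z ^^ n) x = 0" using assms(2) by (auto simp: root_def)
  with * assms(1) show ?thesis by simp
qed

lemma root_Int:
  assumes "z \<noteq> w" "x \<in> root z" "x \<in> root w"
  shows "x = 0"
proof -
  obtain n where "(shift w ^^ n) x = 0" using assms(3) by (auto simp: root_def)
  then show ?thesis using assms(2)
  proof (induction n arbitrary: x)
    case (Suc n)
    from Suc.prems(1) have "(shift w ^^ n) (shift w x) = 0" by (simp add: funpow_swap1)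
    from Suc.IH[OF this shift_root[OF Suc.prems(2)]] have "shift w x = 0" .
    then show ?case by (rule shift_inj_on_root[OF assms(1) Suc.prems(2)])
  qed simp
qed

lemma funpow_shift_root: "x \<in> root z \<Longrightarrow> (shift w ^^ n) x \<in> root z"
  by (induction n) (simp_all add: shift_root)

text \<open>A power of T - w annihilates the summand \<open>f w\<close> and keeps the others in
  their root spaces. By induction it annihilates those too, so they lie in \<open>root w\<close> as
  well as in their own root space, and vanish.\<close>

lemma root_independent:
  assumes "finite Z" "\<And>z. z \<in> Z \<Longrightarrow> f z \<in> root z" "(\<Sum>z\<in>Z. f z) = 0" "z \<in> Z"
  shows "f z = 0"
  using assms
proof (induction Z arbitrary: f z rule: finite_induct)
  case (insert w Z)
  obtain n where n: "(shift w ^^ n) (f w) = 0" using insert.prems(1)[of w] by (auto simp: root_def)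
  have "(shift w ^^ n) (\<Sum>z\<in>insert w Z. f z) = 0"
    unfolding insert.prems(2) by (rule funpow_shift_zero)
  then have "(\<Sum>z\<in>Z. (shift w ^^ n) (f z)) = 0"
    using insert.hyps n by (simp add: funpow_shift_add funpow_shift_sum)
  from insert.IH[of "\<lambda>z. (shift w ^^ n) (f z)", OF _ this]
  have *: "(shift w ^^ n) (f z) = 0" if "z \<in> Z" for z
    by (simp add: insert.prems(1) funpow_shift_root that)
  have Z: "f z = 0" if "z \<in> Z" for z
  proof (rule root_Int)
    show "z \<noteq> w" using that insert.hyps by blast
    show "f z \<in> root z" using insert.prems(1) that by blast
    then show "f z \<in> root w" using *[OF that] by (auto simp: root_def)
  qed
  then have "(\<Sum>z\<in>Z. f z) = 0" by (simp add: sum.neutral)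
  with insert have "f w = 0" by simp
  with Z insert.prems show ?case by auto
qed simp

section \<open>Root vectors span the subspace\<close>

definition poly_op :: "complex poly \<Rightarrow> 'b \<Rightarrow> 'b" where
  "poly_op p x = (\<Sum>i\<le>degree p. coeff p i *s (T ^^ i) x)"

lemma poly_op_bound: "degree p \<le> N \<Longrightarrow> poly_op p x = (\<Sum>i\<le>N. coeff p i *s (T ^^ i) x)"
  unfolding poly_op_def by (rule sum.mono_neutral_left) (auto simp: coeff_eq_0)

lemma poly_op_linear_factor: "poly_op ([:- w, 1:] * q) x = poly_op q (shift w x)"
proof -
  define N where "N = degree q"
  have T: "(T ^^ i) (shift w x) = (T ^^ Suc i) x - w *s (T ^^ i) x" for i
  proof (induction i)
    case (Suc i)
    then show ?case by (simp add: T_diff T_scale)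
  qed (simp add: shift_def)
  have "degree ([:- w, 1:] * q) \<le> Suc N"
    using degree_mult_le[of "[:- w, 1:]" q] by (simp add: N_def)
  then have "poly_op ([:- w, 1:] * q) x = (\<Sum>i\<le>Suc N. coeff ([:- w, 1:] * q) i *s (T ^^ i) x)"
    by (rule poly_op_bound)
  also have "\<dots> = (\<Sum>i\<le>Suc N. coeff (pCons 0 q) i *s (T ^^ i) x) - (\<Sum>i\<le>Suc N. (w * coeff q i) *s (T ^^ i) x)"
    by (simp add: sum_subtractf scale_left_diff_distrib del: sum.atMost_Suc)
  also have "(\<Sum>i\<le>Suc N. coeff (pCons 0 q) i *s (T ^^ i) x) = (\<Sum>i\<le>N. coeff q i *s (T ^^ Suc i) x)"
    by (simp add: sum.atMost_Suc_shift del: sum.atMost_Suc funpow.simps)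
  also have "(\<Sum>i\<le>Suc N. (w * coeff q i) *s (T ^^ i) x) = (\<Sum>i\<le>N. coeff q i *s w *s (T ^^ i) x)"
    by (simp add: N_def coeff_eq_0 mult.commute)
  finally show ?thesis
    unfolding poly_op_def T scale_right_diff_distrib sum_subtractf N_def .
qed

lemma shift_diff: "shift z (x - y) = shift z x - shift z y"
  by (simp add: shift_def T_diff scale_right_diff_distrib)

lemma span_roots: "span (\<Union>z. root z) \<subseteq> E"
  by (rule span_minimal) (auto simp: subspace_E root_E)

text \<open>Solvability modulo \<open>root w\<close>: on every other root space T - w is onto, and
  components in \<open>root w\<close> are left over. This is the correction needed in the induction
  over the linear factors of a polynomial.\<close>

lemma span_roots_shift:
  assumes "y \<in> span (\<Union>z. root z)"
  shows "\<exists>x\<in>span (\<Union>z. root z). y - shift w x \<in> root w"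
  using assms
proof (induction rule: span_induct_alt)
  case base
  show ?case
    by (rule bexI[of _ 0]) (auto simp: shift_zero span_zero subspace_0 subspace_root)
next
  case (step c y\<^sub>0 y)
  then obtain x z where x: "x \<in> span (\<Union>z. root z)" "y - shift w x \<in> root w" and z: "y\<^sub>0 \<in> root z" by blast
  show ?case
  proof (cases "z = w")
    case True
    have "c *s y\<^sub>0 + (y - shift w x) \<in> root w"
      using x z True by (intro subspace_add subspace_scale subspace_root) auto
    with x(1) show ?thesis by (auto simp: add_diff_eq)
  next
    case False
    then obtain x\<^sub>0 where x0: "x\<^sub>0 \<in> root z" "shift w x\<^sub>0 = y\<^sub>0" using shift_surj_on_root z by blast
    show ?thesis
    proof (rule bexI[of _ "c *s x\<^sub>0 + x"])
      show "c *s y\<^sub>0 + y - shift w (c *s x\<^sub>0 + x) \<in> root w"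
        using x(2) x0(2) by (simp add: shift_add shift_scale)
    next
      show "c *s x\<^sub>0 + x \<in> span (\<Union>z. root z)"
        using x0 x(1) by (blast intro: span_add span_scale span_base)
    qed
  qed
qed

text \<open>Induction on the degree. Once a linear factor is split off, (T - w) x is a sum of root
  vectors by induction. Subtracting a suitable sum x' of root vectors leaves (T - w) (x - x') in
  \<open>root w\<close>, so x - x' is itself a root vector.\<close>

lemma in_span_roots_if_poly_op_zero:
  assumes "p \<noteq> 0" "x \<in> E" "poly_op p x = 0"
  shows "x \<in> span (\<Union>z. root z)"
  using assms
proof (induction "degree p" arbitrary: p x)
  case 0
  then obtain a where "p = [:a:]" using degree_eq_zeroE[of p] by metis
  with 0 have "x = 0" by (simp add: poly_op_def)
  then show ?case by (simp add: span_zero)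
next
  case (Suc n)
  then have "\<not> constant (poly p)" by (simp add: constant_degree)
  then obtain w where "poly p w = 0" using fundamental_theorem_of_algebra[of p] by auto
  then obtain q where q: "p = [:- w, 1:] * q" unfolding poly_eq_0_iff_dvd dvd_def by blast
  have q0: "q \<noteq> 0" using q Suc.prems(1) by (metis mult_zero_right)
  then have "degree p = degree [:- w, 1:] + degree q"
    unfolding q by (rule degree_mult_eq[rotated]) simp
  then have nq: "n = degree q" using Suc.hyps(2) by simp
  have "poly_op q (shift w x) = 0" using Suc.prems(3) unfolding q poly_op_linear_factor .
  from Suc.hyps(1)[OF nq q0 shift_E[OF Suc.prems(2)] this]
  have "shift w x \<in> span (\<Union>z. root z)" .
  then have "\<exists>x'\<in>span (\<Union>z. root z). shift w x - shift w x' \<in> root w"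
    by (rule span_roots_shift)
  then obtain x' where x': "x' \<in> span (\<Union>z. root z)" "shift w x - shift w x' \<in> root w" by blast
  have "x' \<in> E" using x'(1) span_roots by blast
  then have "x - x' \<in> root w"
    using root_if_shift_root[OF subspace_diff[OF subspace_E Suc.prems(2)], of x' w] x'(2)
    by (simp only: shift_diff)
  then have "x - x' \<in> span (\<Union>z. root z)" by (blast intro: span_base)
  from span_add[OF this x'(1)] show ?case by simp
qed

text \<open>The iterates of \<open>x\<close> under \<open>T\<close> up to the power
  \<open>card B\<^sub>0\<close> are one more than a spanning set has elements, so they satisfy a
  linear relation, and its coefficients form the polynomial.\<close>

lemma annihilating_poly:
  assumes "x \<in> E"
  shows "\<exists>p. p \<noteq> 0 \<and> poly_op p x = 0"
proof -
  define f where "f i = (T ^^ i) x" for i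
  define d where "d = card B\<^sub>0"
  have fE: "f i \<in> E" for i unfolding f_def by (induction i) (auto intro: T_E assms)
  have poly: "poly_op (\<Sum>i\<le>d. monom (c i) i) x = (\<Sum>i\<le>d. c i *s f i)" for c
  proof -
    have "degree (\<Sum>i\<le>d. monom (c i) i) \<le> d"
      by (rule degree_sum_le) (auto intro: order_trans[OF degree_monom_le])
    then have "poly_op (\<Sum>i\<le>d. monom (c i) i) x = (\<Sum>i\<le>d. coeff (\<Sum>i\<le>d. monom (c i) i) i *s f i)"
      unfolding f_def by (rule poly_op_bound)
    also have "\<dots> = (\<Sum>i\<le>d. c i *s f i)"
      by (intro sum.cong refl) (simp add: coeff_sum)
    finally show ?thesis .
  qed
  have nonzero: "(\<Sum>i\<le>d. monom (c i) i) \<noteq> 0" if "i \<le> d" "c i \<noteq> 0" for c :: "nat \<Rightarrow> complex" and i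
  proof
    assume "(\<Sum>i\<le>d. monom (c i) i) = 0"
    then have "coeff (\<Sum>i\<le>d. monom (c i) i) i = 0" by simp
    with that show False by (simp add: coeff_sum)
  qed
  have "\<exists>c i. i \<le> d \<and> c i \<noteq> 0 \<and> (\<Sum>i\<le>d. c i *s f i) = 0"
  \<comment> \<open>Dependence is a property of sets of vectors, so coinciding iterates need a
    relation of their own.\<close>
  proof (cases "inj_on f {..d}")
    case True
    have "dependent (f ` {..d})"
    proof (rule ccontr)
      assume "\<not> dependent (f ` {..d})"
      from independent_span_bound[OF finite_B0 this] fE E_span have "card (f ` {..d}) \<le> d"
        unfolding d_def by blast
      then show False using card_image[OF True] by simp
    qed
    then obtain u where u: "\<exists>v\<in>f ` {..d}. u v \<noteq> 0" "(\<Sum>v\<in>f ` {..d}. u v *s v) = 0"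
      by (auto simp: dependent_finite)
    from u(2) have "(\<Sum>i\<le>d. u (f i) *s f i) = 0" by (subst (asm) sum.reindex[OF True]) simp
    with u(1) show ?thesis by (intro exI[of _ "\<lambda>i. u (f i)"]) auto
  next
    case False
    then obtain i j where ij: "i \<le> d" "j \<le> d" "i \<noteq> j" "f i = f j" by (auto simp: inj_on_def)
    define c where "c k = (if k = i then 1 else if k = j then -1 else 0 :: complex)" for k
    have "(\<Sum>k\<le>d. c k *s f k) = (\<Sum>k\<in>{i, j}. c k *s f k)"
      by (rule sum.mono_neutral_right) (use ij in \<open>auto simp: c_def\<close>)
    also have "\<dots> = 0" using ij by (simp add: c_def)
    finally show ?thesis using ij by (intro exI[of _ c] exI[of _ i]) (simp add: c_def)
  qed
  then obtain c i where "i \<le> d" "c i \<noteq> 0" "(\<Sum>i\<le>d. c i *s f i) = 0" by blast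
  then show ?thesis by (intro exI[of _ "\<Sum>i\<le>d. monom (c i) i"] conjI nonzero) (simp_all add: poly)
qed

lemma span_roots_eq: "span (\<Union>z. root z) = E"
  using span_roots annihilating_poly in_span_roots_if_poly_op_zero by blast

text \<open>A maximal independent set chosen inside the union of the root spaces is a basis of root
  vectors, and \<open>\<zeta>\<close> records the eigenvalue of each. Counting basis vectors over
  \<open>z\<close> gives the algebraic multiplicity; this is how multiplicities are compared
  later.\<close>

lemma root_basis:
  obtains B \<zeta> where "finite B" "independent B" "span B = E" "\<And>b. b \<in> B \<Longrightarrow> b \<in> root (\<zeta> b)"
    "\<And>z. dim (root z) = card {b \<in> B. \<zeta> b = z}"
proof -
  obtain B where B: "B \<subseteq> (\<Union>z. root z)" "independent B" "(\<Union>z. root z) \<subseteq> span B"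
    using maximal_independent_subset by blast
  have BE: "span B = E" using span_mono[OF B(1)] span_minimal[OF B(3) subspace_span] span_roots_eq by auto
  have fin: "finite B"
    using independent_span_bound[OF finite_B0 B(2)] B(1) root_E E_span by blast
  define \<zeta> where "\<zeta> b = (SOME z. b \<in> root z)" for b
  have \<zeta>: "b \<in> root (\<zeta> b)" if "b \<in> B" for b
    unfolding \<zeta>_def by (rule someI_ex) (use that B(1) in blast)
  have "dim (root z) = card {b \<in> B. \<zeta> b = z}" for z
  proof (rule dim_unique)
    show "{b \<in> B. \<zeta> b = z} \<subseteq> root z" using \<zeta> by blast
    show "independent {b \<in> B. \<zeta> b = z}" by (rule independent_mono[OF B(2)]) auto
    show "root z \<subseteq> span {b \<in> B. \<zeta> b = z}"
    proof
      fix x assume x: "x \<in> root z"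
      then have "x \<in> span B" using BE root_E by blast
      then obtain u where u: "x = (\<Sum>b\<in>B. u b *s b)" by (auto simp: span_finite[OF fin])
      define y where "y w = (\<Sum>b\<in>{b \<in> B. \<zeta> b = w}. u b *s b)" for w
      define Z where "Z = insert z (\<zeta> ` B)"
      \<comment> \<open>The components of \<open>x\<close> over the various eigenvalues, with
        \<open>x\<close> itself subtracted at \<open>z\<close>, form a family of root vectors with
        sum zero, so the member at \<open>z\<close> vanishes.\<close>
      have "(\<Sum>w\<in>Z. y w - (if w = z then x else 0)) = (\<Sum>w\<in>Z. y w) - x"
        using fin by (simp add: Z_def sum_subtractf)
      also have "(\<Sum>w\<in>Z. y w) = x"
        unfolding y_def u by (rule sum.group) (use fin in \<open>auto simp: Z_def\<close>)
      finally have "(\<Sum>w\<in>Z. y w - (if w = z then x else 0)) = 0" by simp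
      then have "y z - (if z = z then x else 0) = 0"
      proof (rule root_independent[rotated 2])
        show "finite Z" "z \<in> Z" using fin by (auto simp: Z_def)
        fix w assume "w \<in> Z"
        have "y w \<in> root w" unfolding y_def
          by (intro subspace_sum subspace_root subspace_scale) (use \<zeta> in auto)
        then show "y w - (if w = z then x else 0) \<in> root w"
          using x by (auto intro: subspace_diff[OF subspace_root])
      qed
      then have "x = y z" by simp
      also have "\<dots> \<in> span {b \<in> B. \<zeta> b = z}"
        unfolding y_def by (intro span_sum span_scale span_base) auto
      finally show "x \<in> span {b \<in> B. \<zeta> b = z}" .
    qed
  qed simp
  then show thesis using that fin B(2) BE \<zeta> by blast
qed

end

section \<open>Fourier coefficients of periodic distributions\<close>

definition br :: "int \<Rightarrow> real" where
  "br k = 1 + \<bar>real_of_int k\<bar>"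

lemma br_ge_1 [simp]: "1 \<le> br k" and br_pos [simp]: "0 < br k" and br_nonneg [simp]: "0 \<le> br k"
  and br_neq_0 [simp]: "br k \<noteq> 0"
  by (simp_all add: br_def)

lemma br_minus [simp]: "br (- k) = br k"
  by (simp add: br_def)

lemma br_sum_bound:
  assumes "1 < p"
  shows "\<exists>C. \<forall>F. finite F \<longrightarrow> (\<Sum>k\<in>F. br k powr (- p)) \<le> C"
proof (intro exI allI impI)
  fix F :: "int set" assume F: "finite F"
  define f where "f n = (1 + real n) powr (- p)" for n :: nat
  have "summable (\<lambda>n. real (Suc n) powr (- p))"
    using assms by (subst summable_Suc_iff) (simp add: summable_real_powr_iff)
  then have sm: "summable f" by (simp add: f_def[abs_def] add.commute)
  have inj: "inj_on (\<lambda>k. nat \<bar>k\<bar>) {k \<in> F. 0 \<le> k}" "inj_on (\<lambda>k. nat \<bar>k\<bar>) {k \<in> F. \<not> 0 \<le> k}"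
    by (auto simp: inj_on_def)
  have *: "(\<Sum>k\<in>G. br k powr (- p)) \<le> suminf f" if "inj_on (\<lambda>k. nat \<bar>k\<bar>) G" "finite G" for G :: "int set"
  proof -
    have "(\<Sum>k\<in>G. br k powr (- p)) = (\<Sum>k\<in>G. f (nat \<bar>k\<bar>))"
      by (intro sum.cong refl) (simp add: br_def f_def)
    also have "\<dots> = (\<Sum>n\<in>(\<lambda>k. nat \<bar>k\<bar>) ` G. f n)" by (simp add: sum.reindex[OF that(1)])
    also have "\<dots> \<le> suminf f" using that(2) sm by (intro sum_le_suminf) (auto simp: f_def[abs_def])
    finally show ?thesis .
  qed
  have "(\<Sum>k\<in>F. br k powr (- p)) = (\<Sum>k\<in>{k\<in>F. 0 \<le> k}. br k powr (- p)) + (\<Sum>k\<in>{k\<in>F. \<not> 0 \<le> k}. br k powr (- p))"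
    using F by (subst sum.union_disjoint[symmetric]) (auto intro!: sum.cong)
  also have "\<dots> \<le> 2 * suminf f" using *[OF inj(1)] *[OF inj(2)] F by simp
  finally show "(\<Sum>k\<in>F. br k powr (- p)) \<le> 2 * suminf f" .
qed

lemma l2_le_br:
  assumes "1 / 2 < p" shows "\<exists>C. l2_le (\<lambda>k. br k powr (- p)) C"
proof -
  obtain C where C: "\<And>F. finite F \<Longrightarrow> (\<Sum>k\<in>F. br k powr (- (2 * p))) \<le> C"
    using br_sum_bound[of "2 * p"] assms by auto
  have "0 \<le> C" using C[of "{}"] by simp
  have "l2_le (\<lambda>k. br k powr (- p)) (sqrt C)"
  proof (rule l2_leI_sq)
    fix F :: "int set" assume "finite F"
    have "(norm (br k powr (- p)))\<^sup>2 = br k powr (- (2 * p))" for k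
      by (simp add: powr_powr mult.commute flip: powr_realpow)
    then show "(\<Sum>k\<in>F. (norm (br k powr (- p)))\<^sup>2) \<le> (sqrt C)\<^sup>2"
      using C[OF \<open>finite F\<close>] \<open>0 \<le> C\<close> by simp
  qed (use \<open>0 \<le> C\<close> in simp)
  then show ?thesis by blast
qed

section \<open>Periodic test functions\<close>

lemma iter_deriv_0 [simp]: "iter_deriv 0 \<phi> = \<phi>"
  by (simp add: iter_deriv_def)

lemma iter_deriv_Suc: "iter_deriv (Suc j) \<phi> = (\<lambda>x. vector_derivative (iter_deriv j \<phi>) (at x))"
  by (simp add: iter_deriv_def)

lemma iter_deriv_add: "iter_deriv i (iter_deriv j \<phi>) = iter_deriv (i + j) \<phi>"
  by (simp add: iter_deriv_def funpow_add)

lemma per_test_has_vector_derivative: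
  "\<phi> \<in> per_test \<Longrightarrow> (iter_deriv j \<phi> has_vector_derivative iter_deriv (Suc j) \<phi> x) (at x)"
  by (simp add: per_test_def iter_deriv_Suc vector_derivative_works)

lemma per_test_periodic: "\<phi> \<in> per_test \<Longrightarrow> \<phi> (x + 2) = \<phi> x"
  by (simp add: per_test_def)

lemma iter_deriv_eqI:
  assumes "\<And>j x. (f j has_vector_derivative f (Suc j) x) (at x)"
  shows "iter_deriv j (f 0) = f j"
proof (induction j)
  case (Suc j)
  then show ?case
    by (auto simp: iter_deriv_Suc intro!: ext vector_derivative_at assms)
qed simp

text \<open>All derivatives are exhibited at once: a sequence in which each member is the derivative
  of the preceding one proves smoothness and, by \<open>iter_deriv_eqI\<close>, identifies the
  iterated derivatives.\<close>

lemma per_testI: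
  assumes f: "\<And>j x. (f j has_vector_derivative f (Suc j) x) (at x)" and "\<And>x. f 0 (x + 2) = f 0 x"
  shows "f 0 \<in> per_test"
  using assms(2) differentiableI_vector[OF f] by (simp add: per_test_def iter_deriv_eqI[of f, OF f])

lemma per_test_iter_deriv_1:
  assumes "\<phi> \<in> per_test" shows "iter_deriv 1 \<phi> \<in> per_test"
proof -
  have "iter_deriv (Suc 0) \<phi> \<in> per_test"
  proof (rule per_testI[where f = "\<lambda>j. iter_deriv (Suc j) \<phi>"])
    fix x
    have "((\<lambda>y. \<phi> (y + 2)) has_vector_derivative iter_deriv (Suc 0) \<phi> (x + 2)) (at x)"
      using vector_diff_chain_at[of "\<lambda>y. y + 2" 1 x \<phi> "iter_deriv (Suc 0) \<phi> (x + 2)"]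
        per_test_has_vector_derivative[OF assms, of 0 "x + 2"]
      by (simp add: o_def has_vector_derivative_add_const has_vector_derivative_id)
    then have "(\<phi> has_vector_derivative iter_deriv (Suc 0) \<phi> (x + 2)) (at x)"
      by (simp add: per_test_periodic[OF assms])
    with per_test_has_vector_derivative[OF assms, of 0 x]
    show "iter_deriv (Suc 0) \<phi> (x + 2) = iter_deriv (Suc 0) \<phi> x"
      using vector_derivative_unique_at by fastforce
  qed (rule per_test_has_vector_derivative[OF assms])
  then show ?thesis by simp
qed

lemma per_test_iter_deriv: "\<phi> \<in> per_test \<Longrightarrow> iter_deriv j \<phi> \<in> per_test"
proof (induction j)
  case (Suc j)
  then show ?case using per_test_iter_deriv_1[of "iter_deriv j \<phi>"] by (simp add: iter_deriv_add)
qed simp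

lemma
  assumes "\<phi> \<in> per_test" "\<psi> \<in> per_test"
  shows per_test_add: "(\<lambda>x. \<phi> x + \<psi> x) \<in> per_test"
    and iter_deriv_plus: "iter_deriv j (\<lambda>x. \<phi> x + \<psi> x) = (\<lambda>x. iter_deriv j \<phi> x + iter_deriv j \<psi> x)"
proof -
  let ?f = "\<lambda>j x. iter_deriv j \<phi> x + iter_deriv j \<psi> x"
  have f: "(?f j has_vector_derivative ?f (Suc j) x) (at x)" for j x
    by (intro has_vector_derivative_add per_test_has_vector_derivative assms)
  show "(\<lambda>x. \<phi> x + \<psi> x) \<in> per_test"
    using per_testI[of ?f, OF f] by (simp add: per_test_periodic[OF assms(1)] per_test_periodic[OF assms(2)])
  show "iter_deriv j (\<lambda>x. \<phi> x + \<psi> x) = (\<lambda>x. iter_deriv j \<phi> x + iter_deriv j \<psi> x)"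
    using iter_deriv_eqI[of ?f, OF f] by simp
qed

lemma
  assumes "\<phi> \<in> per_test"
  shows per_test_cmult: "(\<lambda>x. c * \<phi> x) \<in> per_test"
    and iter_deriv_cmult: "iter_deriv j (\<lambda>x. c * \<phi> x) = (\<lambda>x. c * iter_deriv j \<phi> x)"
proof -
  let ?f = "\<lambda>j x. c * iter_deriv j \<phi> x"
  have f: "(?f j has_vector_derivative ?f (Suc j) x) (at x)" for j x
    by (intro has_vector_derivative_mult_right per_test_has_vector_derivative assms)
  show "(\<lambda>x. c * \<phi> x) \<in> per_test"
    using per_testI[of ?f, OF f] by (simp add: per_test_periodic[OF assms])
  show "iter_deriv j (\<lambda>x. c * \<phi> x) = (\<lambda>x. c * iter_deriv j \<phi> x)"
    using iter_deriv_eqI[of ?f, OF f] by simp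
qed

section \<open>Fourier modes and coefficients of functions\<close>

lemma fourier_mode_0 [simp]: "fourier_mode 0 x = 1"
  by (simp add: fourier_mode_def)

lemma fourier_mode_add: "fourier_mode k x * fourier_mode l x = fourier_mode (k + l) x"
  by (simp add: fourier_mode_def exp_add[symmetric] algebra_simps)

lemma cnj_fourier_mode: "cnj (fourier_mode k x) = fourier_mode (- k) x"
  by (simp add: fourier_mode_def exp_cnj)

lemma norm_fourier_mode [simp]: "cmod (fourier_mode k x) = 1"
  by (simp add: fourier_mode_def)

lemma fourier_mode_periodic: "fourier_mode k (x + 2) = fourier_mode k x"
proof -
  have "fourier_mode k (x + 2) = fourier_mode k x * exp (of_int (2 * k) * of_real pi * \<i>)"
    by (simp add: fourier_mode_def exp_add[symmetric] algebra_simps)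
  also have "exp (of_int (2 * k) * of_real pi * \<i>) = 1"
    using exp_integer_2pi[of "of_int k"] by (simp add: mult_ac)
  finally show ?thesis by simp
qed

lemma fourier_mode_has_vector_derivative:
  "((\<lambda>x. c * fourier_mode k x) has_vector_derivative c * (\<i> * of_int k * of_real pi) * fourier_mode k x) (at x)"
proof -
  have "((\<lambda>x. c * exp (\<i> * of_int k * of_real pi * x)) has_field_derivative
      c * (\<i> * of_int k * of_real pi) * exp (\<i> * of_int k * of_real pi * of_real x)) (at (of_real x))"
    by (auto intro!: derivative_eq_intros)
  from has_vector_derivative_real_field[OF this] show ?thesis by (simp add: fourier_mode_def)
qed

lemma fourier_mode_per_test: "fourier_mode k \<in> per_test"
  and iter_deriv_fourier_mode:
    "iter_deriv j (fourier_mode k) = (\<lambda>x. (\<i> * of_int k * of_real pi) ^ j * fourier_mode k x)"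
proof -
  let ?f = "\<lambda>j x. (\<i> * of_int k * of_real pi) ^ j * fourier_mode k x"
  have f: "(?f j has_vector_derivative ?f (Suc j) x) (at x)" for j x
    using fourier_mode_has_vector_derivative[of "(\<i> * of_int k * of_real pi) ^ j" k x]
    by (simp add: mult_ac)
  have *: "?f 0 = fourier_mode k" by simp
  show "fourier_mode k \<in> per_test"
    using per_testI[of ?f, OF f] unfolding * by (simp add: fourier_mode_periodic)
  show "iter_deriv j (fourier_mode k) = ?f j"
    using iter_deriv_eqI[of ?f, OF f] unfolding * by simp
qed

lemma per_test_continuous: "\<phi> \<in> per_test \<Longrightarrow> continuous_on A \<phi>"
  using per_test_has_vector_derivative[of \<phi> 0]
  by (auto intro!: has_vector_derivative_continuous continuous_at_imp_continuous_on)

definition coef :: "(real \<Rightarrow> complex) \<Rightarrow> int \<Rightarrow> complex" where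
  "coef \<phi> k = (1 / 2) * integral {-1..1} (\<lambda>x. \<phi> x * fourier_mode (- k) x)"

lemma continuous_fourier_mode: "continuous_on A (fourier_mode k)"
  by (rule per_test_continuous[OF fourier_mode_per_test])

lemma integrable_mode:
  "continuous_on {-1..1} \<phi> \<Longrightarrow> (\<lambda>x. \<phi> x * fourier_mode k x) integrable_on {-1..1}"
  by (intro integrable_continuous_interval continuous_on_mult continuous_fourier_mode)

lemma coef_add:
  assumes "continuous_on {-1..1} \<phi>" "continuous_on {-1..1} \<psi>"
  shows "coef (\<lambda>x. \<phi> x + \<psi> x) k = coef \<phi> k + coef \<psi> k"
  unfolding coef_def distrib_right
  by (subst Henstock_Kurzweil_Integration.integral_add) (auto intro: integrable_mode assms simp: distrib_left)

lemma coef_cmult: "coef (\<lambda>x. c * \<phi> x) k = c * coef \<phi> k"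
  unfolding coef_def mult.assoc by (subst integral_mult_right) simp

lemma norm_coef_le:
  assumes "continuous_on {-1..1} \<phi>" "\<And>x. x \<in> {-1..1} \<Longrightarrow> cmod (\<phi> x) \<le> M"
  shows "cmod (coef \<phi> k) \<le> M"
proof -
  have "cmod (integral {-1..1} (\<lambda>x. \<phi> x * fourier_mode (- k) x)) \<le> M * (1 - (-1))"
    by (rule integral_bound) (use assms in \<open>auto simp: norm_mult intro!: continuous_on_mult continuous_fourier_mode\<close>)
  then show ?thesis by (simp add: coef_def norm_mult norm_divide)
qed

text \<open>Integration by parts; the boundary terms cancel because both factors have period
  2.\<close>

lemma coef_iter_deriv_1:
  assumes "\<phi> \<in> per_test"
  shows "coef (iter_deriv 1 \<phi>) k = \<i> * of_int k * of_real pi * coef \<phi> k"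
proof -
  define w where "w = \<i> * of_int k * of_real pi"
  let ?e = "fourier_mode (- k)"
  have "((\<lambda>x. iter_deriv 1 \<phi> x * ?e x - w * (\<phi> x * ?e x)) has_integral
      \<phi> 1 * ?e 1 - \<phi> (-1) * ?e (-1)) {-1..1}"
  proof (rule fundamental_theorem_of_calculus)
    fix x
    have "(?e has_vector_derivative - w * ?e x) (at x)"
      using fourier_mode_has_vector_derivative[of 1 "- k" x] by (simp add: w_def)
    from has_vector_derivative_mult[OF per_test_has_vector_derivative[OF assms, of 0 x] this]
    show "((\<lambda>x. \<phi> x * ?e x) has_vector_derivative iter_deriv 1 \<phi> x * ?e x - w * (\<phi> x * ?e x))
      (at x within {-1..1})"
      by (simp add: algebra_simps has_vector_derivative_at_within)
  qed simp
  moreover have "\<phi> 1 = \<phi> (-1)" "?e 1 = ?e (-1)"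
    using per_test_periodic[OF assms, of "-1"] fourier_mode_periodic[of "- k" "-1"] by simp_all
  ultimately have "integral {-1..1} (\<lambda>x. iter_deriv 1 \<phi> x * ?e x - w * (\<phi> x * ?e x)) = 0"
    by (simp add: integral_unique)
  then have "integral {-1..1} (\<lambda>x. iter_deriv 1 \<phi> x * ?e x) = w * integral {-1..1} (\<lambda>x. \<phi> x * ?e x)"
    by (subst (asm) Henstock_Kurzweil_Integration.integral_diff)
       (auto intro!: integrable_mode integrable_on_mult_right per_test_continuous assms per_test_iter_deriv_1[OF assms]
         simp del: One_nat_def)
  then show ?thesis by (simp add: coef_def w_def)
qed

lemma coef_iter_deriv:
  assumes "\<phi> \<in> per_test"
  shows "coef (iter_deriv j \<phi>) k = (\<i> * of_int k * of_real pi) ^ j * coef \<phi> k"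
proof (induction j)
  case (Suc j)
  have "iter_deriv (Suc j) \<phi> = iter_deriv 1 (iter_deriv j \<phi>)" by (simp add: iter_deriv_add)
  then show ?case
    using coef_iter_deriv_1[OF per_test_iter_deriv[OF assms, of j], of k] Suc by simp
qed simp

text \<open>Orthogonality without evaluating an integral: the coefficient of the derivative of a
  mode is i pi k and also i pi l times the same number, so this number vanishes unless k =
  l.\<close>

lemma coef_fourier_mode: "coef (fourier_mode l) k = (if k = l then 1 else 0)"
proof (cases "k = l")
  case True
  then show ?thesis by (simp add: coef_def fourier_mode_add scaleR_conv_of_real)
next
  case False
  have "coef (iter_deriv 1 (fourier_mode l)) k = \<i> * of_int k * of_real pi * coef (fourier_mode l) k"
    by (rule coef_iter_deriv_1[OF fourier_mode_per_test])
  moreover have "coef (iter_deriv 1 (fourier_mode l)) k = \<i> * of_int l * of_real pi * coef (fourier_mode l) k"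
    unfolding iter_deriv_fourier_mode by (simp add: coef_cmult)
  ultimately show ?thesis using False by simp
qed

lemma coef_sum:
  assumes "\<And>i. i \<in> I \<Longrightarrow> continuous_on {-1..1} (f i)"
  shows "coef (\<lambda>x. \<Sum>i\<in>I. f i x) k = (\<Sum>i\<in>I. coef (f i) k)"
  using assms
proof (induction I rule: infinite_finite_induct)
  case (insert i I)
  then show ?case by (simp add: coef_add continuous_on_sum)
qed (auto simp: coef_def)

section \<open>Completeness of the Fourier modes\<close>

inductive trig_poly :: "(real \<Rightarrow> complex) \<Rightarrow> bool" where
  mode: "trig_poly (\<lambda>x. c * fourier_mode k x)"
| add: "trig_poly p \<Longrightarrow> trig_poly q \<Longrightarrow> trig_poly (\<lambda>x. p x + q x)"

lemma trig_poly_mult_mode: "trig_poly p \<Longrightarrow> trig_poly (\<lambda>x. p x * (c * fourier_mode k x))"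
proof (induction rule: trig_poly.induct)
  case (mode d l)
  have "(\<lambda>x. d * fourier_mode l x * (c * fourier_mode k x)) = (\<lambda>x. (d * c) * fourier_mode (l + k) x)"
    by (simp add: fun_eq_iff fourier_mode_add[symmetric])
  then show ?case by (simp only: trig_poly.mode)
next
  case (add p q)
  show ?case using trig_poly.add[OF add.IH] by (simp add: distrib_right)
qed

lemma trig_poly_mult: "trig_poly q \<Longrightarrow> trig_poly p \<Longrightarrow> trig_poly (\<lambda>x. p x * q x)"
proof (induction rule: trig_poly.induct)
  case (mode c k)
  then show ?case by (rule trig_poly_mult_mode)
next
  case (add q r)
  show ?case using trig_poly.add[OF add.IH[OF add.prems]] by (simp add: distrib_left)
qed

text \<open>On the unit circle the real and imaginary parts are combinations of the modes 1 and -1,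
  and products of modes are modes. This connects the Stone-Weierstrass theorem for polynomial
  functions with Fourier modes.\<close>

lemma trig_poly_real_polynomial:
  assumes "real_polynomial_function r"
  shows "trig_poly (\<lambda>x. of_real (r (fourier_mode 1 x)))"
  using assms
proof induction
  case (linear f)
  interpret bounded_linear f by fact
  have f: "f z = Re z * f 1 + Im z * f \<i>" for z
    using add[of "of_real (Re z)" "\<i> * of_real (Im z)"] scaleR[of "Re z" 1] scaleR[of "Im z" \<i>]
    by (simp add: scaleR_conv_of_real complex_eq[symmetric] mult.commute)
  have "complex_of_real (f (fourier_mode 1 x))
      = ((of_real (f 1) + of_real (f \<i>) / \<i>) / 2) * fourier_mode 1 x
      + ((of_real (f 1) - of_real (f \<i>) / \<i>) / 2) * fourier_mode (-1) x" for x
    unfolding cnj_fourier_mode[of 1 x, symmetric] f[of "fourier_mode 1 x"]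
    by (rule complex_eqI) (simp_all add: field_simps)
  then show ?case by (simp only:) (intro trig_poly.add trig_poly.mode)
next
  case (const c)
  show ?case using trig_poly.mode[of "of_real c" 0] by simp
next
  case (add f g)
  then show ?case using trig_poly.add by simp
next
  case (mult f g)
  then show ?case using trig_poly_mult by simp
qed

lemma continuous_trig_poly: "trig_poly p \<Longrightarrow> continuous_on A p"
  by (induction rule: trig_poly.induct) (auto intro!: continuous_intros continuous_fourier_mode)

lemma integral_trig_poly_zero:
  assumes g: "continuous_on {-1..1} g" "\<And>k. coef g k = 0"
  shows "trig_poly p \<Longrightarrow> integral {-1..1} (\<lambda>x. g x * p x) = 0"
proof (induction rule: trig_poly.induct)
  case (mode c k)
  have "integral {-1..1} (\<lambda>x. g x * (c * fourier_mode k x)) = c * (2 * coef g (- k))"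
    unfolding coef_def by (simp add: mult.left_commute[of _ c])
  then show ?case by (simp add: g)
next
  case (add p q)
  then show ?case unfolding distrib_left
    by (subst Henstock_Kurzweil_Integration.integral_add)
       (auto intro!: integrable_continuous_interval continuous_on_mult g
         continuous_trig_poly[OF add.hyps(1)] continuous_trig_poly[OF add.hyps(2)])
qed

text \<open>\<open>Arg\<close> jumps along the negative axis. There \<open>Arg (- w)\<close> is
  continuous and differs from \<open>Arg w\<close> by pi in one direction or the other; after
  division by pi and addition of 1 the two cases differ by 2, the period of
  \<open>g\<close>.\<close>

lemma continuous_on_circle_lift:
  assumes g: "continuous_on UNIV g" and per: "\<And>x. g (x + 2) = g x"
  shows "continuous_on (sphere 0 1) (\<lambda>w. g (Arg w / pi))"
proof (rule continuous_at_imp_continuous_on, rule ballI)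
  fix w :: complex assume w: "w \<in> sphere 0 1"
  then have "w \<noteq> 0" by auto
  have gc: "isCont g x" for x using g by (simp add: continuous_on_eq_continuous_at)
  show "isCont (\<lambda>w. g (Arg w / pi)) w"
  proof (cases "w \<in> \<real>\<^sub>\<le>\<^sub>0")
    case True
    then have "- w \<notin> \<real>\<^sub>\<le>\<^sub>0" using \<open>w \<noteq> 0\<close> by (auto simp: complex_nonpos_Reals_iff complex_eq_iff)
    then have "isCont Arg (- w)" by (rule continuous_at_Arg)
    with isCont_o2[of w uminus Arg] have "isCont (\<lambda>w. Arg (- w)) w" by simp
    then have "isCont (\<lambda>w. Arg (- w) / pi + 1) w" by (intro continuous_add continuous_divide) auto
    from isCont_o2[OF this gc] have c: "isCont (\<lambda>w. g (Arg (- w) / pi + 1)) w" .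
    have "g (Arg (- v) / pi + 1) = g (Arg v / pi)" if "v \<noteq> 0" for v
    proof (cases "Arg v \<le> 0")
      case True
      then show ?thesis using that per[of "Arg v / pi"] by (simp add: Arg_minus add_divide_distrib add.commute)
    qed (use that in \<open>simp add: Arg_minus diff_divide_distrib\<close>)
    then have "\<forall>\<^sub>F v in nhds w. g (Arg (- v) / pi + 1) = g (Arg v / pi)"
      by (intro eventually_mono[OF t1_space_nhds[OF \<open>w \<noteq> 0\<close>]])
    from iffD1[OF isCont_cong[OF this] c] show ?thesis .
  next
    case False
    then have "isCont Arg w" by (rule continuous_at_Arg)
    then have "isCont (\<lambda>w. Arg w / pi) w" by (intro continuous_divide) auto
    from isCont_o2[OF this gc] show ?thesis .
  qed
qed

text \<open>The conjugate of \<open>g\<close>, viewed on the circle, is uniformly approximated by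
  trigonometric polynomials, against which \<open>g\<close> integrates to zero. So the integral of
  its squared modulus is arbitrarily small.\<close>

lemma coef_zero_imp_zero:
  assumes g: "continuous_on UNIV g" and per: "\<And>x. g (x + 2) = g x" and coef: "\<And>k. coef g k = 0"
  shows "g x = 0"
proof -
  have g': "continuous_on {-1..1} g" using g continuous_on_subset by blast
  obtain M where M: "\<And>x. x \<in> {-1..1} \<Longrightarrow> cmod (g x) \<le> M" and "M > 0"
  proof -
    have "compact (g ` {-1..1})" by (intro compact_continuous_image g') auto
    then have "bounded (g ` {-1..1})" by (rule compact_imp_bounded)
    then obtain b where "0 < b" "\<forall>x\<in>g ` {-1..1}. cmod x \<le> b" unfolding bounded_pos by blast
    then show thesis by (intro that[of b] ballI) blast+
  qed
  define I where "I = integral {-1..1} (\<lambda>x. g x * cnj (g x))"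
  have "cmod I \<le> e" if e: "e > 0" for e
  proof -
    \<comment> \<open>The interval has length 2 and \<open>g\<close> is bounded by \<open>M\<close>
      there, so an approximation error \<open>d\<close> contributes at most
      \<open>2 * M * d\<close>, which is \<open>e\<close>.\<close>
    define d where "d = e / (2 * M)"
    have "d > 0" using e \<open>M > 0\<close> by (simp add: d_def)
    have "continuous_on (sphere 0 1) (\<lambda>w. cnj (g (Arg w / pi)))"
      by (intro continuous_intros continuous_on_circle_lift g per)
    from Stone_Weierstrass_polynomial_function[OF compact_sphere this \<open>d > 0\<close>]
    obtain p where p: "polynomial_function p"
      and pd: "\<And>w. w \<in> sphere 0 1 \<Longrightarrow> norm (cnj (g (Arg w / pi)) - p w) < d" by blast
    define q where "q x = p (fourier_mode 1 x)" for x
    have "trig_poly q"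
    proof -
      have "trig_poly (\<lambda>x. of_real (Re (q x)))" "trig_poly (\<lambda>x. of_real (Im (q x)))"
        using p trig_poly_real_polynomial[of "Re \<circ> p"] trig_poly_real_polynomial[of "Im \<circ> p"]
        by (auto simp: polynomial_function_def bounded_linear_Re bounded_linear_Im q_def)
      from trig_poly.add[OF this(1) trig_poly_mult[OF trig_poly.mode[of \<i> 0] this(2)]]
      show ?thesis by (simp add: complex_eq[symmetric] mult.commute)
    qed
    have dist: "cmod (cnj (g x) - q x) \<le> d" if "x \<in> {-1..1}" for x
    proof -
      \<comment> \<open>\<open>Arg\<close> takes values above - pi, so the left end point is not
        reached and is left to periodicity.\<close>
      have 1: "cmod (cnj (g x) - q x) \<le> d" if "x \<in> {-1<..1}" for x
      proof -
        have m: "fourier_mode 1 x = cis (pi * x)" by (simp add: fourier_mode_def cis_conv_exp mult.assoc)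
        have "Arg (fourier_mode 1 x) = pi * x"
          unfolding m
          by (rule Arg_cis) (use that mult_strict_left_mono[of "-1" x pi] mult_left_mono[of x 1 pi] in simp)
        then show ?thesis using pd[of "fourier_mode 1 x"] by (simp add: q_def)
      qed
      have "g (-1) = g 1" "q (-1) = q 1"
        using per[of "-1"] fourier_mode_periodic[of 1 "-1"] by (simp_all add: q_def)
      then show ?thesis using 1[of x] 1[of 1] that by (cases "x = -1") auto
    qed
    have qc: "continuous_on {-1..1} q" by (rule continuous_trig_poly) fact
    have "I = integral {-1..1} (\<lambda>x. g x * (cnj (g x) - q x))"
      unfolding right_diff_distrib I_def
      by (subst Henstock_Kurzweil_Integration.integral_diff)
         (auto intro!: integrable_continuous_interval continuous_intros g' qc
           simp: integral_trig_poly_zero[OF g' coef \<open>trig_poly q\<close>])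
    moreover have "cmod (integral {-1..1} (\<lambda>x. g x * (cnj (g x) - q x))) \<le> (M * d) * (1 - (-1))"
      by (rule integral_bound)
         (use M dist \<open>M > 0\<close> in \<open>auto simp: norm_mult intro!: continuous_intros g' qc mult_mono\<close>)
    ultimately show ?thesis using \<open>M > 0\<close> by (simp add: d_def)
  qed
  then have "cmod I \<le> 0" using field_le_epsilon[of "cmod I" 0] by simp
  then have "I = 0" by simp
  have c: "continuous_on {-1..1} (\<lambda>x. (cmod (g x))\<^sup>2)" by (intro continuous_intros g')
  have "I = of_real (integral {-1..1} (\<lambda>x. (cmod (g x))\<^sup>2))"
    unfolding I_def complex_norm_square[symmetric]
    by (rule integral_unique, rule has_integral_of_real, rule integrable_integral,
        rule integrable_continuous_interval[OF c])
  then have "((\<lambda>x. (cmod (g x))\<^sup>2) has_integral 0) {-1..1}"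
    using \<open>I = 0\<close> integrable_integral[OF integrable_continuous_interval[OF c]] by simp
  then have zero: "g x = 0" if "x \<in> {-1..1}" for x
    using has_integral_0_cbox_imp_0[of "-1" 1 "\<lambda>x. (cmod (g x))\<^sup>2" x] c that by (auto simp: cbox_interval)
  have per': "g (x + 2 * of_int k) = g x" for x and k :: int
  proof (induction k rule: int_induct[of _ 0])
    case (step1 i) then show ?case using per[of "x + 2 * of_int i"] by (simp add: algebra_simps)
  next
    case (step2 i) then show ?case using per[of "x + 2 * of_int (i - 1)"] by (simp add: algebra_simps)
  qed simp
  \<comment> \<open>A translate of \<open>x\<close> by an even integer lies in the base
    period.\<close>
  have "x + 2 * of_int (- \<lfloor>(x + 1) / 2\<rfloor>) \<in> {-1..1}"
  proof -
    have *: "a \<le> (x + 1) / 2 \<Longrightarrow> (x + 1) / 2 < a + 1 \<Longrightarrow> x + 2 * - a \<in> {-1..1}" for a :: real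
      by (simp add: field_simps)
    show ?thesis unfolding of_int_minus
      by (rule *) (rule of_int_floor_le, rule real_of_int_floor_add_one_gt)
  qed
  from zero[OF this] show ?thesis unfolding per' .
qed

section \<open>Decay of the coefficients and convergence of Fourier series\<close>

lemma per_test_bdd:
  assumes "\<phi> \<in> per_test"
  shows "bdd_above ((\<lambda>x. cmod (iter_deriv j \<phi> x)) ` {-1..1})"
proof -
  have "continuous_on {-1..1} (\<lambda>x. cmod (iter_deriv j \<phi> x))"
    by (intro continuous_on_norm per_test_continuous per_test_iter_deriv assms)
  then have "compact ((\<lambda>x. cmod (iter_deriv j \<phi> x)) ` {-1..1})"
    by (rule compact_continuous_image) auto
  then show ?thesis by (intro bounded_imp_bdd_above compact_imp_bounded)
qed

lemma le_sup_iter_deriv: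
  assumes "\<phi> \<in> per_test" "x \<in> {-1..1}"
  shows "cmod (iter_deriv j \<phi> x) \<le> (SUP x\<in>{-1..1}. cmod (iter_deriv j \<phi> x))"
  by (rule cSUP_upper[OF assms(2) per_test_bdd[OF assms(1)]])

lemma sup_iter_deriv_nonneg:
  assumes "\<phi> \<in> per_test"
  shows "0 \<le> (SUP x\<in>{-1..1}. cmod (iter_deriv j \<phi> x))"
  using le_sup_iter_deriv[OF assms, of 0 j] by (auto intro: order_trans[OF norm_ge_zero])

lemma norm_coef_iter_deriv_le:
  assumes "\<phi> \<in> per_test"
  shows "cmod (coef (iter_deriv j \<phi>) k) \<le> (SUP x\<in>{-1..1}. cmod (iter_deriv j \<phi> x))"
  by (intro norm_coef_le per_test_continuous per_test_iter_deriv assms le_sup_iter_deriv)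

text \<open>Integration by parts \<open>p\<close> times. A factor 2 per order compares
  \<open>br k\<close> with the modulus of k pi, and the mode 0 is covered by the supremum of order
  zero.\<close>

lemma coef_decay:
  assumes "\<phi> \<in> per_test"
  shows "cmod (coef \<phi> k) * br k ^ p
    \<le> 2 ^ p * (\<Sum>j\<le>p. SUP x\<in>{-1..1}. cmod (iter_deriv j \<phi> x))"
proof -
  let ?s = "\<lambda>j. SUP x\<in>{-1..1}. cmod (iter_deriv j \<phi> x)"
  have nn: "0 \<le> ?s j" for j by (rule sup_iter_deriv_nonneg[OF assms])
  have mem: "?s i \<le> (\<Sum>j\<le>p. ?s j)" if "i \<le> p" for i
    by (rule member_le_sum) (use that nn in auto)
  show ?thesis
  proof (cases "k = 0")
    case True
    have "cmod (coef \<phi> k) * br k ^ p \<le> ?s 0"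
      using norm_coef_iter_deriv_le[OF assms, of 0 k] True by (simp add: br_def)
    also have "\<dots> \<le> 1 * (\<Sum>j\<le>p. ?s j)" using mem[of 0] by simp
    also have "\<dots> \<le> 2 ^ p * (\<Sum>j\<le>p. ?s j)" by (intro mult_right_mono sum_nonneg nn) auto
    finally show ?thesis .
  next
    case False
    have k1: "1 \<le> \<bar>real_of_int k\<bar>" using False by linarith
    have "br k \<le> 2 * (\<bar>real_of_int k\<bar> * pi)"
      using k1 mult_mono[of 1 pi "\<bar>real_of_int k\<bar>" "\<bar>real_of_int k\<bar>"] pi_gt3 by (simp add: br_def mult.commute)
    then have "br k ^ p \<le> (2 * (\<bar>real_of_int k\<bar> * pi)) ^ p" by (intro power_mono) auto
    then have "cmod (coef \<phi> k) * br k ^ p \<le> cmod (coef \<phi> k) * (2 * (\<bar>real_of_int k\<bar> * pi)) ^ p"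
      by (intro mult_left_mono) auto
    also have "\<dots> = 2 ^ p * cmod (coef (iter_deriv p \<phi>) k)"
      by (simp add: coef_iter_deriv[OF assms] norm_mult norm_power power_mult_distrib)
    also have "\<dots> \<le> 2 ^ p * (\<Sum>j\<le>p. ?s j)"
      by (intro mult_left_mono order_trans[OF norm_coef_iter_deriv_le[OF assms] mem]) auto
    finally show ?thesis .
  qed
qed

lemma l1_le_coef:
  assumes "\<phi> \<in> per_test" shows "\<exists>C. l1_le (coef \<phi>) C"
proof -
  define S where "S = 2 ^ 2 * (\<Sum>j\<le>2. SUP x\<in>{-1..1}. cmod (iter_deriv j \<phi> x))"
  obtain C where C: "\<And>F. finite F \<Longrightarrow> (\<Sum>k\<in>F. br k powr (- 2)) \<le> C"
    using br_sum_bound[of 2] by auto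
  have S: "0 \<le> S" unfolding S_def by (intro mult_nonneg_nonneg sum_nonneg sup_iter_deriv_nonneg assms) auto
  have le: "cmod (coef \<phi> k) \<le> S * br k powr (- 2)" for k
    using coef_decay[OF assms, of k 2]
    by (simp add: S_def powr_minus divide_simps)
  have "(\<Sum>k\<in>F. cmod (coef \<phi> k)) \<le> S * C" if "finite F" for F
  proof -
    have "(\<Sum>k\<in>F. cmod (coef \<phi> k)) \<le> (\<Sum>k\<in>F. S * br k powr (- 2))" by (intro sum_mono le)
    also have "\<dots> \<le> S * C" unfolding sum_distrib_left[symmetric] by (intro mult_left_mono C that S)
    finally show ?thesis .
  qed
  moreover have "0 \<le> S * C" using C[of "{}"] S by simp
  ultimately show ?thesis unfolding l1_le_def by blast
qed

text \<open>Decay of order 2 makes the series converge absolutely, so it has a continuous limit with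
  the same coefficients; completeness identifies the limit with \<open>\<phi>\<close>.\<close>

lemma fourier_uniform_limit:
  assumes "\<phi> \<in> per_test"
  shows "uniform_limit UNIV (\<lambda>F x. \<Sum>k\<in>F. coef \<phi> k * fourier_mode k x) \<phi> (finite_subsets_at_top UNIV)"
proof -
  obtain C where C: "l1_le (coef \<phi>) C" using l1_le_coef[OF assms] by blast
  define g where "g x = (\<Sum>\<^sub>\<infinity>k. coef \<phi> k * fourier_mode k x)" for x
  have u: "uniform_limit A (\<lambda>F x. \<Sum>k\<in>F. coef \<phi> k * fourier_mode k x) g (finite_subsets_at_top UNIV)" for A
    unfolding g_def
    by (rule Weierstrass_m_test_general[OF _ l1_le_abs_summable[OF C]]) (simp add: norm_mult)
  have cp: "continuous_on A (\<lambda>x. \<Sum>k\<in>F. coef \<phi> k * fourier_mode k x)" for F A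
    by (intro continuous_intros continuous_fourier_mode)
  have cg: "continuous_on UNIV g"
    by (rule uniform_limit_theorem[OF _ u]) (simp_all add: cp)
  have "coef g l = coef \<phi> l" for l
  proof -
    have "uniform_limit {-1..1} (\<lambda>F x. (\<Sum>k\<in>F. coef \<phi> k * fourier_mode k x) * fourier_mode (- l) x)
        (\<lambda>x. g x * fourier_mode (- l) x) (finite_subsets_at_top UNIV)"
    proof (rule uniform_lim_mult[OF u uniform_limit_const])
      show "bounded (g ` {-1..1})"
        by (intro compact_imp_bounded compact_continuous_image continuous_on_subset[OF cg]) auto
      show "bounded (fourier_mode (- l) ` {-1..1})"
        by (auto simp: bounded_iff intro!: exI[of _ 1])
    qed
    moreover have "continuous_on {-1..1} (\<lambda>x. (\<Sum>k\<in>F. coef \<phi> k * fourier_mode k x) * fourier_mode (- l) x)" for F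
      by (intro continuous_intros continuous_fourier_mode)
    ultimately obtain I J where
      I: "\<And>F. ((\<lambda>x. (\<Sum>k\<in>F. coef \<phi> k * fourier_mode k x) * fourier_mode (- l) x) has_integral I F) {-1..1}"
      and J: "((\<lambda>x. g x * fourier_mode (- l) x) has_integral J) {-1..1}"
      and lim: "(I \<longlongrightarrow> J) (finite_subsets_at_top UNIV)"
      by (rule uniform_limit_integral) auto
    have "I F = 2 * coef \<phi> l" if "l \<in> F" "finite F" for F
    proof -
      have "I F = 2 * coef (\<lambda>x. \<Sum>k\<in>F. coef \<phi> k * fourier_mode k x) l"
        using integral_unique[OF I[of F]] by (simp add: coef_def)
      also have "coef (\<lambda>x. \<Sum>k\<in>F. coef \<phi> k * fourier_mode k x) l = (\<Sum>k\<in>F. coef \<phi> k * (if l = k then 1 else 0))"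
        by (subst coef_sum) (auto intro!: continuous_intros continuous_fourier_mode simp: coef_cmult coef_fourier_mode)
      also have "\<dots> = (\<Sum>k\<in>F. if l = k then coef \<phi> k else 0)" by (intro sum.cong) auto
      also have "\<dots> = coef \<phi> l" using that by simp
      finally show ?thesis .
    qed
    then have "\<forall>\<^sub>F F in finite_subsets_at_top UNIV. I F = 2 * coef \<phi> l"
      unfolding eventually_finite_subsets_at_top by (intro exI[of _ "{l}"]) auto
    then have "(I \<longlongrightarrow> 2 * coef \<phi> l) (finite_subsets_at_top UNIV)"
      by (rule tendsto_eventually)
    with lim have "J = 2 * coef \<phi> l" using tendsto_unique[OF finite_subsets_at_top_neq_bot] by blast
    then show ?thesis using integral_unique[OF J] by (simp add: coef_def)
  qed
  moreover have c\<phi>: "continuous_on A \<phi>" for A by (rule per_test_continuous[OF assms])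
  ultimately have "coef (\<lambda>x. \<phi> x + (-1) * g x) l = 0" for l
    by (subst coef_add) (auto intro!: continuous_intros continuous_on_subset[OF cg] simp: coef_cmult[of "-1", simplified])
  moreover have "continuous_on UNIV (\<lambda>x. \<phi> x + (-1) * g x)" by (intro continuous_intros cg c\<phi>)
  moreover have "\<phi> (x + 2) + (-1) * g (x + 2) = \<phi> x + (-1) * g x" for x
    by (simp add: g_def fourier_mode_periodic per_test_periodic[OF assms])
  ultimately have "\<phi> x + (-1) * g x = 0" for x
    using coef_zero_imp_zero[of "\<lambda>x. \<phi> x + (-1) * g x"] by blast
  then have "g = \<phi>" by auto
  then show ?thesis using u[of UNIV] by simp
qed

section \<open>Distributions and their coefficients\<close>

lemma per_dist_add: "u \<in> per_dist \<Longrightarrow> \<phi> \<in> per_test \<Longrightarrow> \<psi> \<in> per_test \<Longrightarrow> u (\<lambda>x. \<phi> x + \<psi> x) = u \<phi> + u \<psi>"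
  and per_dist_cmult: "u \<in> per_dist \<Longrightarrow> \<phi> \<in> per_test \<Longrightarrow> u (\<lambda>x. c * \<phi> x) = c * u \<phi>"
  and per_dist_outside: "u \<in> per_dist \<Longrightarrow> \<phi> \<notin> per_test \<Longrightarrow> u \<phi> = 0"
  by (simp_all add: per_dist_def)

lemma per_dist_bound:
  "u \<in> per_dist \<Longrightarrow> \<exists>C N. \<forall>\<phi>\<in>per_test. cmod (u \<phi>) \<le> C * (\<Sum>j\<le>N. SUP x\<in>{-1..1}. cmod (iter_deriv j \<phi> x))"
  by (simp add: per_dist_def)

lemma per_test_zero: "(\<lambda>x. 0) \<in> per_test"
  using per_test_cmult[OF fourier_mode_per_test, of 0 0] by simp

lemma iter_deriv_zero: "iter_deriv j (\<lambda>x. 0) = (\<lambda>x. 0)"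
  using iter_deriv_cmult[OF fourier_mode_per_test, of j 0 0] by simp

lemma
  assumes "\<And>i. i \<in> I \<Longrightarrow> f i \<in> per_test"
  shows per_test_sum: "(\<lambda>x. \<Sum>i\<in>I. f i x) \<in> per_test"
    and iter_deriv_sum: "iter_deriv j (\<lambda>x. \<Sum>i\<in>I. f i x) = (\<lambda>x. \<Sum>i\<in>I. iter_deriv j (f i) x)"
    and per_dist_sum: "u \<in> per_dist \<Longrightarrow> u (\<lambda>x. \<Sum>i\<in>I. f i x) = (\<Sum>i\<in>I. u (f i))"
proof -
  have "(\<lambda>x. \<Sum>i\<in>I. f i x) \<in> per_test \<and> iter_deriv j (\<lambda>x. \<Sum>i\<in>I. f i x) = (\<lambda>x. \<Sum>i\<in>I. iter_deriv j (f i) x)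
      \<and> (u \<in> per_dist \<longrightarrow> u (\<lambda>x. \<Sum>i\<in>I. f i x) = (\<Sum>i\<in>I. u (f i)))"
    using assms
  proof (induction I rule: infinite_finite_induct)
    case (insert i I)
    then show ?case
      using per_dist_add[of u "f i" "\<lambda>x. \<Sum>i\<in>I. f i x"]
      by (simp add: per_test_add iter_deriv_plus)
  qed (use per_dist_cmult[OF _ per_test_zero, of u 0] in \<open>auto simp: per_test_zero iter_deriv_zero\<close>)
  then show "(\<lambda>x. \<Sum>i\<in>I. f i x) \<in> per_test"
    "iter_deriv j (\<lambda>x. \<Sum>i\<in>I. f i x) = (\<lambda>x. \<Sum>i\<in>I. iter_deriv j (f i) x)"
    "u \<in> per_dist \<Longrightarrow> u (\<lambda>x. \<Sum>i\<in>I. f i x) = (\<Sum>i\<in>I. u (f i))" by auto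
qed

lemma cnj_mode: "(\<lambda>x. cnj (fourier_mode k x)) = fourier_mode (- k)"
  by (simp add: cnj_fourier_mode)

lemma fcoeff_eq: "fcoeff u k = u (fourier_mode (- k))"
  by (simp add: fcoeff_def cnj_mode)

text \<open>A functional that kills all modes kills the partial Fourier sums of
  \<open>\<phi>\<close>. These converge together with any finite number of derivatives, that is, in
  the seminorm that bounds the functional.\<close>

lemma per_dist_eq_zero:
  assumes u: "u \<in> per_dist" and zero: "\<And>k. fcoeff u k = 0" and \<phi>: "\<phi> \<in> per_test"
  shows "u \<phi> = 0"
proof -
  obtain C N where CN: "\<And>\<phi>. \<phi> \<in> per_test \<Longrightarrow>
      cmod (u \<phi>) \<le> C * (\<Sum>j\<le>N. SUP x\<in>{-1..1}. cmod (iter_deriv j \<phi> x))"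
    using per_dist_bound[OF u] by blast
  define r where "r F = (\<lambda>x. \<phi> x + (-1) * (\<Sum>k\<in>F. coef \<phi> k * fourier_mode k x))" for F
  have mode: "u (fourier_mode k) = 0" for k using zero[of "- k"] by (simp add: fcoeff_eq)
  have p: "(\<lambda>x. \<Sum>k\<in>F. coef \<phi> k * fourier_mode k x) \<in> per_test" for F
    by (intro per_test_sum per_test_cmult fourier_mode_per_test)
  have r: "r F \<in> per_test" for F
    unfolding r_def by (intro per_test_add per_test_cmult p \<phi>)
  have ur: "u (r F) = u \<phi>" for F
    unfolding r_def
    by (subst per_dist_add[OF u \<phi> per_test_cmult[OF p]], subst per_dist_cmult[OF u p],
        subst per_dist_sum[OF per_test_cmult[OF fourier_mode_per_test] u])
       (simp add: per_dist_cmult[OF u fourier_mode_per_test] mode)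
  have dr: "iter_deriv j (r F) x = iter_deriv j \<phi> x - (\<Sum>k\<in>F. coef (iter_deriv j \<phi>) k * fourier_mode k x)" for j F x
    unfolding r_def
    by (subst iter_deriv_plus[OF \<phi> per_test_cmult[OF p]], subst iter_deriv_cmult[OF p],
        subst iter_deriv_sum[OF per_test_cmult[OF fourier_mode_per_test]])
       (simp add: iter_deriv_cmult[OF fourier_mode_per_test] iter_deriv_fourier_mode coef_iter_deriv[OF \<phi>]
          mult.assoc mult.left_commute[of "coef \<phi> _"])
  have "cmod (u \<phi>) \<le> \<bar>C\<bar> * (real (Suc N) * e)" if "e > 0" for e
  proof -
    \<comment> \<open>One finite set serves all orders up to \<open>N\<close>, because the
      differentiated partial sums are the partial Fourier sums of the derivatives.\<close>
    have "\<forall>\<^sub>F F in finite_subsets_at_top UNIV. \<forall>j\<in>{..N}. \<forall>x\<in>UNIV.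
        dist (\<Sum>k\<in>F. coef (iter_deriv j \<phi>) k * fourier_mode k x) (iter_deriv j \<phi> x) < e"
      by (intro eventually_ball_finite ballI finite_atMost
          uniform_limitD[OF fourier_uniform_limit[OF per_test_iter_deriv[OF \<phi>]] that])
    from eventually_happens'[OF finite_subsets_at_top_neq_bot this]
    obtain F where F: "\<And>j x. j \<le> N \<Longrightarrow>
        dist (\<Sum>k\<in>F. coef (iter_deriv j \<phi>) k * fourier_mode k x) (iter_deriv j \<phi> x) < e" by auto
    have "(SUP x\<in>{-1..1}. cmod (iter_deriv j (r F) x)) \<le> e" if "j \<le> N" for j
    proof (rule cSUP_least)
      fix x
      show "cmod (iter_deriv j (r F) x) \<le> e"
        using F[OF that, of x] unfolding dr dist_norm by (simp only: norm_minus_commute less_imp_le)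
    qed simp
    then have "(\<Sum>j\<le>N. SUP x\<in>{-1..1}. cmod (iter_deriv j (r F) x)) \<le> (\<Sum>j\<le>N. e)"
      by (intro sum_mono) simp
    then have le: "(\<Sum>j\<le>N. SUP x\<in>{-1..1}. cmod (iter_deriv j (r F) x)) \<le> real (Suc N) * e" by simp
    have "cmod (u \<phi>) \<le> C * (\<Sum>j\<le>N. SUP x\<in>{-1..1}. cmod (iter_deriv j (r F) x))"
      using CN[OF r, of F] ur by simp
    also have "\<dots> \<le> \<bar>C\<bar> * (\<Sum>j\<le>N. SUP x\<in>{-1..1}. cmod (iter_deriv j (r F) x))"
      by (intro mult_right_mono sum_nonneg sup_iter_deriv_nonneg r) auto
    also have "\<dots> \<le> \<bar>C\<bar> * (real (Suc N) * e)" by (intro mult_left_mono le) auto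
    finally show ?thesis .
  qed
  note * = this
  have "cmod (u \<phi>) \<le> d" if "d > 0" for d
  proof -
    \<comment> \<open>Adding 1 keeps the denominator positive even if \<open>C\<close> is 0.\<close>
    define M where "M = \<bar>C\<bar> * real (Suc N) + 1"
    have M: "M > 0" by (simp add: M_def add_nonneg_pos)
    have "\<bar>C\<bar> * (real (Suc N) * (d / M)) = (M - 1) * (d / M)" unfolding M_def by simp
    also have "\<dots> \<le> M * (d / M)" using that M by (intro mult_right_mono) auto
    finally have "\<bar>C\<bar> * (real (Suc N) * (d / M)) \<le> M * (d / M)" .
    with *[of "d / M"] that M show ?thesis by simp
  qed
  then have "cmod (u \<phi>) \<le> 0" using field_le_epsilon[of "cmod (u \<phi>)" 0] by simp
  then show ?thesis by simp
qed

lemma per_dist_plus: "u \<in> per_dist \<Longrightarrow> w \<in> per_dist \<Longrightarrow> u + w \<in> per_dist"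
proof -
  assume u: "u \<in> per_dist" and w: "w \<in> per_dist"
  obtain C N where C: "\<And>\<phi>. \<phi> \<in> per_test \<Longrightarrow>
      cmod (u \<phi>) \<le> C * (\<Sum>j\<le>N. SUP x\<in>{-1..1}. cmod (iter_deriv j \<phi> x))"
    using per_dist_bound[OF u] by blast
  obtain D M where D: "\<And>\<phi>. \<phi> \<in> per_test \<Longrightarrow>
      cmod (w \<phi>) \<le> D * (\<Sum>j\<le>M. SUP x\<in>{-1..1}. cmod (iter_deriv j \<phi> x))"
    using per_dist_bound[OF w] by blast
  have "cmod ((u + w) \<phi>) \<le> (\<bar>C\<bar> + \<bar>D\<bar>) * (\<Sum>j\<le>max N M. SUP x\<in>{-1..1}. cmod (iter_deriv j \<phi> x))"
    if \<phi>: "\<phi> \<in> per_test" for \<phi>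
  proof -
    let ?s = "\<lambda>N. \<Sum>j\<le>N. SUP x\<in>{-1..1}. cmod (iter_deriv j \<phi> x)"
    have nn: "0 \<le> ?s N" for N by (intro sum_nonneg sup_iter_deriv_nonneg \<phi>)
    have mono: "?s N \<le> ?s (max N M)" "?s M \<le> ?s (max N M)"
      by (intro sum_mono2 sup_iter_deriv_nonneg \<phi>; auto)+
    have "cmod ((u + w) \<phi>) \<le> cmod (u \<phi>) + cmod (w \<phi>)" by (simp add: norm_triangle_ineq)
    also have "\<dots> \<le> \<bar>C\<bar> * ?s N + \<bar>D\<bar> * ?s M"
      using C[OF \<phi>] D[OF \<phi>] mult_right_mono[OF abs_ge_self nn] by (meson add_mono order_trans)
    also have "\<dots> \<le> \<bar>C\<bar> * ?s (max N M) + \<bar>D\<bar> * ?s (max N M)"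
      by (intro add_mono mult_left_mono mono) auto
    finally show ?thesis by (simp add: distrib_right)
  qed
  then have "\<exists>C N. \<forall>\<phi>\<in>per_test. cmod ((u + w) \<phi>) \<le> C * (\<Sum>j\<le>N. SUP x\<in>{-1..1}. cmod (iter_deriv j \<phi> x))"
    by blast
  then show "u + w \<in> per_dist"
    using u w by (simp add: per_dist_def distrib_left)
qed

lemma per_dist_cscale: "u \<in> per_dist \<Longrightarrow> cscale c u \<in> per_dist"
proof -
  assume u: "u \<in> per_dist"
  obtain C N where C: "\<And>\<phi>. \<phi> \<in> per_test \<Longrightarrow>
      cmod (u \<phi>) \<le> C * (\<Sum>j\<le>N. SUP x\<in>{-1..1}. cmod (iter_deriv j \<phi> x))"
    using per_dist_bound[OF u] by blast
  have "cmod (cscale c u \<phi>) \<le> (cmod c * C) * (\<Sum>j\<le>N. SUP x\<in>{-1..1}. cmod (iter_deriv j \<phi> x))"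
    if "\<phi> \<in> per_test" for \<phi>
    using mult_left_mono[OF C[OF that], of "cmod c"] by (simp add: cscale_def norm_mult mult.assoc)
  then have "\<exists>C N. \<forall>\<phi>\<in>per_test. cmod (cscale c u \<phi>) \<le> C * (\<Sum>j\<le>N. SUP x\<in>{-1..1}. cmod (iter_deriv j \<phi> x))"
    by blast
  then show "cscale c u \<in> per_dist"
    using u by (simp add: per_dist_def cscale_def distrib_left mult.left_commute)
qed

lemma per_dist_deriv: "u \<in> per_dist \<Longrightarrow> dist_deriv u \<in> per_dist"
proof -
  assume u: "u \<in> per_dist"
  obtain C N where C: "\<And>\<phi>. \<phi> \<in> per_test \<Longrightarrow>
      cmod (u \<phi>) \<le> C * (\<Sum>j\<le>N. SUP x\<in>{-1..1}. cmod (iter_deriv j \<phi> x))"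
    using per_dist_bound[OF u] by blast
  have "cmod (dist_deriv u \<phi>) \<le> \<bar>C\<bar> * (\<Sum>j\<le>Suc N. SUP x\<in>{-1..1}. cmod (iter_deriv j \<phi> x))"
    if \<phi>: "\<phi> \<in> per_test" for \<phi>
  proof -
    have "cmod (dist_deriv u \<phi>) \<le> C * (\<Sum>j\<le>N. SUP x\<in>{-1..1}. cmod (iter_deriv (Suc j) \<phi> x))"
      using C[OF per_test_iter_deriv_1[OF \<phi>]] \<phi> by (simp add: dist_deriv_def iter_deriv_add)
    also have "\<dots> \<le> \<bar>C\<bar> * (\<Sum>j\<le>N. SUP x\<in>{-1..1}. cmod (iter_deriv (Suc j) \<phi> x))"
      by (intro mult_right_mono sum_nonneg sup_iter_deriv_nonneg \<phi>) auto
    also have "\<dots> \<le> \<bar>C\<bar> * (\<Sum>j\<le>Suc N. SUP x\<in>{-1..1}. cmod (iter_deriv j \<phi> x))"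
      using sup_iter_deriv_nonneg[OF \<phi>, of 0]
      by (intro mult_left_mono) (simp_all add: sum.atMost_Suc_shift del: sum.atMost_Suc)
    finally show ?thesis .
  qed
  then have ex: "\<exists>C N. \<forall>\<phi>\<in>per_test. cmod (dist_deriv u \<phi>) \<le> C * (\<Sum>j\<le>N. SUP x\<in>{-1..1}. cmod (iter_deriv j \<phi> x))"
    by blast
  show "dist_deriv u \<in> per_dist"
    unfolding per_dist_def
  proof (intro CollectI conjI ballI allI impI ex)
    fix \<phi> \<psi> assume *: "\<phi> \<in> per_test" "\<psi> \<in> per_test"
    then show "dist_deriv u (\<lambda>x. \<phi> x + \<psi> x) = dist_deriv u \<phi> + dist_deriv u \<psi>"
      using per_dist_add[OF u *[THEN per_test_iter_deriv_1]] per_test_add[OF *]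
      by (simp add: dist_deriv_def iter_deriv_plus)
  next
    fix c \<phi> assume *: "\<phi> \<in> per_test"
    then show "dist_deriv u (\<lambda>x. c * \<phi> x) = c * dist_deriv u \<phi>"
      using per_dist_cmult[OF u *[THEN per_test_iter_deriv_1]] per_test_cmult[OF *]
      by (simp add: dist_deriv_def iter_deriv_cmult)
  qed (simp add: dist_deriv_def)
qed

lemma fcoeff_plus: "fcoeff (u + w) k = fcoeff u k + fcoeff w k"
  by (simp add: fcoeff_def)

lemma fcoeff_cscale: "fcoeff (cscale c u) k = c * fcoeff u k"
  by (simp add: fcoeff_def cscale_def)

lemma per_dist_minus: "u \<in> per_dist \<Longrightarrow> w \<in> per_dist \<Longrightarrow> u - w \<in> per_dist"
proof -
  have "u - w = u + cscale (-1) w" by (simp add: cscale_def fun_eq_iff)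
  then show "u \<in> per_dist \<Longrightarrow> w \<in> per_dist \<Longrightarrow> u - w \<in> per_dist"
    by (metis per_dist_plus per_dist_cscale)
qed

lemma fcoeff_minus: "fcoeff (u - w) k = fcoeff u k - fcoeff w k"
  by (simp add: fcoeff_def)

lemma fcoeff_inject:
  assumes "u \<in> per_dist" "w \<in> per_dist" "\<And>k. fcoeff u k = fcoeff w k"
  shows "u = w"
proof
  fix \<phi> show "u \<phi> = w \<phi>"
  proof (cases "\<phi> \<in> per_test")
    case True
    have "(u - w) \<phi> = 0"
      by (rule per_dist_eq_zero[OF per_dist_minus[OF assms(1,2)] _ True]) (simp add: fcoeff_minus assms(3))
    then show ?thesis by simp
  qed (use assms in \<open>simp add: per_dist_outside\<close>)
qed

lemma fcoeff_dist_deriv: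
  assumes "u \<in> per_dist"
  shows "fcoeff (dist_deriv u) k = \<i> * of_int k * of_real pi * fcoeff u k"
proof -
  have "iter_deriv 1 (fourier_mode (- k)) = (\<lambda>x. (- (\<i> * of_int k * of_real pi)) * fourier_mode (- k) x)"
    unfolding iter_deriv_fourier_mode by simp
  then show ?thesis
    unfolding fcoeff_eq dist_deriv_def
    by (simp only: fourier_mode_per_test per_dist_cmult[OF assms fourier_mode_per_test] if_True) simp
qed

lemma dist_deriv_funpow:
  assumes "u \<in> per_dist"
  shows "(dist_deriv ^^ n) u \<in> per_dist"
    and "fcoeff ((dist_deriv ^^ n) u) k = (\<i> * of_int k * of_real pi) ^ n * fcoeff u k"
proof -
  have "(dist_deriv ^^ n) u \<in> per_dist \<and> fcoeff ((dist_deriv ^^ n) u) k = (\<i> * of_int k * of_real pi) ^ n * fcoeff u k"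
    by (induction n) (simp_all add: assms per_dist_deriv fcoeff_dist_deriv)
  then show "(dist_deriv ^^ n) u \<in> per_dist"
    "fcoeff ((dist_deriv ^^ n) u) k = (\<i> * of_int k * of_real pi) ^ n * fcoeff u k" by auto
qed

section \<open>Distributions with prescribed coefficients, products and the operator\<close>

definition dist_of :: "(int \<Rightarrow> complex) \<Rightarrow> functional" where
  "dist_of c \<phi> = (if \<phi> \<in> per_test then \<Sum>\<^sub>\<infinity>k. c k * coef \<phi> (- k) else 0)"

text \<open>Of the \<open>p + 2\<close> derivatives of the test function, \<open>p\<close> offset
  the growth of the coefficients and two make the series converge. The index in
  \<open>dist_of\<close> is negated because functionals are paired bilinearly with test
  functions.\<close>

lemma dist_of:
  assumes c: "\<And>k. cmod (c k) \<le> A * br k ^ p"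
  shows "dist_of c \<in> per_dist" and "fcoeff (dist_of c) k = c k"
proof -
  obtain Z where Z: "\<And>F. finite F \<Longrightarrow> (\<Sum>k\<in>F. br k powr (- 2)) \<le> Z"
    using br_sum_bound[of 2] by auto
  let ?s = "\<lambda>\<phi>. \<Sum>j\<le>p + 2. SUP x\<in>{-1..1}. cmod (iter_deriv j \<phi> x)"
  have A: "0 \<le> A" using c[of 0] by (simp add: br_def order_trans[OF norm_ge_zero])
  have Z0: "0 \<le> Z" using Z[of "{}"] by simp
  have l1: "l1_le (\<lambda>k. c k * coef \<phi> (- k)) (A * 2 ^ (p + 2) * Z * ?s \<phi>)" if \<phi>: "\<phi> \<in> per_test" for \<phi>
  proof -
    have s: "0 \<le> ?s \<phi>" by (intro sum_nonneg sup_iter_deriv_nonneg \<phi>)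
    have le: "cmod (c k * coef \<phi> (- k)) \<le> (A * 2 ^ (p + 2) * ?s \<phi>) * br k powr (- 2)" for k
    proof -
      have "cmod (c k * coef \<phi> (- k)) \<le> A * br k ^ p * cmod (coef \<phi> (- k))"
        by (simp add: norm_mult mult_right_mono c)
      also have "\<dots> = A * (cmod (coef \<phi> (- k)) * br (- k) ^ (p + 2)) * br k powr (- 2)"
        by (simp add: powr_minus power_add power2_eq_square field_simps)
      also have "\<dots> \<le> A * (2 ^ (p + 2) * ?s \<phi>) * br k powr (- 2)"
        by (intro mult_right_mono mult_left_mono coef_decay \<phi> A) auto
      finally show ?thesis by (simp add: mult_ac)
    qed
    show ?thesis unfolding l1_le_def
    proof (intro conjI allI impI)
      show "0 \<le> A * 2 ^ (p + 2) * Z * ?s \<phi>" by (intro mult_nonneg_nonneg A Z0 s) auto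
      fix F :: "int set" assume F: "finite F"
      have "(\<Sum>k\<in>F. cmod (c k * coef \<phi> (- k))) \<le> (\<Sum>k\<in>F. (A * 2 ^ (p + 2) * ?s \<phi>) * br k powr (- 2))"
        by (intro sum_mono le)
      also have "\<dots> \<le> (A * 2 ^ (p + 2) * ?s \<phi>) * Z"
        unfolding sum_distrib_left[symmetric] by (intro mult_left_mono Z F mult_nonneg_nonneg A s) auto
      finally show "(\<Sum>k\<in>F. cmod (c k * coef \<phi> (- k))) \<le> A * 2 ^ (p + 2) * Z * ?s \<phi>" by (simp add: mult_ac)
    qed
  qed
  note sm = l1_le_summable[OF l1]
  show "dist_of c \<in> per_dist"
    unfolding per_dist_def
  proof (intro CollectI conjI ballI allI impI)
    fix \<phi> \<psi> assume *: "\<phi> \<in> per_test" "\<psi> \<in> per_test"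
    then show "dist_of c (\<lambda>x. \<phi> x + \<psi> x) = dist_of c \<phi> + dist_of c \<psi>"
      by (simp add: dist_of_def per_test_add coef_add per_test_continuous distrib_left infsum_add sm)
  next
    fix b \<phi> assume *: "\<phi> \<in> per_test"
    then show "dist_of c (\<lambda>x. b * \<phi> x) = b * dist_of c \<phi>"
      by (simp add: dist_of_def per_test_cmult coef_cmult mult.left_commute[of _ b] infsum_cmult_right')
  next
    show "\<exists>C N. \<forall>\<phi>\<in>per_test. cmod (dist_of c \<phi>) \<le> C * (\<Sum>j\<le>N. SUP x\<in>{-1..1}. cmod (iter_deriv j \<phi> x))"
      using l1_le_norm_infsum[OF l1] by (intro exI[of _ "A * 2 ^ (p + 2) * Z"] exI[of _ "p + 2"]) (simp add: dist_of_def)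
  qed (simp add: dist_of_def)
  have "fcoeff (dist_of c) k = (\<Sum>\<^sub>\<infinity>j. c j * (if j = k then 1 else 0))"
    by (simp add: fcoeff_eq dist_of_def fourier_mode_per_test coef_fourier_mode)
  also have "\<dots> = (\<Sum>\<^sub>\<infinity>j\<in>{k}. c j)"
    by (rule infsum_cong_neutral) auto
  finally show "fcoeff (dist_of c) k = c k" by simp
qed

text \<open>\<open>dist_mult\<close> is a definite description. Polynomial growth of the convolution
  gives existence through \<open>dist_of\<close>, and injectivity of the coefficients gives
  uniqueness.\<close>

lemma dist_mult:
  assumes "\<And>k. cmod (\<Sum>\<^sub>\<infinity>j. fcoeff V (k - j) * fcoeff f j) \<le> A * br k ^ p"
  shows "dist_mult V f \<in> per_dist"
    and "fcoeff (dist_mult V f) k = (\<Sum>\<^sub>\<infinity>j. fcoeff V (k - j) * fcoeff f j)"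
proof -
  let ?P = "\<lambda>w. w \<in> per_dist \<and> (\<forall>k. fcoeff w k = (\<Sum>\<^sub>\<infinity>j. fcoeff V (k - j) * fcoeff f j))"
  have "?P (dist_of (\<lambda>k. \<Sum>\<^sub>\<infinity>j. fcoeff V (k - j) * fcoeff f j))"
    using dist_of[OF assms] by blast
  then have "\<exists>!w. ?P w" using fcoeff_inject by (intro ex1I) auto
  from theI'[OF this, folded dist_mult_def]
  show "dist_mult V f \<in> per_dist" "fcoeff (dist_mult V f) k = (\<Sum>\<^sub>\<infinity>j. fcoeff V (k - j) * fcoeff f j)"
    by auto
qed

lemma L_op:
  assumes f: "f \<in> per_dist" and c: "\<And>k. cmod (\<Sum>\<^sub>\<infinity>j. fcoeff V (k - j) * fcoeff f j) \<le> A * br k ^ p"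
  shows "L_op m V f \<in> per_dist"
    and "fcoeff (L_op m V f) k = of_real ((of_int k * pi) ^ (2 * m)) * fcoeff f k
          + (\<Sum>\<^sub>\<infinity>j. fcoeff V (k - j) * fcoeff f j)"
proof -
  show "L_op m V f \<in> per_dist"
    unfolding L_op_def by (intro per_dist_plus per_dist_cscale dist_deriv_funpow f dist_mult[OF c])
  have "(-1) ^ m * (\<i> * of_int k * of_real pi) ^ (2 * m) = complex_of_real ((of_int k * pi) ^ (2 * m))"
    by (simp add: power_mult power_mult_distrib flip: power_mult_distrib[of "-1"])
  then show "fcoeff (L_op m V f) k = of_real ((of_int k * pi) ^ (2 * m)) * fcoeff f k
          + (\<Sum>\<^sub>\<infinity>j. fcoeff V (k - j) * fcoeff f j)"
    unfolding L_op_def fcoeff_plus fcoeff_cscale dist_deriv_funpow(2)[OF f] dist_mult(2)[OF c]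
    by (simp only: mult.assoc[symmetric])
qed

section \<open>Gaps of the diagonal and size of the coupling\<close>

lemma l2_le_tensor:
  fixes f :: "'a \<Rightarrow> real" and g :: "'b \<Rightarrow> real"
  assumes "l2_le f C" "l2_le g D"
  shows "l2_le (\<lambda>(x, y). f x * g y) (C * D)"
proof (rule l2_leI_sq)
  show "0 \<le> C * D" using assms by (simp add: l2_le_def)
  fix F :: "('a \<times> 'b) set" assume F: "finite F"
  have "F \<subseteq> fst ` F \<times> snd ` F" by (auto simp: subset_fst_snd)
  then have "(\<Sum>x\<in>F. (norm (case x of (x, y) \<Rightarrow> f x * g y))\<^sup>2)
      \<le> (\<Sum>x\<in>fst ` F \<times> snd ` F. (norm (case x of (x, y) \<Rightarrow> f x * g y))\<^sup>2)"
    using F by (intro sum_mono2) auto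
  also have "\<dots> = (\<Sum>x\<in>fst ` F. (norm (f x))\<^sup>2) * (\<Sum>y\<in>snd ` F. (norm (g y))\<^sup>2)"
    by (simp add: sum_product sum.cartesian_product norm_mult power_mult_distrib case_prod_unfold)
  also have "\<dots> \<le> C\<^sup>2 * D\<^sup>2"
    using F by (intro mult_mono l2_le_sum_sq assms sum_nonneg) auto
  finally show "(\<Sum>x\<in>F. (norm (case x of (x, y) \<Rightarrow> f x * g y))\<^sup>2) \<le> (C * D)\<^sup>2"
    by (simp add: power_mult_distrib)
qed

text \<open>Tonelli for squares, with the norms of the sections as witness. This is the source of
  the sequence \<open>\<tau>\<close> in the coupling estimate.\<close>

lemma l2_le_sections:
  fixes f :: "'a \<times> 'b \<Rightarrow> real"
  assumes "l2_le f C"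
  obtains \<tau> where "\<And>n. 0 \<le> \<tau> n" "l2_le \<tau> C" "\<And>n. l2_le (\<lambda>x. f (n, x)) (\<tau> n)"
proof -
  define s where "s n = (\<Sum>\<^sub>\<infinity>x. (f (n, x))\<^sup>2)" for n
  have sm: "(\<lambda>x. (f (n, x))\<^sup>2) summable_on UNIV" for n
  proof (rule nonneg_bdd_above_summable_on)
    have "(\<Sum>x\<in>F. (f (n, x))\<^sup>2) \<le> C\<^sup>2" if "finite F" for F
      using l2_le_sum_sq[OF l2_le_row[OF assms, of n] that] by simp
    then show "bdd_above (sum (\<lambda>x. (f (n, x))\<^sup>2) ` {F. F \<subseteq> UNIV \<and> finite F})"
      by (auto simp: bdd_above_def)
  qed simp
  have s0: "0 \<le> s n" for n unfolding s_def by (rule infsum_nonneg) simp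
  have "l2_le (\<lambda>x. f (n, x)) (sqrt (s n))" for n
  proof (rule l2_leI_sq)
    fix F :: "'b set" assume "finite F"
    then show "(\<Sum>x\<in>F. (norm (f (n, x)))\<^sup>2) \<le> (sqrt (s n))\<^sup>2"
      using finite_sum_le_infsum[OF sm, of F] s0 by (simp add: s_def)
  qed (simp add: s0)
  moreover have "l2_le (\<lambda>n. sqrt (s n)) C"
  proof (rule l2_leI_sq)
    show "0 \<le> C" using assms by (rule l2_le_nonneg)
    fix F :: "'a set" assume F: "finite F"
    have "(\<Sum>n\<in>F. (norm (sqrt (s n)))\<^sup>2) = (\<Sum>n\<in>F. s n)" by (simp add: s0)
    also have "\<dots> = (\<Sum>\<^sub>\<infinity>x. \<Sum>n\<in>F. (f (n, x))\<^sup>2)"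
      unfolding s_def by (rule infsumI[symmetric], rule has_sum_sum) (rule has_sum_infsum[OF sm])
    also have "\<dots> \<le> C\<^sup>2"
    proof (rule infsum_le_finite_sums)
      show "(\<lambda>x. \<Sum>n\<in>F. (f (n, x))\<^sup>2) summable_on UNIV"
        by (rule has_sum_imp_summable[OF has_sum_sum], rule has_sum_infsum[OF sm])
      fix G :: "'b set" assume G: "finite G"
      have "(\<Sum>x\<in>G. \<Sum>n\<in>F. (f (n, x))\<^sup>2) = (\<Sum>n\<in>F. \<Sum>x\<in>G. (f (n, x))\<^sup>2)" by (rule sum.swap)
      also have "\<dots> = (\<Sum>x\<in>F\<times>G. (norm (f x))\<^sup>2)" by (simp add: sum.cartesian_product)
      also have "\<dots> \<le> C\<^sup>2" using F G by (intro l2_le_sum_sq assms) simp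
      finally show "(\<Sum>x\<in>G. \<Sum>n\<in>F. (f (n, x))\<^sup>2) \<le> C\<^sup>2" .
    qed
    finally show "(\<Sum>n\<in>F. (norm (sqrt (s n)))\<^sup>2) \<le> C\<^sup>2" .
  qed
  ultimately show thesis using that[of "\<lambda>n. sqrt (s n)"] s0 by simp
qed

section \<open>The diagonal, the weights and the gaps\<close>

definition diag :: "nat \<Rightarrow> int \<Rightarrow> real" where
  "diag m k = (of_int k * pi) ^ (2 * m)"

definition wt :: "nat \<Rightarrow> nat \<Rightarrow> int \<Rightarrow> real" where
  "wt m n k = max (real n) \<bar>of_int k\<bar> ^ (2 * m - 1) * (1 + \<bar>\<bar>of_int k\<bar> - real n\<bar>)"

lemma diag_abs: "diag m k = pi ^ (2 * m) * \<bar>of_int k\<bar> ^ (2 * m)"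
  by (simp add: diag_def power_mult_distrib power_even_abs mult.commute)

text \<open>The margin in the gap estimates: a factor 9 pays for the added 1 in each of two weights
  and for the halving of a gap at \<open>cut\<close>.\<close>

lemma pi_power_ge_9: "1 \<le> m \<Longrightarrow> 9 \<le> pi ^ (2 * m)"
proof -
  assume "1 \<le> m"
  have "(3::real) ^ 2 \<le> pi ^ 2" using pi_gt3 by (intro power_mono) auto
  also have "\<dots> \<le> pi ^ (2 * m)" using pi_gt3 \<open>1 \<le> m\<close> by (intro power_increasing) auto
  finally show ?thesis by simp
qed

lemma wt_pos: "1 \<le> n \<Longrightarrow> 0 < wt m n k"
  by (auto simp: wt_def intro!: mult_pos_pos zero_less_power add_pos_nonneg)

lemma power_diff_lower:
  fixes x y :: real
  assumes "0 \<le> y" "y \<le> x" "1 \<le> m"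
  shows "(x - y) * x ^ (2 * m - 1) \<le> x ^ (2 * m) - y ^ (2 * m)"
proof -
  have e: "z ^ (2 * m) = z * z ^ (2 * m - 1)" for z :: real
    using assms(3) by (cases m) auto
  have "y * y ^ (2 * m - 1) \<le> y * x ^ (2 * m - 1)"
    using assms by (intro mult_left_mono power_mono) auto
  then show ?thesis by (simp add: e left_diff_distrib)
qed

lemma diag_diff_lower:
  assumes "1 \<le> m" "\<bar>j\<bar> \<le> \<bar>k\<bar>"
  shows "\<bar>of_int k\<bar> ^ (2 * m - 1) * (9 * (\<bar>of_int k\<bar> - \<bar>of_int j\<bar>)) \<le> diag m k - diag m j"
proof -
  have jk: "\<bar>real_of_int j\<bar> \<le> \<bar>real_of_int k\<bar>" using assms(2) by linarith
  have "9 * ((\<bar>of_int k\<bar> - \<bar>of_int j\<bar>) * \<bar>of_int k\<bar> ^ (2 * m - 1))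
      \<le> pi ^ (2 * m) * ((\<bar>of_int k\<bar> - \<bar>of_int j\<bar>) * \<bar>of_int k\<bar> ^ (2 * m - 1))"
    using jk by (intro mult_right_mono pi_power_ge_9 assms mult_nonneg_nonneg) auto
  also have "\<dots> \<le> pi ^ (2 * m) * (\<bar>of_int k\<bar> ^ (2 * m) - \<bar>of_int j\<bar> ^ (2 * m))"
    using jk by (intro mult_left_mono power_diff_lower assms) auto
  finally have *: "9 * ((\<bar>of_int k\<bar> - \<bar>of_int j\<bar>) * \<bar>of_int k\<bar> ^ (2 * m - 1)) \<le> diag m k - diag m j"
    by (simp only: diag_abs right_diff_distrib)
  have comm: "x ^ p * (9 * y) = 9 * (y * x ^ p)" for x y :: real and p :: nat by simp
  show ?thesis unfolding comm by (rule *)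
qed

text \<open>The moduli differ by at least 1, so the constants added in the two weights are absorbed
  by the factor 9. The power of the larger modulus serves for both weights.\<close>

lemma gap_pair:
  assumes "1 \<le> m" "1 \<le> n" "\<bar>k\<bar> \<noteq> int n"
  shows "wt m n k + wt m n (int n) \<le> \<bar>diag m k - diag m (int n)\<bar>"
proof -
  define x where "x = \<bar>real_of_int k\<bar>"
  define N where "N = real n"
  define M where "M = max N x"
  have "\<bar>x - N\<bar> = real_of_int \<bar>\<bar>k\<bar> - int n\<bar>" by (simp add: x_def N_def)
  moreover have "1 \<le> \<bar>\<bar>k\<bar> - int n\<bar>" using assms(3) by linarith
  ultimately have xn: "1 \<le> \<bar>x - N\<bar>" by linarith
  have M: "0 \<le> M ^ (2 * m - 1)" "N ^ (2 * m - 1) \<le> M ^ (2 * m - 1)"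
    by (auto simp: M_def N_def intro!: power_mono)
  have "wt m n k + wt m n (int n) = M ^ (2 * m - 1) * (1 + \<bar>x - N\<bar>) + N ^ (2 * m - 1)"
    by (simp add: wt_def x_def N_def M_def)
  also have "\<dots> \<le> M ^ (2 * m - 1) * (1 + \<bar>x - N\<bar>) + M ^ (2 * m - 1)" using M by simp
  also have "\<dots> = M ^ (2 * m - 1) * (2 + \<bar>x - N\<bar>)" by (simp add: algebra_simps)
  also have "\<dots> \<le> M ^ (2 * m - 1) * (9 * \<bar>x - N\<bar>)" using M xn by (intro mult_left_mono) auto
  also have "\<dots> \<le> \<bar>diag m k - diag m (int n)\<bar>"
  proof (cases "\<bar>k\<bar> \<le> int n")
    case True
    then have "x \<le> N" by (simp add: x_def N_def)
    have "N ^ (2 * m - 1) * (9 * (N - x)) \<le> diag m (int n) - diag m k"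
      using diag_diff_lower[OF assms(1), of k "int n"] True unfolding x_def N_def by simp
    then show ?thesis using \<open>x \<le> N\<close> unfolding M_def by (simp only: max_absorb1 abs_if) auto
  next
    case False
    then have "N \<le> x" by (simp add: x_def N_def)
    have "x ^ (2 * m - 1) * (9 * (x - N)) \<le> diag m k - diag m (int n)"
      using diag_diff_lower[OF assms(1), of "int n" k] False unfolding x_def N_def by simp
    then show ?thesis using \<open>N \<le> x\<close> unfolding M_def by (simp only: max_absorb2 abs_if) auto
  qed
  finally show ?thesis .
qed

text \<open>The difference of the moduli of \<open>k\<close> and \<open>j\<close> splits at
  \<open>n\<close> into the two distances that occur in the weights, so adding the weights loses
  only constants.\<close>

lemma gap_block:
  assumes "1 \<le> m" "\<bar>j\<bar> \<le> int n" "int n < \<bar>k\<bar>"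
  shows "wt m n k + wt m n j \<le> diag m k - diag m j"
proof -
  define x where "x = \<bar>real_of_int k\<bar>"
  define y where "y = \<bar>real_of_int j\<bar>"
  define N where "N = real n"
  have xy: "y \<le> N" "N + 1 \<le> x" "0 \<le> y"
    using assms(2,3) unfolding x_def y_def N_def by linarith+
  have p: "N ^ (2 * m - 1) \<le> x ^ (2 * m - 1)" "0 \<le> x ^ (2 * m - 1)"
    using xy by (auto intro!: power_mono simp: N_def)
  have "wt m n k + wt m n j = x ^ (2 * m - 1) * (1 + (x - N)) + N ^ (2 * m - 1) * (1 + (N - y))"
    using xy by (simp add: wt_def x_def[symmetric] y_def[symmetric] N_def[symmetric] max_absorb1 max_absorb2)
  also have "\<dots> \<le> x ^ (2 * m - 1) * (1 + (x - N)) + x ^ (2 * m - 1) * (1 + (N - y))"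
    using p xy by (intro add_mono mult_right_mono) auto
  also have "\<dots> = x ^ (2 * m - 1) * (2 + (x - y))" by (simp add: algebra_simps)
  also have "\<dots> \<le> x ^ (2 * m - 1) * (9 * (x - y))" using p xy by (intro mult_left_mono) auto
  also have "\<dots> \<le> diag m k - diag m j"
    unfolding x_def y_def by (rule diag_diff_lower) (use assms in auto)
  finally show ?thesis .
qed

definition cut :: "nat \<Rightarrow> nat \<Rightarrow> real" where
  "cut m n = (diag m (int n) + diag m (int n + 1)) / 2"

lemma diag_mono: "\<bar>j\<bar> \<le> \<bar>k\<bar> \<Longrightarrow> diag m j \<le> diag m k"
  unfolding diag_abs by (intro mult_left_mono power_mono) auto

text \<open>Half of the gap between the levels \<open>n\<close> and \<open>k\<close> separates the
  mode from the region left of \<open>cut m n\<close>. Half suffices, since a number that is at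
  least 1 grows by more than 1 when multiplied by 9/2.\<close>

lemma far_outside:
  assumes "1 \<le> m" "int n < \<bar>k\<bar>" "Re z \<le> cut m n"
  shows "wt m n k \<le> cmod (of_real (diag m k) - z)"
proof -
  define x where "x = \<bar>real_of_int k\<bar>"
  define N where "N = real n"
  have x: "N + 1 \<le> x" "0 \<le> N" using assms(2) unfolding x_def N_def by linarith+
  have "wt m n k = x ^ (2 * m - 1) * (1 + (x - N))"
    using x by (simp add: wt_def x_def[symmetric] N_def[symmetric] max_absorb2)
  also have "\<dots> \<le> x ^ (2 * m - 1) * (9 * (x - N) / 2)" using x by (intro mult_left_mono) auto
  also have "\<dots> = x ^ (2 * m - 1) * (9 * (x - N)) / 2" by simp
  also have "\<dots> \<le> (diag m k - diag m (int n)) / 2"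
    using diag_diff_lower[OF assms(1), of "int n" k] assms(2) unfolding x_def N_def
    by (intro divide_right_mono) auto
  also have "\<dots> \<le> diag m k - cut m n"
    using diag_mono[of "int n + 1" k m] assms(2) by (simp add: cut_def field_simps)
  also have "\<dots> \<le> Re (of_real (diag m k) - z)" using assms(3) by simp
  also have "\<dots> \<le> cmod (of_real (diag m k) - z)" by (rule complex_Re_le_cmod)
  finally show ?thesis .
qed

lemma far_inside:
  assumes "1 \<le> m" "\<bar>j\<bar> \<le> int n" "cut m n \<le> Re z"
  shows "wt m n j \<le> cmod (of_real (diag m j) - z)"
proof -
  define y where "y = \<bar>real_of_int j\<bar>"
  define N where "N = real n"
  have y: "y \<le> N" "0 \<le> y" using assms(2) unfolding y_def N_def by linarith+
  have "wt m n j = N ^ (2 * m - 1) * (1 + (N - y))"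
    using y by (simp add: wt_def y_def[symmetric] N_def[symmetric] max_absorb1)
  also have "\<dots> \<le> (N + 1) ^ (2 * m - 1) * (9 * (N + 1 - y) / 2)"
    using y by (intro mult_mono power_mono) auto
  also have "\<dots> = (N + 1) ^ (2 * m - 1) * (9 * (N + 1 - y)) / 2" by simp
  also have "\<dots> \<le> (diag m (int n + 1) - diag m j) / 2"
    using diag_diff_lower[OF assms(1), of j "int n + 1"] assms(2) unfolding y_def N_def
    by (intro divide_right_mono) auto
  also have "\<dots> \<le> cut m n - diag m j"
    using diag_mono[of j "int n" m] assms(2) by (simp add: cut_def field_simps)
  also have "\<dots> \<le> - Re (of_real (diag m j) - z)" using assms(3) by simp
  also have "\<dots> \<le> cmod (of_real (diag m j) - z)" using abs_Re_le_cmod[of "of_real (diag m j) - z"] by linarith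
  finally show ?thesis .
qed

text \<open>Together with \<open>wt_upper\<close> this makes finite energy the same as lying in the
  weighted space of order \<open>m\<close> or contained in it by higher order, for each fixed
  \<open>n\<close>. Constants depending on \<open>n\<close> are harmless here, because the
  comparison only serves to place vectors in domains.\<close>

lemma wt_lower:
  assumes "1 \<le> m" "1 \<le> n"
  shows "br k ^ (2 * m) \<le> 2 ^ (2 * m) * (1 + real n) * wt m n k"
proof -
  define x where "x = \<bar>real_of_int k\<bar>"
  have x: "0 \<le> x" "br k = 1 + x" by (auto simp: x_def br_def)
  have "br k ^ (2 * m) = (1 + x) ^ (2 * m - 1) * (1 + x)"
    using assms(1) x by (cases m) (auto simp: mult.commute)
  also have "\<dots> \<le> (2 * max (real n) x) ^ (2 * m - 1) * ((1 + real n) * (1 + \<bar>x - real n\<bar>))"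
  proof (intro mult_mono power_mono)
    show "1 + x \<le> 2 * max (real n) x" using assms(2) x by (auto simp: max_def)
    have "1 + x \<le> 1 + real n + \<bar>x - real n\<bar>" by linarith
    also have "\<dots> \<le> (1 + real n) * (1 + \<bar>x - real n\<bar>)" by (simp add: algebra_simps)
    finally show "1 + x \<le> (1 + real n) * (1 + \<bar>x - real n\<bar>)" .
  qed (use x in auto)
  also have "\<dots> = 2 ^ (2 * m - 1) * (1 + real n) * wt m n k"
    by (simp add: wt_def x_def power_mult_distrib mult_ac)
  also have "\<dots> \<le> 2 ^ (2 * m) * (1 + real n) * wt m n k"
    using wt_pos[OF assms(2), of m k] by (intro mult_right_mono power_increasing) auto
  finally show ?thesis .
qed

lemma wt_upper:
  assumes "1 \<le> m" "1 \<le> n"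
  shows "wt m n k \<le> (1 + real n) ^ (2 * m) * br k ^ (2 * m)"
proof -
  define x where "x = \<bar>real_of_int k\<bar>"
  have x: "0 \<le> x" "br k = 1 + x" by (auto simp: x_def br_def)
  have "wt m n k = max (real n) x ^ (2 * m - 1) * (1 + \<bar>x - real n\<bar>)" by (simp add: wt_def x_def)
  also have "\<dots> \<le> ((1 + real n) * (1 + x)) ^ (2 * m - 1) * ((1 + real n) * (1 + x))"
    using x by (intro mult_mono power_mono) (auto simp: max_def algebra_simps abs_if)
  also have "\<dots> = ((1 + real n) * (1 + x)) ^ (2 * m)" using assms(1) by (cases m) (auto simp: mult.commute)
  finally show ?thesis by (simp add: x power_mult_distrib)
qed

text \<open>The maximum of \<open>n\<close> and the modulus of \<open>k\<close> is at least
  \<open>n\<close> and at least half of \<open>r\<close>. Distributing its exponent over the two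
  gives a family of bounds: a larger \<open>s\<close> buys decay away from the modes n and - n at
  the price of powers of \<open>n\<close>.\<close>

lemma inverse_sqrt_wt:
  fixes k :: int
  assumes "1 \<le> m" "1 \<le> n" "0 \<le> s" "s \<le> 2 * real m - 1"
  defines "r \<equiv> 1 + \<bar>\<bar>real_of_int k\<bar> - real n\<bar>"
  shows "1 / sqrt (wt m n k) \<le> 2 powr (s / 2) * real n powr (- ((2 * real m - 1 - s) / 2)) * r powr (- ((1 + s) / 2))"
proof -
  define M where "M = max (real n) \<bar>real_of_int k\<bar>"
  have n1: "1 \<le> real n" using assms(2) by simp
  have r: "1 \<le> r" by (simp add: r_def)
  have M: "real n \<le> M" "0 < M" using n1 by (simp_all add: M_def less_max_iff_disj)
  have M2: "r / 2 \<le> M"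
    unfolding M_def r_def by (cases "\<bar>real_of_int k\<bar> \<le> real n") (use n1 in \<open>simp_all add: max_absorb1 max_absorb2\<close>)
  have e: "real (2 * m - 1) = 2 * real m - 1" using assms(1) by simp
  have "wt m n k = M powr (2 * real m - 1) * r"
    unfolding wt_def M_def[symmetric] r_def[symmetric] e[symmetric] powr_realpow[OF M(2)] ..
  moreover have "M powr (2 * real m - 1) = M powr (2 * real m - 1 - s) * M powr s"
    unfolding powr_add[symmetric] by simp
  moreover have "real n powr (2 * real m - 1 - s) * (r / 2) powr s * r
      \<le> M powr (2 * real m - 1 - s) * M powr s * r"
    by (intro mult_right_mono mult_mono powr_mono2) (use M M2 r assms(3,4) n1 in auto)
  moreover have "(r / 2) powr s * r = r powr (1 + s) / 2 powr s"
    using r by (simp add: powr_divide powr_add)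
  ultimately have le: "real n powr (2 * real m - 1 - s) * (r powr (1 + s) / 2 powr s) \<le> wt m n k"
    by (simp only: mult.assoc)
  have pos: "0 < real n powr (2 * real m - 1 - s) * (r powr (1 + s) / 2 powr s)"
    using assms(2) r by simp
  have "1 / sqrt (wt m n k) = wt m n k powr (- (1 / 2))"
    unfolding powr_minus_divide using powr_half_sqrt[of "wt m n k"] wt_pos[OF assms(2), of m k] by simp
  also have "\<dots> \<le> (real n powr (2 * real m - 1 - s) * (r powr (1 + s) / 2 powr s)) powr (- (1 / 2))"
    using le pos by (intro powr_mono2') auto
  also have "\<dots> = real n powr ((2 * real m - 1 - s) * (- (1 / 2))) *
      (r powr ((1 + s) * (- (1 / 2))) / 2 powr (s * (- (1 / 2))))"
    using r by (simp only: powr_mult powr_divide powr_powr powr_ge_zero zero_le_divide_iff divide_nonneg_nonneg)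
  also have "2 powr (s * (- (1 / 2))) = 1 / (2 powr (s / 2) :: real)"
    by (simp add: powr_minus_divide)
  also have "real n powr ((2 * real m - 1 - s) * (- (1 / 2))) = real n powr (- ((2 * real m - 1 - s) / 2))"
    by (rule arg_cong) (simp add: field_simps)
  also have "r powr ((1 + s) * (- (1 / 2))) = r powr (- ((1 + s) / 2))"
    by (rule arg_cong) (simp add: field_simps)
  finally show ?thesis by (simp add: mult_ac)
qed

text \<open>For indices of equal sign, the difference is controlled by the distances
  \<open>r\<close> of their moduli from \<open>n\<close>, and the weights absorb the growth of order
  \<theta>. For opposite signs the difference is about 2 n even if both moduli are close to
  \<open>n\<close>; this growth is booked as a power of \<open>n\<close>, and a product of two
  decaying factors is kept.\<close>

lemma coupling_pointwise:
  fixes k j :: int and n :: nat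
  assumes "1 \<le> m" "1 \<le> n" "0 \<le> \<theta>" "0 < \<eta>" "\<eta> \<le> 1" "0 \<le> u" "2 * \<theta> - 1 + \<eta> \<le> u" "u \<le> 2 * real m - 1"
  defines "g \<equiv> \<lambda>k. br k powr (- ((1 + \<eta>) / 2))"
  shows "br (k - j) powr \<theta> * (1 / sqrt (wt m n k)) * (1 / sqrt (wt m n j))
    \<le> 2 * 4 powr \<theta> * 4 powr real m *
      (real n powr (1 - 2 * real m + u / 2) * (g (k - int n) + g (k + int n) + (g (j - int n) + g (j + int n)))
       + real n powr (\<theta> + 1 - 2 * real m + \<eta>) * (g (k - int n) * g (j + int n) + g (k + int n) * g (j - int n)))"
proof -
  define r where "r k = 1 + \<bar>\<bar>real_of_int k\<bar> - real n\<bar>" for k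
  define \<rho> where "\<rho> = (1 + \<eta>) / 2"
  define b where "b k = 1 / sqrt (wt m n k)" for k
  define opp where "opp = (if (0 \<le> k) = (0 \<le> j) then 0 else 1 :: real)"
  have r1: "1 \<le> r k" for k by (simp add: r_def)
  have m1: "1 \<le> real m" using assms(1) by simp
  have \<eta>: "\<eta> \<le> 2 * real m - 1" "\<theta> - (1 + u) / 2 \<le> - (\<eta> / 2)"
    using m1 assms(5,7) by (auto simp: field_simps)
  have b0: "0 \<le> b k" for k using wt_pos[OF assms(2), of m k] by (simp add: b_def)
  have g: "r k powr (- \<rho>) \<le> g (k - int n) + g (k + int n)" for k
  proof -
    show ?thesis
    proof (cases "0 \<le> k")
      case True
      then have "r k = br (k - int n)" by (simp add: r_def br_def)
      then show ?thesis by (simp add: g_def \<rho>_def)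
    next
      case False
      then have "r k = br (k + int n)" by (simp add: r_def br_def abs_minus_commute)
      then show ?thesis by (simp add: g_def \<rho>_def)
    qed
  qed
  have bound: "b k \<le> 2 powr (s / 2) * real n powr (- ((2 * real m - 1 - s) / 2)) * r k powr (- ((1 + s) / 2))"
    if "0 \<le> s" "s \<le> 2 * real m - 1" for s k
    unfolding b_def r_def using inverse_sqrt_wt[OF assms(1,2) that] .
  have two: "2 powr (u / 2) \<le> 4 powr real m" "2 powr \<eta> \<le> 4 powr real m"
  proof -
    have four: "(4::real) powr real m = 2 powr (2 * real m)"
      by (simp add: powr_powr[symmetric])
    show "2 powr (u / 2) \<le> 4 powr real m" "2 powr \<eta> \<le> 4 powr real m"
      unfolding four using assms(1,5,8) by (auto intro!: powr_mono)
  qed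
  \<comment> \<open>The extra exponent \<open>u\<close> is spent on the index that carries the
    growth, none on the other. The total decay left is \<open>\<rho>\<close>, just above 1/2, at the
    index whose modulus is closer to \<open>n\<close>.\<close>
  have A: "r k powr \<theta> * (b k * b j) \<le> 4 powr real m * (real n powr (1 - 2 * real m + u / 2) * (r k powr (- \<rho>) + r j powr (- \<rho>)))" for k j
  proof -
    have "b k * b j \<le> (2 powr (u / 2) * real n powr (- ((2 * real m - 1 - u) / 2)) * r k powr (- ((1 + u) / 2)))
        * (2 powr (0 / 2) * real n powr (- ((2 * real m - 1 - 0) / 2)) * r j powr (- ((1 + 0) / 2)))"
      using assms by (intro mult_mono bound b0) auto
    also have "\<dots> = 2 powr (u / 2) * real n powr (1 - 2 * real m + u / 2) * (r k powr (- ((1 + u) / 2)) * r j powr (- (1 / 2)))"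
    proof -
      have "real n powr (- ((2 * real m - 1 - u) / 2)) * real n powr (- ((2 * real m - 1 - 0) / 2))
        = real n powr (1 - 2 * real m + u / 2)"
        unfolding powr_add[symmetric] by (rule arg_cong) (simp add: field_simps)
      then show ?thesis by (simp add: mult_ac)
    qed
    finally have "r k powr \<theta> * (b k * b j) \<le> r k powr \<theta> *
        (2 powr (u / 2) * real n powr (1 - 2 * real m + u / 2) * (r k powr (- ((1 + u) / 2)) * r j powr (- (1 / 2))))"
      by (intro mult_left_mono) auto
    also have "\<dots> = 2 powr (u / 2) * (real n powr (1 - 2 * real m + u / 2) * (r k powr (\<theta> - (1 + u) / 2) * r j powr (- (1 / 2))))"
    proof -
      have e: "\<theta> - (1 + u) / 2 = \<theta> + - ((1 + u) / 2)" by simp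
      show ?thesis unfolding e powr_add by (simp only: mult_ac)
    qed
    also have "\<dots> \<le> 4 powr real m * (real n powr (1 - 2 * real m + u / 2) * (r k powr (- \<rho>) + r j powr (- \<rho>)))"
    proof (intro mult_mono mult_left_mono two)
      have "r k powr (\<theta> - (1 + u) / 2) \<le> r k powr (- (\<eta> / 2))"
        by (intro powr_mono \<eta> r1)
      then have "r k powr (\<theta> - (1 + u) / 2) * r j powr (- (1 / 2)) \<le> r k powr (- (\<eta> / 2)) * r j powr (- (1 / 2))"
        by (intro mult_right_mono) auto
      also have "\<dots> \<le> r k powr (- \<rho>) + r j powr (- \<rho>)"
      proof (cases "r k \<le> r j")
        case True
        have "r k powr (- (\<eta> / 2)) * r j powr (- (1 / 2)) \<le> r k powr (- (\<eta> / 2)) * r k powr (- (1 / 2))"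
          using True r1[of k] by (intro mult_left_mono powr_mono2') auto
        also have "\<dots> = r k powr (- \<rho>)" unfolding powr_add[symmetric] by (rule arg_cong) (simp add: \<rho>_def field_simps)
        finally show ?thesis using powr_ge_zero[of "r j" "- \<rho>"] by linarith
      next
        case False
        have "r k powr (- (\<eta> / 2)) * r j powr (- (1 / 2)) \<le> r j powr (- (\<eta> / 2)) * r j powr (- (1 / 2))"
          using False r1[of j] assms by (intro mult_right_mono powr_mono2') auto
        also have "\<dots> = r j powr (- \<rho>)" unfolding powr_add[symmetric] by (rule arg_cong) (simp add: \<rho>_def field_simps)
        finally show ?thesis using powr_ge_zero[of "r k" "- \<rho>"] by linarith
      qed
      finally show "r k powr (\<theta> - (1 + u) / 2) * r j powr (- (1 / 2)) \<le> r k powr (- \<rho>) + r j powr (- \<rho>)" .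
    qed auto
    finally show ?thesis .
  qed
  \<comment> \<open>Both indices receive the same small exponent \<open>\<eta>\<close>, since the
    growth is already a power of \<open>n\<close>.\<close>
  have B: "opp * (real n powr \<theta> * (b k * b j)) \<le> 4 powr real m * (real n powr (\<theta> + 1 - 2 * real m + \<eta>)
      * (g (k - int n) * g (j + int n) + g (k + int n) * g (j - int n)))"
  proof (cases "opp = 0")
    case True
    then show ?thesis by (auto simp: g_def)
  next
    case False
    then have opp: "opp = 1" "(0 \<le> k) \<noteq> (0 \<le> j)" by (auto simp: opp_def split: if_splits)
    have "b k * b j \<le> (2 powr (\<eta> / 2) * real n powr (- ((2 * real m - 1 - \<eta>) / 2)) * r k powr (- ((1 + \<eta>) / 2)))
        * (2 powr (\<eta> / 2) * real n powr (- ((2 * real m - 1 - \<eta>) / 2)) * r j powr (- ((1 + \<eta>) / 2)))"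
      using assms(4) by (intro mult_mono bound b0 \<eta>) auto
    also have "\<dots> = 2 powr \<eta> * real n powr (1 - 2 * real m + \<eta>) * (r k powr (- \<rho>) * r j powr (- \<rho>))"
    proof -
      have "real n powr (- ((2 * real m - 1 - \<eta>) / 2)) * real n powr (- ((2 * real m - 1 - \<eta>) / 2))
        = real n powr (1 - 2 * real m + \<eta>)"
        unfolding powr_add[symmetric] by (rule arg_cong) (simp add: field_simps)
      moreover have "(2::real) powr (\<eta> / 2) * 2 powr (\<eta> / 2) = 2 powr \<eta>"
        unfolding powr_add[symmetric] by (rule arg_cong) simp
      moreover have comm: "(p * x * y) * (p * x * y') = (p * p) * (x * x) * (y * y')" for p x y y' :: real
        by (simp add: mult_ac)
      ultimately show ?thesis unfolding \<rho>_def comm by simp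
    qed
    also have "r k powr (- \<rho>) * r j powr (- \<rho>) \<le> g (k - int n) * g (j + int n) + g (k + int n) * g (j - int n)"
    proof (cases "0 \<le> k")
      case True
      then have "0 \<le> k" "j < 0" using opp by auto
      then have "r k = br (k - int n)" "r j = br (j + int n)" by (simp_all add: r_def br_def abs_minus_commute)
      then show ?thesis by (simp add: g_def \<rho>_def)
    next
      case False
      then have "k < 0" "0 \<le> j" using opp by auto
      then have "r k = br (k + int n)" "r j = br (j - int n)" by (simp_all add: r_def br_def abs_minus_commute)
      then show ?thesis by (simp add: g_def \<rho>_def)
    qed
    finally have "b k * b j \<le> 2 powr \<eta> * real n powr (1 - 2 * real m + \<eta>)
       * (g (k - int n) * g (j + int n) + g (k + int n) * g (j - int n))"
      by (simp add: mult_left_mono)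
    then have "real n powr \<theta> * (b k * b j) \<le> real n powr \<theta> * (2 powr \<eta> * real n powr (1 - 2 * real m + \<eta>)
       * (g (k - int n) * g (j + int n) + g (k + int n) * g (j - int n)))"
      by (intro mult_left_mono) auto
    also have "\<dots> = 2 powr \<eta> * (real n powr (\<theta> + 1 - 2 * real m + \<eta>)
       * (g (k - int n) * g (j + int n) + g (k + int n) * g (j - int n)))"
    proof -
      have "real n powr \<theta> * real n powr (1 - 2 * real m + \<eta>) = real n powr (\<theta> + 1 - 2 * real m + \<eta>)"
        unfolding powr_add[symmetric] by (rule arg_cong) simp
      moreover have "x * (p * y * q) = p * ((x * y) * q)" for p q x y :: real
        by (simp add: mult_ac)
      ultimately show ?thesis by simp
    qed
    also have "\<dots> \<le> 4 powr real m * (real n powr (\<theta> + 1 - 2 * real m + \<eta>)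
       * (g (k - int n) * g (j + int n) + g (k + int n) * g (j - int n)))"
      by (intro mult_right_mono two) (auto simp: g_def)
    finally show ?thesis by (simp add: opp)
  qed
  \<comment> \<open>The factor 4 counts the quantities in the sum
    \<open>2 * (opp * real n) + r k + r j\<close>.\<close>
  have "br (k - j) \<le> 4 * max (max (r k) (r j)) (opp * real n)"
  proof -
    have "r k \<le> max (max (r k) (r j)) (opp * real n)" "r j \<le> max (max (r k) (r j)) (opp * real n)"
      "opp * real n \<le> max (max (r k) (r j)) (opp * real n)" by simp_all
    moreover have "br (k - j) \<le> 2 * (opp * real n) + r k + r j"
    proof (cases "(0 \<le> k) = (0 \<le> j)")
      case True
      have "br (k - j) = 1 + \<bar>\<bar>real_of_int k\<bar> - \<bar>real_of_int j\<bar>\<bar>"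
        using True by (cases "0 \<le> k") (simp_all add: br_def abs_minus_commute)
      moreover have "\<bar>\<bar>real_of_int k\<bar> - \<bar>real_of_int j\<bar>\<bar> \<le> \<bar>\<bar>real_of_int k\<bar> - real n\<bar> + \<bar>\<bar>real_of_int j\<bar> - real n\<bar>"
        by linarith
      ultimately show ?thesis using True by (simp add: opp_def r_def)
    next
      case False
      have "br (k - j) \<le> 1 + \<bar>real_of_int k\<bar> + \<bar>real_of_int j\<bar>" by (simp add: br_def)
      moreover have "\<bar>real_of_int k\<bar> \<le> real n + (r k - 1)" "\<bar>real_of_int j\<bar> \<le> real n + (r j - 1)"
        unfolding r_def by linarith+
      ultimately show ?thesis using False by (simp add: opp_def)
    qed
    ultimately show ?thesis by linarith
  qed
  then have "br (k - j) powr \<theta> \<le> (4 * max (max (r k) (r j)) (opp * real n)) powr \<theta>"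
    using assms(3) by (intro powr_mono2) auto
  also have "\<dots> = 4 powr \<theta> * max (max (r k) (r j)) (opp * real n) powr \<theta>"
    using r1[of k] by (intro powr_mult)
  also have "max (max (r k) (r j)) (opp * real n) powr \<theta> \<le> r k powr \<theta> + r j powr \<theta> + opp * real n powr \<theta>"
  proof -
    have "max (max (r k) (r j)) (opp * real n) = r k \<or> max (max (r k) (r j)) (opp * real n) = r j
       \<or> opp = 1 \<and> max (max (r k) (r j)) (opp * real n) = real n"
      using r1[of k] by (cases "(0 \<le> k) = (0 \<le> j)") (auto simp: opp_def max_def)
    moreover have "0 \<le> r k powr \<theta>" "0 \<le> r j powr \<theta>" "0 \<le> opp * real n powr \<theta>" by (auto simp: opp_def)
    ultimately show ?thesis by (elim disjE conjE) simp_all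
  qed
  finally have "br (k - j) powr \<theta> \<le> 4 powr \<theta> * (r k powr \<theta> + r j powr \<theta> + opp * real n powr \<theta>)" by simp
  then have "br (k - j) powr \<theta> * (b k * b j) \<le> 4 powr \<theta> * (r k powr \<theta> + r j powr \<theta> + opp * real n powr \<theta>) * (b k * b j)"
    by (intro mult_right_mono mult_nonneg_nonneg b0)
  also have "\<dots> = 4 powr \<theta> * (r k powr \<theta> * (b k * b j) + r j powr \<theta> * (b j * b k) + opp * (real n powr \<theta> * (b k * b j)))"
    by (simp only: distrib_left distrib_right mult.assoc mult.commute[of "b j"])
  also have "\<dots> \<le> 4 powr \<theta> * (4 powr real m * (real n powr (1 - 2 * real m + u / 2) * (r k powr (- \<rho>) + r j powr (- \<rho>)))
     + 4 powr real m * (real n powr (1 - 2 * real m + u / 2) * (r j powr (- \<rho>) + r k powr (- \<rho>)))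
     + 4 powr real m * (real n powr (\<theta> + 1 - 2 * real m + \<eta>)
      * (g (k - int n) * g (j + int n) + g (k + int n) * g (j - int n))))"
    by (intro mult_left_mono add_mono A B) auto
  also have "\<dots> = 4 powr \<theta> * 4 powr real m * (2 * (real n powr (1 - 2 * real m + u / 2) * (r k powr (- \<rho>) + r j powr (- \<rho>)))
      + real n powr (\<theta> + 1 - 2 * real m + \<eta>) * (g (k - int n) * g (j + int n) + g (k + int n) * g (j - int n)))"
    by (simp add: algebra_simps)
  also have "\<dots> \<le> 4 powr \<theta> * 4 powr real m * (2 * (real n powr (1 - 2 * real m + u / 2)
        * ((g (k - int n) + g (k + int n)) + (g (j - int n) + g (j + int n))))
      + 2 * (real n powr (\<theta> + 1 - 2 * real m + \<eta>) * (g (k - int n) * g (j + int n) + g (k + int n) * g (j - int n))))"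
  proof (intro mult_left_mono add_mono g)
    have "0 \<le> real n powr (\<theta> + 1 - 2 * real m + \<eta>) * (g (k - int n) * g (j + int n) + g (k + int n) * g (j - int n))"
      by (auto simp: g_def)
    then show "real n powr (\<theta> + 1 - 2 * real m + \<eta>) * (g (k - int n) * g (j + int n) + g (k + int n) * g (j - int n))
      \<le> 2 * (real n powr (\<theta> + 1 - 2 * real m + \<eta>) * (g (k - int n) * g (j + int n) + g (k + int n) * g (j - int n)))"
      by linarith
  qed auto
  finally show ?thesis by (simp add: b_def distrib_left mult_ac)
qed

text \<open>The summand with \<open>\<tau>\<close> accounts for the coefficients \<open>v l\<close> with \<open>l\<close> close to \<open>\<plusminus> 2 n\<close>, which couple
  modes near \<open>n\<close> with modes near \<open>- n\<close>.\<close>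

lemma coupling_bound:
  assumes "1 \<le> m" "0 \<le> \<theta>" "0 < \<eta>" "\<eta> \<le> 1" "0 \<le> u" "2 * \<theta> - 1 + \<eta> \<le> u" "u \<le> 2 * real m - 1"
  obtains C where "0 < C"
    "\<And>(v :: int \<Rightarrow> complex) R. l2_le (\<lambda>k. of_real (br k powr (- \<theta>)) * v k) R \<Longrightarrow>
      \<exists>\<tau>. (\<forall>n. 0 \<le> \<tau> n) \<and> l2_le \<tau> (C * R) \<and>
        (\<forall>n\<ge>1. l2_le (\<lambda>(k, j). v (k - j) / of_real (sqrt (wt m n k * wt m n j)))
          (C * (R * real n powr (1 - 2 * real m + u / 2) + real n powr (\<theta> + 1 - 2 * real m + \<eta>) * \<tau> n)))"
proof -
  define g where "g k = br k powr (- ((1 + \<eta>) / 2))" for k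
  obtain Z where Z: "l2_le g Z" using l2_le_br[of "(1 + \<eta>) / 2"] assms(3) unfolding g_def by auto
  have Z0: "0 \<le> Z" using Z by (rule l2_le_nonneg)
  define C\<^sub>0 where "C\<^sub>0 = 2 * 4 powr \<theta> * 4 powr real m"
  have C0: "0 < C\<^sub>0" by (simp add: C\<^sub>0_def)
  \<comment> \<open>\<open>C\<close> dominates at once the four row and column terms, the factor in
    front of \<open>\<tau>\<close> and the norm of \<open>\<tau>\<close>.\<close>
  define C where "C = C\<^sub>0 * (4 * Z + 1) + 2 * (Z * Z)"
  have "0 < C\<^sub>0 * (4 * Z + 1)" using C0 Z0 by simp
  then have C: "0 < C" unfolding C_def using Z0 by (intro add_pos_nonneg) auto
  have "\<exists>\<tau>. (\<forall>n. 0 \<le> \<tau> n) \<and> l2_le \<tau> (C * R) \<and>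
        (\<forall>n\<ge>1. l2_le (\<lambda>(k, j). v (k - j) / of_real (sqrt (wt m n k * wt m n j)))
          (C * (R * real n powr (1 - 2 * real m + u / 2) + real n powr (\<theta> + 1 - 2 * real m + \<eta>) * \<tau> n)))"
    if v: "l2_le (\<lambda>k. of_real (br k powr (- \<theta>)) * v k) R" for v :: "int \<Rightarrow> complex" and R
  proof -
    define A where "A k = br k powr (- \<theta>) * cmod (v k)" for k
    have A: "l2_le A R"
      by (rule l2_le_mono[OF v]) (simp_all add: A_def norm_mult)
    have R0: "0 \<le> R" using v by (rule l2_le_nonneg)
    have A0: "0 \<le> A k" and g0: "0 \<le> g k" for k by (simp_all add: A_def g_def)
    \<comment> \<open>The map from (n, p, q) to (c n + p - q, p, q) is injective, so this family is
      square summable jointly in all three indices. Its sections over \<open>n\<close> give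
      \<open>\<tau>\<close>.\<close>
    have triple: "l2_le (\<lambda>(n::nat, p, q). A (c * int n + p - q) * (g p * g q)) (R * (Z * Z))" if "c \<noteq> 0" for c
    proof -
      have "inj (\<lambda>(n::nat, p, q). (c * int n + p - q, p, q))" using that by (auto simp: inj_def)
      from l2_le_comp[OF l2_le_tensor[OF A l2_le_tensor[OF Z Z]] this]
      show ?thesis by (simp add: case_prod_unfold)
    qed
    obtain \<tau>\<^sub>1 where \<tau>1: "\<And>n. 0 \<le> \<tau>\<^sub>1 n" "l2_le \<tau>\<^sub>1 (R * (Z * Z))"
      "\<And>n. l2_le (\<lambda>(p, q). A (2 * int n + p - q) * (g p * g q)) (\<tau>\<^sub>1 n)"
      by (rule l2_le_sections[OF triple[of 2]]) auto
    obtain \<tau>\<^sub>2 where \<tau>2: "\<And>n. 0 \<le> \<tau>\<^sub>2 n" "l2_le \<tau>\<^sub>2 (R * (Z * Z))"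
      "\<And>n. l2_le (\<lambda>(p, q). A (- 2 * int n + p - q) * (g p * g q)) (\<tau>\<^sub>2 n)"
      by (rule l2_le_sections[OF triple[of "- 2"]]) auto
    define \<tau> where "\<tau> n = \<tau>\<^sub>1 n + \<tau>\<^sub>2 n" for n
    have \<tau>: "l2_le \<tau> (C * R)" unfolding \<tau>_def
    proof (rule l2_le_mono[OF l2_le_add[OF \<tau>1(2) \<tau>2(2)]])
      show "R * (Z * Z) + R * (Z * Z) \<le> C * R"
        using mult_right_mono[of "2 * (Z * Z)" C R] R0 Z0 C0 by (simp add: C_def algebra_simps)
    qed simp
    have K: "l2_le (\<lambda>(k, j). v (k - j) / of_real (sqrt (wt m n k * wt m n j)))
          (C * (R * real n powr (1 - 2 * real m + u / 2) + real n powr (\<theta> + 1 - 2 * real m + \<eta>) * \<tau> n))"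
      if n: "1 \<le> n" for n
    proof -
      define x where "x = real n powr (1 - 2 * real m + u / 2)"
      define y where "y = real n powr (\<theta> + 1 - 2 * real m + \<eta>)"
      have xy: "0 \<le> x" "0 \<le> y" by (simp_all add: x_def y_def)
      \<comment> \<open>As \<open>A\<close> depends on k - j only, the variables (k - j, k + c) turn
        the family into a tensor product.\<close>
      have row: "l2_le (\<lambda>(k, j). A (k - j) * g (k + c)) (R * Z)" for c
      proof -
        have "inj (\<lambda>(k, j). (k - j :: int, k + c))" by (auto simp: inj_def)
        from l2_le_comp[OF l2_le_tensor[OF A Z] this] show ?thesis by (simp add: case_prod_unfold)
      qed
      have col: "l2_le (\<lambda>(k, j). A (k - j) * g (j + c)) (R * Z)" for c
      proof -
        have "inj (\<lambda>(k, j). (k - j :: int, j + c))" by (auto simp: inj_def)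
        from l2_le_comp[OF l2_le_tensor[OF A Z] this] show ?thesis by (simp add: case_prod_unfold)
      qed
      have o1: "l2_le (\<lambda>(k, j). A (k - j) * (g (k - int n) * g (j + int n))) (\<tau>\<^sub>1 n)"
      proof -
        have "inj (\<lambda>(k, j). (k - int n, j + int n))" by (auto simp: inj_def)
        moreover have "2 * int n + (k - int n) - (j + int n) = k - j" for k j by simp
        ultimately show ?thesis using l2_le_comp[OF \<tau>1(3)[of n]] by (fastforce simp: case_prod_unfold)
      qed
      have o2: "l2_le (\<lambda>(k, j). A (k - j) * (g (k + int n) * g (j - int n))) (\<tau>\<^sub>2 n)"
      proof -
        have "inj (\<lambda>(k, j). (k + int n, j - int n))" by (auto simp: inj_def)
        moreover have "- 2 * int n + (k + int n) - (j - int n) = k - j" for k j by simp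
        ultimately show ?thesis using l2_le_comp[OF \<tau>2(3)[of n]] by (fastforce simp: case_prod_unfold)
      qed
      define F where "F p = (case p of (k, j) \<Rightarrow> A (k - j) * g (k + - int n)) + (case p of (k, j) \<Rightarrow> A (k - j) * g (k + int n))
        + ((case p of (k, j) \<Rightarrow> A (k - j) * g (j + - int n)) + (case p of (k, j) \<Rightarrow> A (k - j) * g (j + int n)))" for p
      define G where "G p = (case p of (k, j) \<Rightarrow> A (k - j) * (g (k - int n) * g (j + int n)))
        + (case p of (k, j) \<Rightarrow> A (k - j) * (g (k + int n) * g (j - int n)))" for p
      have F: "l2_le F (R * Z + R * Z + (R * Z + R * Z))"
        unfolding F_def by (intro l2_le_add row col)
      have G: "l2_le G (\<tau> n)" unfolding G_def \<tau>_def by (intro l2_le_add o1 o2)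
      have "l2_le (\<lambda>p. C\<^sub>0 * (x * F p + y * G p)) (norm C\<^sub>0 * (norm x * (R * Z + R * Z + (R * Z + R * Z)) + norm y * \<tau> n))"
        by (intro l2_le_cmult l2_le_add F G)
      then show ?thesis
      proof (rule l2_le_mono)
        fix p :: "int \<times> int"
        obtain k j where p: "p = (k, j)" by force
        have "norm (v (k - j) / of_real (sqrt (wt m n k * wt m n j)))
            = A (k - j) * (br (k - j) powr \<theta> * (1 / sqrt (wt m n k)) * (1 / sqrt (wt m n j)))"
          using wt_pos[OF n, of m k] wt_pos[OF n, of m j]
          by (simp add: norm_divide norm_mult real_sqrt_mult A_def powr_minus abs_of_pos)
        also have "\<dots> \<le> A (k - j) * (C\<^sub>0 * (x * (g (k - int n) + g (k + int n) + (g (j - int n) + g (j + int n)))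
           + y * (g (k - int n) * g (j + int n) + g (k + int n) * g (j - int n))))"
          unfolding C\<^sub>0_def x_def y_def g_def
          by (intro mult_left_mono A0 coupling_pointwise assms n)
        also have "\<dots> = C\<^sub>0 * (x * F p + y * G p)"
          unfolding F_def G_def p by (simp add: algebra_simps)
        also have "\<dots> \<le> norm (C\<^sub>0 * (x * F p + y * G p))" by simp
        finally show "norm (case p of (k, j) \<Rightarrow> v (k - j) / of_real (sqrt (wt m n k * wt m n j)))
            \<le> norm (C\<^sub>0 * (x * F p + y * G p))" by (simp add: p)
        have "C\<^sub>0 * (x * (R * Z + R * Z + (R * Z + R * Z)) + y * \<tau> n) = (C\<^sub>0 * (4 * Z)) * (R * x) + C\<^sub>0 * (y * \<tau> n)"
          by (simp add: algebra_simps)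
        also have "\<dots> \<le> C * (R * x) + C * (y * \<tau> n)"
          using C0 Z0 R0 xy \<tau>1(1)[of n] \<tau>2(1)[of n]
          by (intro add_mono mult_right_mono) (auto simp: C_def \<tau>_def algebra_simps intro!: mult_nonneg_nonneg)
        finally show "norm C\<^sub>0 * (norm x * (R * Z + R * Z + (R * Z + R * Z)) + norm y * \<tau> n)
            \<le> C * (R * real n powr (1 - 2 * real m + u / 2) + real n powr (\<theta> + 1 - 2 * real m + \<eta>) * \<tau> n)"
          using C0 xy by (simp add: distrib_left flip: x_def y_def)
      qed
    qed
    have "0 \<le> \<tau> n" for n using \<tau>1(1) \<tau>2(1) by (simp add: \<tau>_def)
    with \<tau> K show ?thesis by blast
  qed
  with C that show thesis by blast
qed

section \<open>Second order terms\<close>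

lemma power_add_superadditive:
  fixes a b :: real
  assumes "0 \<le> a" "0 \<le> b" "1 \<le> m"
  shows "a ^ m + b ^ m \<le> (a + b) ^ m"
  using assms(3)
proof (induction m rule: dec_induct)
  case (step m)
  have "a ^ Suc m + b ^ Suc m \<le> (a + b) * (a ^ m + b ^ m)"
    using assms by (simp add: algebra_simps)
  also have "\<dots> \<le> (a + b) * (a + b) ^ m" using assms step by (intro mult_left_mono) auto
  finally show ?case by simp
qed simp

text \<open>For squares x = k^2 and y = l^2 with y at most x, the difference of their powers of
  order m is at least (x - y)^m, and x - y is (k - l)(k + l). For k = n these factors are, up to
  sign, the arguments of the two coefficients in the off-diagonal sum.\<close>

lemma diag_diff_factors:
  assumes "1 \<le> m"
  shows "\<bar>of_int (k - l)\<bar> ^ m * \<bar>of_int (k + l)\<bar> ^ m \<le> \<bar>diag m k - diag m l\<bar>"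
proof -
  have *: "\<bar>of_int (k - l)\<bar> ^ m * \<bar>of_int (k + l)\<bar> ^ m \<le> diag m k - diag m l" if "\<bar>l\<bar> \<le> \<bar>k\<bar>" for k l :: int
  proof -
    define x where "x = (real_of_int k)\<^sup>2"
    define y where "y = (real_of_int l)\<^sup>2"
    have "\<bar>real_of_int l\<bar> \<le> \<bar>real_of_int k\<bar>" using that by linarith
    then have xy: "0 \<le> y" "y \<le> x" by (auto simp: x_def y_def abs_le_square_iff)
    have "\<bar>real_of_int (k - l)\<bar> ^ m * \<bar>real_of_int (k + l)\<bar> ^ m = (x - y) ^ m"
      using xy by (simp add: power_mult_distrib[symmetric] abs_mult[symmetric] x_def y_def
          power2_eq_square algebra_simps)
    also have "\<dots> \<le> x ^ m - y ^ m"
      using power_add_superadditive[of "x - y" y m] xy assms by simp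
    also have "\<dots> \<le> pi ^ (2 * m) * (x ^ m - y ^ m)"
      using pi_power_ge_9[OF assms] xy power_mono[of y x m]
      by (simp add: mult_le_cancel_right1)
    also have "\<dots> = diag m k - diag m l"
      unfolding diag_def x_def y_def power_mult_distrib right_diff_distrib
      by (simp add: power_mult[symmetric] mult.commute)
    finally show ?thesis .
  qed
  show ?thesis
  proof (cases "\<bar>l\<bar> \<le> \<bar>k\<bar>")
    case True
    then show ?thesis using *[OF True] by linarith
  next
    case False
    then show ?thesis using *[of k l] by (simp add: abs_minus_commute add.commute)
  qed
qed

lemma br_le_twice: "p \<noteq> 0 \<Longrightarrow> br p \<le> 2 * \<bar>of_int p\<bar>"
proof -
  assume "p \<noteq> 0"
  then have "1 \<le> \<bar>p\<bar>" by linarith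
  then have "1 \<le> \<bar>real_of_int p\<bar>" by linarith
  then show ?thesis by (simp add: br_def)
qed

lemma inverse_power_le_br:
  assumes "p \<noteq> 0"
  shows "1 / \<bar>of_int p\<bar> ^ m \<le> 2 ^ m * br p powr (- real m)"
proof -
  have "0 < \<bar>real_of_int p\<bar>" using assms by simp
  moreover have "br p ^ m \<le> (2 * \<bar>real_of_int p\<bar>) ^ m" by (intro power_mono br_le_twice assms) simp
  ultimately show ?thesis
    by (simp add: powr_minus powr_realpow power_mult_distrib field_simps)
qed

text \<open>The larger of the two arguments is at least \<open>n\<close> and absorbs a power of
  \<open>n\<close>. The smaller one is either at most 4 n, and the remaining power of
  \<open>n\<close> is traded for a power of it, or it exceeds \<open>n\<close> as well.\<close>

lemma convolution_weight:
  fixes p q :: int and n :: nat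
  assumes "1 \<le> n" "p + q = 2 * int n" "0 < \<kappa>" "s \<le> \<kappa>"
  shows "real n powr s * (br p powr (- \<kappa>) * br q powr (- \<kappa>))
    \<le> 4 powr (\<kappa> - s) * (br p powr (s - 2 * \<kappa>) + br q powr (s - 2 * \<kappa>) + real n powr (s - 2 * \<kappa>))"
proof -
  have *: "real n powr s * (br p powr (- \<kappa>) * br q powr (- \<kappa>))
    \<le> 4 powr (\<kappa> - s) * (br q powr (s - 2 * \<kappa>) + real n powr (s - 2 * \<kappa>))"
    if "p + q = 2 * int n" "br q \<le> br p" for p q
  proof -
    have n: "0 < real n" using assms(1) by simp
    have pn: "real n \<le> br p" using that by (simp add: br_def)
    have c1: "1 \<le> 4 powr (\<kappa> - s)" using assms(4) by (intro ge_one_powr_ge_zero) auto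
    show ?thesis
    proof (cases "br q \<le> 4 * real n")
      case True
      have "real n powr s * (br p powr (- \<kappa>) * br q powr (- \<kappa>)) \<le> real n powr s * (real n powr (- \<kappa>) * br q powr (- \<kappa>))"
        using n pn assms(3) by (intro mult_left_mono mult_right_mono powr_mono2') auto
      also have "\<dots> = real n powr (s - \<kappa>) * br q powr (- \<kappa>)"
        by (simp add: powr_diff powr_minus field_simps)
      also have "real n powr (s - \<kappa>) \<le> (br q / 4) powr (s - \<kappa>)"
        using True assms(4) by (intro powr_mono2') auto
      also have "(br q / 4) powr (s - \<kappa>) * br q powr (- \<kappa>) = 4 powr (\<kappa> - s) * br q powr (s - 2 * \<kappa>)"
      proof -
        have e: "\<kappa> - s = - (s - \<kappa>)" "s - 2 * \<kappa> = (s - \<kappa>) + (- \<kappa>)" by simp_all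
        show ?thesis unfolding e powr_add powr_divide powr_minus_divide[of 4 "s - \<kappa>"] by simp
      qed
      also have "\<dots> \<le> 4 powr (\<kappa> - s) * (br q powr (s - 2 * \<kappa>) + real n powr (s - 2 * \<kappa>))"
        by (intro mult_left_mono) auto
      finally show ?thesis by (simp add: mult_right_mono)
    next
      case False
      then have q: "real n \<le> br q" using n by linarith
      have "real n powr s * (br p powr (- \<kappa>) * br q powr (- \<kappa>)) \<le> real n powr s * (real n powr (- \<kappa>) * real n powr (- \<kappa>))"
        using n pn q assms(3) by (intro mult_left_mono mult_mono powr_mono2') auto
      also have "\<dots> = real n powr (s - 2 * \<kappa>)"
        unfolding powr_add[symmetric] by (rule arg_cong) simp
      also have "\<dots> \<le> br q powr (s - 2 * \<kappa>) + real n powr (s - 2 * \<kappa>)" by simp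
      also have "\<dots> \<le> 4 powr (\<kappa> - s) * (br q powr (s - 2 * \<kappa>) + real n powr (s - 2 * \<kappa>))"
        using mult_right_mono[OF c1, of "br q powr (s - 2 * \<kappa>) + real n powr (s - 2 * \<kappa>)"] by simp
      finally show ?thesis .
    qed
  qed
  show ?thesis
  proof (cases "br q \<le> br p")
    case True
    from *[OF assms(2) True] show ?thesis
      by (rule order_trans) (intro mult_left_mono, auto)
  next
    case False
    have "q + p = 2 * int n" "br p \<le> br q" using False assms(2) by auto
    from *[OF this] show ?thesis
      by (rule order_trans[rotated, OF order_trans]) (auto simp: mult.commute intro!: mult_left_mono)
  qed
qed

lemma l2_le_nat_powr:
  assumes "p < - (1 / 2)"
  shows "\<exists>C. l2_le (\<lambda>n::nat. if 1 \<le> n then real n powr p else 0) C"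
proof -
  obtain C where C: "l2_le (\<lambda>k. br k powr (- (- p))) C" using l2_le_br[of "- p"] assms by auto
  have i: "inj (\<lambda>n::nat. int n - 1)" by (auto simp: inj_def)
  have "l2_le (\<lambda>n::nat. if 1 \<le> n then real n powr p else 0) C"
  proof (rule l2_le_mono[OF l2_le_comp[OF C i]])
    fix n :: nat
    show "norm (if 1 \<le> n then real n powr p else 0) \<le> norm (br (int n - 1) powr (- (- p)))"
      by (auto simp: br_def)
  qed simp
  then show ?thesis by blast
qed

text \<open>Up to sign, the second order part of the reduced matrix at (n, - n). The entry at (- n,
  n) is obtained from the reflected sequence.\<close>

definition offdiag_sum :: "nat \<Rightarrow> (int \<Rightarrow> complex) \<Rightarrow> nat \<Rightarrow> complex" where
  "offdiag_sum m v n = (\<Sum>\<^sub>\<infinity>l. if \<bar>l\<bar> = int n then 0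
     else v (int n - l) * v (l + int n) / of_real (diag m l - diag m (int n)))"

text \<open>After the weights are distributed, one coefficient remains square summable, while the
  other becomes summable because \<open>\<omega>\<close> exceeds 1/2; Young's inequality applies.
  The leftover term is \<open>n\<close> to the power \<open>- \<omega>\<close>, again square
  summable, times a Cauchy-Schwarz bound.\<close>

lemma offdiag_bound:
  assumes "1 \<le> m" "0 \<le> \<theta>" "\<theta> < real m" "s \<le> real m - \<theta>" "1 / 2 < 2 * (real m - \<theta>) - s"
  obtains C where "0 \<le> C"
    "\<And>(v :: int \<Rightarrow> complex) R. l2_le (\<lambda>k. of_real (br k powr (- \<theta>)) * v k) R \<Longrightarrow>
      l2_le (\<lambda>n. if 1 \<le> n then real n powr s * cmod (offdiag_sum m v n) else 0) (C * R\<^sup>2)"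
proof -
  define \<kappa> where "\<kappa> = real m - \<theta>"
  define \<omega> where "\<omega> = 2 * \<kappa> - s"
  have \<kappa>: "0 < \<kappa>" "s \<le> \<kappa>" "1 / 2 < \<omega>" using assms by (auto simp: \<kappa>_def \<omega>_def)
  obtain Z where Z: "l2_le (\<lambda>k. br k powr (- \<omega>)) Z" using l2_le_br[OF \<kappa>(3)] by blast
  obtain Z' where Z': "l2_le (\<lambda>n::nat. if 1 \<le> n then real n powr (- \<omega>) else 0) Z'"
    using l2_le_nat_powr[of "- \<omega>"] \<kappa>(3) by auto
  have Z0: "0 \<le> Z" "0 \<le> Z'" using Z Z' by (auto dest: l2_le_nonneg)
  define c where "c = 4 ^ m * 4 powr (\<kappa> - s)"
  have c0: "0 \<le> c" by (simp add: c_def)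
  have "l2_le (\<lambda>n. if 1 \<le> n then real n powr s * cmod (offdiag_sum m v n) else 0) (c * (2 * Z + Z') * R\<^sup>2)"
    if v: "l2_le (\<lambda>k. of_real (br k powr (- \<theta>)) * v k) R" for v :: "int \<Rightarrow> complex" and R
  proof -
    define A where "A k = br k powr (- \<theta>) * cmod (v k)" for k
    have A: "l2_le A R"
      by (rule l2_le_mono[OF v]) (simp_all add: A_def norm_mult)
    have R0: "0 \<le> R" using v by (rule l2_le_nonneg)
    have A0: "0 \<le> A k" for k by (simp add: A_def)
    have vA: "cmod (v k) = A k * br k powr \<theta>" for k by (simp add: A_def powr_minus)
    define b where "b p = A p * br p powr (- \<omega>)" for p
    have b0: "0 \<le> b p" for p by (simp add: b_def A0)
    have b: "l1_le b (R * Z)" unfolding b_def by (rule l2_le_prod[OF A Z])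
    \<comment> \<open>A convolution of a summable with a square summable sequence, sampled at the
      points 2 n.\<close>
    define T where "T n = (\<Sum>\<^sub>\<infinity>p. b p * A (2 * int n - p))" for n :: nat
    have Al: "l2_le (\<lambda>n::nat. A (2 * int n - p)) R" for p
      by (rule l2_le_comp[OF A]) (auto simp: inj_def)
    have T: "l2_le T (R * Z * R)"
      unfolding T_def
    proof (rule l2_le_infsum)
      show "l2_le (\<lambda>n::nat. b p * A (2 * int n - p)) (b p * R)" for p
        using l2_le_cmult[OF Al, of "b p" p] b0[of p] by simp
      have "(\<Sum>p\<in>F. norm (b p * R)) \<le> R * Z * R" if "finite F" for F
      proof -
        have "(\<Sum>p\<in>F. norm (b p * R)) = (\<Sum>p\<in>F. norm (b p)) * R"
          using R0 by (simp add: abs_mult sum_distrib_right)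
        also have "\<dots> \<le> R * Z * R" using b that R0 by (intro mult_right_mono) (auto simp: l1_le_def)
        finally show ?thesis .
      qed
      then show "l1_le (\<lambda>p. b p * R) (R * Z * R)" using R0 Z0 by (simp add: l1_le_def)
    qed
    have Ar: "l2_le (\<lambda>l. A (int n + l)) R" and Ar': "l2_le (\<lambda>l. A (int n - l)) R"
      and br: "l2_le (\<lambda>l. br (int n + l) powr (- \<omega>)) Z" and br': "l2_le (\<lambda>l. br (int n - l) powr (- \<omega>)) Z" for n
      by (rule l2_le_comp[OF A] l2_le_comp[OF Z], simp add: inj_def)+
    have bl: "l1_le (\<lambda>l. b (int n - l)) (R * Z)" "l1_le (\<lambda>l. b (int n + l)) (R * Z)" for n
      unfolding b_def by (rule l2_le_prod[OF Ar' br'], rule l2_le_prod[OF Ar br])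
    have AR: "A k \<le> R" for k using l2_le_point[OF A, of k] by simp
    have sm1: "(\<lambda>l. b (int n - l) * A (int n + l)) summable_on UNIV" for n
      by (rule summable_on_comparison_test[OF summable_on_cmult_right[OF l1_le_summable[OF bl(1)[of n]], of R]])
         (auto simp: mult.commute[of "b _"] intro!: mult_right_mono AR b0 mult_nonneg_nonneg A0)
    have sm2: "(\<lambda>l. b (int n + l) * A (int n - l)) summable_on UNIV" for n
      by (rule summable_on_comparison_test[OF summable_on_cmult_right[OF l1_le_summable[OF bl(2)[of n]], of R]])
         (auto simp: mult.commute[of "b _"] intro!: mult_right_mono AR b0 mult_nonneg_nonneg A0)
    have sm3: "l1_le (\<lambda>l. A (int n - l) * A (int n + l)) (R * R)" for n
      by (rule l2_le_prod[OF Ar' Ar])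
    have T1: "(\<Sum>\<^sub>\<infinity>l. b (int n - l) * A (int n + l)) = T n" for n
      unfolding T_def
      by (rule infsum_reindex_bij_witness[of _ "\<lambda>p. int n - p" "\<lambda>l. int n - l"]) auto
    have T2: "(\<Sum>\<^sub>\<infinity>l. b (int n + l) * A (int n - l)) = T n" for n
      unfolding T_def
      by (rule infsum_reindex_bij_witness[of _ "\<lambda>p. p - int n" "\<lambda>l. int n + l"]) auto
    have T0: "0 \<le> T n" for n unfolding T_def by (intro infsum_nonneg mult_nonneg_nonneg b0 A0)
    have main: "real n powr s * cmod (offdiag_sum m v n) \<le> c * (T n + T n + real n powr (- \<omega>) * R\<^sup>2)" if n: "1 \<le> n" for n
    proof -
      let ?f = "\<lambda>l. if \<bar>l\<bar> = int n then 0 else v (int n - l) * v (l + int n) / of_real (diag m l - diag m (int n))"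
      let ?g = "\<lambda>l. c * (b (int n - l) * A (int n + l) + b (int n + l) * A (int n - l)
              + real n powr (- \<omega>) * (A (int n - l) * A (int n + l)))"
      have sg: "(\<lambda>l. b (int n - l) * A (int n + l) + b (int n + l) * A (int n - l)
              + real n powr (- \<omega>) * (A (int n - l) * A (int n + l))) summable_on UNIV"
        by (intro summable_on_add sm1 sm2 summable_on_cmult_right l1_le_summable[OF sm3])
      have le: "norm (of_real (real n powr s) * ?f l) \<le> ?g l" for l
      proof (cases "\<bar>l\<bar> = int n")
        case True
        then show ?thesis by (auto intro!: mult_nonneg_nonneg add_nonneg_nonneg b0 A0 c0)
      next
        case False
        define p where "p = int n - l"
        define q where "q = int n + l"
        have pq: "p \<noteq> 0" "q \<noteq> 0" "p + q = 2 * int n" using False by (auto simp: p_def q_def)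
        have le: "\<bar>of_int p\<bar> ^ m * \<bar>of_int q\<bar> ^ m \<le> \<bar>diag m l - diag m (int n)\<bar>"
          using diag_diff_factors[OF assms(1), of l "int n"]
          by (simp add: p_def q_def abs_minus_commute add.commute)
        have pos: "0 < \<bar>real_of_int p\<bar> ^ m * \<bar>real_of_int q\<bar> ^ m" using pq by simp
        have "1 / \<bar>diag m l - diag m (int n)\<bar> \<le> 1 / (\<bar>of_int p\<bar> ^ m * \<bar>of_int q\<bar> ^ m)"
          by (intro divide_left_mono mult_pos_pos le less_le_trans[OF pos le] pos) simp
        also have "\<dots> = (1 / \<bar>of_int p\<bar> ^ m) * (1 / \<bar>of_int q\<bar> ^ m)" by simp
        also have "\<dots> \<le> (2 ^ m * br p powr (- real m)) * (2 ^ m * br q powr (- real m))"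
          by (intro mult_mono inverse_power_le_br pq) auto
        also have "\<dots> = 4 ^ m * (br p powr (- real m) * br q powr (- real m))"
          by (simp add: power_mult_distrib[symmetric])
        finally have inv: "1 / \<bar>diag m l - diag m (int n)\<bar> \<le> 4 ^ m * (br p powr (- real m) * br q powr (- real m))" .
        have "norm (of_real (real n powr s) * ?f l) = real n powr s * (cmod (v p) * cmod (v q) * (1 / \<bar>diag m l - diag m (int n)\<bar>))"
          using False by (simp add: norm_mult norm_divide p_def q_def add.commute flip: of_real_diff)
        also have "\<dots> \<le> real n powr s * (cmod (v p) * cmod (v q) * (4 ^ m * (br p powr (- real m) * br q powr (- real m))))"
          by (intro mult_left_mono inv) auto
        also have "\<dots> = 4 ^ m * (A p * A q) * (real n powr s * (br p powr (- \<kappa>) * br q powr (- \<kappa>)))"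
        proof -
          have e: "br x powr (- \<kappa>) = br x powr \<theta> * br x powr (- real m)" for x
            unfolding powr_add[symmetric] by (rule arg_cong) (simp add: \<kappa>_def)
          show ?thesis unfolding vA e by (simp add: mult_ac)
        qed
        also have "\<dots> \<le> 4 ^ m * (A p * A q) * (4 powr (\<kappa> - s) * (br p powr (- \<omega>) + br q powr (- \<omega>) + real n powr (- \<omega>)))"
          using convolution_weight[OF n pq(3) \<kappa>(1,2)] by (intro mult_left_mono) (auto simp: A0 \<omega>_def)
        also have "\<dots> = ?g l"
          unfolding c_def b_def p_def[symmetric] q_def[symmetric] by (simp add: algebra_simps)
        finally show ?thesis .
      qed
      have "real n powr s * cmod (offdiag_sum m v n) = norm (\<Sum>\<^sub>\<infinity>l. of_real (real n powr s) * ?f l)"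
        unfolding offdiag_sum_def infsum_cmult_right' by (simp add: norm_mult)
      also have "\<dots> \<le> (\<Sum>\<^sub>\<infinity>l. ?g l)"
      proof (rule norm_infsum_le[OF has_sum_infsum has_sum_infsum])
        show sg': "?g summable_on UNIV" by (rule summable_on_cmult_right[OF sg])
        show "(\<lambda>l. of_real (real n powr s) * ?f l) summable_on UNIV"
          by (rule abs_summable_summable, rule summable_on_comparison_test[OF sg'])
             (rule le, rule norm_ge_zero)
      qed (rule le)
      also have "\<dots> = c * (T n + T n + real n powr (- \<omega>) * (\<Sum>\<^sub>\<infinity>l. A (int n - l) * A (int n + l)))"
        unfolding T1[symmetric, of n]
        by (subst infsum_cmult_right', subst infsum_add, intro summable_on_add sm1 sm2,
            intro summable_on_cmult_right l1_le_summable[OF sm3], subst infsum_add[OF sm1 sm2],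
            simp add: infsum_cmult_right' T1 T2)
      also have "\<dots> \<le> c * (T n + T n + real n powr (- \<omega>) * R\<^sup>2)"
        using l1_le_norm_infsum[OF sm3[of n]] by (intro mult_left_mono add_left_mono c0) (auto simp: power2_eq_square)
      finally show ?thesis .
    qed
    have "l2_le (\<lambda>n. c * (T n + T n + (if 1 \<le> n then real n powr (- \<omega>) else 0) * R\<^sup>2))
       (norm c * (R * Z * R + R * Z * R + norm (R\<^sup>2) * Z'))"
      using l2_le_cmult[OF Z', of "R\<^sup>2"] by (intro l2_le_cmult l2_le_add T) (simp add: mult.commute)
    then show ?thesis
    proof (rule l2_le_mono)
      fix n show "norm (if 1 \<le> n then real n powr s * cmod (offdiag_sum m v n) else 0)
        \<le> norm (c * (T n + T n + (if 1 \<le> n then real n powr (- \<omega>) else 0) * R\<^sup>2))"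
        using main[of n] by auto
    qed (use c0 in \<open>simp add: power2_eq_square algebra_simps\<close>)
  qed
  moreover have "0 \<le> c * (2 * Z + Z')" using c0 Z0 by simp
  ultimately show thesis using that by blast
qed

section \<open>The diagonal term of second order\<close>

lemma second_difference_bound:
  fixes t :: real
  assumes "0 \<le> t" "t \<le> 1"
  shows "\<bar>(1 + t) ^ p + (1 - t) ^ p - 2\<bar> \<le> 4 ^ p * t\<^sup>2" "\<bar>(1 + t) ^ p - (1 - t) ^ p\<bar> \<le> 4 ^ p * t"
proof -
  define S where "S p = (1 + t) ^ p + (1 - t) ^ p - 2" for p :: nat
  define U where "U p = (1 + t) ^ p - (1 - t) ^ p" for p :: nat
  have "0 \<le> S p \<and> S p \<le> 4 ^ p * t\<^sup>2 \<and> 0 \<le> U p \<and> U p \<le> 4 ^ p * t" for p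
  proof (induction p)
    case 0
    then show ?case by (simp add: S_def U_def assms)
  next
    case (Suc p)
    \<comment> \<open>The second difference \<open>S\<close> and the first difference
      \<open>U\<close> satisfy a linear recursion when one more factor is multiplied out; growth by
      4 per step is ample.\<close>
    have S: "S (Suc p) = S p + t * U p" and U: "U (Suc p) = U p + t * (S p + 2)"
      by (simp_all add: S_def U_def algebra_simps)
    have t2: "t\<^sup>2 \<le> t" using assms by (simp add: power2_eq_square mult_left_le)
    have "t * U p \<le> t * (4 ^ p * t)" using Suc assms by (intro mult_left_mono) auto
    then have 1: "S (Suc p) \<le> 4 ^ p * t\<^sup>2 + 4 ^ p * t\<^sup>2"
      using Suc by (simp add: S power2_eq_square mult_ac)
    have "4 ^ p * t\<^sup>2 \<le> 4 ^ p * 1" using t2 assms by (intro mult_left_mono) auto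
    moreover have "(2::real) \<le> 2 * 4 ^ p" by simp
    ultimately have "t * (S p + 2) \<le> t * (4 ^ p * 1 + 2 * 4 ^ p)"
      using Suc assms(1) by (intro mult_left_mono) linarith+
    with Suc have 2: "U (Suc p) \<le> 4 ^ p * t + t * (4 ^ p * 1 + 2 * 4 ^ p)"
      unfolding U by (intro add_mono) auto
    have "0 \<le> S (Suc p)" "0 \<le> U (Suc p)" unfolding S U using Suc assms by auto
    moreover have "4 ^ p * t\<^sup>2 + 4 ^ p * t\<^sup>2 \<le> 4 ^ Suc p * t\<^sup>2" by simp
    moreover have "4 ^ p * t + t * (4 ^ p * 1 + 2 * 4 ^ p) = 4 ^ Suc p * t" by (simp add: algebra_simps)
    ultimately show ?case using 1 2 by linarith
  qed
  from this[of p] show "\<bar>(1 + t) ^ p + (1 - t) ^ p - 2\<bar> \<le> 4 ^ p * t\<^sup>2" "\<bar>(1 + t) ^ p - (1 - t) ^ p\<bar> \<le> 4 ^ p * t"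
    unfolding S_def U_def by auto
qed

text \<open>With j = n - l this is the reciprocal gap in the diagonal entry of second order. The
  excluded modes l = n and l = - n, which form \<open>P\<close>, become j = 0 and j = 2 n, where the
  kernel is set to 0.\<close>

definition resolvent_kernel :: "nat \<Rightarrow> nat \<Rightarrow> int \<Rightarrow> real" where
  "resolvent_kernel m n j = (if j = 0 \<or> j = 2 * int n then 0
     else 1 / (diag m (int n - j) - diag m (int n)))"

lemma diag_scale: "diag m k = pi ^ (2 * m) * (real_of_int k) ^ (2 * m)"
  by (simp add: diag_def power_mult_distrib mult.commute)

text \<open>Here the symmetrization pays off. With t = j / n, each kernel alone may be of order 1 /
  t, but the numerator of their sum is a second difference of order t^2, which cancels the factor
  t^2 bounding the denominator from below.\<close>

lemma kernel_near:
  assumes m: "1 \<le> m" and n: "1 \<le> n" and j: "0 < j" "j \<le> int n"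
  shows "\<bar>resolvent_kernel m n j + resolvent_kernel m n (- j)\<bar> \<le> 16 ^ m / real n ^ (2 * m)"
proof -
  define N where "N = real n"
  define t where "t = of_int j / N"
  define P where "P = 1 - (1 - t) ^ (2 * m)"
  define Q where "Q = (1 + t) ^ (2 * m) - 1"
  define c where "c = pi ^ (2 * m) * N ^ (2 * m)"
  have N: "1 \<le> N" using n by (simp add: N_def)
  have t: "0 < t" "t \<le> 1" using j N by (auto simp: t_def N_def)
  have tN: "of_int j = t * N" using N by (simp add: t_def)
  have c: "0 < c" "N ^ (2 * m) \<le> c"
    unfolding c_def using N pi_power_ge_9[OF m] by (auto simp: mult_le_cancel_right1)
  have Pt: "t \<le> P"
  proof -
    have "(1 - t) ^ (2 * m) \<le> (1 - t) ^ 1" using t m by (intro power_decreasing) auto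
    then show ?thesis by (simp add: P_def)
  qed
  have Qt: "t \<le> Q"
  proof -
    have "(1 + t) ^ 1 \<le> (1 + t) ^ (2 * m)" using t m by (intro power_increasing) auto
    then show ?thesis by (simp add: Q_def)
  qed
  have "diag m (int n - j) - diag m (int n) = - (c * P)"
  proof -
    have e: "real_of_int (int n - j) = N * (1 - t)" "real_of_int (int n) = N"
      using tN by (simp_all add: N_def algebra_simps)
    show ?thesis unfolding diag_scale e c_def P_def power_mult_distrib by (simp add: algebra_simps)
  qed
  moreover have "diag m (int n - (- j)) - diag m (int n) = c * Q"
  proof -
    have e: "real_of_int (int n - (- j)) = N * (1 + t)" "real_of_int (int n) = N"
      using tN by (simp_all add: N_def algebra_simps)
    show ?thesis unfolding diag_scale e c_def Q_def power_mult_distrib by (simp add: algebra_simps)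
  qed
  ultimately have "resolvent_kernel m n j + resolvent_kernel m n (- j) = 1 / - (c * P) + 1 / (c * Q)"
    using j n by (simp add: resolvent_kernel_def)
  also have "\<dots> = (P - Q) / (c * (P * Q))"
    using c Pt Qt t by (simp add: field_simps)
  finally have "\<bar>resolvent_kernel m n j + resolvent_kernel m n (- j)\<bar> = \<bar>P - Q\<bar> / (c * (P * Q))"
    using c Pt Qt t by (simp add: abs_div abs_mult)
  also have "\<bar>P - Q\<bar> = \<bar>(1 + t) ^ (2 * m) + (1 - t) ^ (2 * m) - 2\<bar>" by (simp add: P_def Q_def)
  also have "\<dots> / (c * (P * Q)) \<le> (4 ^ (2 * m) * t\<^sup>2) / (N ^ (2 * m) * t\<^sup>2)"
  proof (rule frac_le)
    show "\<bar>(1 + t) ^ (2 * m) + (1 - t) ^ (2 * m) - 2\<bar> \<le> 4 ^ (2 * m) * t\<^sup>2"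
      using second_difference_bound(1)[of t "2 * m"] t by auto
    show "N ^ (2 * m) * t\<^sup>2 \<le> c * (P * Q)"
      unfolding power2_eq_square using c Pt Qt t N by (intro mult_mono) auto
  qed (use t N in auto)
  also have "\<dots> = 16 ^ m / real n ^ (2 * m)"
    using t by (simp add: N_def power_mult)
  finally show ?thesis .
qed

lemma inverse_diag_diff:
  assumes "1 \<le> m" "\<bar>k\<bar> \<noteq> \<bar>l\<bar>"
  shows "\<bar>1 / (diag m k - diag m l)\<bar>
    \<le> 1 / (max \<bar>of_int k\<bar> \<bar>of_int l\<bar> ^ (2 * m - 1) * \<bar>\<bar>of_int k\<bar> - \<bar>of_int l\<bar>\<bar>)"
proof -
  define M where "M = max \<bar>real_of_int k\<bar> \<bar>real_of_int l\<bar>"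
  define x where "x = \<bar>\<bar>real_of_int k\<bar> - \<bar>real_of_int l\<bar>\<bar>"
  have x: "0 < x" using assms(2) by (auto simp: x_def)
  have M: "0 < M" using assms(2) by (auto simp: M_def less_max_iff_disj)
  have "M ^ (2 * m - 1) * (9 * x) \<le> \<bar>diag m k - diag m l\<bar>"
  proof (cases "\<bar>l\<bar> \<le> \<bar>k\<bar>")
    case True
    then have "\<bar>real_of_int l\<bar> \<le> \<bar>real_of_int k\<bar>" by linarith
    then show ?thesis using order_trans[OF diag_diff_lower[OF assms(1) True] abs_ge_self]
      unfolding M_def x_def by (simp only: max_absorb1 abs_of_nonneg diff_ge_0_iff_ge)
  next
    case False
    then have "\<bar>real_of_int k\<bar> \<le> \<bar>real_of_int l\<bar>" by linarith
    moreover have "\<bar>k\<bar> \<le> \<bar>l\<bar>" using False by simp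
    ultimately show ?thesis using order_trans[OF diag_diff_lower[OF assms(1), of k l] abs_ge_self]
      unfolding M_def x_def abs_minus_commute[of "diag m k"] abs_minus_commute[of "\<bar>real_of_int k\<bar>"]
      by (simp only: max_absorb2 abs_of_nonneg diff_ge_0_iff_ge)
  qed
  moreover have "M ^ (2 * m - 1) * x \<le> M ^ (2 * m - 1) * (9 * x)" using x M by (intro mult_left_mono) auto
  ultimately have le: "M ^ (2 * m - 1) * x \<le> \<bar>diag m k - diag m l\<bar>" by linarith
  have pos: "0 < M ^ (2 * m - 1) * x" using x M by simp
  have "\<bar>1 / (diag m k - diag m l)\<bar> = 1 / \<bar>diag m k - diag m l\<bar>" by simp
  also have "\<dots> \<le> 1 / (M ^ (2 * m - 1) * x)"
    by (intro divide_left_mono le mult_pos_pos pos less_le_trans[OF pos le]) simp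
  finally show ?thesis by (simp add: M_def x_def)
qed

text \<open>No cancellation is used beyond \<open>n\<close>: the two kernels are estimated
  separately, and the bound at - j is weakened to the one at j.\<close>

lemma kernel_far:
  assumes m: "1 \<le> m" and n: "1 \<le> n" and j: "int n < j" "j \<noteq> 2 * int n"
  defines "M \<equiv> max (real n) (of_int j - real n)"
  shows "\<bar>resolvent_kernel m n j + resolvent_kernel m n (- j)\<bar> \<le> 2 / (M ^ (2 * m - 1) * \<bar>2 * real n - of_int j\<bar>)"
proof -
  define d where "d = \<bar>2 * real n - of_int j\<bar>"
  have d: "0 < d" using j by (auto simp: d_def)
  have jn: "real n < of_int j" "1 \<le> real n" using j n by auto
  have M: "0 < M" "M \<le> real n + of_int j" using jn by (auto simp: M_def)
  have "\<bar>resolvent_kernel m n j\<bar> \<le> 1 / (M ^ (2 * m - 1) * d)"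
  proof -
    have "\<bar>int n - j\<bar> \<noteq> \<bar>int n\<bar>" using j n by auto
    from inverse_diag_diff[OF m this]
    have "\<bar>1 / (diag m (int n - j) - diag m (int n))\<bar> \<le> 1 / (max (of_int j - real n) (real n) ^ (2 * m - 1) * \<bar>of_int j - real n - real n\<bar>)"
      using jn by (simp add: abs_of_neg)
    moreover have "max (of_int j - real n) (real n) = M" by (simp add: M_def max.commute)
    moreover have "\<bar>of_int j - real n - real n\<bar> = d" by (simp add: d_def abs_minus_commute)
    ultimately show ?thesis using j n by (simp add: resolvent_kernel_def)
  qed
  moreover have "\<bar>resolvent_kernel m n (- j)\<bar> \<le> 1 / (M ^ (2 * m - 1) * d)"
  proof -
    have "\<bar>int n + j\<bar> \<noteq> \<bar>int n\<bar>" using j n by auto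
    from inverse_diag_diff[OF m this]
    have "\<bar>1 / (diag m (int n + j) - diag m (int n))\<bar> \<le> 1 / ((real n + of_int j) ^ (2 * m - 1) * of_int j)"
      using jn by (simp add: max_absorb1)
    also have "\<dots> \<le> 1 / (M ^ (2 * m - 1) * d)"
    proof (intro divide_left_mono mult_mono power_mono mult_pos_pos)
      show "d \<le> of_int j" using jn by (simp add: d_def abs_le_iff)
    qed (use M d jn in auto)
    finally show ?thesis using j n by (simp add: resolvent_kernel_def)
  qed
  ultimately show ?thesis
    unfolding d_def[symmetric] using abs_triangle_ineq[of "resolvent_kernel m n j" "resolvent_kernel m n (- j)"] by linarith
qed

text \<open>At j = 2 n one kernel is 0 by definition, and the other belongs to the mode l = 3
  n.\<close>

lemma kernel_double:
  assumes m: "1 \<le> m" and n: "1 \<le> n"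
  shows "\<bar>resolvent_kernel m n (2 * int n) + resolvent_kernel m n (- (2 * int n))\<bar> \<le> 1 / real n ^ (2 * m)"
proof -
  have n1: "1 \<le> real n" using n by simp
  have "\<bar>3 * int n\<bar> \<noteq> \<bar>int n\<bar>" using n by auto
  from inverse_diag_diff[OF m this]
  have "\<bar>1 / (diag m (3 * int n) - diag m (int n))\<bar> \<le> 1 / ((3 * real n) ^ (2 * m - 1) * (2 * real n))"
    using n1 by (simp add: max_absorb1)
  also have "\<dots> \<le> 1 / (real n ^ (2 * m - 1) * real n)"
    using n1 by (intro divide_left_mono mult_mono power_mono mult_pos_pos) auto
  also have "real n ^ (2 * m - 1) * real n = real n ^ (2 * m)" using m by (cases m) auto
  finally show ?thesis using n by (simp add: resolvent_kernel_def)
qed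

text \<open>There are four ranges for positive j. Up to \<open>n\<close>, and at 2 n, the powers of
  \<open>n\<close> combine to the order - m. Between \<open>n\<close> and 4 n the singularity at 2 n
  remains as a reciprocal distance. Beyond 4 n the decay of order 2 m beats the growth of order 2
  \<theta>. The base 144 exceeds the squares of the factors 2, 3 and 5 that compare
  \<open>br j\<close> with the scale.\<close>

lemma kernel_weight:
  fixes n :: nat and j :: int
  assumes m: "1 \<le> m" and n: "1 \<le> n" and \<theta>: "0 \<le> \<theta>" "\<theta> < real m"
  shows "real n powr (real m - 2 * \<theta>) * br j powr (2 * \<theta>)
      * \<bar>resolvent_kernel m n j + resolvent_kernel m n (- j)\<bar>
    \<le> 4 * 16 ^ m * 144 powr \<theta> * (real n powr (- real m) + (1 / br (2 * int n - j) + 1 / br (2 * int n + j)))"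
proof -
  define N where "N = real n"
  have N: "1 \<le> N" using n by (simp add: N_def)
  define C where "C = 4 * 16 ^ m * 144 powr \<theta>"
  have base: "b powr \<theta> \<le> 144 powr \<theta>" if "0 \<le> b" "b \<le> 144" for b :: real
    using that \<theta> by (intro powr_mono2) auto
  have C: "a * b powr \<theta> \<le> C" if "0 \<le> b" "b \<le> 144" "0 \<le> a" "a \<le> 4 * 16 ^ m" for a b
    unfolding C_def using that base by (intro mult_mono) auto
  have sq: "b powr (2 * \<theta>) = (b\<^sup>2) powr \<theta>" if "0 < b" for b :: real
    using powr_powr[of b 2 \<theta>] that by simp
  have Npow: "N powr (real m - 2 * \<theta>) * N powr (2 * \<theta>) / N ^ (2 * m) = N powr (- real m)"
  proof -
    have e: "N ^ (2 * m) = N powr (2 * real m)" using powr_realpow[of N "2 * m"] N by simp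
    show ?thesis unfolding e powr_add[symmetric] powr_diff[symmetric] by (rule arg_cong) simp
  qed
  have mono3: "a * x * y \<le> a * x' * y'" if "0 \<le> a" "x \<le> x'" "y \<le> y'" "0 \<le> y" "0 \<le> x'" for a x y x' y' :: real
    using that by (intro mult_mono mult_left_mono) auto
  have small: "N powr (real m - 2 * \<theta>) * br j powr (2 * \<theta>) * x \<le> C * N powr (- real m)"
    if "br j \<le> b * N" "0 < b" "b\<^sup>2 \<le> 144" "x \<le> a / N ^ (2 * m)" "0 \<le> a" "a \<le> 4 * 16 ^ m" for j b x a
  proof -
    have "br j powr (2 * \<theta>) \<le> (b * N) powr (2 * \<theta>)" using that \<theta> by (intro powr_mono2) auto
    also have "\<dots> = (b\<^sup>2) powr \<theta> * N powr (2 * \<theta>)" using that N by (simp add: powr_mult sq)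
    finally have "N powr (real m - 2 * \<theta>) * br j powr (2 * \<theta>) * x
        \<le> N powr (real m - 2 * \<theta>) * ((b\<^sup>2) powr \<theta> * N powr (2 * \<theta>)) * (a / N ^ (2 * m))"
      using that N by (intro order_trans[OF mult_left_mono[OF that(4)]] mult_right_mono mult_left_mono) auto
    also have "\<dots> = (a * (b\<^sup>2) powr \<theta>) * (N powr (real m - 2 * \<theta>) * N powr (2 * \<theta>) / N ^ (2 * m))" by simp
    also have "\<dots> \<le> C * N powr (- real m)"
      unfolding Npow using that by (intro mult_right_mono C) auto
    finally show ?thesis .
  qed
  have pos: "N powr (real m - 2 * \<theta>) * br j powr (2 * \<theta>) * \<bar>resolvent_kernel m n j + resolvent_kernel m n (- j)\<bar>
    \<le> C * (N powr (- real m) + 1 / br (2 * int n - j))" if j: "0 < j" for j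
  proof -
    consider "j \<le> int n" | "j = 2 * int n" | "int n < j" "j \<noteq> 2 * int n" "j \<le> 4 * int n" | "4 * int n < j"
      by linarith
    then show ?thesis
    proof cases
      case 1
      have "N powr (real m - 2 * \<theta>) * br j powr (2 * \<theta>) * \<bar>resolvent_kernel m n j + resolvent_kernel m n (- j)\<bar>
          \<le> C * N powr (- real m)"
      proof (rule small[where b = 2])
        show "br j \<le> 2 * N" using 1 j N by (simp add: br_def N_def)
        show "\<bar>resolvent_kernel m n j + resolvent_kernel m n (- j)\<bar> \<le> 16 ^ m / N ^ (2 * m)"
          unfolding N_def by (rule kernel_near[OF m n j 1])
      qed auto
      also have "\<dots> \<le> C * (N powr (- real m) + 1 / br (2 * int n - j))"
        by (intro mult_left_mono) (auto simp: C_def)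
      finally show ?thesis .
    next
      case 2
      have "N powr (real m - 2 * \<theta>) * br j powr (2 * \<theta>) * \<bar>resolvent_kernel m n j + resolvent_kernel m n (- j)\<bar>
          \<le> C * N powr (- real m)"
      proof (rule small[where b = 3])
        show "br j \<le> 3 * N" using 2 N by (simp add: br_def N_def)
        show "\<bar>resolvent_kernel m n j + resolvent_kernel m n (- j)\<bar> \<le> 1 / N ^ (2 * m)"
          unfolding N_def 2 by (rule kernel_double[OF m n])
        show "(1::real) \<le> 4 * 16 ^ m" using one_le_power[of "16::real" m] by linarith
      qed auto
      also have "\<dots> \<le> C * (N powr (- real m) + 1 / br (2 * int n - j))"
        by (intro mult_left_mono) (auto simp: C_def)
      finally show ?thesis .
    next
      case 3
      define M where "M = max N (of_int j - N)"
      define d where "d = \<bar>2 * N - of_int j\<bar>"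
      have d: "0 < d" "br (2 * int n - j) \<le> 2 * d"
        using 3 br_le_twice[of "2 * int n - j"] by (auto simp: d_def N_def)
      have jN: "of_int j \<le> 4 * N" using 3 unfolding N_def by linarith
      have "N powr (real m - 2 * \<theta>) * br j powr (2 * \<theta>) * \<bar>resolvent_kernel m n j + resolvent_kernel m n (- j)\<bar>
         \<le> N powr (real m - 2 * \<theta>) * (5 * N) powr (2 * \<theta>) * (2 / (M ^ (2 * m - 1) * d))"
      proof (rule mono3)
        show "\<bar>resolvent_kernel m n j + resolvent_kernel m n (- j)\<bar> \<le> 2 / (M ^ (2 * m - 1) * d)"
          using kernel_far[OF m n 3(1,2)] by (simp add: M_def d_def N_def)
        show "br j powr (2 * \<theta>) \<le> (5 * N) powr (2 * \<theta>)"
          using jN N j \<theta> by (intro powr_mono2) (auto simp: br_def)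
      qed auto
      also have "\<dots> \<le> N powr (real m - 2 * \<theta>) * (5 * N) powr (2 * \<theta>) * (2 / (N ^ (2 * m - 1) * d))"
        using N d by (intro mult_left_mono divide_left_mono mult_right_mono power_mono mult_pos_pos) (auto simp: M_def)
      also have "\<dots> = (2 * 25 powr \<theta>) * (N powr (real m - 2 * \<theta>) * N powr (2 * \<theta>) / N ^ (2 * m - 1)) * (1 / d)"
        using N by (simp add: powr_mult sq)
      also have "N powr (real m - 2 * \<theta>) * N powr (2 * \<theta>) = N ^ m"
        unfolding powr_add[symmetric] using powr_realpow[of N m] N by simp
      also have "2 * 25 powr \<theta> * (N ^ m / N ^ (2 * m - 1)) * (1 / d) \<le> 2 * 25 powr \<theta> * 1 * (2 / br (2 * int n - j))"
      proof (rule mono3)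
        show "N ^ m / N ^ (2 * m - 1) \<le> 1" using N m by (simp add: power_increasing)
        show "1 / d \<le> 2 / br (2 * int n - j)" using d by (simp add: field_simps)
      qed (use d in auto)
      also have "\<dots> = (4 * 25 powr \<theta>) * (1 / br (2 * int n - j))" by simp
      also have "\<dots> \<le> C * (N powr (- real m) + 1 / br (2 * int n - j))"
        by (intro mult_mono C) (auto simp: C_def)
      finally show ?thesis .
    next
      case 4
      define M where "M = max N (of_int j - N)"
      define d where "d = \<bar>2 * N - of_int j\<bar>"
      have jN: "4 * N < of_int j" using 4 unfolding N_def by linarith
      have M: "M = of_int j - N" "N \<le> M" "0 < M" "M \<le> 2 * d" "br j \<le> 3 * M"
        using jN N j by (auto simp: M_def d_def br_def)
      have "N powr (real m - 2 * \<theta>) * br j powr (2 * \<theta>) * \<bar>resolvent_kernel m n j + resolvent_kernel m n (- j)\<bar>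
         \<le> N powr (real m - 2 * \<theta>) * (3 * M) powr (2 * \<theta>) * (4 / M ^ (2 * m))"
      proof (rule mono3)
        have "\<bar>resolvent_kernel m n j + resolvent_kernel m n (- j)\<bar> \<le> 2 / (M ^ (2 * m - 1) * d)"
          using kernel_far[OF m n, of j] 4 n by (simp add: M_def d_def N_def)
        also have "\<dots> \<le> 2 / (M ^ (2 * m - 1) * (M / 2))"
          using M by (intro divide_left_mono mult_left_mono mult_pos_pos) auto
        also have "\<dots> = 4 / (M ^ (2 * m - 1) * M)" by simp
        also have "M ^ (2 * m - 1) * M = M ^ (2 * m)" using m by (cases m) auto
        finally show "\<bar>resolvent_kernel m n j + resolvent_kernel m n (- j)\<bar> \<le> 4 / M ^ (2 * m)" .
        show "br j powr (2 * \<theta>) \<le> (3 * M) powr (2 * \<theta>)"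
          using M(5) \<theta> by (intro powr_mono2) auto
      qed auto
      also have "\<dots> = (4 * 9 powr \<theta>) * (N powr (real m - 2 * \<theta>) * (M powr (2 * \<theta>) / M ^ (2 * m)))"
        using M(3) sq[OF M(3)] by (simp add: powr_mult sq)
      also have "M powr (2 * \<theta>) / M ^ (2 * m) = M powr (2 * \<theta> - 2 * real m)"
        using M(3) powr_realpow[of M "2 * m"] by (simp add: powr_diff)
      also have "\<dots> \<le> N powr (2 * \<theta> - 2 * real m)" using M N \<theta> by (intro powr_mono2') auto
      also have "N powr (real m - 2 * \<theta>) * N powr (2 * \<theta> - 2 * real m) = N powr (- real m)"
        unfolding powr_add[symmetric] by (rule arg_cong) simp
      also have "4 * 9 powr \<theta> * N powr (- real m) \<le> C * (N powr (- real m) + 1 / br (2 * int n - j))"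
        by (intro mult_mono C) (auto simp: C_def)
      finally show ?thesis by (simp add: mult_left_mono)
    qed
  qed
  have C0: "0 \<le> C" by (simp add: C_def)
  consider "j = 0" | "0 < j" | "0 < - j" by linarith
  then have "N powr (real m - 2 * \<theta>) * br j powr (2 * \<theta>) * \<bar>resolvent_kernel m n j + resolvent_kernel m n (- j)\<bar>
      \<le> C * (N powr - real m + (1 / br (2 * int n - j) + 1 / br (2 * int n + j)))"
  proof cases
    case 1
    then show ?thesis using C0 by (simp add: resolvent_kernel_def)
  next
    case 2
    from pos[OF this] show ?thesis
      by (rule order_trans) (intro mult_left_mono C0, simp)
  next
    case 3
    from pos[OF this] show ?thesis
      unfolding br_minus minus_minus add.commute[of "resolvent_kernel m n (- j)"]
      by (rule order_trans) (intro mult_left_mono C0, simp)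
  qed
  then show ?thesis unfolding N_def C_def .
qed

definition diag_sum :: "nat \<Rightarrow> (int \<Rightarrow> complex) \<Rightarrow> nat \<Rightarrow> complex" where
  "diag_sum m v n = (\<Sum>\<^sub>\<infinity>j. v j * v (- j) * of_real (resolvent_kernel m n j))"

text \<open>The products \<open>v j * v (- j)\<close> are even in j, so twice the sum has the kernel
  symmetrized. Their weighted moduli are summable by Cauchy-Schwarz, and the bound for the weighted
  kernel is square summable in \<open>n\<close> uniformly in j; Minkowski's inequality
  concludes.\<close>

lemma diag_bound:
  assumes "1 \<le> m" "0 \<le> \<theta>" "\<theta> < real m"
  obtains C where "0 \<le> C"
    "\<And>(v :: int \<Rightarrow> complex) R N. l2_le (\<lambda>k. of_real (br k powr (- \<theta>)) * v k) R \<Longrightarrow> 1 \<le> N \<Longrightarrow>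
      (\<And>n. N \<le> n \<Longrightarrow> (\<lambda>j. v j * v (- j) * of_real (resolvent_kernel m n j)) summable_on UNIV) \<Longrightarrow>
      l2_le (\<lambda>n. if N \<le> n then real n powr (real m - 2 * \<theta>) * cmod (diag_sum m v n) else 0) (C * R\<^sup>2)"
proof -
  define c where "c = 4 * 16 ^ m * 144 powr \<theta>"
  have c0: "0 \<le> c" by (simp add: c_def)
  obtain Z where Z: "l2_le (\<lambda>k. br k powr (- 1)) Z" using l2_le_br[of 1] by auto
  obtain Z' where Z': "l2_le (\<lambda>n::nat. if 1 \<le> n then real n powr (- real m) else 0) Z'"
    using l2_le_nat_powr[of "- real m"] assms(1) by auto
  have Z0: "0 \<le> Z" "0 \<le> Z'" using Z Z' by (auto dest: l2_le_nonneg)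
  have "l2_le (\<lambda>n. if N \<le> n then real n powr (real m - 2 * \<theta>) * cmod (diag_sum m v n) else 0)
      (c * (Z' + (Z + Z)) * R\<^sup>2)"
    if v: "l2_le (\<lambda>k. of_real (br k powr (- \<theta>)) * v k) R"
      and N: "1 \<le> N" and sm: "\<And>n. N \<le> n \<Longrightarrow> (\<lambda>j. v j * v (- j) * of_real (resolvent_kernel m n j)) summable_on UNIV"
    for v :: "int \<Rightarrow> complex" and R and N :: nat
  proof -
    define A where "A k = br k powr (- \<theta>) * cmod (v k)" for k
    have A: "l2_le A R"
      by (rule l2_le_mono[OF v]) (simp_all add: A_def norm_mult)
    have R0: "0 \<le> R" using v by (rule l2_le_nonneg)
    have A0: "0 \<le> A k" for k by (simp add: A_def)
    have vA: "cmod (v k) = A k * br k powr \<theta>" for k by (simp add: A_def powr_minus)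
    define \<beta> where "\<beta> j = A j * A (- j)" for j
    have \<beta>0: "0 \<le> \<beta> j" for j by (simp add: \<beta>_def A0)
    have "l2_le (\<lambda>j. A (- j)) R" by (rule l2_le_comp[OF A]) (auto simp: inj_def)
    from l2_le_prod[OF A this] have \<beta>: "l1_le \<beta> (R * R)" by (simp add: \<beta>_def[abs_def])
    define w where "w j n = (if 1 \<le> n then real n powr (- real m) else 0)
      + (br (2 * int n - j) powr (-1) + br (2 * int n + j) powr (-1))" for j :: int and n :: nat
    have w: "l2_le (w j) (Z' + (Z + Z))" for j
    proof -
      have i: "inj (\<lambda>n::nat. 2 * int n - j)" "inj (\<lambda>n::nat. 2 * int n + j)" by (auto simp: inj_def)
      show ?thesis unfolding w_def
        by (intro l2_le_add Z' l2_le_comp[OF Z i(1)] l2_le_comp[OF Z i(2)])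
    qed
    have w0: "0 \<le> w j n" for j n by (simp add: w_def)
    have wB: "w j n \<le> Z' + (Z + Z)" for j n using l2_le_point[OF w, of j n] by simp
    have W: "l2_le (\<lambda>n. \<Sum>\<^sub>\<infinity>j. \<beta> j * w j n) (R * R * (Z' + (Z + Z)))"
    proof (rule l2_le_infsum)
      show "l2_le (\<lambda>n. \<beta> j * w j n) (\<beta> j * (Z' + (Z + Z)))" for j
        using l2_le_cmult[OF w, of "\<beta> j" j] \<beta>0[of j] by simp
      have "(\<Sum>j\<in>F. norm (\<beta> j * (Z' + (Z + Z)))) \<le> R * R * (Z' + (Z + Z))" if "finite F" for F
      proof -
        have "(\<Sum>j\<in>F. norm (\<beta> j * (Z' + (Z + Z)))) = (\<Sum>j\<in>F. norm (\<beta> j)) * (Z' + (Z + Z))"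
          using Z0 by (simp add: abs_mult sum_distrib_right)
        also have "\<dots> \<le> R * R * (Z' + (Z + Z))" using \<beta> that Z0 by (intro mult_right_mono) (auto simp: l1_le_def)
        finally show ?thesis .
      qed
      then show "l1_le (\<lambda>j. \<beta> j * (Z' + (Z + Z))) (R * R * (Z' + (Z + Z)))"
        using R0 Z0 by (simp add: l1_le_def)
    qed
    have sW: "(\<lambda>j. \<beta> j * w j n) summable_on UNIV" for n
      by (rule summable_on_comparison_test[OF summable_on_cmult_left[OF l1_le_summable[OF \<beta>], of "Z' + (Z + Z)"]])
         (rule mult_left_mono[OF wB \<beta>0], rule mult_nonneg_nonneg[OF \<beta>0 w0])
    have main: "real n powr (real m - 2 * \<theta>) * cmod (diag_sum m v n) \<le> c * (\<Sum>\<^sub>\<infinity>j. \<beta> j * w j n)" if nN: "N \<le> n" for n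
    proof -
      have n: "1 \<le> n" using N nN by simp
      let ?f = "\<lambda>j. v j * v (- j) * of_real (resolvent_kernel m n j)"
      let ?h = "\<lambda>j. resolvent_kernel m n j + resolvent_kernel m n (- j)"
      have refl: "(\<lambda>j. ?f (- j)) summable_on UNIV" "(\<Sum>\<^sub>\<infinity>j. ?f (- j)) = diag_sum m v n"
      proof -
        have bij: "bij (uminus :: int \<Rightarrow> int)" by (rule bij_uminus)
        show "(\<lambda>j. ?f (- j)) summable_on UNIV"
          using summable_on_reindex_bij_betw[OF bij, of ?f] sm[OF nN] by simp
        show "(\<Sum>\<^sub>\<infinity>j. ?f (- j)) = diag_sum m v n"
          using infsum_reindex_bij_betw[OF bij, of ?f] by (simp add: diag_sum_def)
      qed
      have "2 * diag_sum m v n = (\<Sum>\<^sub>\<infinity>j. ?f j) + (\<Sum>\<^sub>\<infinity>j. ?f (- j))"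
        unfolding refl(2) by (simp add: diag_sum_def)
      also have "\<dots> = (\<Sum>\<^sub>\<infinity>j. ?f j + ?f (- j))" by (intro infsum_add[symmetric] sm nN refl)
      also have "\<dots> = (\<Sum>\<^sub>\<infinity>j. v j * v (- j) * of_real (?h j))" by (simp add: distrib_left mult.commute)
      finally have two: "2 * diag_sum m v n = (\<Sum>\<^sub>\<infinity>j. v j * v (- j) * of_real (?h j))" .
      have sh: "(\<lambda>j. v j * v (- j) * of_real (?h j)) summable_on UNIV"
        using summable_on_add[OF sm[OF nN] refl(1)] by (simp add: distrib_left mult.commute)
      have le: "norm (of_real (real n powr (real m - 2 * \<theta>)) * (v j * v (- j) * of_real (?h j))) \<le> c * (\<beta> j * w j n)" for j
      proof -
        have "norm (of_real (real n powr (real m - 2 * \<theta>)) * (v j * v (- j) * of_real (?h j)))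
            = real n powr (real m - 2 * \<theta>) * (cmod (v j) * cmod (v (- j)) * \<bar>?h j\<bar>)"
          by (simp only: norm_mult norm_of_real) simp
        also have "\<dots> = \<beta> j * (real n powr (real m - 2 * \<theta>) * br j powr (2 * \<theta>) * \<bar>?h j\<bar>)"
        proof -
          have "br j powr (2 * \<theta>) = br j powr \<theta> * br j powr \<theta>" by (simp add: powr_add[symmetric])
          then show ?thesis by (simp add: vA \<beta>_def mult_ac)
        qed
        also have "\<dots> \<le> \<beta> j * (c * w j n)"
        proof (intro mult_left_mono \<beta>0)
          show "real n powr (real m - 2 * \<theta>) * br j powr (2 * \<theta>) * \<bar>?h j\<bar> \<le> c * w j n"
            using kernel_weight[OF assms(1) n assms(2,3), of j] n
            by (simp add: c_def w_def powr_minus_divide)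
        qed
        finally show ?thesis by (simp add: mult_ac)
      qed
      have "real n powr (real m - 2 * \<theta>) * (2 * cmod (diag_sum m v n))
          = norm (of_real (real n powr (real m - 2 * \<theta>)) * (2 * diag_sum m v n))"
        by (simp add: norm_mult)
      also have "\<dots> = norm (\<Sum>\<^sub>\<infinity>j. of_real (real n powr (real m - 2 * \<theta>)) * (v j * v (- j) * of_real (?h j)))"
        unfolding two infsum_cmult_right' ..
      also have "\<dots> \<le> (\<Sum>\<^sub>\<infinity>j. c * (\<beta> j * w j n))"
        by (rule norm_infsum_le[OF has_sum_infsum[OF summable_on_cmult_right[OF sh]]
            has_sum_infsum[OF summable_on_cmult_right[OF sW]]]) (rule le)
      also have "\<dots> = c * (\<Sum>\<^sub>\<infinity>j. \<beta> j * w j n)" by (rule infsum_cmult_right')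
      finally have "real n powr (real m - 2 * \<theta>) * (2 * cmod (diag_sum m v n)) \<le> c * (\<Sum>\<^sub>\<infinity>j. \<beta> j * w j n)" .
      moreover have "real n powr (real m - 2 * \<theta>) * cmod (diag_sum m v n)
          \<le> real n powr (real m - 2 * \<theta>) * (2 * cmod (diag_sum m v n))"
        by (intro mult_left_mono) auto
      ultimately show ?thesis by linarith
    qed
    have "l2_le (\<lambda>n. c * (\<Sum>\<^sub>\<infinity>j. \<beta> j * w j n)) (norm c * (R * R * (Z' + (Z + Z))))"
      by (intro l2_le_cmult W)
    then show ?thesis
    proof (rule l2_le_mono)
      fix n show "norm (if N \<le> n then real n powr (real m - 2 * \<theta>) * cmod (diag_sum m v n) else 0)
        \<le> norm (c * (\<Sum>\<^sub>\<infinity>j. \<beta> j * w j n))"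
        using main[of n] by auto
    qed (use c0 in \<open>simp add: power2_eq_square mult_ac\<close>)
  qed
  moreover have "0 \<le> c * (Z' + (Z + Z))" using c0 Z0 by simp
  ultimately show thesis using that by blast
qed

section \<open>Root spaces in terms of Fourier coefficients\<close>

lemma br_powr_square: "(br k powr s)\<^sup>2 = br k powr (2 * s)"
  unfolding power2_eq_square powr_add[symmetric] by simp

lemma Hper_weight:
  "(norm (of_real (br k powr s) * fcoeff f k :: complex))\<^sup>2
    = (1 + \<bar>real_of_int k\<bar>) powr (2 * s) * (cmod (fcoeff f k))\<^sup>2"
  by (simp only: norm_mult norm_of_real power_mult_distrib power2_abs br_powr_square) (simp add: br_def)

lemma Hper_l2:
  assumes "f \<in> Hper s" "Hper_norm s f \<le> R"
  shows "f \<in> per_dist" "l2_le (\<lambda>k. of_real (br k powr s) * fcoeff f k) R"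
proof -
  show "f \<in> per_dist" using assms by (simp add: Hper_def)
  note e = Hper_weight
  have sm: "(\<lambda>k. (norm (of_real (br k powr s) * fcoeff f k))\<^sup>2) summable_on UNIV"
    using assms(1) unfolding e by (simp add: Hper_def)
  have n: "Hper_norm s f = sqrt (\<Sum>\<^sub>\<infinity>k. (norm (of_real (br k powr s) * fcoeff f k))\<^sup>2)"
    unfolding e Hper_norm_def ..
  have n0: "0 \<le> Hper_norm s f" unfolding n by (intro real_sqrt_ge_zero infsum_nonneg) simp
  show "l2_le (\<lambda>k. of_real (br k powr s) * fcoeff f k) R"
  proof (rule l2_leI_sq)
    show "0 \<le> R" using n0 assms(2) by linarith
    fix F :: "int set" assume "finite F"
    then have "(\<Sum>k\<in>F. (norm (of_real (br k powr s) * fcoeff f k))\<^sup>2)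
        \<le> (\<Sum>\<^sub>\<infinity>k. (norm (of_real (br k powr s) * fcoeff f k))\<^sup>2)"
      by (intro finite_sum_le_infsum sm) auto
    also have "\<dots> = (Hper_norm s f)\<^sup>2" unfolding n by (simp add: infsum_nonneg)
    also have "\<dots> \<le> R\<^sup>2" using n0 assms(2) by (intro power_mono) auto
    finally show "(\<Sum>k\<in>F. (norm (of_real (br k powr s) * fcoeff f k))\<^sup>2) \<le> R\<^sup>2" .
  qed
qed

lemma l2_le_summable_sq:
  assumes "l2_le f C"
  shows "(\<lambda>x. (norm (f x))\<^sup>2) summable_on UNIV" "(\<Sum>\<^sub>\<infinity>x. (norm (f x))\<^sup>2) \<le> C\<^sup>2"
proof -
  show sm: "(\<lambda>x. (norm (f x))\<^sup>2) summable_on UNIV"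
    by (rule nonneg_bdd_above_summable_on)
       (use l2_le_sum_sq[OF assms] in \<open>auto simp: bdd_above_def\<close>)
  show "(\<Sum>\<^sub>\<infinity>x. (norm (f x))\<^sup>2) \<le> C\<^sup>2"
    by (rule infsum_le_finite_sums[OF sm]) (use l2_le_sum_sq[OF assms] in auto)
qed

lemma Hper_iff: "f \<in> Hper s \<longleftrightarrow> f \<in> per_dist \<and> (\<exists>C. l2_le (\<lambda>k. of_real (br k powr s) * fcoeff f k) C)"
proof
  assume "f \<in> Hper s"
  with Hper_l2[OF this order_refl] show "f \<in> per_dist \<and> (\<exists>C. l2_le (\<lambda>k. of_real (br k powr s) * fcoeff f k) C)"
    by blast
next
  assume *: "f \<in> per_dist \<and> (\<exists>C. l2_le (\<lambda>k. of_real (br k powr s) * fcoeff f k) C)"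
  then obtain C where "l2_le (\<lambda>k. of_real (br k powr s) * fcoeff f k) C" by blast
  from l2_le_summable_sq(1)[OF this] show "f \<in> Hper s"
    using * unfolding Hper_weight Hper_def by blast
qed

text \<open>The ratio of \<open>br (k - j)\<close> to \<open>br k\<close> is at most 1 plus that of
  \<open>br j\<close> to \<open>br k\<close>. The exponent \<theta> may be raised to
  \<open>m\<close> once the base is at least 1.\<close>

lemma convolution_ratio:
  assumes "0 \<le> \<theta>" "\<theta> \<le> real m"
  shows "br k powr (- \<theta>) * br (k - j) powr \<theta> \<le> 2 powr \<theta> * (1 + br k powr (- real m) * br j powr real m)"
proof -
  define q where "q = br j / br k"
  have q: "0 < q" by (simp add: q_def)
  have "br (k - j) \<le> br k + br j" by (simp add: br_def)
  then have "br (k - j) / br k \<le> 1 + q" by (simp add: q_def field_simps)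
  also have "\<dots> \<le> 2 * max 1 q" by simp
  finally have le: "br (k - j) / br k \<le> 2 * max 1 q" .
  have "br k powr (- \<theta>) * br (k - j) powr \<theta> = (br (k - j) / br k) powr \<theta>"
    by (simp add: powr_divide powr_minus_divide)
  also have "\<dots> \<le> (2 * max 1 q) powr \<theta>" using le assms by (intro powr_mono2) auto
  also have "\<dots> = 2 powr \<theta> * max 1 q powr \<theta>" by (rule powr_mult)
  also have "max 1 q powr \<theta> \<le> max 1 q powr real m" using assms by (intro powr_mono) auto
  also have "max 1 q powr real m \<le> 1 + q powr real m" by (auto simp: max_def)
  also have "q powr real m = br k powr (- real m) * br j powr real m"
    by (simp add: q_def powr_divide powr_minus_divide)
  finally show ?thesis by (simp add: mult_left_mono)
qed

text \<open>Of the two parts of \<open>convolution_ratio\<close>, the constant leads to the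
  convolution of a square summable with a summable sequence, as \<open>m\<close> exceeds 1/2. The
  other leads to a sum bounded by Cauchy-Schwarz, times the square summable
  \<open>br k powr (- real m)\<close>. This is the continuity of multiplication by \<open>V\<close>
  on the form domain.\<close>

lemma convolution_bound:
  fixes v x :: "int \<Rightarrow> complex"
  assumes "1 \<le> m" "0 \<le> \<theta>" "\<theta> \<le> real m"
    and v: "l2_le (\<lambda>k. of_real (br k powr (- \<theta>)) * v k) R"
    and x: "l2_le (\<lambda>k. of_real (br k powr real m) * x k) B"
  shows "\<exists>B'. l2_le (\<lambda>k. of_real (br k powr (- \<theta>)) * (\<Sum>\<^sub>\<infinity>j. v (k - j) * x j)) B'"
proof -
  define A where "A k = br k powr (- \<theta>) * cmod (v k)" for k
  define X where "X k = br k powr real m * cmod (x k)" for k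
  have A: "l2_le A R" by (rule l2_le_mono[OF v]) (simp_all add: A_def norm_mult)
  have X: "l2_le X B" by (rule l2_le_mono[OF x]) (simp_all add: X_def norm_mult)
  have A0: "0 \<le> A k" and X0: "0 \<le> X k" for k by (simp_all add: A_def X_def)
  have R0: "0 \<le> R" using v by (rule l2_le_nonneg)
  have vA: "cmod (v k) = A k * br k powr \<theta>" for k by (simp add: A_def powr_minus)
  obtain Z where Z: "l2_le (\<lambda>k. br k powr (- real m)) Z" using l2_le_br[of "real m"] assms(1) by auto
  have xX: "cmod (x j) = X j * br j powr (- real m)" for j by (simp add: X_def powr_minus)
  have x1: "l1_le x (B * Z)"
    by (rule l1_le_mono[OF l2_le_prod[OF X Z]]) (simp_all add: xX X0)
  have Ak: "l2_le (\<lambda>j. A (k - j)) R" for k by (rule l2_le_comp[OF A]) (auto simp: inj_def)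
  have Aj: "l2_le (\<lambda>k. A (k - j)) R" for j by (rule l2_le_comp[OF A]) (auto simp: inj_def)
  define S where "S k = (\<Sum>\<^sub>\<infinity>j. A (k - j) * cmod (x j))" for k
  have x1': "l1_le (\<lambda>j. cmod (x j)) (B * Z)" using x1 by (simp add: l1_le_def)
  have S: "l2_le S (B * Z * R)"
    unfolding S_def
  proof (rule l2_le_infsum)
    show "l2_le (\<lambda>k. A (k - j) * cmod (x j)) (cmod (x j) * R)" for j
      using l2_le_cmult[OF Aj, of "cmod (x j)" j] by (simp add: mult.commute)
    have "(\<Sum>j\<in>F. norm (cmod (x j) * R)) \<le> B * Z * R" if "finite F" for F
    proof -
      have "(\<Sum>j\<in>F. norm (cmod (x j) * R)) = (\<Sum>j\<in>F. cmod (x j)) * R"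
        using R0 by (simp add: abs_mult sum_distrib_right)
      also have "\<dots> \<le> B * Z * R" using x1 that R0 by (intro mult_right_mono) (auto simp: l1_le_def)
      finally show ?thesis .
    qed
    then show "l1_le (\<lambda>j. cmod (x j) * R) (B * Z * R)"
      using R0 l1_le_nonneg[OF x1] by (simp add: l1_le_def)
  qed
  have AX: "l1_le (\<lambda>j. A (k - j) * X j) (R * B)" for k by (rule l2_le_prod[OF Ak X])
  have sm1: "(\<lambda>j. A (k - j) * cmod (x j)) summable_on UNIV" for k
  proof (rule summable_on_comparison_test[OF l1_le_summable[OF AX[of k]]])
    fix j
    have "cmod (x j) \<le> X j"
      using mult_right_mono[of 1 "br j powr real m" "cmod (x j)"] by (simp add: X_def ge_one_powr_ge_zero)
    then show "A (k - j) * cmod (x j) \<le> A (k - j) * X j" by (intro mult_left_mono A0)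
  qed (simp add: A0)
  have main: "norm (of_real (br k powr (- \<theta>)) * (\<Sum>\<^sub>\<infinity>j. v (k - j) * x j))
      \<le> 2 powr \<theta> * (S k + br k powr (- real m) * (R * B))" for k
  proof -
    let ?g = "\<lambda>j. 2 powr \<theta> * (A (k - j) * cmod (x j) + br k powr (- real m) * (A (k - j) * X j))"
    have le: "norm (of_real (br k powr (- \<theta>)) * (v (k - j) * x j)) \<le> ?g j" for j
    proof -
      have "norm (of_real (br k powr (- \<theta>)) * (v (k - j) * x j))
          = A (k - j) * cmod (x j) * (br k powr (- \<theta>) * br (k - j) powr \<theta>)"
        by (simp add: norm_mult vA)
      also have "\<dots> \<le> A (k - j) * cmod (x j) * (2 powr \<theta> * (1 + br k powr (- real m) * br j powr real m))"
        by (intro mult_left_mono convolution_ratio assms mult_nonneg_nonneg A0) auto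
      finally show ?thesis by (simp add: X_def algebra_simps)
    qed
    have sg0: "(\<lambda>j. A (k - j) * cmod (x j) + br k powr (- real m) * (A (k - j) * X j)) summable_on UNIV"
      by (intro summable_on_add sm1 summable_on_cmult_right l1_le_summable[OF AX])
    have sg: "?g summable_on UNIV" by (rule summable_on_cmult_right[OF sg0])
    have "norm (of_real (br k powr (- \<theta>)) * (\<Sum>\<^sub>\<infinity>j. v (k - j) * x j))
        = norm (\<Sum>\<^sub>\<infinity>j. of_real (br k powr (- \<theta>)) * (v (k - j) * x j))"
      by (simp only: infsum_cmult_right')
    also have "\<dots> \<le> (\<Sum>\<^sub>\<infinity>j. ?g j)"
    proof (rule norm_infsum_le[OF has_sum_infsum has_sum_infsum])
      show "?g summable_on UNIV" by fact
      show "(\<lambda>j. of_real (br k powr (- \<theta>)) * (v (k - j) * x j)) summable_on UNIV"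
        by (rule abs_summable_summable, rule summable_on_comparison_test[OF sg]) (rule le, rule norm_ge_zero)
    qed (rule le)
    also have "\<dots> = 2 powr \<theta> * (S k + br k powr (- real m) * (\<Sum>\<^sub>\<infinity>j. A (k - j) * X j))"
      unfolding infsum_cmult_right' infsum_add[OF sm1 summable_on_cmult_right[OF l1_le_summable[OF AX]]] S_def ..
    also have "\<dots> \<le> 2 powr \<theta> * (S k + br k powr (- real m) * (R * B))"
      using l1_le_norm_infsum[OF AX[of k]] by (intro mult_left_mono add_left_mono) auto
    finally show ?thesis .
  qed
  have "l2_le (\<lambda>k. 2 powr \<theta> * (S k + (R * B) * br k powr (- real m)))
      (norm (2 powr \<theta>) * (B * Z * R + norm (R * B) * Z))"
    by (intro l2_le_cmult l2_le_add S Z)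
  then have "l2_le (\<lambda>k. of_real (br k powr (- \<theta>)) * (\<Sum>\<^sub>\<infinity>j. v (k - j) * x j))
      (norm (2 powr \<theta>) * (B * Z * R + norm (R * B) * Z))"
    by (rule l2_le_mono) (use main in \<open>auto simp: mult.commute[of "R * B"] intro: order_trans[OF _ abs_ge_self]\<close>)
  then show ?thesis by blast
qed

text \<open>Ellipticity; the added 1 takes care of the mode 0.\<close>

lemma br_power_le_diag: "br k ^ (2 * m) \<le> 4 ^ m * (1 + diag m k)"
proof -
  define x where "x = \<bar>real_of_int k\<bar>"
  have "br k ^ (2 * m) \<le> (2 * max 1 x) ^ (2 * m)" by (intro power_mono) (auto simp: br_def x_def max_def)
  also have "\<dots> = 4 ^ m * max 1 x ^ (2 * m)" by (simp add: power_mult_distrib power_mult)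
  also have "max 1 x ^ (2 * m) \<le> 1 + x ^ (2 * m)" by (auto simp: max_def)
  also have "x ^ (2 * m) \<le> diag m k"
  proof -
    have "1 \<le> pi ^ (2 * m)" using pi_gt3 by (intro one_le_power) simp
    from mult_right_mono[OF this, of "x ^ (2 * m)"] show ?thesis by (simp add: diag_abs x_def)
  qed
  finally show ?thesis by simp
qed

lemma (in vector_space_pair) dim_injective_image:
  assumes "Vector_Spaces.linear s1 s2 f" "inj_on f (vs1.span S)"
  shows "vs2.dim (f ` S) = vs1.dim S"
proof -
  obtain B where B: "B \<subseteq> S" "vs1.independent B" "S \<subseteq> vs1.span B" "card B = vs1.dim S"
    by (rule vs1.basis_exists)
  have eq: "vs1.span B = vs1.span S"
    using B vs1.span_mono[OF B(1)] vs1.span_minimal[OF B(3) vs1.subspace_span] by blast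
  have inj: "inj_on f (vs1.span B)" using assms(2) by (simp add: eq)
  show ?thesis
  proof (rule vs2.dim_unique)
    show "f ` B \<subseteq> f ` S" using B by blast
    show "f ` S \<subseteq> vs2.span (f ` B)" using B(3) linear_span_image[OF assms(1)] by blast
    show "vs2.independent (f ` B)"
      by (rule linear_independent_injective_image[OF assms(1) B(2) inj])
    show "card (f ` B) = vs1.dim S"
      using B(4) card_image[OF inj_on_subset[OF inj vs1.span_superset]] by simp
  qed
qed

section \<open>Root spaces of sequences and the reduced matrix\<close>

definition sscale :: "complex \<Rightarrow> (int \<Rightarrow> complex) \<Rightarrow> int \<Rightarrow> complex" where
  "sscale c u = (\<lambda>k. c * u k)"

global_interpretation seqs: vector_space sscale
  by unfold_locales (auto simp: sscale_def plus_fun_def algebra_simps)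

text \<open>\<open>P\<close> is left open: it will be the block of all modes up to \<open>n\<close>
  for counting, and the pair n, - n for the asymptotics. The weights are those of \<open>n\<close>
  in both cases.\<close>

locale mode_block = small_coupling P "diag m" "wt m n" "\<lambda>k j. v (k - j)" e
  for P :: "int set" and m n :: nat and v :: "int \<Rightarrow> complex" and e :: real +
  fixes \<theta> R :: real
  assumes m: "1 \<le> m" and n: "1 \<le> n" and \<theta>: "0 \<le> \<theta>" "\<theta> < real m"
    and v: "l2_le (\<lambda>k. of_real (br k powr (- \<theta>)) * v k) R"
begin

text \<open>For \<open>\<theta> = real m * \<alpha>\<close>, the domain of the operator in terms of
  Fourier coefficients.\<close>

definition dom :: "(int \<Rightarrow> complex) \<Rightarrow> bool" where
  "dom x \<longleftrightarrow> (\<exists>B. l2_le (\<lambda>k. of_real (br k powr (2 * real m - \<theta>)) * x k) B)"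

primrec kerp :: "complex \<Rightarrow> nat \<Rightarrow> (int \<Rightarrow> complex) set" where
  "kerp z 0 = {\<lambda>_. 0}"
| "kerp z (Suc p) = {x. dom x \<and> (\<lambda>k. Lop x k - z * x k) \<in> kerp z p}"

lemma sqrt_wt_upper: "sqrt (wt m n k) \<le> (1 + real n) ^ m * br k ^ m"
proof -
  have "wt m n k \<le> ((1 + real n) ^ m * br k ^ m)\<^sup>2"
    using wt_upper[OF m n, of k] unfolding power_mult_distrib power_mult[symmetric]
    by (simp add: mult.commute)
  then show ?thesis by (intro real_le_lsqrt) (auto simp: br_def)
qed

lemma dom_energy: "dom x \<Longrightarrow> \<exists>B. energy_le x B"
proof -
  assume "dom x"
  then obtain B where B: "l2_le (\<lambda>k. of_real (br k powr (2 * real m - \<theta>)) * x k) B" by (auto simp: dom_def)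
  have "energy_le x (norm (of_real ((1 + real n) ^ m) :: complex) * B)"
    unfolding energy_le_def
  proof (rule l2_le_mono[OF l2_le_cmult[OF B]])
    fix k
    have "br k ^ m = br k powr real m" by (simp add: powr_realpow)
    also have "\<dots> \<le> br k powr (2 * real m - \<theta>)" using \<theta> by (intro powr_mono) auto
    finally have "(1 + real n) ^ m * br k ^ m \<le> (1 + real n) ^ m * br k powr (2 * real m - \<theta>)"
      by (intro mult_left_mono) auto
    with sqrt_wt_upper[of k] have "sqrt (wt m n k) \<le> (1 + real n) ^ m * br k powr (2 * real m - \<theta>)" by linarith
    then show "norm (of_real (sqrt (wt m n k)) * x k)
        \<le> norm (of_real ((1 + real n) ^ m) * (of_real (br k powr (2 * real m - \<theta>)) * x k))"
      using wt_pos[OF n, of m k]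
      by (simp add: norm_mult abs_of_pos mult_right_mono norm_power mult.assoc[symmetric]
          flip: of_real_power of_real_mult)
  qed simp
  then show ?thesis by blast
qed

lemma energy_h_m: "energy_le x B \<Longrightarrow> \<exists>B'. l2_le (\<lambda>k. of_real (br k powr real m) * x k) B'"
proof -
  assume B: "energy_le x B"
  define c where "c = sqrt (2 ^ (2 * m) * (1 + real n))"
  have "l2_le (\<lambda>k. of_real (br k powr real m) * x k) (norm (of_real c :: complex) * B)"
  proof (rule l2_le_mono[OF l2_le_cmult[OF B[unfolded energy_le_def]]])
    fix k
    have "br k ^ (2 * m) = (br k ^ m)\<^sup>2" unfolding power_mult[symmetric] by (simp add: mult.commute)
    then have "br k powr real m = sqrt (br k ^ (2 * m))" by (simp add: powr_realpow)
    also have "\<dots> \<le> sqrt (2 ^ (2 * m) * (1 + real n) * wt m n k)" using wt_lower[OF m n] by simp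
    also have "\<dots> = c * sqrt (wt m n k)" by (simp add: c_def real_sqrt_mult)
    finally have "br k powr real m \<le> c * sqrt (wt m n k)" .
    then show "norm (of_real (br k powr real m) * x k) \<le> norm (of_real c * (of_real (sqrt (wt m n k)) * x k))"
      using wt_pos[OF n, of m k]
      by (simp add: norm_mult abs_of_pos c_def mult_right_mono mult.assoc[symmetric])
  qed simp
  then show ?thesis by blast
qed

text \<open>A regularity argument. A graph has finite energy, hence order \<open>m\<close>, and so
  has its image under D + V, which is the graph over \<open>Top u\<close>. Since V maps it to order
  \<open>- \<theta>\<close>, so does D; dividing by 1 + D raises the order to
  \<open>2 * real m - \<theta>\<close>.\<close>

lemma dom_graph: "dom (graph u)"
proof -
  have "\<exists>B'. l2_le (\<lambda>k. of_real (br k powr real m) * graph w k) B'" for w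
    using energy_h_m[of "graph w"] energy_le_graph[of w] by blast
  from this[of u] this[of "Top u"]
  obtain C1 C2 where C: "l2_le (\<lambda>k. of_real (br k powr real m) * graph u k) C1"
    "l2_le (\<lambda>k. of_real (br k powr real m) * graph (Top u) k) C2" by blast
  have weak: "l2_le (\<lambda>k. of_real (br k powr (- \<theta>)) * x k) B" if "l2_le (\<lambda>k. of_real (br k powr real m) * x k) B"
    for x :: "int \<Rightarrow> complex" and B
    by (rule l2_le_mono[OF that]) (use \<theta> in \<open>auto simp: norm_mult intro!: mult_right_mono powr_mono\<close>)
  have "\<theta> \<le> real m" using \<theta> by simp
  from convolution_bound[OF m \<theta>(1) this v C(1)]
  obtain C3 where C3: "l2_le (\<lambda>k. of_real (br k powr (- \<theta>)) * (\<Sum>\<^sub>\<infinity>j. v (k - j) * graph u j)) C3" by blast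
  have "l2_le (\<lambda>k. of_real (4 ^ m) * (of_real (br k powr (- \<theta>)) * graph (Top u) k + of_real (br k powr (- \<theta>)) * graph u k
        - of_real (br k powr (- \<theta>)) * (\<Sum>\<^sub>\<infinity>j. v (k - j) * graph u j))) (norm (of_real (4 ^ m) :: complex) * (C2 + C1 + C3))"
    by (intro l2_le_cmult l2_le_diff l2_le_add weak C C3)
  then have "l2_le (\<lambda>k. of_real (br k powr (2 * real m - \<theta>)) * graph u k) (norm (of_real (4 ^ m) :: complex) * (C2 + C1 + C3))"
  proof (rule l2_le_mono)
    fix k
    have d0: "0 \<le> diag m k" by (simp add: diag_abs)
    have eq: "of_real (br k powr (- \<theta>)) * graph (Top u) k + of_real (br k powr (- \<theta>)) * graph u k
        - of_real (br k powr (- \<theta>)) * (\<Sum>\<^sub>\<infinity>j. v (k - j) * graph u j)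
        = of_real (br k powr (- \<theta>)) * (of_real (1 + diag m k) * graph u k)"
      unfolding Lop_graph[symmetric] by (simp add: Lop_def algebra_simps)
    have "br k powr (2 * real m - \<theta>) = br k ^ (2 * m) * br k powr (- \<theta>)"
      using powr_realpow[of "br k" "2 * m"] by (simp add: powr_diff powr_minus divide_inverse)
    also have "\<dots> \<le> 4 ^ m * (1 + diag m k) * br k powr (- \<theta>)"
      by (intro mult_right_mono br_power_le_diag) auto
    finally have "br k powr (2 * real m - \<theta>) * norm (graph u k)
        \<le> 4 ^ m * (1 + diag m k) * br k powr (- \<theta>) * norm (graph u k)"
      by (rule mult_right_mono) simp
    then show "norm (of_real (br k powr (2 * real m - \<theta>)) * graph u k)
      \<le> norm (of_real (4 ^ m) * (of_real (br k powr (- \<theta>)) * graph (Top u) k + of_real (br k powr (- \<theta>)) * graph u k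
        - of_real (br k powr (- \<theta>)) * (\<Sum>\<^sub>\<infinity>j. v (k - j) * graph u j)))"
      unfolding eq norm_mult norm_of_real using d0 by (simp add: mult_ac)
  qed simp
  then show ?thesis by (auto simp: dom_def)
qed

definition supp :: "(int \<Rightarrow> complex) set" where
  "supp = {u. \<forall>k. k \<notin> P \<longrightarrow> u k = 0}"

definition unit_vec :: "int \<Rightarrow> int \<Rightarrow> complex" where
  "unit_vec i = (\<lambda>k. if k = i then 1 else 0)"

lemma supp_span: "supp \<subseteq> seqs.span (unit_vec ` P)"
proof
  fix u assume u: "u \<in> supp"
  have fs: "(\<Sum>i\<in>A. f i) k = (\<Sum>i\<in>A. f i k)" for A k and f :: "int \<Rightarrow> int \<Rightarrow> complex"
    by (induction A rule: infinite_finite_induct) auto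
  have "u = (\<Sum>i\<in>P. sscale (u i) (unit_vec i))"
  proof
    fix k
    show "u k = (\<Sum>i\<in>P. sscale (u i) (unit_vec i)) k"
      using u finite_P by (auto simp: fs sscale_def unit_vec_def supp_def if_distrib cong: if_cong)
  qed
  also have "\<dots> \<in> seqs.span (unit_vec ` P)"
    by (intro seqs.span_sum seqs.span_scale seqs.span_base) auto
  finally show "u \<in> seqs.span (unit_vec ` P)" .
qed

lemma subspace_supp: "seqs.subspace supp"
  by (rule seqs.subspaceI) (auto simp: supp_def sscale_def)

lemma unit_vec_supp: "i \<in> P \<Longrightarrow> unit_vec i \<in> supp"
  by (auto simp: unit_vec_def supp_def)

lemma dim_supp: "seqs.dim supp = card P"
proof (rule seqs.dim_unique)
  show "unit_vec ` P \<subseteq> supp" using unit_vec_supp by blast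
  have inj: "inj_on unit_vec P" by (auto simp: inj_on_def unit_vec_def fun_eq_iff split: if_splits)
  show "card (unit_vec ` P) = card P" using card_image[OF inj] .
  have fs: "(\<Sum>i\<in>A. f i) k = (\<Sum>i\<in>A. f i k)" for A k and f :: "int \<Rightarrow> int \<Rightarrow> complex"
    by (induction A rule: infinite_finite_induct) auto
  show "\<not> seqs.dependent (unit_vec ` P)"
  proof
    assume "seqs.dependent (unit_vec ` P)"
    then obtain c where c: "\<exists>w\<in>unit_vec ` P. c w \<noteq> 0" "(\<Sum>w\<in>unit_vec ` P. sscale (c w) w) = 0"
      using finite_P by (auto simp: seqs.dependent_finite)
    from c(2) have "(\<Sum>i\<in>P. sscale (c (unit_vec i)) (unit_vec i)) = 0"
      by (subst (asm) sum.reindex[OF inj]) simp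
    then have z: "(\<Sum>i\<in>P. sscale (c (unit_vec i)) (unit_vec i)) k = 0" for k by simp
    have d: "(\<Sum>i\<in>P. sscale (c (unit_vec i)) (unit_vec i)) k = (\<Sum>i\<in>P. if k = i then c (unit_vec i) else 0)" for k
      unfolding fs sscale_def by (intro sum.cong) (auto simp: unit_vec_def)
    have "c (unit_vec k) = 0" if "k \<in> P" for k
    proof -
      have "(\<Sum>i\<in>P. if k = i then c (unit_vec i) else 0) = 0" using z[of k] unfolding d .
      then show ?thesis using that finite_P by (simp only: sum.delta sum.delta' if_True)
    qed
    with c(1) show False by auto
  qed
qed (rule supp_span)

lemma Top_supp: "Top u \<in> supp"
  by (simp add: Top_def supp_def)

sublocale op: operator_on_subspace sscale Top supp "unit_vec ` P"
proof unfold_locales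
  fix x y c
  show "Top (x + y) = Top x + Top y"
    by (rule ext) (simp add: Top_def algebra_simps sum.distrib)
  show "Top (sscale c x) = sscale c (Top x)"
    by (rule ext) (simp add: Top_def sscale_def algebra_simps sum_distrib_left)
  show "Top x \<in> supp" by (rule Top_supp)
qed (use subspace_supp finite_P supp_span in auto)

end

section \<open>Passage between distributions and sequences\<close>

lemma zero_per_dist: "0 \<in> per_dist"
  using per_dist_cscale[OF dist_of(1)[of "\<lambda>_. 0" 0 0], of 0] by (simp add: cscale_def zero_fun_def)

lemma fcoeff_zero: "fcoeff 0 k = 0"
  by (simp add: fcoeff_def)

lemma subspace_per_dist: "fnl.subspace per_dist"
  by (rule fnl.subspaceI) (auto intro: zero_per_dist per_dist_plus per_dist_cscale)

interpretation fcoeff: vector_space_pair cscale sscale ..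

interpretation seq_seq: vector_space_pair sscale sscale ..

lemma linear_fcoeff: "Vector_Spaces.linear cscale sscale fcoeff"
  by unfold_locales (auto simp: fun_eq_iff fcoeff_plus fcoeff_cscale sscale_def)

lemma inj_on_fcoeff: "inj_on fcoeff per_dist"
proof (rule inj_onI)
  fix u w assume "u \<in> per_dist" "w \<in> per_dist" and eq: "fcoeff u = fcoeff w"
  show "u = w" by (rule fcoeff_inject) (simp_all add: eq \<open>u \<in> per_dist\<close> \<open>w \<in> per_dist\<close>)
qed

context mode_block
begin

text \<open>The graph map turns T - z into D + V - z, so it carries root vectors to root vectors of
  the same order.\<close>

lemma residual_graph: "(\<lambda>k. Lop (graph u) k - z * graph u k) = graph (op.shift z u)"
proof
  fix k
  have "op.shift z u = (\<lambda>j. Top u j - (\<lambda>j. z * u j) j)" by (simp add: op.shift_def sscale_def fun_eq_iff)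
  then show "Lop (graph u) k - z * graph u k = graph (op.shift z u) k"
    by (simp only: graph_diff graph_cmult Lop_graph)
qed

lemma graph_zero: "graph 0 = (\<lambda>_. 0)"
  by (auto simp: graph_def)

lemma graph_kerp: "u \<in> supp \<Longrightarrow> (op.shift z ^^ p) u = 0 \<Longrightarrow> graph u \<in> kerp z p"
proof (induction p arbitrary: u)
  case 0
  then have "u = 0" by (simp only: funpow.simps id_apply)
  then show ?case by (simp only: graph_zero kerp.simps singleton_iff)
next
  case (Suc p)
  have "(op.shift z ^^ p) (op.shift z u) = 0" using Suc.prems(2) by (simp only: funpow_Suc_right o_apply)
  from Suc.IH[OF op.shift_E[OF Suc.prems(1)] this] show ?case
    by (simp add: dom_graph residual_graph)
qed

lemma graph_inj: "u \<in> supp \<Longrightarrow> w \<in> supp \<Longrightarrow> graph u = graph w \<Longrightarrow> u = w"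
proof
  fix k assume *: "u \<in> supp" "w \<in> supp" "graph u = graph w"
  show "u k = w k"
  proof (cases "k \<in> P")
    case True
    then show ?thesis using fun_cong[OF *(3), of k] by (simp add: graph_def)
  qed (use * in \<open>auto simp: supp_def\<close>)
qed

text \<open>Induction on the order: the residual of a generalized eigenvector lies in the graph by
  induction, and \<open>in_graph_if_residual_in_graph\<close> pulls the vector itself into it. Hence
  restriction to the graph loses nothing of the root space when \<open>z\<close> is far from the
  diagonal entries outside \<open>P\<close>.\<close>

lemma kerp_graph:
  assumes far: "\<And>k. k \<notin> P \<Longrightarrow> wt m n k \<le> cmod (of_real (diag m k) - z)"
  shows "x \<in> kerp z p \<Longrightarrow> \<exists>u\<in>supp. x = graph u \<and> (op.shift z ^^ p) u = 0"
proof (induction p arbitrary: x)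
  case 0
  then have "x = graph 0" by (simp only: graph_zero kerp.simps singleton_iff)
  moreover have "(op.shift z ^^ 0) 0 = 0" by (simp only: funpow.simps id_apply)
  ultimately show ?case using seqs.subspace_0[OF subspace_supp] by blast
next
  case (Suc p)
  have x: "dom x" "(\<lambda>k. Lop x k - z * x k) \<in> kerp z p" using Suc.prems by simp_all
  from Suc.IH[OF x(2)] obtain u' where u': "u' \<in> supp" "(\<lambda>k. Lop x k - z * x k) = graph u'"
    "(op.shift z ^^ p) u' = 0" by (elim bexE conjE)
  obtain B where B: "energy_le x B" using dom_energy[OF x(1)] by blast
  have res: "Lop x k - z * x k = graph u' k" for k using fun_cong[OF u'(2), of k] .
  have xg: "x = graph x"
    by (rule in_graph_if_residual_in_graph[OF B]) (rule res, rule far)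
  define u where "u k = (if k \<in> P then x k else 0)" for k
  have u: "u \<in> supp" by (simp add: u_def supp_def)
  have "graph x k = graph u k" for k by (simp add: graph_def u_def)
  then have "graph x = graph u" by (rule ext)
  then have xu: "x = graph u" by (rule trans[OF xg])
  have "graph (op.shift z u) = graph u'" unfolding residual_graph[of u z, symmetric] xu[symmetric] by (rule u'(2))
  then have "op.shift z u = u'" by (rule graph_inj[OF op.shift_E[OF u] u'(1)])
  then have "(op.shift z ^^ Suc p) u = 0" using u'(3) by (simp only: funpow_Suc_right o_apply)
  with xu show ?case by (intro bexI[OF _ u] conjI)
qed

text \<open>The last nonzero iterate of T - z on a root vector is an eigenvector.\<close>

lemma eigenvector_of_root:
  assumes "b \<in> op.root z" "b \<noteq> 0"
  shows "\<exists>u\<in>supp. u \<noteq> 0 \<and> (\<forall>i. Top u i = z * u i)"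
proof -
  obtain N where N: "(op.shift z ^^ N) b = 0" "b \<in> supp" using assms by (auto simp: op.root_def)
  define p where "p = (LEAST p. (op.shift z ^^ p) b = 0)"
  have p: "(op.shift z ^^ p) b = 0" unfolding p_def by (rule LeastI[of _ N]) (rule N)
  then have "p \<noteq> 0" using assms(2) by (cases p) auto
  then obtain q where q: "p = Suc q" by (cases p) auto
  have "(op.shift z ^^ q) b \<noteq> 0" using not_less_Least[of q "\<lambda>p. (op.shift z ^^ p) b = 0"] q by (auto simp: p_def)
  moreover have "op.shift z ((op.shift z ^^ q) b) = 0" using p q by simp
  then have "Top ((op.shift z ^^ q) b) i = z * (op.shift z ^^ q) b i" for i
    by (simp add: op.shift_def sscale_def fun_eq_iff)
  moreover have "(op.shift z ^^ q) b \<in> supp" by (rule op.funpow_shift_E[OF N(2)])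
  ultimately show ?thesis by blast
qed

lemma root_near_diagonal:
  assumes "b \<in> op.root z" "b \<noteq> 0"
  shows "\<exists>j\<in>P. cmod (of_real (diag m j) - z) < wt m n j"
proof -
  obtain u where u: "u \<in> supp" "u \<noteq> 0" "\<And>i. Top u i = z * u i" using eigenvector_of_root[OF assms] by blast
  show ?thesis
    by (rule eigenvalue_near_diagonal[OF u(3)]) (use u(1,2) in \<open>auto simp: supp_def zero_fun_def\<close>)
qed

context
  fixes V :: functional and \<alpha> :: real
  assumes V: "V \<in> per_dist" and v_eq: "v = fcoeff V" and \<theta>_eq: "\<theta> = real m * \<alpha>"
begin

lemma L_dom_iff: "f \<in> L_dom m \<alpha> \<longleftrightarrow> f \<in> per_dist \<and> dom (fcoeff f)"
proof -
  have "real m * (2 - \<alpha>) = 2 * real m - \<theta>" by (simp add: \<theta>_eq algebra_simps)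
  then show ?thesis by (simp add: L_dom_def Hper_iff dom_def)
qed

lemma L_op_seq:
  assumes "f \<in> per_dist" "dom (fcoeff f)"
  shows "L_op m V f \<in> per_dist" "fcoeff (L_op m V f) = Lop (fcoeff f)"
proof -
  obtain B where "energy_le (fcoeff f) B" using dom_energy[OF assms(2)] by blast
  then obtain B' where "l2_le (\<lambda>k. of_real (br k powr real m) * fcoeff f k) B'" using energy_h_m by blast
  moreover have "\<theta> \<le> real m" using \<theta> by simp
  ultimately obtain C where C: "l2_le (\<lambda>k. of_real (br k powr (- \<theta>)) * (\<Sum>\<^sub>\<infinity>j. v (k - j) * fcoeff f j)) C"
    using convolution_bound[OF m \<theta>(1) _ v] by blast
  have bound: "cmod (\<Sum>\<^sub>\<infinity>j. fcoeff V (k - j) * fcoeff f j) \<le> C * br k ^ m" for k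
  proof -
    have "cmod (\<Sum>\<^sub>\<infinity>j. v (k - j) * fcoeff f j)
        = br k powr \<theta> * norm (of_real (br k powr (- \<theta>)) * (\<Sum>\<^sub>\<infinity>j. v (k - j) * fcoeff f j))"
      by (simp add: norm_mult powr_minus norm_inverse)
    also have "\<dots> \<le> br k powr \<theta> * C" by (intro mult_left_mono l2_le_point[OF C]) auto
    also have "\<dots> \<le> br k powr real m * C"
      using \<theta> l2_le_nonneg[OF C] by (intro mult_right_mono powr_mono) auto
    finally show ?thesis by (simp add: v_eq powr_realpow mult.commute)
  qed
  show "L_op m V f \<in> per_dist" by (rule L_op(1)[OF assms(1) bound])
  show "fcoeff (L_op m V f) = Lop (fcoeff f)"
    unfolding fun_eq_iff L_op(2)[OF assms(1) bound] Lop_def diag_def by (simp add: v_eq)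
qed

lemma ker_pow_iff: "f \<in> ker_pow m \<alpha> V z p \<longleftrightarrow> f \<in> per_dist \<and> fcoeff f \<in> kerp z p"
proof (induction p arbitrary: f)
  case 0
  have "f = 0" if "f \<in> per_dist" "fcoeff f = (\<lambda>_. 0)"
    by (rule fcoeff_inject[OF that(1) zero_per_dist]) (simp only: that fcoeff_zero)
  moreover have "fcoeff 0 = (\<lambda>_. 0)" by (rule ext) (rule fcoeff_zero)
  ultimately show ?case unfolding ker_pow.simps kerp.simps singleton_iff using zero_per_dist by blast
next
  case (Suc p)
  have "L_op m V f - cscale z f \<in> ker_pow m \<alpha> V z p \<longleftrightarrow> (\<lambda>k. Lop (fcoeff f) k - z * fcoeff f k) \<in> kerp z p"
    if f: "f \<in> per_dist" "dom (fcoeff f)"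
  proof -
    have "L_op m V f - cscale z f \<in> per_dist"
      by (intro per_dist_minus per_dist_cscale L_op_seq f)
    moreover have "fcoeff (L_op m V f - cscale z f) = (\<lambda>k. Lop (fcoeff f) k - z * fcoeff f k)"
      by (simp only: fun_eq_iff fcoeff_minus fcoeff_cscale L_op_seq[OF f]) simp
    ultimately show ?thesis by (simp only: Suc.IH simp_thms)
  qed
  then show ?case unfolding ker_pow.simps kerp.simps mem_Collect_eq L_dom_iff by blast
qed

text \<open>The inclusion from right to left needs a distribution with given coefficients; it exists
  because sequences in the domain are bounded.\<close>

lemma fcoeff_root_space: "fcoeff ` root_space m \<alpha> V z = (\<Union>p. kerp z p)"
proof
  show "fcoeff ` root_space m \<alpha> V z \<subseteq> (\<Union>p. kerp z p)"
    by (auto simp: root_space_def ker_pow_iff)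
  show "(\<Union>p. kerp z p) \<subseteq> fcoeff ` root_space m \<alpha> V z"
  proof
    fix x assume "x \<in> (\<Union>p. kerp z p)"
    then obtain p where p: "x \<in> kerp z p" by blast
    have "\<exists>B. \<forall>k. cmod (x k) \<le> B * br k ^ 0"
    proof (cases p)
      case 0
      then show ?thesis using p by (intro exI[of _ 0]) simp
    next
      case (Suc q)
      then obtain B where B: "l2_le (\<lambda>k. of_real (br k powr (2 * real m - \<theta>)) * x k) B"
        using p by (auto simp: dom_def)
      have "cmod (x k) \<le> B" for k
      proof -
        have "1 \<le> br k powr (2 * real m - \<theta>)" using \<theta> by (intro ge_one_powr_ge_zero) auto
        from mult_right_mono[OF this, of "cmod (x k)"] l2_le_point[OF B, of k]
        show ?thesis by (simp add: norm_mult)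
      qed
      then show ?thesis by auto
    qed
    then obtain B where B: "\<And>k. cmod (x k) \<le> B * br k ^ 0" by blast
    from dist_of[OF B] have "dist_of x \<in> per_dist" "fcoeff (dist_of x) = x" by auto
    then show "x \<in> fcoeff ` root_space m \<alpha> V z"
      using p by (intro image_eqI[of _ _ "dist_of x"]) (auto simp: root_space_def ker_pow_iff)
  qed
qed

lemma linear_graph: "Vector_Spaces.linear sscale sscale graph"
proof unfold_locales
  fix x y c
  show "graph (x + y) = graph x + graph y"
    by (auto simp: graph_def fun_eq_iff distrib_left sum.distrib)
  show "graph (sscale c x) = sscale c (graph x)"
    by (auto simp: graph_def fun_eq_iff sscale_def sum_distrib_left mult_ac)
qed

text \<open>Two injective linear maps are composed: \<open>fcoeff\<close> carries the root space of
  the operator to that of sequences, and the graph map carries the root space of the matrix onto the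
  same set. So the algebraic multiplicities agree.\<close>

lemma dim_root_space:
  assumes far: "\<And>k. k \<notin> P \<Longrightarrow> wt m n k \<le> cmod (of_real (diag m k) - z)"
  shows "fnl.dim (root_space m \<alpha> V z) = seqs.dim (op.root z)"
proof -
  have "root_space m \<alpha> V z \<subseteq> per_dist" by (auto simp: root_space_def ker_pow_iff)
  then have "fnl.span (root_space m \<alpha> V z) \<subseteq> per_dist"
    by (rule fnl.span_minimal[OF _ subspace_per_dist])
  then have "inj_on fcoeff (fnl.span (root_space m \<alpha> V z))"
    by (rule inj_on_subset[OF inj_on_fcoeff])
  from fcoeff.dim_injective_image[OF linear_fcoeff this]
  have "fnl.dim (root_space m \<alpha> V z) = seqs.dim (\<Union>p. kerp z p)" by (simp add: fcoeff_root_space)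
  also have "(\<Union>p. kerp z p) = graph ` op.root z"
    using kerp_graph[OF far] graph_kerp by (fastforce simp: op.root_def)
  also have "seqs.dim (graph ` op.root z) = seqs.dim (op.root z)"
  proof (rule seq_seq.dim_injective_image[OF linear_graph])
    have "seqs.span (op.root z) \<subseteq> supp"
      by (rule seqs.span_minimal[OF _ subspace_supp]) (auto simp: op.root_def)
    then show "inj_on graph (seqs.span (op.root z))"
      by (intro inj_onI) (auto intro: graph_inj)
  qed
  finally show ?thesis .
qed

text \<open>By the Gershgorin bound, \<open>near\<close> puts all eigenvalues of the reduced matrix
  into \<open>S\<close>, and \<open>far\<close> makes the multiplicities agree on \<open>S\<close>.
  Hence the eigenvalues of the operator in \<open>S\<close> and those of the matrix agree as
  multisets.\<close>

lemma eigenvalue_transfer: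
  assumes ev: "ordered_eigenvalues m \<alpha> V ev"
    and far: "\<And>z k. z \<in> S \<Longrightarrow> k \<notin> P \<Longrightarrow> wt m n k \<le> cmod (of_real (diag m k) - z)"
    and near: "\<And>z j. j \<in> P \<Longrightarrow> cmod (of_real (diag m j) - z) < wt m n j \<Longrightarrow> z \<in> S"
    and fin: "finite {k. ev k \<in> S}"
  obtains B \<zeta> where "finite B" "card B = card P" "seqs.independent B" "seqs.span B = supp"
    "\<And>b. b \<in> B \<Longrightarrow> b \<in> op.root (\<zeta> b)" "\<And>b. b \<in> B \<Longrightarrow> b \<noteq> 0"
    "\<And>f :: complex \<Rightarrow> complex. (\<Sum>k\<in>{k. ev k \<in> S}. f (ev k)) = (\<Sum>b\<in>B. f (\<zeta> b))"
    "card {k. ev k \<in> S} = card P"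
    "\<And>k. ev k \<in> S \<Longrightarrow> \<exists>b\<in>B. ev k = \<zeta> b"
proof -
  obtain B \<zeta> where B: "finite B" "seqs.independent B" "seqs.span B = supp"
    "\<And>b. b \<in> B \<Longrightarrow> b \<in> op.root (\<zeta> b)" "\<And>z. seqs.dim (op.root z) = card {b \<in> B. \<zeta> b = z}"
  proof -
    show thesis by (rule op.root_basis) (rule that; assumption)
  qed
  have cardB: "card B = card P" using dim_supp seqs.dim_span_eq_card_independent[OF B(2)] B(3) by simp
  have nz: "b \<noteq> 0" if "b \<in> B" for b using B(2) that seqs.dependent_zero by blast
  have S: "\<zeta> b \<in> S" if b: "b \<in> B" for b
  proof -
    obtain j where "j \<in> P" "cmod (of_real (diag m j) - \<zeta> b) < wt m n j"
      using root_near_diagonal[OF B(4)[OF b] nz[OF b]] by blast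
    then show ?thesis by (rule near)
  qed
  define I where "I = {k. ev k \<in> S}"
  have mult: "card {k \<in> I. ev k = z} = card {b \<in> B. \<zeta> b = z}" for z
  proof (cases "z \<in> S")
    case True
    have "card {k. ev k = z} = fnl.dim (root_space m \<alpha> V z)" using ev by (simp add: ordered_eigenvalues_def)
    also have "\<dots> = card {b \<in> B. \<zeta> b = z}" using dim_root_space[OF far[OF True]] B(5) by simp
    also have "{k. ev k = z} = {k \<in> I. ev k = z}" using True by (auto simp: I_def)
    finally show ?thesis .
  next
    case False
    then have e: "{k \<in> I. ev k = z} = {}" "{b \<in> B. \<zeta> b = z} = {}" using S by (auto simp: I_def)
    show ?thesis unfolding e by simp
  qed
  have img: "ev ` I = \<zeta> ` B"
  proof -
    have "z \<in> ev ` I \<longleftrightarrow> {k \<in> I. ev k = z} \<noteq> {}" for z by auto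
    moreover have "z \<in> \<zeta> ` B \<longleftrightarrow> {b \<in> B. \<zeta> b = z} \<noteq> {}" for z by auto
    moreover have "{k \<in> I. ev k = z} \<noteq> {} \<longleftrightarrow> {b \<in> B. \<zeta> b = z} \<noteq> {}" for z
    proof -
      have f: "finite {k \<in> I. ev k = z}" "finite {b \<in> B. \<zeta> b = z}" using fin B(1) by (simp_all add: I_def)
      from card_0_eq[OF f(1)] card_0_eq[OF f(2)] show ?thesis using mult[of z] by argo
    qed
    ultimately show ?thesis by blast
  qed
  \<comment> \<open>Sums of an arbitrary function express equality of multisets. The function 1
    gives the count; the identity and the square will give trace and discriminant.\<close>
  have sums: "(\<Sum>k\<in>I. f (ev k)) = (\<Sum>b\<in>B. f (\<zeta> b))" for f :: "complex \<Rightarrow> complex"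
  proof -
    have "(\<Sum>k\<in>I. f (ev k)) = (\<Sum>z\<in>ev ` I. \<Sum>k\<in>{k \<in> I. ev k = z}. f (ev k))"
      by (rule sum.image_gen) (use fin in \<open>simp add: I_def\<close>)
    also have "\<dots> = (\<Sum>z\<in>ev ` I. of_nat (card {k \<in> I. ev k = z}) * f z)" by (intro sum.cong) auto
    also have "\<dots> = (\<Sum>z\<in>\<zeta> ` B. of_nat (card {b \<in> B. \<zeta> b = z}) * f z)" unfolding img mult ..
    also have "\<dots> = (\<Sum>z\<in>\<zeta> ` B. \<Sum>b\<in>{b \<in> B. \<zeta> b = z}. f (\<zeta> b))" by (intro sum.cong) auto
    also have "\<dots> = (\<Sum>b\<in>B. f (\<zeta> b))" by (rule sum.image_gen[symmetric, OF B(1)])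
    finally show ?thesis .
  qed
  have card: "card I = card P"
  proof -
    have "complex_of_nat (card I) = of_nat (card B)" using sums[of "\<lambda>_. 1"] by simp
    then show ?thesis using cardB by simp
  qed
  have ex: "\<exists>b\<in>B. ev k = \<zeta> b" if "ev k \<in> S" for k using img that by (auto simp: I_def)
  show thesis
    by (rule that[of B \<zeta>]) (fact B cardB nz ex sums[unfolded I_def] card[unfolded I_def])+
qed

end

end

section \<open>Localization of the eigenvalues\<close>

lemma diag_minus [simp]: "diag m (- k) = diag m k"
  by (simp add: diag_abs)

lemma wt_minus [simp]: "wt m n (- k) = wt m n k"
  by (simp add: wt_def)

lemma mode_block_interval:
  assumes "1 \<le> m" "1 \<le> n" "0 \<le> \<theta>" "\<theta> < real m" "l2_le (\<lambda>k. of_real (br k powr (- \<theta>)) * v k) R"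
    and "l2_le (\<lambda>(k, j). v (k - j) / of_real (sqrt (wt m n k * wt m n j))) e" "e \<le> 1 / 8"
  shows "mode_block {- int n..int n} m n v e \<theta> R"
proof unfold_locales
  fix k j assume "k \<notin> {- int n..int n}" "j \<in> {- int n..int n}"
  then have "\<bar>j\<bar> \<le> int n" "int n < \<bar>k\<bar>" by auto
  from gap_block[OF assms(1) this] show "wt m n k + wt m n j \<le> \<bar>diag m k - diag m j\<bar>" by linarith
qed (use assms wt_pos in auto)

lemma mode_block_pair:
  assumes "1 \<le> m" "1 \<le> n" "0 \<le> \<theta>" "\<theta> < real m" "l2_le (\<lambda>k. of_real (br k powr (- \<theta>)) * v k) R"
    and "l2_le (\<lambda>(k, j). v (k - j) / of_real (sqrt (wt m n k * wt m n j))) e" "e \<le> 1 / 8"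
  shows "mode_block {int n, - int n} m n v e \<theta> R"
proof unfold_locales
  fix k j assume "k \<notin> {int n, - int n}" "j \<in> {int n, - int n}"
  then have "\<bar>k\<bar> \<noteq> int n" "diag m j = diag m (int n)" "wt m n j = wt m n (int n)" by auto
  with gap_pair[OF assms(1,2), of k] show "wt m n k + wt m n j \<le> \<bar>diag m k - diag m j\<bar>" by simp
qed (use assms wt_pos in auto)

lemma ordered_eigenvalues_mono:
  assumes "ordered_eigenvalues m \<alpha> V ev" "k \<le> l"
  shows "Re (ev k) \<le> Re (ev l)"
  by (rule lift_Suc_mono_le[of "\<lambda>k. Re (ev k)", OF _ assms(2)])
     (use assms(1) in \<open>auto simp: ordered_eigenvalues_def intro: less_imp_le\<close>)

lemma finite_eigenvalues_le:
  assumes "ordered_eigenvalues m \<alpha> V ev"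
  shows "finite {k. Re (ev k) \<le> c}"
proof -
  have "filterlim (\<lambda>k. Re (ev k)) at_top sequentially" using assms by (simp add: ordered_eigenvalues_def)
  then have "\<forall>\<^sub>F k in sequentially. c + 1 \<le> Re (ev k)" by (simp add: filterlim_at_top)
  then obtain K where "\<And>k. K \<le> k \<Longrightarrow> c + 1 \<le> Re (ev k)" by (auto simp: eventually_sequentially)
  then have "{k. Re (ev k) \<le> c} \<subseteq> {..<K}" by (force simp: not_le[symmetric])
  then show ?thesis using finite_subset by blast
qed

lemma down_closed_eq_lessThan:
  fixes S :: "nat set"
  assumes "finite S" "\<And>k l. l \<in> S \<Longrightarrow> k \<le> l \<Longrightarrow> k \<in> S"
  shows "S = {..<card S}"
proof -
  obtain N where N: "S = {..<N}"
  proof (cases "S = {}")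
    case True
    then show thesis using that[of 0] by simp
  next
    case False
    then have "S = {..Max S}" using assms(2)[OF Max_in[OF assms(1) False]] Max_ge[OF assms(1)] by auto
    then show thesis using that[of "Suc (Max S)"] by (simp add: lessThan_Suc_atMost)
  qed
  show ?thesis by (simp add: N)
qed

context mode_block
begin

text \<open>The half plane left of \<open>cut m n\<close> contains the discs about the levels up to
  \<open>n\<close> and keeps away from the higher levels. The ordering by real parts turns the count
  into an initial segment of indices. The bound on the modulus will serve the finitely many indices
  below the threshold.\<close>

lemma eigenvalue_count:
  assumes V: "V \<in> per_dist" "v = fcoeff V" "\<theta> = real m * \<alpha>" and P: "P = {- int n..int n}"
    and ev: "ordered_eigenvalues m \<alpha> V ev"
  shows "{k. Re (ev k) \<le> cut m n} = {..<2 * n + 1}"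
    and "k < 2 * n + 1 \<Longrightarrow> cmod (ev k) \<le> diag m (int n) + real n ^ (2 * m - 1) * (1 + real n)"
proof -
  define S where "S = {z. Re z \<le> cut m n}"
  have fin: "finite {k. ev k \<in> S}" using finite_eigenvalues_le[OF ev] by (simp add: S_def)
  obtain B \<zeta> where B: "\<And>b. b \<in> B \<Longrightarrow> b \<in> op.root (\<zeta> b)" "\<And>b. b \<in> B \<Longrightarrow> b \<noteq> 0"
    "card {k. ev k \<in> S} = card P" "\<And>k. ev k \<in> S \<Longrightarrow> \<exists>b\<in>B. ev k = \<zeta> b"
  proof (rule eigenvalue_transfer[OF V ev _ _ fin])
    fix z k assume "z \<in> S" "k \<notin> P"
    then show "wt m n k \<le> cmod (of_real (diag m k) - z)"
      by (intro far_outside m) (auto simp: S_def P)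
  next
    fix z j assume "j \<in> P" "cmod (of_real (diag m j) - z) < wt m n j"
    then show "z \<in> S" using far_inside[OF m, of j n z] by (force simp: S_def P)
  qed (rule that; assumption)
  have S: "{k. ev k \<in> S} = {k. Re (ev k) \<le> cut m n}" by (simp add: S_def)
  have "{k. Re (ev k) \<le> cut m n} = {..<card {k. Re (ev k) \<le> cut m n}}"
    by (rule down_closed_eq_lessThan)
       (use finite_eigenvalues_le[OF ev] ordered_eigenvalues_mono[OF ev] order_trans in blast)+
  also have "card {k. Re (ev k) \<le> cut m n} = card P" using B(3) unfolding S .
  also have "card P = 2 * n + 1" by (simp add: P)
  finally show count: "{k. Re (ev k) \<le> cut m n} = {..<2 * n + 1}" .
  show "cmod (ev k) \<le> diag m (int n) + real n ^ (2 * m - 1) * (1 + real n)" if "k < 2 * n + 1"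
  proof -
    have "ev k \<in> S" using that count by (auto simp: S_def)
    then obtain b where b: "b \<in> B" "ev k = \<zeta> b" using B(4) by blast
    from root_near_diagonal[OF B(1)[OF b(1)] B(2)[OF b(1)]]
    obtain j where j: "j \<in> P" "cmod (of_real (diag m j) - ev k) < wt m n j" by (auto simp: b(2))
    have jn: "\<bar>j\<bar> \<le> int n" using j(1) by (auto simp: P)
    then have jr: "\<bar>real_of_int j\<bar> \<le> real n" by linarith
    have d: "diag m j \<le> diag m (int n)" by (rule diag_mono) (use jn in simp)
    have d0: "0 \<le> diag m j" by (simp add: diag_abs)
    have "wt m n j \<le> real n ^ (2 * m - 1) * (1 + real n)"
      unfolding wt_def using jr by (intro mult_mono power_mono) (auto simp: max_absorb1)
    moreover have "cmod (ev k) \<le> cmod (of_real (diag m j)) + cmod (of_real (diag m j) - ev k)"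
      using norm_triangle_ineq4[of "of_real (diag m j)" "of_real (diag m j) - ev k"] by simp
    ultimately show ?thesis using j(2) d d0 by simp
  qed
qed

end

section \<open>The pair of eigenvalues near a double diagonal entry\<close>

lemma two_by_two_eigenvector:
  fixes a b c d z :: complex
  assumes "(a - z) * (d - z) = b * c"
  obtains x y where "x \<noteq> 0 \<or> y \<noteq> 0" "a * x + b * y = z * x" "c * x + d * y = z * y"
proof (cases "b = 0 \<and> a = z")
  case True
  show thesis
  proof (cases "d = z \<and> c = 0")
    case True
    then show thesis using \<open>b = 0 \<and> a = z\<close> by (intro that[of 1 0]) auto
  next
    case False
    then show thesis using \<open>b = 0 \<and> a = z\<close> by (intro that[of "d - z" "- c"]) (auto simp: algebra_simps)
  qed
next
  case False
  have "c * b + d * (z - a) = z * (z - a)" using assms by (simp add: algebra_simps)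
  then show thesis using False by (intro that[of b "z - a"]) (auto simp: algebra_simps)
qed

text \<open>The substitutions l = n - j and l = j - n lead both diagonal entries to the same sum,
  because the product of \<open>v j\<close> and \<open>v (- j)\<close> is symmetric. Therefore their
  difference is only a remainder.\<close>

lemma reindexed_diag_sum:
  assumes "1 \<le> n"
  shows "(\<Sum>\<^sub>\<infinity>l. if l \<in> {int n, - int n} then 0 else v (int n - l) * v (l - int n) / of_real (diag m l - diag m (int n)))
      = diag_sum m v n" (is "?a")
    and "(\<Sum>\<^sub>\<infinity>l. if l \<in> {int n, - int n} then 0 else v (- int n - l) * v (l - - int n) / of_real (diag m l - diag m (- int n)))
      = diag_sum m v n" (is "?b")
    and "(\<lambda>l. if l \<in> {int n, - int n} then 0 else v (int n - l) * v (l - int n) / of_real (diag m l - diag m (int n)))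
      summable_on UNIV \<Longrightarrow> (\<lambda>j. v j * v (- j) * of_real (resolvent_kernel m n j)) summable_on UNIV" (is "PROP ?c")
proof -
  have i1: "bij (\<lambda>j. int n - j)" by (rule bij_betwI[where g = "\<lambda>j. int n - j"]) auto
  have i2: "bij (\<lambda>j. j - int n)" by (rule bij_betwI[where g = "\<lambda>j. j + int n"]) auto
  have e1: "(if int n - j \<in> {int n, - int n} then 0 else v (int n - (int n - j)) * v ((int n - j) - int n)
        / of_real (diag m (int n - j) - diag m (int n))) = v j * v (- j) * of_real (resolvent_kernel m n j)" for j
    by (auto simp: resolvent_kernel_def)
  have e2: "(if j - int n \<in> {int n, - int n} then 0 else v (- int n - (j - int n)) * v ((j - int n) - - int n)
        / of_real (diag m (j - int n) - diag m (- int n))) = v j * v (- j) * of_real (resolvent_kernel m n j)" for j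
    using diag_minus[of m "int n - j"] by (auto simp: resolvent_kernel_def mult.commute)
  show ?a
    unfolding diag_sum_def e1[symmetric]
    by (rule infsum_reindex_bij_betw[OF i1, symmetric])
  show ?b
    unfolding diag_sum_def e2[symmetric]
    by (rule infsum_reindex_bij_betw[OF i2, symmetric])
  show "PROP ?c"
    unfolding e1[symmetric]
    by (subst summable_on_reindex_bij_betw[OF i1, of "\<lambda>l. if l \<in> {int n, - int n} then 0
        else v (int n - l) * v (l - int n) / of_real (diag m l - diag m (int n))"])
qed

text \<open>The counts at n - 1 and n leave exactly the indices 2 n - 1 and 2 n between the two
  cuts, and the disc of radius \<open>n ^ (2 * m - 1)\<close> about the double diagonal entry lies
  there. The formulas are trace and discriminant of the reduced matrix, with
  \<open>C_expansion\<close> for its entries.\<close>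

lemma eigenvalue_pair:
  assumes mb: "mode_block {int n, - int n} m n v e \<theta> R"
    and V: "V \<in> per_dist" "v = fcoeff V" "\<theta> = real m * \<alpha>"
    and ev: "ordered_eigenvalues m \<alpha> V ev" and n: "1 \<le> n"
    and below: "{k. Re (ev k) \<le> cut m (n - 1)} = {..<2 * (n - 1) + 1}"
    and above: "{k. Re (ev k) \<le> cut m n} = {..<2 * n + 1}"
  obtains \<rho>\<^sub>1 \<rho>\<^sub>2 \<sigma>\<^sub>1 \<sigma>\<^sub>2 where
    "tau ev n = of_real (diag m (int n)) + v 0 + (\<rho>\<^sub>1 + \<rho>\<^sub>2) / 2"
    "(gam ev n)\<^sup>2 = (\<rho>\<^sub>1 - \<rho>\<^sub>2)\<^sup>2 + 4 * ((v (2 * int n) + \<sigma>\<^sub>1) * (v (- 2 * int n) + \<sigma>\<^sub>2))"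
    "cmod (\<rho>\<^sub>1 + diag_sum m v n) \<le> real n ^ (2 * m - 1) * (5 * e ^ 3)"
    "cmod (\<rho>\<^sub>2 + diag_sum m v n) \<le> real n ^ (2 * m - 1) * (5 * e ^ 3)"
    "cmod (\<sigma>\<^sub>1 + offdiag_sum m v n) \<le> real n ^ (2 * m - 1) * (5 * e ^ 3)"
    "cmod (\<sigma>\<^sub>2 + offdiag_sum m (\<lambda>k. v (- k)) n) \<le> real n ^ (2 * m - 1) * (5 * e ^ 3)"
    "(\<lambda>j. v j * v (- j) * of_real (resolvent_kernel m n j)) summable_on UNIV"
proof -
  let ?P = "{int n, - int n}"
  interpret mode_block ?P m n v e \<theta> R by fact
  define N where "N = int n"
  define D where "D = complex_of_real (diag m N)"
  have N: "N \<noteq> - N" "- N \<noteq> N" using n by (auto simp: N_def)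
  have wtn: "wt m n N = real n ^ (2 * m - 1)" by (simp add: wt_def N_def)
  define S where "S = {z. cmod (D - z) < wt m n N}"
  \<comment> \<open>Half of the gap to either neighbouring level is at least 9/2 times the radius of
    the disc.\<close>
  have strip: "cut m (n - 1) < Re z \<and> Re z \<le> cut m n" if "z \<in> S" for z
  proof -
    have "\<bar>Re (D - z)\<bar> < real n ^ (2 * m - 1)"
      using that abs_Re_le_cmod[of "D - z"] by (simp add: S_def wtn)
    then have Re: "\<bar>diag m N - Re z\<bar> < real n ^ (2 * m - 1)" by (simp add: D_def)
    have n1: "int (n - 1) = N - 1" "1 \<le> real n" using n by (auto simp: N_def)
    have "real n ^ (2 * m - 1) * (9 * 1) \<le> diag m N - diag m (N - 1)"
      using diag_diff_lower[OF m, of "N - 1" N] n1 by (simp add: N_def)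
    moreover have "real n ^ (2 * m - 1) * (9 * 1) \<le> (real n + 1) ^ (2 * m - 1) * (9 * 1)"
      by (intro mult_right_mono power_mono) auto
    moreover have "(real n + 1) ^ (2 * m - 1) * (9 * 1) \<le> diag m (N + 1) - diag m N"
      using diag_diff_lower[OF m, of N "N + 1"] n1 by (simp add: N_def)
    moreover have "cut m (n - 1) = (diag m (N - 1) + diag m N) / 2" using n1 by (simp add: cut_def)
    moreover have "cut m n = (diag m N + diag m (N + 1)) / 2" by (simp add: cut_def N_def)
    moreover have "0 \<le> real n ^ (2 * m - 1)" by simp
    ultimately show ?thesis using Re by (simp only: abs_less_iff) (simp add: field_simps)
  qed
  have sub: "{k. ev k \<in> S} \<subseteq> {2 * n - 1, 2 * n}"
  proof
    fix k assume "k \<in> {k. ev k \<in> S}"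
    then have "k \<notin> {k. Re (ev k) \<le> cut m (n - 1)}" "k \<in> {k. Re (ev k) \<le> cut m n}"
      using strip[of "ev k"] by auto
    then show "k \<in> {2 * n - 1, 2 * n}" unfolding below above using n by auto
  qed
  have fin: "finite {k. ev k \<in> S}" by (rule finite_subset[OF sub]) simp
  obtain B \<zeta> where B: "finite B" "card B = card ?P" "seqs.span B = supp"
    "\<And>b. b \<in> B \<Longrightarrow> b \<in> op.root (\<zeta> b)" "\<And>b. b \<in> B \<Longrightarrow> b \<noteq> 0"
    "\<And>f :: complex \<Rightarrow> complex. (\<Sum>k\<in>{k. ev k \<in> S}. f (ev k)) = (\<Sum>b\<in>B. f (\<zeta> b))"
    "card {k. ev k \<in> S} = card ?P"
  proof (rule eigenvalue_transfer[OF V ev _ _ fin])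
    fix z k assume z: "z \<in> S" and k: "k \<notin> ?P"
    have "wt m n k + wt m n N \<le> \<bar>diag m k - diag m N\<bar>"
      using gap_pair[OF m n, of k] k by (auto simp: N_def abs_if split: if_splits)
    also have "\<dots> = cmod (of_real (diag m k) - D)" by (simp add: D_def flip: of_real_diff)
    also have "\<dots> \<le> cmod (of_real (diag m k) - z) + cmod (D - z)"
      using norm_triangle_ineq4[of "of_real (diag m k) - z" "D - z"] by simp
    finally show "wt m n k \<le> cmod (of_real (diag m k) - z)" using z by (simp add: S_def)
  next
    fix z j assume "j \<in> ?P" "cmod (of_real (diag m j) - z) < wt m n j"
    then show "z \<in> S" by (auto simp: S_def D_def N_def)
  qed (rule that; assumption)
  have cP: "card ?P = 2" using N by (simp add: N_def)
  have K: "{k. ev k \<in> S} = {2 * n - 1, 2 * n}"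
    by (rule card_subset_eq[OF _ sub]) (use B(7) cP n in auto)
  obtain b\<^sub>1 b\<^sub>2 where b: "B = {b\<^sub>1, b\<^sub>2}" "b\<^sub>1 \<noteq> b\<^sub>2" using B(2) cP by (auto simp: card_2_iff)
  define z\<^sub>1 z\<^sub>2 where "z\<^sub>1 = \<zeta> b\<^sub>1" and "z\<^sub>2 = \<zeta> b\<^sub>2"
  have sums: "f (ev (2 * n - 1)) + f (ev (2 * n)) = f z\<^sub>1 + f z\<^sub>2" for f :: "complex \<Rightarrow> complex"
    using B(6)[of f] b n unfolding K by (simp add: z\<^sub>1_def z\<^sub>2_def)
  define c where "c i j = C i j" for i j
  define A A' where "A = D + c N N" and "A' = D + c (- N) (- N)"
  have Top: "Top u N = A * u N + c N (- N) * u (- N)" "Top u (- N) = c (- N) N * u N + A' * u (- N)" for u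
    unfolding Top_def using N by (simp_all add: D_def A_def A'_def c_def N_def algebra_simps)
  \<comment> \<open>Some coordinate of an eigenvector is nonzero, and eliminating the other one
    shows that the determinant vanishes.\<close>
  have char: "(A - z) * (A' - z) = c N (- N) * c (- N) N" if bz: "b \<in> op.root z" "b \<noteq> 0" for b z
  proof -
    obtain u where u: "u \<in> supp" "u \<noteq> 0" "\<And>i. Top u i = z * u i" using eigenvector_of_root[OF bz] by blast
    have nz: "u N \<noteq> 0 \<or> u (- N) \<noteq> 0"
    proof (rule ccontr)
      assume "\<not> ?thesis"
      then have "u k = 0" for k using u(1) by (cases "k \<in> ?P") (auto simp: supp_def N_def)
      with u(2) show False by (auto simp: fun_eq_iff)
    qed
    have e: "(A - z) * u N = - (c N (- N) * u (- N))" "(A' - z) * u (- N) = - (c (- N) N * u N)"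
      using u(3)[of N] u(3)[of "- N"] unfolding Top by (simp_all add: algebra_simps eq_neg_iff_add_eq_0)
    have "((A - z) * (A' - z) - c N (- N) * c (- N) N) * u N = (A' - z) * ((A - z) * u N) - c N (- N) * (c (- N) N * u N)"
      by (simp add: algebra_simps)
    also have "\<dots> = c N (- N) * (- ((A' - z) * u (- N)) - c (- N) N * u N)"
      unfolding e(1) by (simp add: algebra_simps)
    also have "\<dots> = 0" unfolding e(2) by simp
    finally have 1: "((A - z) * (A' - z) - c N (- N) * c (- N) N) * u N = 0" .
    have "((A - z) * (A' - z) - c N (- N) * c (- N) N) * u (- N) = (A - z) * ((A' - z) * u (- N)) - c (- N) N * (c N (- N) * u (- N))"
      by (simp add: algebra_simps)
    also have "\<dots> = c (- N) N * (- ((A - z) * u N) - c N (- N) * u (- N))"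
      unfolding e(2) by (simp add: algebra_simps)
    also have "\<dots> = 0" unfolding e(1) by simp
    finally have 2: "((A - z) * (A' - z) - c N (- N) * c (- N) N) * u (- N) = 0" .
    from 1 2 nz show ?thesis by auto
  qed
  have z1: "(A - z\<^sub>1) * (A' - z\<^sub>1) = c N (- N) * c (- N) N"
    and z2: "(A - z\<^sub>2) * (A' - z\<^sub>2) = c N (- N) * c (- N) N"
    unfolding z\<^sub>1_def z\<^sub>2_def using char[OF B(4) B(5)] b(1) by auto
  \<comment> \<open>Distinct roots of the characteristic equation determine the trace. If they
    coincide, the other root \<open>w\<close> of that equation still has an eigenvector, while all
    of \<open>supp\<close> is the root space of \<open>z\<^sub>1\<close>; since root spaces of
    different values meet in 0, \<open>w\<close> equals \<open>z\<^sub>1\<close>.\<close>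
  have tr: "z\<^sub>1 + z\<^sub>2 = A + A'"
  proof (cases "z\<^sub>1 = z\<^sub>2")
    case False
    have "(z\<^sub>1 - z\<^sub>2) * (z\<^sub>1 + z\<^sub>2 - (A + A')) = (A - z\<^sub>1) * (A' - z\<^sub>1) - (A - z\<^sub>2) * (A' - z\<^sub>2)"
      by (simp add: algebra_simps)
    also have "\<dots> = 0" unfolding z1 z2 by simp
    finally show ?thesis using False by simp
  next
    case True
    define w where "w = A + A' - z\<^sub>1"
    have "(A - w) * (A' - w) = c N (- N) * c (- N) N" using z1 by (simp add: w_def algebra_simps)
    then obtain x y where xy: "x \<noteq> 0 \<or> y \<noteq> 0" "A * x + c N (- N) * y = w * x" "c (- N) N * x + A' * y = w * y"
      by (rule two_by_two_eigenvector)
    define u where "u k = (if k = N then x else if k = - N then y else 0)" for k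
    have uN: "u N = x" "u (- N) = y" using N by (auto simp: u_def)
    have us: "u \<in> supp" by (auto simp: u_def supp_def N_def)
    have "op.shift w u = 0"
    proof
      fix k
      consider "k = N" | "k = - N" | "k \<notin> ?P" by (auto simp: N_def)
      then show "op.shift w u k = 0 k"
      proof cases
        case 3
        then show ?thesis by (auto simp: op.shift_def sscale_def Top_def u_def N_def)
      qed (use xy uN in \<open>simp_all add: op.shift_def sscale_def Top\<close>)
    qed
    then have "u \<in> op.root w" using us unfolding op.root_def by (auto intro!: exI[of _ 1])
    moreover have "u \<in> op.root z\<^sub>1"
    proof -
      have "B \<subseteq> op.root z\<^sub>1" using B(4)[of b\<^sub>1] B(4)[of b\<^sub>2] b(1) True by (auto simp: z\<^sub>1_def z\<^sub>2_def)
      then have "seqs.span B \<subseteq> op.root z\<^sub>1" by (rule seqs.span_minimal[OF _ op.subspace_root])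
      then show ?thesis using us B(3) by blast
    qed
    moreover have "u \<noteq> 0" using xy(1) uN by auto
    ultimately have "w = z\<^sub>1" using op.root_Int by blast
    then show ?thesis using True by (simp add: w_def)
  qed
  have disc: "(z\<^sub>1 - z\<^sub>2)\<^sup>2 = (A - A')\<^sup>2 + 4 * (c N (- N) * c (- N) N)"
  proof -
    have z2e: "z\<^sub>2 = A + A' - z\<^sub>1" using tr by (simp add: algebra_simps)
    show ?thesis unfolding z2e z1[symmetric] by (simp add: power2_eq_square algebra_simps)
  qed
  have s1: "ev (2 * n - 1) + ev (2 * n) = z\<^sub>1 + z\<^sub>2" using sums[of "\<lambda>x. x"] by simp
  \<comment> \<open>Which index carries \<open>z\<^sub>1\<close> is not known, so the square of the
    gap is expressed by symmetric functions.\<close>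
  have "(gam ev n)\<^sup>2 = 2 * ((ev (2 * n - 1))\<^sup>2 + (ev (2 * n))\<^sup>2) - (ev (2 * n - 1) + ev (2 * n))\<^sup>2"
    by (simp add: gam_def power2_eq_square algebra_simps)
  also have "\<dots> = (z\<^sub>1 - z\<^sub>2)\<^sup>2"
    unfolding s1 sums[of "\<lambda>x. x\<^sup>2"] by (simp add: power2_eq_square algebra_simps)
  finally have gam: "(gam ev n)\<^sup>2 = (A - A')\<^sup>2 + 4 * (c N (- N) * c (- N) N)" unfolding disc .
  have tau: "tau ev n = (A + A') / 2" using s1 tr by (simp add: tau_def add.commute)
  have bound: "cmod (C i j - v (i - j) + (\<Sum>\<^sub>\<infinity>l. if l \<in> ?P then 0 else v (i - l) * v (l - j) / of_real (diag m l - diag m j)))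
      \<le> real n ^ (2 * m - 1) * (5 * e ^ 3)" if "i \<in> ?P" "j \<in> ?P" for i j
  proof -
    have "wt m n i = real n ^ (2 * m - 1)" "wt m n j = real n ^ (2 * m - 1)"
      using that wtn by (auto simp: N_def)
    then show ?thesis using C_expansion(1)[OF that] by simp
  qed
  have NP: "N \<in> ?P" "- N \<in> ?P" by (auto simp: N_def)
  show thesis
  proof (rule that[of "c N N - v 0" "c (- N) (- N) - v 0" "c N (- N) - v (2 * int n)" "c (- N) N - v (- 2 * int n)"])
    show "tau ev n = of_real (diag m (int n)) + v 0 + (c N N - v 0 + (c (- N) (- N) - v 0)) / 2"
      by (simp add: tau A_def A'_def D_def N_def field_simps)
    show "(gam ev n)\<^sup>2 = (c N N - v 0 - (c (- N) (- N) - v 0))\<^sup>2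
        + 4 * ((v (2 * int n) + (c N (- N) - v (2 * int n))) * (v (- 2 * int n) + (c (- N) N - v (- 2 * int n))))"
      unfolding gam A_def A'_def by simp
    show "cmod (c N N - v 0 + diag_sum m v n) \<le> real n ^ (2 * m - 1) * (5 * e ^ 3)"
      using bound[OF NP(1) NP(1)] unfolding N_def c_def reindexed_diag_sum(1)[OF n, of v m] by simp
    show "cmod (c (- N) (- N) - v 0 + diag_sum m v n) \<le> real n ^ (2 * m - 1) * (5 * e ^ 3)"
      using bound[OF NP(2) NP(2)] unfolding N_def c_def reindexed_diag_sum(2)[OF n, of v m] by simp
    have "offdiag_sum m v n = (\<Sum>\<^sub>\<infinity>l. if l \<in> ?P then 0 else v (N - l) * v (l - - N) / of_real (diag m l - diag m (- N)))"
      unfolding offdiag_sum_def by (intro infsum_cong) (auto simp: N_def abs_if)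
    then show "cmod (c N (- N) - v (2 * int n) + offdiag_sum m v n) \<le> real n ^ (2 * m - 1) * (5 * e ^ 3)"
      using bound[OF NP(1) NP(2)] by (simp add: c_def N_def)
    have "offdiag_sum m (\<lambda>k. v (- k)) n = (\<Sum>\<^sub>\<infinity>l. if l \<in> ?P then 0 else v (- N - l) * v (l - N) / of_real (diag m l - diag m N))"
      unfolding offdiag_sum_def
    proof (intro infsum_cong, goal_cases)
      case (1 l)
      have "\<bar>l\<bar> = int n \<longleftrightarrow> l \<in> ?P" by auto
      moreover have "- (int n - l) = l - N" "- (l + int n) = - N - l" "diag m (int n) = diag m N" by (simp_all add: N_def)
      ultimately show ?case by (simp only: mult.commute)
    qed
    then show "cmod (c (- N) N - v (- 2 * int n) + offdiag_sum m (\<lambda>k. v (- k)) n) \<le> real n ^ (2 * m - 1) * (5 * e ^ 3)"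
      using bound[OF NP(2) NP(1)] by (simp add: c_def N_def)
    show "(\<lambda>j. v j * v (- j) * of_real (resolvent_kernel m n j)) summable_on UNIV"
      using C_expansion(2)[OF NP(1) NP(1)] unfolding N_def by (rule reindexed_diag_sum(3)[OF n])
  qed
qed

section \<open>Asymptotics\<close>

lemma l2_le_finite_support:
  assumes "finite A" "0 \<le> B" "\<And>x. x \<in> A \<Longrightarrow> norm (f x) \<le> B" "\<And>x. x \<notin> A \<Longrightarrow> f x = 0"
  shows "l2_le f (real (card A) * B)"
  unfolding l2_le_def
proof (intro conjI allI impI)
  show "0 \<le> real (card A) * B" using assms(2) by simp
  fix F :: "'a set" assume F: "finite F"
  have "L2_set (\<lambda>x. norm (f x)) F \<le> (\<Sum>x\<in>F. norm (f x))" by (rule L2_set_le_sum) simp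
  also have "\<dots> = (\<Sum>x\<in>F \<inter> A. norm (f x))" using F assms(4) by (intro sum.mono_neutral_right) auto
  also have "\<dots> \<le> (\<Sum>x\<in>A. norm (f x))" using assms(1) by (intro sum_mono2) auto
  also have "\<dots> \<le> real (card A) * B" using assms(3) by (rule sum_bounded_above)
  finally show "L2_set (\<lambda>x. norm (f x)) F \<le> real (card A) * B" .
qed

text \<open>Only from \<open>N\<close> on are the perturbative estimates available, and for positive
  indices \<open>n\<close> is as good a weight as \<open>1 + n\<close>.\<close>

definition tail_le :: "real \<Rightarrow> nat \<Rightarrow> (nat \<Rightarrow> real) \<Rightarrow> real \<Rightarrow> bool" where
  "tail_le s N x C \<longleftrightarrow> l2_le (\<lambda>n. if N \<le> n then real n powr s * x n else 0) C"

lemma tail_le_mono: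
  assumes "tail_le s N y C" "1 \<le> N" "\<And>n. N \<le> n \<Longrightarrow> \<bar>x n\<bar> \<le> \<bar>y n\<bar>" "t \<le> s"
  shows "tail_le t N x C"
  unfolding tail_le_def
proof (rule l2_le_mono[OF _ _ order_refl])
  show "l2_le (\<lambda>n. if N \<le> n then real n powr s * y n else 0) C" using assms(1) by (simp add: tail_le_def)
  fix n
  show "norm (if N \<le> n then real n powr t * x n else 0) \<le> norm (if N \<le> n then real n powr s * y n else 0)"
    using assms(2-4) by (auto simp: abs_mult intro!: mult_mono powr_mono)
qed

lemma tail_le_start: "tail_le s N x C \<Longrightarrow> N \<le> M \<Longrightarrow> tail_le s M x C"
  unfolding tail_le_def by (erule l2_le_mono) auto

lemma tail_le_add: "tail_le s N x C \<Longrightarrow> tail_le s N y D \<Longrightarrow> tail_le s N (\<lambda>n. x n + y n) (C + D)"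
  unfolding tail_le_def by (drule (1) l2_le_add, erule l2_le_mono) (auto simp: distrib_left)

lemma tail_le_cmult: "tail_le s N x C \<Longrightarrow> 0 \<le> a \<Longrightarrow> tail_le s N (\<lambda>n. a * x n) (a * C)"
  unfolding tail_le_def by (drule l2_le_cmult[of _ _ a], erule l2_le_mono) (auto simp: ac_simps)

text \<open>Cauchy-Schwarz in the form that the gap needs: its square is bounded by products, so the
  gap is bounded by roots of products, whose order is the mean of the two orders.\<close>

lemma tail_le_sqrt_mult:
  assumes "tail_le s N x C" "tail_le t N y D" "\<And>n. N \<le> n \<Longrightarrow> 0 \<le> x n" "\<And>n. N \<le> n \<Longrightarrow> 0 \<le> y n"
  shows "tail_le ((s + t) / 2) N (\<lambda>n. sqrt (x n * y n)) (sqrt (C * D))"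
  unfolding tail_le_def
proof (rule l2_leI_sq)
  let ?x = "\<lambda>n. if N \<le> n then real n powr s * x n else 0"
  let ?y = "\<lambda>n. if N \<le> n then real n powr t * y n else 0"
  have p: "l1_le (\<lambda>n. ?x n * ?y n) (C * D)"
    by (rule l2_le_prod) (use assms(1,2) in \<open>simp_all add: tail_le_def\<close>)
  have CD: "0 \<le> C * D" using l1_le_nonneg[OF p] .
  then show "0 \<le> sqrt (C * D)" by simp
  fix F :: "nat set" assume F: "finite F"
  have e: "(norm (if N \<le> n then real n powr ((s + t) / 2) * sqrt (x n * y n) else 0))\<^sup>2 = norm (?x n * ?y n)" for n
  proof (cases "N \<le> n")
    case True
    have "(real n powr ((s + t) / 2))\<^sup>2 = real n powr s * real n powr t"
      by (simp add: power2_eq_square flip: powr_add)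
    then show ?thesis using True assms(3,4)[of n] by (simp add: power_mult_distrib abs_mult ac_simps)
  qed simp
  show "(\<Sum>n\<in>F. (norm (if N \<le> n then real n powr ((s + t) / 2) * sqrt (x n * y n) else 0))\<^sup>2) \<le> (sqrt (C * D))\<^sup>2"
    unfolding e using p F CD by (simp add: l1_le_def)
qed

text \<open>Passing from \<open>n\<close> to \<open>1 + n\<close> costs the factor
  \<open>2 powr \<bar>s\<bar>\<close>, and the finitely many indices below \<open>N\<close> enter
  through the crude bound \<open>B\<close>.\<close>

lemma hseqI_tail:
  assumes x: "tail_le s N (\<lambda>n. cmod (x n)) C" and "1 \<le> N" "0 \<le> B" and small: "\<And>n. 1 \<le> n \<Longrightarrow> n < N \<Longrightarrow> cmod (x n) \<le> B"
  shows "x \<in> hseq s \<and> hseq_norm s x \<le> 2 powr \<bar>s\<bar> * (C + real N * (real N powr \<bar>s\<bar> * B))"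
proof -
  define g where "g n = (if n \<in> {1..<N} then real n powr s * cmod (x n) else 0)" for n
  have g: "l2_le g (real (card {1..<N}) * (real N powr \<bar>s\<bar> * B))"
  proof (rule l2_le_finite_support)
    fix n assume n: "n \<in> {1..<N}"
    have "real n powr s \<le> real n powr \<bar>s\<bar>" using n by (intro powr_mono) auto
    also have "\<dots> \<le> real N powr \<bar>s\<bar>" using n by (intro powr_mono2) auto
    finally have "real n powr s * cmod (x n) \<le> real N powr \<bar>s\<bar> * B"
      using small[of n] n by (intro mult_mono) auto
    then show "norm (g n) \<le> real N powr \<bar>s\<bar> * B" using n by (simp add: g_def)
  qed (use assms(3) in \<open>auto simp: g_def\<close>)
  have gN: "real (card {1..<N}) * (real N powr \<bar>s\<bar> * B) \<le> real N * (real N powr \<bar>s\<bar> * B)"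
    using assms(3) by (intro mult_right_mono) auto
  define w where "w n = (if 1 \<le> n then (1 + real n) powr s * cmod (x n) else 0)" for n :: nat
  have "l2_le (\<lambda>n. 2 powr \<bar>s\<bar> * ((if N \<le> n then real n powr s * cmod (x n) else 0) + g n))
      (norm (2 powr \<bar>s\<bar>) * (C + real (card {1..<N}) * (real N powr \<bar>s\<bar> * B)))"
    using x g unfolding tail_le_def by (intro l2_le_cmult l2_le_add)
  then have w: "l2_le w (2 powr \<bar>s\<bar> * (C + real N * (real N powr \<bar>s\<bar> * B)))"
  proof (rule l2_le_mono)
    fix n
    show "norm (w n) \<le> norm (2 powr \<bar>s\<bar> * ((if N \<le> n then real n powr s * cmod (x n) else 0) + g n))"
    proof (cases "1 \<le> n")
      case True
      have "(1 + real n) powr s \<le> 2 powr \<bar>s\<bar> * real n powr s"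
      proof (cases "0 \<le> s")
        case True
        have "(1 + real n) powr s \<le> (2 * real n) powr s" using True \<open>1 \<le> n\<close> by (intro powr_mono2) auto
        then show ?thesis using True by (simp add: powr_mult)
      next
        case False
        have "(1 + real n) powr s \<le> real n powr s" using False \<open>1 \<le> n\<close> by (intro powr_mono2') auto
        also have "\<dots> \<le> 2 powr \<bar>s\<bar> * real n powr s" by (simp add: mult_le_cancel_right1 ge_one_powr_ge_zero)
        finally show ?thesis .
      qed
      then have "(1 + real n) powr s * cmod (x n) \<le> 2 powr \<bar>s\<bar> * real n powr s * cmod (x n)"
        by (intro mult_right_mono) auto
      then show ?thesis using True by (simp add: w_def g_def mult.assoc)
    qed (simp add: w_def)
  qed (use gN in simp)
  have e: "(norm (w n))\<^sup>2 = (1 + real n) powr (2 * s) * (cmod (x n))\<^sup>2" if "n \<in> {1..}" for n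
    using that by (simp add: w_def power_mult_distrib powr_power mult.commute)
  have "(\<lambda>n. (norm (w n))\<^sup>2) summable_on {1..}"
    using l2_le_summable_sq(1)[OF w] by (rule summable_on_subset_banach) simp
  then have mem: "x \<in> hseq s" unfolding hseq_def mem_Collect_eq
    by (subst (asm) summable_on_cong[OF e])
  have "(\<Sum>\<^sub>\<infinity>n\<in>{1..}. (1 + real n) powr (2 * s) * (cmod (x n))\<^sup>2) = (\<Sum>\<^sub>\<infinity>n. (norm (w n))\<^sup>2)"
    by (rule infsum_cong_neutral) (use e in \<open>auto simp: w_def\<close>)
  also have "\<dots> \<le> (2 powr \<bar>s\<bar> * (C + real N * (real N powr \<bar>s\<bar> * B)))\<^sup>2"
    by (rule infsum_le_finite_sums[OF l2_le_summable_sq(1)[OF w]]) (rule l2_le_sum_sq[OF w])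
  finally have "hseq_norm s x \<le> 2 powr \<bar>s\<bar> * (C + real N * (real N powr \<bar>s\<bar> * B))"
    unfolding hseq_norm_def using l2_le_nonneg[OF w] by (intro real_le_lsqrt infsum_nonneg) auto
  with mem show ?thesis ..
qed

text \<open>The interface between the spectral part and the final estimates; \<open>N\<close> and
  \<open>C\<close> will not depend on \<open>V\<close>. The first conjunct is for the indices below
  \<open>N\<close>. In the estimate of the gap, \<open>(r n)\<^sup>2\<close> stems from the
  difference of the diagonal entries and the rest from the product of the other two.\<close>

definition pair_asymptotics ::
  "nat \<Rightarrow> real \<Rightarrow> nat \<Rightarrow> real \<Rightarrow> (int \<Rightarrow> complex) \<Rightarrow> (nat \<Rightarrow> complex) \<Rightarrow> bool" where
  "pair_asymptotics m s N C v ev \<longleftrightarrow>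
      (\<forall>k\<le>2 * N. cmod (ev k) \<le> C) \<and>
      (\<forall>n\<ge>N. (\<lambda>j. v j * v (- j) * of_real (resolvent_kernel m n j)) summable_on UNIV) \<and>
      (\<exists>r. tail_le s N r C \<and> (\<forall>n\<ge>N. 0 \<le> r n \<and>
        cmod (tau ev n - of_real (diag m (int n)) - v 0) \<le> cmod (diag_sum m v n) + r n \<and>
        cmod ((gam ev n)\<^sup>2 - 4 * (v (- 2 * int n) * v (2 * int n)))
          \<le> 4 * ((r n)\<^sup>2 + cmod (v (2 * int n)) * (cmod (offdiag_sum m (\<lambda>k. v (- k)) n) + r n)
            + cmod (v (- 2 * int n)) * (cmod (offdiag_sum m v n) + r n)
            + (cmod (offdiag_sum m v n) + r n) * (cmod (offdiag_sum m (\<lambda>k. v (- k)) n) + r n))))"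

text \<open>Up to a small loss \<eta>, the coupling has size R n^p + n^q \<tau> with p = 1 - 2 m +
  max 0 (2 \<theta> - 1) / 2 and q = \<theta> + 1 - 2 m. In the remainder, n^(2 m - 1) times its
  cube, two factors are bounded by the larger order q. The conditions on \<open>s\<close> say that
  the part with p is then square summable and that the power of n in front of \<tau> is not
  positive.\<close>

lemma eigenvalue_asymptotics:
  assumes m: "1 \<le> m" and \<theta>: "0 \<le> \<theta>" "\<theta> < real m" "\<theta> = real m * \<alpha>" and R: "0 \<le> R"
    and s: "s + 2 * \<theta> + max 0 (2 * \<theta> - 1) / 2 < 4 * real m - 5 / 2" "s + 3 * \<theta> < 4 * real m - 2"
  obtains N C where "1 \<le> N" "0 \<le> C"
    "\<And>V ev v. V \<in> per_dist \<Longrightarrow> v = fcoeff V \<Longrightarrow> l2_le (\<lambda>k. of_real (br k powr (- \<theta>)) * v k) R \<Longrightarrow>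
      ordered_eigenvalues m \<alpha> V ev \<Longrightarrow>
      pair_asymptotics m s N C v ev"
proof -
  define \<kappa> where "\<kappa> = real m - \<theta>"
  note \<theta>\<alpha> = \<theta>(3)
  define M where "M = max 0 (2 * \<theta> - 1)"
  define g\<^sub>1 where "g\<^sub>1 = 4 * real m - 5 / 2 - (s + 2 * \<theta> + M / 2)"
  define g\<^sub>2 where "g\<^sub>2 = 4 * real m - 2 - (s + 3 * \<theta>)"
  have pos: "0 < \<kappa>" "0 < g\<^sub>1" "0 < g\<^sub>2" using \<theta> s by (simp_all add: \<kappa>_def g\<^sub>1_def g\<^sub>2_def M_def)
  \<comment> \<open>The strict inequalities for \<open>s\<close> leave the margins
    \<open>g\<^sub>1\<close> and \<open>g\<^sub>2\<close>, of which at most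
    \<open>3 * \<eta>\<close> is used; keeping \<open>\<eta>\<close> below \<open>\<kappa>\<close>
    makes \<open>q\<close> negative.\<close>
  define \<eta> where "\<eta> = Min {1, \<kappa> / 2, g\<^sub>1 / 3, g\<^sub>2 / 3}"
  have \<eta>: "0 < \<eta>" "\<eta> \<le> 1" "\<eta> < \<kappa>" "3 * \<eta> \<le> g\<^sub>1" "3 * \<eta> \<le> g\<^sub>2"
    using pos unfolding \<eta>_def by (auto simp: min_def)
  \<comment> \<open>The least value that \<open>coupling_bound\<close> admits.\<close>
  define u where "u = max 0 (2 * \<theta> - 1 + \<eta>)"
  have m1: "1 \<le> real m" using m by simp
  have u: "0 \<le> u" "2 * \<theta> - 1 + \<eta> \<le> u" "u \<le> 2 * real m - 1" "u \<le> M + \<eta>" "u \<le> 2 * \<theta> + 2 * \<eta>"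
    using \<eta>(1-3) \<theta>(1) m1 unfolding u_def \<kappa>_def M_def by linarith+
  obtain c where c: "0 < c"
    "\<And>(v :: int \<Rightarrow> complex) R. l2_le (\<lambda>k. of_real (br k powr (- \<theta>)) * v k) R \<Longrightarrow>
      \<exists>\<tau>. (\<forall>n. 0 \<le> \<tau> n) \<and> l2_le \<tau> (c * R) \<and>
        (\<forall>n\<ge>1. l2_le (\<lambda>(k, j). v (k - j) / of_real (sqrt (wt m n k * wt m n j)))
          (c * (R * real n powr (1 - 2 * real m + u / 2) + real n powr (\<theta> + 1 - 2 * real m + \<eta>) * \<tau> n)))"
    using coupling_bound[OF m \<theta>(1) \<eta>(1,2) u(1-3)] by blast
  define p q where "p = 1 - 2 * real m + u / 2" and "q = \<theta> + 1 - 2 * real m + \<eta>"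
  have pq: "p \<le> q" "q < 0" using u(5) \<eta>(3) m1 unfolding p_def q_def \<kappa>_def by linarith+
  \<comment> \<open>As \<open>\<tau>\<close> is bounded, \<open>E\<close> bounds the coupling by a
    pure power of \<open>n\<close>. This crude form serves for two of the three factors in the
    remainder and for the threshold.\<close>
  define E where "E = c * R * (1 + c)"
  have E: "0 \<le> E" using c(1) R by (simp add: E_def)
  define B where "B = 5 * E\<^sup>2 * c"
  have B: "0 \<le> B" using c(1) by (simp add: B_def)
  define e where "e \<tau> n = c * (R * real n powr p + real n powr q * \<tau> n)" for \<tau> :: "nat \<Rightarrow> real" and n :: nat
  have e_le: "0 \<le> e \<tau> n \<and> e \<tau> n \<le> E * real n powr q" if "0 \<le> \<tau> n" "\<tau> n \<le> c * R" "1 \<le> n" for \<tau> n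
  proof -
    have "real n powr p \<le> real n powr q" using that pq by (intro powr_mono) auto
    then have "e \<tau> n \<le> c * (R * real n powr q + real n powr q * (c * R))"
      unfolding e_def using that c(1) R by (intro mult_left_mono add_mono) auto
    also have "\<dots> = E * real n powr q" by (simp add: E_def algebra_simps)
    finally show ?thesis using that c(1) R by (simp add: e_def)
  qed
  define rem where "rem \<tau> n = real n ^ (2 * m - 1) * (5 * e \<tau> n ^ 3)" for \<tau> n
  have rem_le: "0 \<le> rem \<tau> n \<and> real n powr s * rem \<tau> n \<le> B * (R * real n powr (s + 2 * real m - 1 + 2 * q + p) + \<tau> n)"
    if "0 \<le> \<tau> n" "\<tau> n \<le> c * R" "1 \<le> n" for \<tau> n
  proof -
    note e = e_le[of \<tau> n, OF that]
    let ?w = "real n"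
    have w: "1 \<le> ?w" using that by simp
    have mp: "?w ^ (2 * m - 1) = ?w powr (2 * real m - 1)"
      using w m by (simp add: of_nat_diff flip: powr_realpow)
    have "e \<tau> n ^ 3 = (e \<tau> n)\<^sup>2 * e \<tau> n" by (simp add: power2_eq_square power3_eq_cube)
    also have "\<dots> \<le> (E * ?w powr q)\<^sup>2 * e \<tau> n" using e by (intro mult_right_mono power_mono) auto
    also have "\<dots> = E\<^sup>2 * ?w powr (2 * q) * e \<tau> n"
      by (simp add: power_mult_distrib power2_eq_square powr_add[symmetric])
    finally have "?w powr s * rem \<tau> n \<le> ?w powr s * (?w powr (2 * real m - 1) * (5 * (E\<^sup>2 * ?w powr (2 * q) * e \<tau> n)))"
      unfolding rem_def mp by (intro mult_left_mono) auto
    also have "\<dots> = B * (R * ?w powr (s + 2 * real m - 1 + 2 * q + p) + ?w powr (s + 2 * real m - 1 + 2 * q + q) * \<tau> n)"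
    proof -
      have 1: "?w powr (s + 2 * real m - 1 + 2 * q + x) = ?w powr s * ?w powr (2 * real m - 1) * ?w powr (2 * q) * ?w powr x" for x
        by (simp add: powr_add[symmetric] algebra_simps)
      show ?thesis unfolding 1 by (simp add: e_def B_def algebra_simps)
    qed
    also have "\<dots> \<le> B * (R * ?w powr (s + 2 * real m - 1 + 2 * q + p) + 1 * \<tau> n)"
    proof -
      have "s + 2 * real m - 1 + 2 * q + q \<le> 0" using \<eta>(5) by (simp add: q_def g\<^sub>2_def)
      then have "?w powr (s + 2 * real m - 1 + 2 * q + q) \<le> ?w powr 0" using w by (intro powr_mono) auto
      then show ?thesis using w B that by (intro mult_left_mono add_mono mult_right_mono) auto
    qed
    finally show ?thesis using e by (simp add: rem_def)
  qed
  have "s + 2 * real m - 1 + 2 * q + p < - (1 / 2)"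
  proof -
    have "u / 2 \<le> M / 2 + \<eta> / 2" "2 * \<eta> + \<eta> / 2 < 3 * \<eta>" using u(4) \<eta>(1) by simp_all
    moreover have "s + 2 * real m - 1 + 2 * q + p = s + 2 * \<theta> + u / 2 - 4 * real m + 2 + 2 * \<eta>"
      unfolding p_def q_def by (simp add: algebra_simps)
    ultimately show ?thesis using \<eta>(4) unfolding g\<^sub>1_def by argo
  qed
  from l2_le_nat_powr[OF this] obtain Z where
    Z: "l2_le (\<lambda>n::nat. if 1 \<le> n then real n powr (s + 2 * real m - 1 + 2 * q + p) else 0) Z" by blast
  have "((\<lambda>n. E * real n powr q) \<longlongrightarrow> E * 0) sequentially"
    using pq(2) by (intro tendsto_mult_left tendsto_neg_powr filterlim_real_sequentially)
  then have "eventually (\<lambda>n. E * real n powr q < 1 / 8) sequentially"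
    by (rule order_tendstoD) simp
  then obtain N\<^sub>0 where N0: "\<And>n. N\<^sub>0 \<le> n \<Longrightarrow> E * real n powr q < 1 / 8" by (auto simp: eventually_sequentially)
  \<comment> \<open>From \<open>N\<^sub>0\<close> on the coupling is at most 1/8. Adding 2 keeps n -
    1 positive and at least \<open>N\<^sub>0\<close>, since the count is needed at n - 1 as well as
    at n.\<close>
  define N where "N = N\<^sub>0 + 2"
  define C where "C = B * (R * Z + c * R) + (diag m (int N) + real N ^ (2 * m - 1) * (1 + real N))"
  have Z0: "0 \<le> Z" using Z by (rule l2_le_nonneg)
  have C1: "0 \<le> B * (R * Z + c * R)" using B R c(1) Z0 by simp
  have C2: "0 \<le> diag m (int N) + real N ^ (2 * m - 1) * (1 + real N)" by (simp add: diag_abs)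
  show thesis
  proof (rule that[of N C])
    show "1 \<le> N" by (simp add: N_def)
    show "0 \<le> C" using C1 C2 by (simp add: C_def)
    fix V ev v
    assume V: "V \<in> per_dist" "v = fcoeff V" and v: "l2_le (\<lambda>k. of_real (br k powr (- \<theta>)) * v k) R"
      and ev: "ordered_eigenvalues m \<alpha> V ev"
    obtain \<tau> where \<tau>: "\<And>n. 0 \<le> \<tau> n" "l2_le \<tau> (c * R)"
      "\<And>n. 1 \<le> n \<Longrightarrow> l2_le (\<lambda>(k, j). v (k - j) / of_real (sqrt (wt m n k * wt m n j))) (e \<tau> n)"
      using c(2)[OF v] unfolding e_def p_def q_def by blast
    have \<tau>R: "\<tau> n \<le> c * R" for n using l2_le_point[OF \<tau>(2), of n] by simp
    have small: "e \<tau> n \<le> 1 / 8" if "N\<^sub>0 \<le> n" "1 \<le> n" for n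
      using e_le[of \<tau> n, OF \<tau>(1) \<tau>R that(2)] N0[OF that(1)] by linarith
    have count: "{k. Re (ev k) \<le> cut m n} = {..<2 * n + 1}"
      and ev_le: "k < 2 * n + 1 \<Longrightarrow> cmod (ev k) \<le> diag m (int n) + real n ^ (2 * m - 1) * (1 + real n)"
      if n: "N\<^sub>0 \<le> n" "1 \<le> n" for n k
    proof -
      interpret mode_block "{- int n..int n}" m n v "e \<tau> n" \<theta> R
        by (rule mode_block_interval[OF m n(2) \<theta>(1,2) v \<tau>(3)[OF n(2)] small[OF n]])
      show "{k. Re (ev k) \<le> cut m n} = {..<2 * n + 1}"
        by (rule eigenvalue_count(1)[OF V \<theta>\<alpha> refl ev])
      show "k < 2 * n + 1 \<Longrightarrow> cmod (ev k) \<le> diag m (int n) + real n ^ (2 * m - 1) * (1 + real n)"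
        by (rule eigenvalue_count(2)[OF V \<theta>\<alpha> refl ev])
    qed
    have pair: "(\<lambda>j. v j * v (- j) * of_real (resolvent_kernel m n j)) summable_on UNIV \<and>
        cmod (tau ev n - of_real (diag m (int n)) - v 0) \<le> cmod (diag_sum m v n) + rem \<tau> n \<and>
        cmod ((gam ev n)\<^sup>2 - 4 * (v (- 2 * int n) * v (2 * int n)))
          \<le> 4 * ((rem \<tau> n)\<^sup>2 + cmod (v (2 * int n)) * (cmod (offdiag_sum m (\<lambda>k. v (- k)) n) + rem \<tau> n)
            + cmod (v (- 2 * int n)) * (cmod (offdiag_sum m v n) + rem \<tau> n)
            + (cmod (offdiag_sum m v n) + rem \<tau> n) * (cmod (offdiag_sum m (\<lambda>k. v (- k)) n) + rem \<tau> n))"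
      if "N \<le> n" for n
    proof -
      have n: "N\<^sub>0 \<le> n - 1" "1 \<le> n - 1" "N\<^sub>0 \<le> n" "1 \<le> n" using that by (auto simp: N_def)
      have mb: "mode_block {int n, - int n} m n v (e \<tau> n) \<theta> R"
        by (rule mode_block_pair[OF m n(4) \<theta>(1,2) v \<tau>(3)[OF n(4)] small[OF n(3,4)]])
      obtain \<rho>\<^sub>1 \<rho>\<^sub>2 \<sigma>\<^sub>1 \<sigma>\<^sub>2 where *:
        "tau ev n = of_real (diag m (int n)) + v 0 + (\<rho>\<^sub>1 + \<rho>\<^sub>2) / 2"
        "(gam ev n)\<^sup>2 = (\<rho>\<^sub>1 - \<rho>\<^sub>2)\<^sup>2 + 4 * ((v (2 * int n) + \<sigma>\<^sub>1) * (v (- 2 * int n) + \<sigma>\<^sub>2))"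
        "cmod (\<rho>\<^sub>1 + diag_sum m v n) \<le> rem \<tau> n" "cmod (\<rho>\<^sub>2 + diag_sum m v n) \<le> rem \<tau> n"
        "cmod (\<sigma>\<^sub>1 + offdiag_sum m v n) \<le> rem \<tau> n"
        "cmod (\<sigma>\<^sub>2 + offdiag_sum m (\<lambda>k. v (- k)) n) \<le> rem \<tau> n"
        "(\<lambda>j. v j * v (- j) * of_real (resolvent_kernel m n j)) summable_on UNIV"
        using eigenvalue_pair[OF mb V \<theta>\<alpha> ev n(4) count[OF n(1,2)] count[OF n(3,4)]]
        unfolding rem_def by blast
      have r: "0 \<le> rem \<tau> n" using *(3) norm_ge_zero order_trans by blast
      have tri: "cmod x \<le> cmod y + rem \<tau> n" if "cmod (x + y) \<le> rem \<tau> n" for x y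
        using that norm_triangle_ineq4[of "x + y" y] by simp
      have \<rho>: "cmod \<rho>\<^sub>1 \<le> cmod (diag_sum m v n) + rem \<tau> n" "cmod \<rho>\<^sub>2 \<le> cmod (diag_sum m v n) + rem \<tau> n"
        and \<sigma>: "cmod \<sigma>\<^sub>1 \<le> cmod (offdiag_sum m v n) + rem \<tau> n"
          "cmod \<sigma>\<^sub>2 \<le> cmod (offdiag_sum m (\<lambda>k. v (- k)) n) + rem \<tau> n"
        using *(3-6) by (auto intro: tri)
      have "cmod (tau ev n - of_real (diag m (int n)) - v 0) = cmod (\<rho>\<^sub>1 + \<rho>\<^sub>2) / 2"
        unfolding *(1) by (simp add: norm_divide)
      also have "\<dots> \<le> (cmod \<rho>\<^sub>1 + cmod \<rho>\<^sub>2) / 2" by (simp add: norm_triangle_ineq)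
      finally have 1: "cmod (tau ev n - of_real (diag m (int n)) - v 0) \<le> cmod (diag_sum m v n) + rem \<tau> n"
        using \<rho> by simp
      have "cmod (\<rho>\<^sub>1 - \<rho>\<^sub>2) \<le> 2 * rem \<tau> n"
        using *(3,4) norm_triangle_ineq4[of "\<rho>\<^sub>1 + diag_sum m v n" "\<rho>\<^sub>2 + diag_sum m v n"] by simp
      then have "(cmod (\<rho>\<^sub>1 - \<rho>\<^sub>2))\<^sup>2 \<le> (2 * rem \<tau> n)\<^sup>2" by (intro power_mono) auto
      then have d: "cmod ((\<rho>\<^sub>1 - \<rho>\<^sub>2)\<^sup>2) \<le> 4 * (rem \<tau> n)\<^sup>2" by (simp add: norm_power power_mult_distrib)
      let ?a = "v (2 * int n)" and ?b = "v (- 2 * int n)"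
      have "(gam ev n)\<^sup>2 - 4 * (?b * ?a) = (\<rho>\<^sub>1 - \<rho>\<^sub>2)\<^sup>2 + 4 * (?a * \<sigma>\<^sub>2 + ?b * \<sigma>\<^sub>1 + \<sigma>\<^sub>1 * \<sigma>\<^sub>2)"
        unfolding *(2) by (simp add: algebra_simps)
      also have "cmod \<dots> \<le> cmod ((\<rho>\<^sub>1 - \<rho>\<^sub>2)\<^sup>2) + cmod (4 * (?a * \<sigma>\<^sub>2 + ?b * \<sigma>\<^sub>1 + \<sigma>\<^sub>1 * \<sigma>\<^sub>2))"
        by (rule norm_triangle_ineq)
      also have "cmod (4 * (?a * \<sigma>\<^sub>2 + ?b * \<sigma>\<^sub>1 + \<sigma>\<^sub>1 * \<sigma>\<^sub>2)) = 4 * cmod (?a * \<sigma>\<^sub>2 + ?b * \<sigma>\<^sub>1 + \<sigma>\<^sub>1 * \<sigma>\<^sub>2)"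
        by (subst norm_mult) simp
      also have "cmod (?a * \<sigma>\<^sub>2 + ?b * \<sigma>\<^sub>1 + \<sigma>\<^sub>1 * \<sigma>\<^sub>2) \<le> cmod ?a * cmod \<sigma>\<^sub>2 + cmod ?b * cmod \<sigma>\<^sub>1 + cmod \<sigma>\<^sub>1 * cmod \<sigma>\<^sub>2"
        by (intro norm_triangle_le add_mono) (simp_all add: norm_mult)
      also have "\<dots> \<le> cmod ?a * (cmod (offdiag_sum m (\<lambda>k. v (- k)) n) + rem \<tau> n)
          + cmod ?b * (cmod (offdiag_sum m v n) + rem \<tau> n)
          + (cmod (offdiag_sum m v n) + rem \<tau> n) * (cmod (offdiag_sum m (\<lambda>k. v (- k)) n) + rem \<tau> n)"
        using \<sigma> r by (intro add_mono mult_mono) auto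
      finally have 2: "cmod ((gam ev n)\<^sup>2 - 4 * (?b * ?a)) \<le> 4 * ((rem \<tau> n)\<^sup>2
          + cmod ?a * (cmod (offdiag_sum m (\<lambda>k. v (- k)) n) + rem \<tau> n)
          + cmod ?b * (cmod (offdiag_sum m v n) + rem \<tau> n)
          + (cmod (offdiag_sum m v n) + rem \<tau> n) * (cmod (offdiag_sum m (\<lambda>k. v (- k)) n) + rem \<tau> n))"
        using d by simp
      from *(7) 1 2 show ?thesis by blast
    qed
    have tail: "tail_le s N (rem \<tau>) C"
      unfolding tail_le_def
    proof (rule l2_le_mono)
      show "l2_le (\<lambda>n. B * (R * (if 1 \<le> n then real n powr (s + 2 * real m - 1 + 2 * q + p) else 0) + \<tau> n))
          (norm B * (norm R * Z + c * R))"
        by (intro l2_le_cmult l2_le_add Z \<tau>(2))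
      show "norm B * (norm R * Z + c * R) \<le> C" using B R C2 by (simp add: C_def)
      fix n
      show "norm (if N \<le> n then real n powr s * rem \<tau> n else 0) \<le>
          norm (B * (R * (if 1 \<le> n then real n powr (s + 2 * real m - 1 + 2 * q + p) else 0) + \<tau> n))"
      proof (cases "N \<le> n")
        case True
        then have "1 \<le> n" by (simp add: N_def)
        from rem_le[of \<tau> n, OF \<tau>(1) \<tau>R this] B R True \<open>1 \<le> n\<close> show ?thesis
          by (auto intro: order_trans[OF _ abs_ge_self])
      qed simp
    qed
    have evC: "\<forall>k\<le>2 * N. cmod (ev k) \<le> C"
    proof (intro allI impI)
      fix k assume "k \<le> 2 * N"
      with ev_le[of N k] C1 show "cmod (ev k) \<le> C" by (simp add: C_def N_def)
    qed
    have rem0: "0 \<le> rem \<tau> n" if "N \<le> n" for n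
      using rem_le[of \<tau> n, OF \<tau>(1) \<tau>R] that by (simp add: N_def)
    show "pair_asymptotics m s N C v ev"
      unfolding pair_asymptotics_def
      by (intro conjI exI[of _ "rem \<tau>"]) (use evC tail rem0 pair in blast)+
  qed
qed

section \<open>Estimates for the means and the gaps\<close>

lemma coefficient_le:
  assumes "l2_le (\<lambda>k. of_real (br k powr (- \<theta>)) * v k) R"
  shows "cmod (v k) \<le> R * br k powr \<theta>"
proof -
  have "cmod (v k) = br k powr (- \<theta>) * cmod (v k) * br k powr \<theta>"
    by (simp add: powr_minus)
  also have "\<dots> \<le> R * br k powr \<theta>"
    using l2_le_point[OF assms, of k] by (intro mult_right_mono) (simp_all add: norm_mult)
  finally show ?thesis .
qed

text \<open>Here \<open>br (h n)\<close> is at most 3 n, which converts the weight of the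
  coefficient into a power of \<open>n\<close>. The cases in view are h n = 2 n and h n = - 2
  n.\<close>

lemma tail_le_coefficient:
  assumes v: "l2_le (\<lambda>k. of_real (br k powr (- \<theta>)) * v k) R" and "0 \<le> \<theta>" "1 \<le> N"
    and h: "inj h" "\<And>n. \<bar>h n\<bar> \<le> 2 * int n"
  shows "tail_le (- \<theta>) N (\<lambda>n. cmod (v (h n))) (3 powr \<theta> * R)"
  unfolding tail_le_def
proof (rule l2_le_mono)
  show "l2_le (\<lambda>n. of_real (3 powr \<theta>) * (of_real (br (h n) powr (- \<theta>)) * v (h n))) (norm (complex_of_real (3 powr \<theta>)) * R)"
    by (intro l2_le_cmult l2_le_comp[OF v h(1)])
  fix n
  show "norm (if N \<le> n then real n powr (- \<theta>) * cmod (v (h n)) else 0)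
      \<le> norm (of_real (3 powr \<theta>) * (of_real (br (h n) powr (- \<theta>)) * v (h n)))"
  proof (cases "N \<le> n")
    case True
    have "br (h n) \<le> 3 * real n" using h(2)[of n] True assms(3) unfolding br_def by linarith
    then have "(3 * real n) powr (- \<theta>) \<le> br (h n) powr (- \<theta>)" using assms(2) by (intro powr_mono2') auto
    then have "3 powr \<theta> * (3 * real n) powr (- \<theta>) \<le> 3 powr \<theta> * br (h n) powr (- \<theta>)" by (intro mult_left_mono) auto
    moreover have "3 powr \<theta> * (3 * real n) powr (- \<theta>) = real n powr (- \<theta>)"
      by (simp add: powr_mult powr_minus field_simps)
    ultimately have "real n powr (- \<theta>) \<le> 3 powr \<theta> * br (h n) powr (- \<theta>)" by simp
    then have "real n powr (- \<theta>) * cmod (v (h n)) \<le> 3 powr \<theta> * br (h n) powr (- \<theta>) * cmod (v (h n))"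
      by (intro mult_right_mono) auto
    then show ?thesis using True by (simp add: norm_mult mult.assoc)
  qed simp
qed simp

text \<open>The square of the smaller of the two moduli is at most their product, which is the
  modulus of a difference of squares. So neither the sign of the root nor a root of the discriminant
  has to be determined.\<close>

lemma gap_deviation_sq:
  "(gap_deviation V ev n)\<^sup>2 \<le> cmod ((gam ev n)\<^sup>2 - 4 * (fcoeff V (- 2 * int n) * fcoeff V (2 * int n)))"
proof -
  define r where "r = 2 * csqrt (fcoeff V (- 2 * int n) * fcoeff V (2 * int n))"
  have r: "r\<^sup>2 = 4 * (fcoeff V (- 2 * int n) * fcoeff V (2 * int n))"
    unfolding r_def power_mult_distrib power2_csqrt by simp
  have "(gap_deviation V ev n)\<^sup>2 = min (cmod (gam ev n + r)) (cmod (gam ev n - r)) * min (cmod (gam ev n + r)) (cmod (gam ev n - r))"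
    by (simp add: gap_deviation_def r_def power2_eq_square Let_def)
  also have "\<dots> \<le> cmod (gam ev n + r) * cmod (gam ev n - r)" by (intro mult_mono) auto
  also have "\<dots> = cmod ((gam ev n)\<^sup>2 - r\<^sup>2)" by (simp add: norm_mult[symmetric] power2_eq_square algebra_simps)
  finally show ?thesis unfolding r .
qed

lemma gap_deviation_nonneg: "0 \<le> gap_deviation V ev n"
  by (simp add: gap_deviation_def Let_def)

lemma gap_deviation_le:
  "gap_deviation V ev n \<le> cmod (ev (2 * n)) + cmod (ev (2 * n - 1))
    + 2 * sqrt (cmod (fcoeff V (- 2 * int n)) * cmod (fcoeff V (2 * int n)))"
proof -
  define r where "r = 2 * csqrt (fcoeff V (- 2 * int n) * fcoeff V (2 * int n))"
  have "gap_deviation V ev n \<le> cmod (gam ev n + r)" by (simp add: gap_deviation_def r_def Let_def)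
  also have "\<dots> \<le> cmod (gam ev n) + cmod r" by (rule norm_triangle_ineq)
  also have "cmod r = 2 * sqrt (cmod (fcoeff V (- 2 * int n)) * cmod (fcoeff V (2 * int n)))"
  proof -
    have "(cmod (csqrt z))\<^sup>2 = cmod z" for z by (simp flip: norm_power)
    then have "cmod (csqrt z) = sqrt (cmod z)" for z by (metis real_sqrt_unique norm_ge_zero)
    then show ?thesis by (simp add: r_def norm_mult)
  qed
  finally show ?thesis using norm_triangle_ineq4[of "ev (2 * n)" "ev (2 * n - 1)"] by (simp add: gam_def)
qed

text \<open>The decisive order \<open>real m - 2 * \<theta>\<close> comes from
  \<open>diag_bound\<close>; the remainder can be given the same order because \<theta> < m and m is
  at least 1.\<close>

lemma tau_uniformly_in_hseq:
  assumes m: "1 \<le> m" and \<alpha>: "0 \<le> \<alpha>" "\<alpha> < 1" and t: "t \<le> real m * (1 - 2 * \<alpha>)"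
  shows "uniformly_in_hseq m \<alpha> t
    (\<lambda>V ev n. tau ev n - of_real (real n ^ (2 * m) * pi ^ (2 * m)) - fcoeff V 0)"
  unfolding uniformly_in_hseq_def
proof (intro allI impI)
  fix R :: real assume R: "0 < R"
  define \<theta> where "\<theta> = real m * \<alpha>"
  have \<theta>: "0 \<le> \<theta>" "\<theta> < real m" using m \<alpha> by (simp_all add: \<theta>_def)
  define s where "s = real m - 2 * \<theta>"
  have m1: "1 \<le> real m" using m by simp
  have s: "s + 2 * \<theta> + max 0 (2 * \<theta> - 1) / 2 < 4 * real m - 5 / 2" "s + 3 * \<theta> < 4 * real m - 2"
  proof -
    define M where "M = max 0 (2 * \<theta> - 1)"
    have "M < 2 * real m - 1" using \<theta> m1 unfolding M_def by linarith
    then show "s + 2 * \<theta> + max 0 (2 * \<theta> - 1) / 2 < 4 * real m - 5 / 2" "s + 3 * \<theta> < 4 * real m - 2"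
      using \<theta> m1 unfolding s_def M_def[symmetric] by linarith+
  qed
  have ts: "t \<le> s" using t by (simp add: s_def \<theta>_def algebra_simps)
  obtain N C where NC: "1 \<le> N" "0 \<le> C" and asym:
    "\<And>V ev v. V \<in> per_dist \<Longrightarrow> v = fcoeff V \<Longrightarrow> l2_le (\<lambda>k. of_real (br k powr (- \<theta>)) * v k) R \<Longrightarrow>
      ordered_eigenvalues m \<alpha> V ev \<Longrightarrow> pair_asymptotics m s N C v ev"
    using eigenvalue_asymptotics[OF m \<theta> \<theta>_def less_imp_le[OF R] s] by metis
  obtain C' where C': "0 \<le> C'"
    "\<And>(v :: int \<Rightarrow> complex) R N. l2_le (\<lambda>k. of_real (br k powr (- \<theta>)) * v k) R \<Longrightarrow> 1 \<le> N \<Longrightarrow>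
      (\<And>n. N \<le> n \<Longrightarrow> (\<lambda>j. v j * v (- j) * of_real (resolvent_kernel m n j)) summable_on UNIV) \<Longrightarrow>
      l2_le (\<lambda>n. if N \<le> n then real n powr (real m - 2 * \<theta>) * cmod (diag_sum m v n) else 0) (C' * R\<^sup>2)"
    using diag_bound[OF m \<theta>] by blast
  define B where "B = C + diag m (int N) + R"
  have B: "0 \<le> B" using NC R by (simp add: B_def diag_abs)
  show "\<exists>K. \<forall>V ev. V \<in> Hper (- real m * \<alpha>) \<and> Hper_norm (- real m * \<alpha>) V \<le> R \<and> ordered_eigenvalues m \<alpha> V ev \<longrightarrow>
      (\<lambda>n. tau ev n - of_real (real n ^ (2 * m) * pi ^ (2 * m)) - fcoeff V 0) \<in> hseq t \<and>
      hseq_norm t (\<lambda>n. tau ev n - of_real (real n ^ (2 * m) * pi ^ (2 * m)) - fcoeff V 0) \<le> K"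
  proof (intro exI allI impI)
    fix V ev
    assume *: "V \<in> Hper (- real m * \<alpha>) \<and> Hper_norm (- real m * \<alpha>) V \<le> R \<and> ordered_eigenvalues m \<alpha> V ev"
    define v where "v = fcoeff V"
    have V: "V \<in> per_dist" and v: "l2_le (\<lambda>k. of_real (br k powr (- \<theta>)) * v k) R"
      using Hper_l2[of V "- real m * \<alpha>" R] * by (simp_all add: v_def \<theta>_def)
    obtain r where ev: "\<forall>k\<le>2 * N. cmod (ev k) \<le> C"
      and sm: "\<forall>n\<ge>N. (\<lambda>j. v j * v (- j) * of_real (resolvent_kernel m n j)) summable_on UNIV"
      and r: "tail_le s N r C" "\<forall>n\<ge>N. 0 \<le> r n \<and>
        cmod (tau ev n - of_real (diag m (int n)) - v 0) \<le> cmod (diag_sum m v n) + r n"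
      using asym[OF V v_def v] * unfolding pair_asymptotics_def by blast
    have d: "tail_le s N (\<lambda>n. cmod (diag_sum m v n)) (C' * R\<^sup>2)"
      unfolding tail_le_def s_def by (rule C'(2)[OF v NC(1)]) (use sm in blast)
    have D: "of_real (real n ^ (2 * m) * pi ^ (2 * m)) = complex_of_real (diag m (int n))" for n
      by (simp add: diag_def power_mult_distrib)
    have "tail_le t N (\<lambda>n. cmod (tau ev n - of_real (diag m (int n)) - v 0)) (C' * R\<^sup>2 + C)"
    proof (rule tail_le_mono[OF tail_le_add[OF d r(1)] NC(1) _ ts])
      fix n assume "N \<le> n"
      with r(2) show "\<bar>cmod (tau ev n - of_real (diag m (int n)) - v 0)\<bar> \<le> \<bar>cmod (diag_sum m v n) + r n\<bar>" by fastforce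
    qed
    then show "(\<lambda>n. tau ev n - of_real (real n ^ (2 * m) * pi ^ (2 * m)) - fcoeff V 0) \<in> hseq t \<and>
      hseq_norm t (\<lambda>n. tau ev n - of_real (real n ^ (2 * m) * pi ^ (2 * m)) - fcoeff V 0)
        \<le> 2 powr \<bar>t\<bar> * (C' * R\<^sup>2 + C + real N * (real N powr \<bar>t\<bar> * B))"
      unfolding D v_def[symmetric]
    proof (rule hseqI_tail[OF _ NC(1) B])
      fix n assume n: "1 \<le> n" "n < N"
      have "cmod (tau ev n) = cmod (ev (2 * n) + ev (2 * n - 1)) / 2" by (simp add: tau_def norm_divide)
      also have "\<dots> \<le> (cmod (ev (2 * n)) + cmod (ev (2 * n - 1))) / 2" by (simp add: norm_triangle_ineq)
      also have "\<dots> \<le> (C + C) / 2" using ev n by (intro divide_right_mono add_mono) auto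
      finally have "cmod (tau ev n) \<le> C" by simp
      moreover have "cmod (complex_of_real (diag m (int n))) \<le> diag m (int N)"
      proof -
        have "0 \<le> diag m (int n)" by (simp add: diag_abs)
        then show ?thesis using diag_mono[of "int n" "int N" m] n by (simp only: norm_of_real abs_of_nonneg)
      qed
      moreover have "cmod (v 0) \<le> R" using coefficient_le[OF v, of 0] by (simp add: br_def)
      moreover have "cmod (tau ev n - of_real (diag m (int n)) - v 0)
          \<le> cmod (tau ev n) + cmod (complex_of_real (diag m (int n))) + cmod (v 0)"
        by (meson norm_triangle_ineq4 norm_triangle_le_diff add_right_mono order_trans)
      ultimately show "cmod (tau ev n - of_real (diag m (int n)) - v 0) \<le> B" unfolding B_def by linarith
    qed
  qed
qed

text \<open>The square of the deviation is bounded by products of a coefficient, of order -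
  \<theta>, with a second order term, of order \<open>s\<close>, and by products of two terms of
  order \<open>s\<close>. The deviation itself thus gets the orders
  \<open>(s - \<theta>) / 2\<close> and \<open>s\<close>, whence the two conditions on
  \<open>t\<close>.\<close>

lemma gap_uniformly_in_hseq:
  assumes m: "1 \<le> m" and \<alpha>: "0 \<le> \<alpha>" "\<alpha> < 1" and \<theta>_def: "\<theta> = real m * \<alpha>"
    and s: "s + 2 * \<theta> + max 0 (2 * \<theta> - 1) / 2 < 4 * real m - 5 / 2" "s + 3 * \<theta> < 4 * real m - 2"
    and s': "s \<le> real m - \<theta>" "1 / 2 < 2 * (real m - \<theta>) - s"
    and t: "t \<le> s" "2 * t + \<theta> \<le> s"
  shows "uniformly_in_hseq m \<alpha> t (\<lambda>V ev n. of_real (gap_deviation V ev n))"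
  unfolding uniformly_in_hseq_def
proof (intro allI impI)
  fix R :: real assume R: "0 < R"
  have \<theta>: "0 \<le> \<theta>" "\<theta> < real m" using m \<alpha> by (simp_all add: \<theta>_def)
  obtain N C where NC: "1 \<le> N" "0 \<le> C" and asym:
    "\<And>V ev v. V \<in> per_dist \<Longrightarrow> v = fcoeff V \<Longrightarrow> l2_le (\<lambda>k. of_real (br k powr (- \<theta>)) * v k) R \<Longrightarrow>
      ordered_eigenvalues m \<alpha> V ev \<Longrightarrow> pair_asymptotics m s N C v ev"
    using eigenvalue_asymptotics[OF m \<theta> \<theta>_def less_imp_le[OF R] s] by metis
  obtain C' where C': "0 \<le> C'"
    "\<And>(v :: int \<Rightarrow> complex) R. l2_le (\<lambda>k. of_real (br k powr (- \<theta>)) * v k) R \<Longrightarrow>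
      l2_le (\<lambda>n. if 1 \<le> n then real n powr s * cmod (offdiag_sum m v n) else 0) (C' * R\<^sup>2)"
    using offdiag_bound[OF m \<theta> s'] by blast
  define S where "S = C' * R\<^sup>2 + C"
  define B where "B = C + C + 2 * (R * (1 + 2 * real N) powr \<theta>)"
  have B: "0 \<le> B" using NC R by (simp add: B_def)
  show "\<exists>K. \<forall>V ev. V \<in> Hper (- real m * \<alpha>) \<and> Hper_norm (- real m * \<alpha>) V \<le> R \<and> ordered_eigenvalues m \<alpha> V ev \<longrightarrow>
      (\<lambda>n. of_real (gap_deviation V ev n)) \<in> hseq t \<and> hseq_norm t (\<lambda>n. of_real (gap_deviation V ev n)) \<le> K"
  proof (intro exI allI impI)
    fix V ev
    assume *: "V \<in> Hper (- real m * \<alpha>) \<and> Hper_norm (- real m * \<alpha>) V \<le> R \<and> ordered_eigenvalues m \<alpha> V ev"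
    define v where "v = fcoeff V"
    have V: "V \<in> per_dist" and v: "l2_le (\<lambda>k. of_real (br k powr (- \<theta>)) * v k) R"
      using Hper_l2[of V "- real m * \<alpha>" R] * by (simp_all add: v_def \<theta>_def)
    have v': "l2_le (\<lambda>k. of_real (br k powr (- \<theta>)) * v (- k)) R"
      using l2_le_comp[OF v, of uminus] by (simp add: inj_def)
    obtain r where ev: "\<forall>k\<le>2 * N. cmod (ev k) \<le> C" and r: "tail_le s N r C" "\<And>n. N \<le> n \<Longrightarrow> 0 \<le> r n" 
      "\<And>n. N \<le> n \<Longrightarrow> cmod ((gam ev n)\<^sup>2 - 4 * (v (- 2 * int n) * v (2 * int n)))
          \<le> 4 * ((r n)\<^sup>2 + cmod (v (2 * int n)) * (cmod (offdiag_sum m (\<lambda>k. v (- k)) n) + r n)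
            + cmod (v (- 2 * int n)) * (cmod (offdiag_sum m v n) + r n)
            + (cmod (offdiag_sum m v n) + r n) * (cmod (offdiag_sum m (\<lambda>k. v (- k)) n) + r n))"
      using asym[OF V v_def v] * unfolding pair_asymptotics_def by blast
    define a b where "a n = cmod (v (2 * int n))" and "b n = cmod (v (- 2 * int n))" for n
    define p q where "p n = cmod (offdiag_sum m v n) + r n"
      and "q n = cmod (offdiag_sum m (\<lambda>k. v (- k)) n) + r n" for n
    have nn: "0 \<le> a n" "0 \<le> b n" "N \<le> n \<Longrightarrow> 0 \<le> p n" "N \<le> n \<Longrightarrow> 0 \<le> q n" for n
      using r(2) by (simp_all add: a_def b_def p_def q_def)
    have a: "tail_le (- \<theta>) N a (3 powr \<theta> * R)" and b: "tail_le (- \<theta>) N b (3 powr \<theta> * R)"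
      unfolding a_def b_def by (intro tail_le_coefficient v \<theta> NC; simp add: inj_def)+
    have off: "tail_le s N (\<lambda>n. cmod (offdiag_sum m w n)) (C' * R\<^sup>2)"
      if "l2_le (\<lambda>k. of_real (br k powr (- \<theta>)) * w k) R" for w
      by (rule tail_le_start[OF _ NC(1)]) (use C'(2)[OF that] in \<open>simp add: tail_le_def\<close>)
    have p: "tail_le s N p S" and q: "tail_le s N q S"
      unfolding p_def q_def S_def by (intro tail_le_add off r(1) v v')+
    have st: "t \<le> (- \<theta> + s) / 2" "t \<le> (s + s) / 2" using t by simp_all
    have aq: "tail_le t N (\<lambda>n. sqrt (a n * q n)) (sqrt (3 powr \<theta> * R * S))"
      by (rule tail_le_mono[OF tail_le_sqrt_mult[OF a q] NC(1) order_refl st(1)]) (use nn in auto)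
    have bp: "tail_le t N (\<lambda>n. sqrt (b n * p n)) (sqrt (3 powr \<theta> * R * S))"
      by (rule tail_le_mono[OF tail_le_sqrt_mult[OF b p] NC(1) order_refl st(1)]) (use nn in auto)
    have pq: "tail_le t N (\<lambda>n. sqrt (p n * q n)) (sqrt (S * S))"
      by (rule tail_le_mono[OF tail_le_sqrt_mult[OF p q] NC(1) order_refl st(2)]) (use nn in auto)
    have rt: "tail_le t N r C" by (rule tail_le_mono[OF r(1) NC(1) order_refl t(1)])
    let ?K = "2 * (C + sqrt (3 powr \<theta> * R * S) + sqrt (3 powr \<theta> * R * S) + sqrt (S * S))"
    have "tail_le t N (\<lambda>n. 2 * (r n + sqrt (a n * q n) + sqrt (b n * p n) + sqrt (p n * q n))) ?K"
      by (intro tail_le_cmult tail_le_add rt aq bp pq) simp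
    then have "tail_le t N (\<lambda>n. cmod (of_real (gap_deviation V ev n))) ?K"
    proof (rule tail_le_mono[OF _ NC(1) _ order_refl])
      fix n assume n: "N \<le> n"
      note nn = nn[of n] nn(3,4)[OF n] r(2)[OF n]
      have "(gap_deviation V ev n)\<^sup>2 \<le> 4 * ((r n)\<^sup>2 + a n * q n + b n * p n + p n * q n)"
        using gap_deviation_sq[of V ev n] r(3)[OF n] unfolding a_def b_def p_def q_def v_def by linarith
      then have "gap_deviation V ev n \<le> sqrt (4 * ((r n)\<^sup>2 + a n * q n + b n * p n + p n * q n))"
        by (rule real_le_rsqrt)
      also have "\<dots> = 2 * sqrt ((r n)\<^sup>2 + a n * q n + b n * p n + p n * q n)"
        by (subst real_sqrt_mult) simp
      also have "sqrt ((r n)\<^sup>2 + a n * q n + b n * p n + p n * q n)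
          \<le> sqrt ((r n)\<^sup>2) + sqrt (a n * q n) + sqrt (b n * p n) + sqrt (p n * q n)"
        using nn by (intro order_trans[OF sqrt_add_le_add_sqrt] add_mono) auto
      finally have "gap_deviation V ev n \<le> 2 * (r n + sqrt (a n * q n) + sqrt (b n * p n) + sqrt (p n * q n))"
        using nn by simp
      then show "\<bar>cmod (of_real (gap_deviation V ev n))\<bar> \<le> \<bar>2 * (r n + sqrt (a n * q n) + sqrt (b n * p n) + sqrt (p n * q n))\<bar>"
        using gap_deviation_nonneg[of V ev n] by simp
    qed
    then show "(\<lambda>n. of_real (gap_deviation V ev n)) \<in> hseq t \<and>
      hseq_norm t (\<lambda>n. of_real (gap_deviation V ev n)) \<le> 2 powr \<bar>t\<bar> * (?K + real N * (real N powr \<bar>t\<bar> * B))"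
    proof (rule hseqI_tail[OF _ NC(1) B])
      fix n assume n: "1 \<le> n" "n < N"
      have vk: "cmod (v k) \<le> R * (1 + 2 * real N) powr \<theta>" if "\<bar>k\<bar> \<le> 2 * int N" for k
      proof -
        have "br k \<le> 1 + 2 * real N" using that unfolding br_def by linarith
        then have "R * br k powr \<theta> \<le> R * (1 + 2 * real N) powr \<theta>"
          using R \<theta>(1) by (intro mult_left_mono powr_mono2) auto
        then show ?thesis using coefficient_le[OF v, of k] by linarith
      qed
      have "cmod (v (- 2 * int n)) * cmod (v (2 * int n)) \<le> (R * (1 + 2 * real N) powr \<theta>) * (R * (1 + 2 * real N) powr \<theta>)"
        using n R by (intro mult_mono vk) auto
      then have "sqrt (cmod (v (- 2 * int n)) * cmod (v (2 * int n))) \<le> R * (1 + 2 * real N) powr \<theta>"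
        using R by (intro real_le_lsqrt) (auto simp: power2_eq_square)
      moreover have "cmod (ev (2 * n)) \<le> C" "cmod (ev (2 * n - 1)) \<le> C" using ev n by auto
      ultimately have "gap_deviation V ev n \<le> B"
        using gap_deviation_le[of V ev n] unfolding v_def B_def by linarith
      then show "cmod (of_real (gap_deviation V ev n)) \<le> B" using gap_deviation_nonneg[of V ev n] by simp
    qed
  qed
qed

theorem theorem1p1:
  fixes m :: nat and \<alpha> \<epsilon> :: real
  assumes "m \<ge> 1" and "0 \<le> \<alpha>" and "\<alpha> < 1" and "\<epsilon> > 0"
  shows
    "uniformly_in_hseq m \<alpha> (real m * (1 - 2 * \<alpha> - \<epsilon>))
       (\<lambda>V ev n. tau ev n - of_real (real n ^ (2 * m) * pi ^ (2 * m)) - fcoeff V 0) \<and>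
     (\<alpha> < 1 / 2 \<longrightarrow>
        uniformly_in_hseq m \<alpha> (real m * (1 / 2 - \<alpha>))
          (\<lambda>V ev n. of_real (gap_deviation V ev n))) \<and>
     (1 / 2 \<le> \<alpha> \<longrightarrow>
        uniformly_in_hseq m \<alpha> (real m * (1 - 2 * \<alpha> - \<epsilon>))
          (\<lambda>V ev n. of_real (gap_deviation V ev n)))"
proof (intro conjI impI)
  define \<theta> where "\<theta> = real m * \<alpha>"
  have m1: "1 \<le> real m" using assms(1) by simp
  have \<theta>: "0 \<le> \<theta>" "\<theta> < real m" using assms by (simp_all add: \<theta>_def)
  show "uniformly_in_hseq m \<alpha> (real m * (1 - 2 * \<alpha> - \<epsilon>))
       (\<lambda>V ev n. tau ev n - of_real (real n ^ (2 * m) * pi ^ (2 * m)) - fcoeff V 0)"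
    using assms by (intro tau_uniformly_in_hseq) auto
  show "uniformly_in_hseq m \<alpha> (real m * (1 / 2 - \<alpha>)) (\<lambda>V ev n. of_real (gap_deviation V ev n))" if "\<alpha> < 1 / 2"
  proof -
    have h: "\<theta> < real m / 2" using that assms(1) by (simp add: \<theta>_def)
    have t: "real m * (1 / 2 - \<alpha>) = real m / 2 - \<theta>" by (simp add: \<theta>_def algebra_simps)
    define M where "M = max 0 (2 * \<theta> - 1)"
    have "M \<le> real m - 1" using h m1 unfolding M_def by linarith
    \<comment> \<open>The largest order that \<open>offdiag_bound\<close> permits,
      \<open>s = real m - \<theta>\<close>, gives the mean order m / 2 - \<theta>.\<close>
    then show ?thesis unfolding t
      by (intro gap_uniformly_in_hseq[OF assms(1-3) \<theta>_def, where s = "real m - \<theta>"])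
         ((unfold M_def[symmetric])?, use h \<theta> m1 in argo)+
  qed
  show "uniformly_in_hseq m \<alpha> (real m * (1 - 2 * \<alpha> - \<epsilon>)) (\<lambda>V ev n. of_real (gap_deviation V ev n))" if "1 / 2 \<le> \<alpha>"
  proof -
    have h: "real m / 2 \<le> \<theta>" using mult_left_mono[OF that, of "real m"] by (simp add: \<theta>_def)
    have t: "real m * (1 - 2 * \<alpha> - \<epsilon>) = real m - 2 * \<theta> - real m * \<epsilon>" by (simp add: \<theta>_def algebra_simps)
    \<comment> \<open>For \<open>s = 2 * real m - 3 * \<theta> - 2 * \<delta>\<close> the mean order
      is m - 2 \<theta> - \<delta>, so \<delta> spends part of the allowance
      \<open>real m * \<epsilon>\<close>. The cap \<open>real m - \<theta>\<close> keeps the target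
      order at most \<open>s\<close>, and \<delta> > 0 makes the strict inequalities hold also for m
      = 1.\<close>
    define \<delta> where "\<delta> = min (real m * \<epsilon>) (real m - \<theta>)"
    have \<delta>: "0 < \<delta>" "\<delta> \<le> real m * \<epsilon>" "\<delta> \<le> real m - \<theta>" using assms \<theta> by (auto simp: \<delta>_def)
    have M: "max 0 (2 * \<theta> - 1) = 2 * \<theta> - 1" using h m1 by linarith
    show ?thesis unfolding t
      by (intro gap_uniformly_in_hseq[OF assms(1-3) \<theta>_def, where s = "2 * real m - 3 * \<theta> - 2 * \<delta>"])
         ((unfold M)?, use h \<delta> \<theta> m1 in argo)+
  qed
qed

end
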